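(* For $\tau\in(0,1]$ let the initial data $(v_0^\tau,u_0^\tau,S_0^\tau)$ satisfy Assumption (A) of the context and $E_0<\epsilon_0$, and let $(v^\tau,u^\tau,S^\tau)$ be the corresponding global solution described in the context. Then there exist functions $(v^0,u^0)\in L^\infty(\mathbb R^+;H^2(\Omega))$ and $S^0\in L^2(\mathbb R^+;H^2(\Omega))$ such that, as $\tau\to0$ and up to subsequences, $$(v^\tau,u^\tau)\rightharpoonup(v^0,u^0)\quad\text{weak-}\ast\text{ in }L^\infty(\mathbb R^+;H^2(\Omega)),$$ $$S^\tau\rightharpoonup S^0\quad\text{weakly in }L^2(\mathbb R^+;H^2(\Omega)),$$ where $(v^0,u^0)$ is the solution of the one-dimensional isentropic compressible Navier-Stokes equations $$v_t=u_x,\qquad u_t+p(v)_x=\left(\frac{\mu u_x}{v}\right)_x$$ with initial value $(v_0^0,u_0^0)$, which is the weak limit of $(v_0^\tau,u_0^\tau)$ up to subsequences. Moreover, $$S^0=\mu\frac{(u^0)_x}{v^0}.$$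
   Context: $\Omega\subset\mathbb R$ is a bounded interval; $H^m=H^m(\Omega)$ is the usual $L^2$-based Sobolev space. $\mu>0$ is a constant and $\tau\in(0,1]$ is the relaxation parameter. The pressure is $p(v)=a v^{-\gamma}$ with constants $a>0$, $\gamma>1$. Relaxed problem: for $\tau>0$, $$v_t=u_x,\quad u_t+p(v)_x=S_x,\quad \tau S_t+vS=\mu u_x\ \text{ in }(0,\infty)\times\Omega,\qquad (v,u,S)|_{t=0}=(v_0,u_0,S_0),\quad u|_{\partial\Omega}=0 .$$ The initial data $(v_0,u_0,S_0)=(v_0^\tau,u_0^\tau,S_0^\tau):\Omega\to(0,\infty)\times\mathbb R\times\mathbb R$ may depend on $\tau$. Initial time derivatives are defined recursively from the equations: $v_1=(u_0)_x$, $u_1=(S_0)_x-p(v_0)_x$, $S_1=\frac1\tau(\mu (u_0)_x-v_0S_0)$; $v_2=(u_1)_x$, $u_2=(S_1)_x-(p'(v_0)v_1)_x$, $S_2=\frac1\tau(\mu (u_1)_x-v_1S_0-v_0S_1)$. Set $V_0^0=(v_0-1,u_0,\sqrt\tau S_0)$, $V_0^1=(v_1,u_1,\sqrt\tau S_1)$, $V_0^2=\tau\,(v_2,u_2,\sqrt\tau S_2)$, and $E_0=\sum_{k=0}^2\|V_0^k\|_{H^{2-k}}^2$. Assumption (A): (i) compatibility: $u_0|_{\partial\Omega}=0$ and $u_1|_{\partial\Omega}=0$; (ii) well-preparedness: $\|v_0S_0-\mu(u_0)_x\|_{H^1}=O(\sqrt\tau)$ as $\tau\to0$; (iii) $V_0^k\in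 H^{2-k}$ for $k=0,1,2$. Global solutions: there are constants $\epsilon_0>0$ and $C>0$, with $C$ independent of $\tau$, such that under Assumption (A) and $E_0<\epsilon_0$ the relaxed problem has a unique global solution $(v^\tau,u^\tau,S^\tau)\in C^1([0,\infty)\times\Omega)$ with $(v^\tau-1,u^\tau,S^\tau)\in C([0,\infty),H^{2-\delta_0})\cap C^1([0,\infty),H^{1-\delta_0})$ for any $\delta_0>0$ and $$\sup_{0\le t<\infty}\|(v^\tau-1,u^\tau,\sqrt\tau S^\tau)(t,\cdot)\|_{H^2}^2+\int_0^\infty\left(\|(v^\tau_x,u^\tau_x)\|_{H^1}^2+\|S^\tau\|_{H^2}^2\right)dt\le CE_0 .$$ These are the solutions referred to in the claim. *)

theory Defs
  imports "HOL-Analysis.Analysis" "HOL-Library.Landau_Symbols"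
begin

section \<open>Test functions and Sobolev spaces\<close>

text \<open>Smooth maps: differentiable everywhere, with all directional derivatives smooth again.\<close>

coinductive smooth :: "('a::real_normed_vector \<Rightarrow> 'b::real_normed_vector) \<Rightarrow> bool" where
  "(\<forall>x. (f has_derivative f' x) (at x)) \<Longrightarrow> (\<forall>h. smooth (\<lambda>x. f' x h)) \<Longrightarrow> smooth f"

definition test_functions :: "'a::euclidean_space set \<Rightarrow> ('a \<Rightarrow> real) set" where
  "test_functions U = {\<phi>. smooth \<phi> \<and> compact (closure {x. \<phi> x \<noteq> 0}) \<and> closure {x. \<phi> x \<noteq> 0} \<subseteq> U}"

definition locally_integrable :: "real set \<Rightarrow> (real \<Rightarrow> real) \<Rightarrow> bool" where
  "locally_integrable \<Omega> f \<longleftrightarrow> (\<forall>K. compact K \<and> K \<subseteq> \<Omega> \<longrightarrow> integrable (lebesgue_on K) f)"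

definition has_weak_deriv :: "real set \<Rightarrow> nat \<Rightarrow> (real \<Rightarrow> real) \<Rightarrow> (real \<Rightarrow> real) \<Rightarrow> bool" where
  "has_weak_deriv \<Omega> k f g \<longleftrightarrow>
     locally_integrable \<Omega> f \<and> locally_integrable \<Omega> g \<and>
     (\<forall>\<phi>\<in>test_functions \<Omega>.
        integral\<^sup>L (lebesgue_on \<Omega>) (\<lambda>x. f x * (deriv ^^ k) \<phi> x) =
        (- 1) ^ k * integral\<^sup>L (lebesgue_on \<Omega>) (\<lambda>x. g x * \<phi> x))"

text \<open>Elements of Lebesgue and Sobolev spaces are represented by functions; the weak derivative
  is determined only almost everywhere on \<open>\<Omega>\<close>, and the norms and traces below depend only on
  the almost-everywhere class.\<close>

definition wderiv :: "real set \<Rightarrow> nat \<Rightarrow> (real \<Rightarrow> real) \<Rightarrow> real \<Rightarrow> real" where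
  "wderiv \<Omega> k f = (SOME g. has_weak_deriv \<Omega> k f g)"

definition L2_space :: "real set \<Rightarrow> (real \<Rightarrow> real) set" where
  "L2_space \<Omega> = {f \<in> borel_measurable (lebesgue_on \<Omega>). integrable (lebesgue_on \<Omega>) (\<lambda>x. (f x)\<^sup>2)}"

definition H_space :: "real set \<Rightarrow> nat \<Rightarrow> (real \<Rightarrow> real) set" where
  "H_space \<Omega> m = {f \<in> L2_space \<Omega>. \<forall>k\<le>m. \<exists>g\<in>L2_space \<Omega>. has_weak_deriv \<Omega> k f g}"

definition H_norm :: "real set \<Rightarrow> nat \<Rightarrow> (real \<Rightarrow> real) \<Rightarrow> real" where
  "H_norm \<Omega> m f = sqrt (\<Sum>k\<le>m. integral\<^sup>L (lebesgue_on \<Omega>) (\<lambda>x. (wderiv \<Omega> k f x)\<^sup>2))"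

text \<open>Sobolev--Slobodeckij space of order \<open>k + \<sigma>\<close> with \<open>0 < \<sigma> < 1\<close>, normed by means of
  the Gagliardo seminorm of the derivative of order \<open>k\<close>.\<close>

definition gagliardo :: "real \<Rightarrow> (real \<Rightarrow> real) \<Rightarrow> real \<times> real \<Rightarrow> real" where
  "gagliardo \<sigma> g = (\<lambda>(x, y). (g x - g y)\<^sup>2 / \<bar>x - y\<bar> powr (1 + 2 * \<sigma>))"

definition frac_H_space :: "real set \<Rightarrow> nat \<Rightarrow> real \<Rightarrow> (real \<Rightarrow> real) set" where
  "frac_H_space \<Omega> k \<sigma> =
     {f \<in> H_space \<Omega> k. integrable (lebesgue_on (\<Omega> \<times> \<Omega>)) (gagliardo \<sigma> (wderiv \<Omega> k f))}"

definition frac_H_norm :: "real set \<Rightarrow> nat \<Rightarrow> real \<Rightarrow> (real \<Rightarrow> real) \<Rightarrow> real" where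
  "frac_H_norm \<Omega> k \<sigma> f =
     sqrt ((H_norm \<Omega> k f)\<^sup>2 + integral\<^sup>L (lebesgue_on (\<Omega> \<times> \<Omega>)) (gagliardo \<sigma> (wderiv \<Omega> k f)))"

text \<open>Boundary value 0 on the interval with end points \<open>\<alpha>\<close>, \<open>\<beta>\<close>, through the continuous
  representative.\<close>

definition zero_trace :: "real \<Rightarrow> real \<Rightarrow> (real \<Rightarrow> real) \<Rightarrow> bool" where
  "zero_trace \<alpha> \<beta> f \<longleftrightarrow>
     (\<exists>w. continuous_on {\<alpha>..\<beta>} w \<and> w \<alpha> = 0 \<and> w \<beta> = 0 \<and> (AE x in lebesgue_on {\<alpha><..<\<beta>}. w x = f x))"


section \<open>Dual spaces and spaces of vector-valued functions of time\<close>

text \<open>A space is given by a set \<open>X\<close> of real functions and a (semi)norm \<open>N\<close>. A function of time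
  with values in \<open>X\<close> is written uncurried, so that its value at \<open>t\<close> is \<open>\<lambda>x. F (t, x)\<close>.\<close>

definition dual_space :: "('b \<Rightarrow> real) set \<Rightarrow> (('b \<Rightarrow> real) \<Rightarrow> real) \<Rightarrow> (('b \<Rightarrow> real) \<Rightarrow> real) set" where
  "dual_space X N =
     {l. (\<forall>f\<in>X. \<forall>g\<in>X. \<forall>a b. l (\<lambda>x. a * f x + b * g x) = a * l f + b * l g) \<and>
         (\<exists>K. \<forall>f\<in>X. \<bar>l f\<bar> \<le> K * N f)}"

definition dual_norm :: "('b \<Rightarrow> real) set \<Rightarrow> (('b \<Rightarrow> real) \<Rightarrow> real) \<Rightarrow> (('b \<Rightarrow> real) \<Rightarrow> real) \<Rightarrow> real" where
  "dual_norm X N l = (SUP f\<in>{f\<in>X. N f \<le> 1}. \<bar>l f\<bar>)"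

definition weakly_converges ::
  "('b \<Rightarrow> real) set \<Rightarrow> (('b \<Rightarrow> real) \<Rightarrow> real) \<Rightarrow> (nat \<Rightarrow> 'b \<Rightarrow> real) \<Rightarrow> ('b \<Rightarrow> real) \<Rightarrow> bool" where
  "weakly_converges X N f g \<longleftrightarrow>
     (\<forall>n. f n \<in> X) \<and> g \<in> X \<and> (\<forall>l\<in>dual_space X N. (\<lambda>n. l (f n)) \<longlonglongrightarrow> l g)"

text \<open>Strong (Bochner) measurability on \<open>(0,\<infinity>)\<close>: almost everywhere the limit of simple functions.\<close>

definition bochner_measurable ::
  "('b \<Rightarrow> real) set \<Rightarrow> (('b \<Rightarrow> real) \<Rightarrow> real) \<Rightarrow> (real \<times> 'b \<Rightarrow> real) \<Rightarrow> bool" where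
  "bochner_measurable X N F \<longleftrightarrow>
     (\<exists>s :: nat \<Rightarrow> real \<Rightarrow> 'b \<Rightarrow> real.
        (\<forall>n. finite (s n ` {0<..}) \<and> s n ` {0<..} \<subseteq> X \<and>
             (\<forall>y. {t \<in> {0<..}. s n t = y} \<in> sets lebesgue)) \<and>
        (AE t in lebesgue_on {0<..}.
             (\<lambda>x. F (t, x)) \<in> X \<and> (\<lambda>n. N (\<lambda>x. s n t x - F (t, x))) \<longlonglongrightarrow> 0))"

definition L1_time :: "('b \<Rightarrow> real) set \<Rightarrow> (('b \<Rightarrow> real) \<Rightarrow> real) \<Rightarrow> (real \<times> 'b \<Rightarrow> real) set" where
  "L1_time X N =
     {F. bochner_measurable X N F \<and> integrable (lebesgue_on {0<..}) (\<lambda>t. N (\<lambda>x. F (t, x)))}"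

definition L2_time :: "('b \<Rightarrow> real) set \<Rightarrow> (('b \<Rightarrow> real) \<Rightarrow> real) \<Rightarrow> (real \<times> 'b \<Rightarrow> real) set" where
  "L2_time X N =
     {F. bochner_measurable X N F \<and> integrable (lebesgue_on {0<..}) (\<lambda>t. (N (\<lambda>x. F (t, x)))\<^sup>2)}"

definition L2_time_norm :: "(('b \<Rightarrow> real) \<Rightarrow> real) \<Rightarrow> (real \<times> 'b \<Rightarrow> real) \<Rightarrow> real" where
  "L2_time_norm N F = sqrt (integral\<^sup>L (lebesgue_on {0<..}) (\<lambda>t. (N (\<lambda>x. F (t, x)))\<^sup>2))"

definition Linf_time :: "('b \<Rightarrow> real) set \<Rightarrow> (('b \<Rightarrow> real) \<Rightarrow> real) \<Rightarrow> (real \<times> 'b \<Rightarrow> real) set" where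
  "Linf_time X N =
     {F. bochner_measurable X N F \<and> (\<exists>K. AE t in lebesgue_on {0<..}. N (\<lambda>x. F (t, x)) \<le> K)}"

text \<open>Weak-star convergence in \<open>L\<^sup>\<infinity>(0,\<infinity>; X)\<close>, for reflexive separable \<open>X\<close>, as the dual space of
  \<open>L\<^sup>1(0,\<infinity>; X')\<close>.\<close>

definition weakstar_converges_Linf_time ::
  "('b \<Rightarrow> real) set \<Rightarrow> (('b \<Rightarrow> real) \<Rightarrow> real) \<Rightarrow> (nat \<Rightarrow> real \<times> 'b \<Rightarrow> real) \<Rightarrow> (real \<times> 'b \<Rightarrow> real) \<Rightarrow> bool"
  where
  "weakstar_converges_Linf_time X N F F0 \<longleftrightarrow>
     (\<forall>n. F n \<in> Linf_time X N) \<and> F0 \<in> Linf_time X N \<and>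
     (\<forall>G\<in>L1_time (dual_space X N) (dual_norm X N).
        (\<lambda>n. integral\<^sup>L (lebesgue_on {0<..}) (\<lambda>t. G (t, \<lambda>x. F n (t, x))))
          \<longlonglongrightarrow> integral\<^sup>L (lebesgue_on {0<..}) (\<lambda>t. G (t, \<lambda>x. F0 (t, x))))"

definition C0_time :: "('b \<Rightarrow> real) set \<Rightarrow> (('b \<Rightarrow> real) \<Rightarrow> real) \<Rightarrow> (real \<times> 'b \<Rightarrow> real) set" where
  "C0_time X N =
     {F. \<forall>t\<ge>0. (\<lambda>x. F (t, x)) \<in> X \<and>
                ((\<lambda>s. N (\<lambda>x. F (s, x) - F (t, x))) \<longlongrightarrow> 0) (at t within {0..})}"

definition C1_time :: "('b \<Rightarrow> real) set \<Rightarrow> (('b \<Rightarrow> real) \<Rightarrow> real) \<Rightarrow> (real \<times> 'b \<Rightarrow> real) set" where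
  "C1_time X N =
     {F \<in> C0_time X N. \<exists>F'\<in>C0_time X N. \<forall>t\<ge>0.
        ((\<lambda>s. N (\<lambda>x. (F (s, x) - F (t, x)) / (s - t) - F' (t, x))) \<longlongrightarrow> 0) (at t within {0..})}"


section \<open>The relaxed problem\<close>

definition pressure :: "real \<Rightarrow> real \<Rightarrow> real \<Rightarrow> real" where
  "pressure a \<gamma> v = a * v powr (- \<gamma>)"

definition C1_spacetime :: "real set \<Rightarrow> (real \<times> real \<Rightarrow> real) \<Rightarrow> bool" where
  "C1_spacetime \<Omega> f \<longleftrightarrow>
     (\<exists>ft fx. continuous_on ({0..} \<times> \<Omega>) ft \<and> continuous_on ({0..} \<times> \<Omega>) fx \<and>
        (\<forall>p\<in>{0..} \<times> \<Omega>.
           (f has_derivative (\<lambda>h. fst h * ft p + snd h * fx p)) (at p within {0..} \<times> \<Omega>)))"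

definition relaxed_problem ::
  "real \<Rightarrow> real \<Rightarrow> real \<Rightarrow> real \<Rightarrow> real \<Rightarrow> real \<Rightarrow>
   (real \<Rightarrow> real) \<Rightarrow> (real \<Rightarrow> real) \<Rightarrow> (real \<Rightarrow> real) \<Rightarrow>
   (real \<times> real \<Rightarrow> real) \<Rightarrow> (real \<times> real \<Rightarrow> real) \<Rightarrow> (real \<times> real \<Rightarrow> real) \<Rightarrow> bool" where
  "relaxed_problem \<alpha> \<beta> \<mu> a \<gamma> \<tau> v\<^sub>0 u\<^sub>0 S\<^sub>0 v u S \<longleftrightarrow>
     (\<forall>t\<ge>0. \<forall>x\<in>{\<alpha><..<\<beta>}. v (t, x) > 0) \<and>
     (\<forall>t>0. \<forall>x\<in>{\<alpha><..<\<beta>}.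
        deriv (\<lambda>s. v (s, x)) t = deriv (\<lambda>y. u (t, y)) x \<and>
        deriv (\<lambda>s. u (s, x)) t + deriv (\<lambda>y. pressure a \<gamma> (v (t, y))) x = deriv (\<lambda>y. S (t, y)) x \<and>
        \<tau> * deriv (\<lambda>s. S (s, x)) t + v (t, x) * S (t, x) = \<mu> * deriv (\<lambda>y. u (t, y)) x) \<and>
     (\<forall>x\<in>{\<alpha><..<\<beta>}. v (0, x) = v\<^sub>0 x \<and> u (0, x) = u\<^sub>0 x \<and> S (0, x) = S\<^sub>0 x) \<and>
     (\<forall>t>0. zero_trace \<alpha> \<beta> (\<lambda>x. u (t, x)))"

text \<open>Initial time derivatives \<open>v\<^sub>1, u\<^sub>1, S\<^sub>1, v\<^sub>2, u\<^sub>2, S\<^sub>2\<close>, read off recursively from the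
  differential equations, with weak space derivatives.\<close>

definition init_v1 :: "real set \<Rightarrow> (real \<Rightarrow> real) \<Rightarrow> real \<Rightarrow> real" where
  "init_v1 \<Omega> u\<^sub>0 = wderiv \<Omega> 1 u\<^sub>0"

definition init_u1 ::
  "real set \<Rightarrow> real \<Rightarrow> real \<Rightarrow> (real \<Rightarrow> real) \<Rightarrow> (real \<Rightarrow> real) \<Rightarrow> real \<Rightarrow> real" where
  "init_u1 \<Omega> a \<gamma> v\<^sub>0 S\<^sub>0 = (\<lambda>x. wderiv \<Omega> 1 S\<^sub>0 x - wderiv \<Omega> 1 (\<lambda>y. pressure a \<gamma> (v\<^sub>0 y)) x)"

definition init_S1 ::
  "real set \<Rightarrow> real \<Rightarrow> real \<Rightarrow> (real \<Rightarrow> real) \<Rightarrow> (real \<Rightarrow> real) \<Rightarrow> (real \<Rightarrow> real) \<Rightarrow> real \<Rightarrow> real" where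
  "init_S1 \<Omega> \<mu> \<tau> v\<^sub>0 u\<^sub>0 S\<^sub>0 = (\<lambda>x. (\<mu> * wderiv \<Omega> 1 u\<^sub>0 x - v\<^sub>0 x * S\<^sub>0 x) / \<tau>)"

definition init_v2 ::
  "real set \<Rightarrow> real \<Rightarrow> real \<Rightarrow> (real \<Rightarrow> real) \<Rightarrow> (real \<Rightarrow> real) \<Rightarrow> real \<Rightarrow> real" where
  "init_v2 \<Omega> a \<gamma> v\<^sub>0 S\<^sub>0 = wderiv \<Omega> 1 (init_u1 \<Omega> a \<gamma> v\<^sub>0 S\<^sub>0)"

definition init_u2 ::
  "real set \<Rightarrow> real \<Rightarrow> real \<Rightarrow> real \<Rightarrow> real \<Rightarrow>
   (real \<Rightarrow> real) \<Rightarrow> (real \<Rightarrow> real) \<Rightarrow> (real \<Rightarrow> real) \<Rightarrow> real \<Rightarrow> real" where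
  "init_u2 \<Omega> \<mu> a \<gamma> \<tau> v\<^sub>0 u\<^sub>0 S\<^sub>0 =
     (\<lambda>x. wderiv \<Omega> 1 (init_S1 \<Omega> \<mu> \<tau> v\<^sub>0 u\<^sub>0 S\<^sub>0) x
          - wderiv \<Omega> 1 (\<lambda>y. deriv (pressure a \<gamma>) (v\<^sub>0 y) * init_v1 \<Omega> u\<^sub>0 y) x)"

definition init_S2 ::
  "real set \<Rightarrow> real \<Rightarrow> real \<Rightarrow> real \<Rightarrow> real \<Rightarrow>
   (real \<Rightarrow> real) \<Rightarrow> (real \<Rightarrow> real) \<Rightarrow> (real \<Rightarrow> real) \<Rightarrow> real \<Rightarrow> real" where
  "init_S2 \<Omega> \<mu> a \<gamma> \<tau> v\<^sub>0 u\<^sub>0 S\<^sub>0 =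
     (\<lambda>x. (\<mu> * wderiv \<Omega> 1 (init_u1 \<Omega> a \<gamma> v\<^sub>0 S\<^sub>0) x
           - init_v1 \<Omega> u\<^sub>0 x * S\<^sub>0 x - v\<^sub>0 x * init_S1 \<Omega> \<mu> \<tau> v\<^sub>0 u\<^sub>0 S\<^sub>0 x) / \<tau>)"

text \<open>Only \<open>k \<in> {0, 1, 2}\<close> is relevant; the triple for \<open>k = 2\<close> carries the extra weight \<open>\<tau>\<close>.\<close>

definition V_init ::
  "real set \<Rightarrow> real \<Rightarrow> real \<Rightarrow> real \<Rightarrow> real \<Rightarrow>
   (real \<Rightarrow> real) \<Rightarrow> (real \<Rightarrow> real) \<Rightarrow> (real \<Rightarrow> real) \<Rightarrow> nat \<Rightarrow>
   (real \<Rightarrow> real) \<times> (real \<Rightarrow> real) \<times> (real \<Rightarrow> real)" where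
  "V_init \<Omega> \<mu> a \<gamma> \<tau> v\<^sub>0 u\<^sub>0 S\<^sub>0 k =
     (if k = 0 then (\<lambda>x. v\<^sub>0 x - 1, u\<^sub>0, \<lambda>x. sqrt \<tau> * S\<^sub>0 x)
      else if k = 1 then
        (init_v1 \<Omega> u\<^sub>0, init_u1 \<Omega> a \<gamma> v\<^sub>0 S\<^sub>0, \<lambda>x. sqrt \<tau> * init_S1 \<Omega> \<mu> \<tau> v\<^sub>0 u\<^sub>0 S\<^sub>0 x)
      else
        (\<lambda>x. \<tau> * init_v2 \<Omega> a \<gamma> v\<^sub>0 S\<^sub>0 x,
         \<lambda>x. \<tau> * init_u2 \<Omega> \<mu> a \<gamma> \<tau> v\<^sub>0 u\<^sub>0 S\<^sub>0 x,
         \<lambda>x. \<tau> * (sqrt \<tau> * init_S2 \<Omega> \<mu> a \<gamma> \<tau> v\<^sub>0 u\<^sub>0 S\<^sub>0 x)))"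

definition E_init ::
  "real set \<Rightarrow> real \<Rightarrow> real \<Rightarrow> real \<Rightarrow> real \<Rightarrow>
   (real \<Rightarrow> real) \<Rightarrow> (real \<Rightarrow> real) \<Rightarrow> (real \<Rightarrow> real) \<Rightarrow> real" where
  "E_init \<Omega> \<mu> a \<gamma> \<tau> v\<^sub>0 u\<^sub>0 S\<^sub>0 =
     (\<Sum>k\<le>2. case V_init \<Omega> \<mu> a \<gamma> \<tau> v\<^sub>0 u\<^sub>0 S\<^sub>0 k of (f, g, h) \<Rightarrow>
        (H_norm \<Omega> (2 - k) f)\<^sup>2 + (H_norm \<Omega> (2 - k) g)\<^sup>2 + (H_norm \<Omega> (2 - k) h)\<^sup>2)"

text \<open>Positivity, compatibility, regularity and well-preparedness of a family of data indexed by
  \<open>\<tau> \<in> (0,1]\<close>.\<close>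

definition assumption_A ::
  "real \<Rightarrow> real \<Rightarrow> real \<Rightarrow> real \<Rightarrow> real \<Rightarrow>
   (real \<Rightarrow> real \<Rightarrow> real) \<Rightarrow> (real \<Rightarrow> real \<Rightarrow> real) \<Rightarrow> (real \<Rightarrow> real \<Rightarrow> real) \<Rightarrow> bool" where
  "assumption_A \<alpha> \<beta> \<mu> a \<gamma> v\<^sub>0 u\<^sub>0 S\<^sub>0 \<longleftrightarrow>
     (let \<Omega> = {\<alpha><..<\<beta>} in
      (\<forall>\<tau>\<in>{0<..1}.
         (\<forall>x\<in>\<Omega>. v\<^sub>0 \<tau> x > 0) \<and>
         zero_trace \<alpha> \<beta> (u\<^sub>0 \<tau>) \<and> zero_trace \<alpha> \<beta> (init_u1 \<Omega> a \<gamma> (v\<^sub>0 \<tau>) (S\<^sub>0 \<tau>)) \<and>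
         (\<forall>k\<le>2. case V_init \<Omega> \<mu> a \<gamma> \<tau> (v\<^sub>0 \<tau>) (u\<^sub>0 \<tau>) (S\<^sub>0 \<tau>) k of (f, g, h) \<Rightarrow>
            f \<in> H_space \<Omega> (2 - k) \<and> g \<in> H_space \<Omega> (2 - k) \<and> h \<in> H_space \<Omega> (2 - k))) \<and>
      (\<lambda>\<tau>. H_norm \<Omega> 1 (\<lambda>x. v\<^sub>0 \<tau> x * S\<^sub>0 \<tau> x - \<mu> * wderiv \<Omega> 1 (u\<^sub>0 \<tau>) x))
        \<in> O[at_right 0](\<lambda>\<tau>. sqrt \<tau>))"

text \<open>Global solutions in the stated regularity class, with the energy estimate with constant \<open>C\<close>.
  The range \<open>0 < \<delta> < 1\<close> suffices because the spaces grow with \<open>\<delta>\<close>.\<close>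

definition global_solution ::
  "real \<Rightarrow> real \<Rightarrow> real \<Rightarrow> real \<Rightarrow> real \<Rightarrow> real \<Rightarrow> real \<Rightarrow>
   (real \<Rightarrow> real) \<Rightarrow> (real \<Rightarrow> real) \<Rightarrow> (real \<Rightarrow> real) \<Rightarrow>
   (real \<times> real \<Rightarrow> real) \<Rightarrow> (real \<times> real \<Rightarrow> real) \<Rightarrow> (real \<times> real \<Rightarrow> real) \<Rightarrow> bool" where
  "global_solution \<alpha> \<beta> \<mu> a \<gamma> C \<tau> v\<^sub>0 u\<^sub>0 S\<^sub>0 v u S \<longleftrightarrow>
     (let \<Omega> = {\<alpha><..<\<beta>} in
      relaxed_problem \<alpha> \<beta> \<mu> a \<gamma> \<tau> v\<^sub>0 u\<^sub>0 S\<^sub>0 v u S \<and>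
      C1_spacetime \<Omega> v \<and> C1_spacetime \<Omega> u \<and> C1_spacetime \<Omega> S \<and>
      (\<forall>\<delta>. 0 < \<delta> \<and> \<delta> < 1 \<longrightarrow>
         (\<forall>F\<in>{\<lambda>p. v p - 1, u, S}.
            F \<in> C0_time (frac_H_space \<Omega> 1 (1 - \<delta>)) (frac_H_norm \<Omega> 1 (1 - \<delta>)) \<and>
            F \<in> C1_time (frac_H_space \<Omega> 0 (1 - \<delta>)) (frac_H_norm \<Omega> 0 (1 - \<delta>)))) \<and>
      (\<forall>t\<ge>0. (\<lambda>x. v (t, x) - 1) \<in> H_space \<Omega> 2 \<and> (\<lambda>x. u (t, x)) \<in> H_space \<Omega> 2 \<and>
              (\<lambda>x. sqrt \<tau> * S (t, x)) \<in> H_space \<Omega> 2) \<and>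
      (SUP t\<in>{0..}. ennreal ((H_norm \<Omega> 2 (\<lambda>x. v (t, x) - 1))\<^sup>2 + (H_norm \<Omega> 2 (\<lambda>x. u (t, x)))\<^sup>2
                              + (H_norm \<Omega> 2 (\<lambda>x. sqrt \<tau> * S (t, x)))\<^sup>2))
      + (\<integral>\<^sup>+ t. ennreal ((H_norm \<Omega> 1 (wderiv \<Omega> 1 (\<lambda>x. v (t, x))))\<^sup>2
                          + (H_norm \<Omega> 1 (wderiv \<Omega> 1 (\<lambda>x. u (t, x))))\<^sup>2
                          + (H_norm \<Omega> 2 (\<lambda>x. S (t, x)))\<^sup>2) \<partial>lebesgue_on {0<..})
      \<le> ennreal (C * E_init \<Omega> \<mu> a \<gamma> \<tau> v\<^sub>0 u\<^sub>0 S\<^sub>0))"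


section \<open>The isentropic compressible Navier--Stokes equations\<close>

text \<open>Solutions in \<open>L\<^sup>\<infinity>(0,\<infinity>; H\<^sup>2)\<close> without vacuum and with \<open>u = 0\<close> on the boundary. The equations
  hold in the sense of distributions on \<open>(0,\<infinity>) \<times> \<Omega>\<close>; the initial values are attained by
  continuity in time with values in \<open>L\<^sup>2 = H\<^sup>0\<close>.\<close>

definition navier_stokes_solution ::
  "real \<Rightarrow> real \<Rightarrow> real \<Rightarrow> real \<Rightarrow> real \<Rightarrow> (real \<Rightarrow> real) \<Rightarrow> (real \<Rightarrow> real) \<Rightarrow>
   (real \<times> real \<Rightarrow> real) \<Rightarrow> (real \<times> real \<Rightarrow> real) \<Rightarrow> bool" where
  "navier_stokes_solution \<alpha> \<beta> \<mu> a \<gamma> v\<^sub>0 u\<^sub>0 v u \<longleftrightarrow>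
     (let \<Omega> = {\<alpha><..<\<beta>} in
      v \<in> Linf_time (H_space \<Omega> 2) (H_norm \<Omega> 2) \<and>
      u \<in> Linf_time (H_space \<Omega> 2) (H_norm \<Omega> 2) \<and>
      (\<exists>c>0. AE t in lebesgue_on {0<..}. AE x in lebesgue_on \<Omega>. c \<le> v (t, x)) \<and>
      (\<forall>\<phi>\<in>test_functions ({0<..} \<times> \<Omega>).
         (LINT t|lebesgue_on {0<..}. LINT x|lebesgue_on \<Omega>. v (t, x) * deriv (\<lambda>s. \<phi> (s, x)) t) =
         (LINT t|lebesgue_on {0<..}. LINT x|lebesgue_on \<Omega>. u (t, x) * deriv (\<lambda>y. \<phi> (t, y)) x) \<and>
         (LINT t|lebesgue_on {0<..}. LINT x|lebesgue_on \<Omega>.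
            u (t, x) * deriv (\<lambda>s. \<phi> (s, x)) t + pressure a \<gamma> (v (t, x)) * deriv (\<lambda>y. \<phi> (t, y)) x) =
         (LINT t|lebesgue_on {0<..}. LINT x|lebesgue_on \<Omega>.
            \<mu> * wderiv \<Omega> 1 (\<lambda>y. u (t, y)) x / v (t, x) * deriv (\<lambda>y. \<phi> (t, y)) x)) \<and>
      (AE t in lebesgue_on {0<..}. zero_trace \<alpha> \<beta> (\<lambda>x. u (t, x))) \<and>
      v \<in> C0_time (H_space \<Omega> 0) (H_norm \<Omega> 0) \<and>
      u \<in> C0_time (H_space \<Omega> 0) (H_norm \<Omega> 0) \<and>
      (AE x in lebesgue_on \<Omega>. v (0, x) = v\<^sub>0 x \<and> u (0, x) = u\<^sub>0 x))"

end

theory Submission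
  imports Defs "HOL-Library.Diagonal_Subsequence"
begin

text \<open>
  Once \<open>\<epsilon>\<^sub>0\<close> is so small that the Sobolev embedding \<open>H\<^sup>2 \<subseteq> C\<^sup>1\<close> turns the energy estimate into the
  pointwise bounds \<open>\<bar>v - 1\<bar>, \<bar>v\<^sub>x\<bar>, \<bar>u\<bar>, \<bar>u\<^sub>x\<bar> \<le> 1/2\<close>, the solutions are equicontinuous: \<open>v\<^sub>t = u\<^sub>x\<close> is
  bounded, and \<open>u\<^sub>t = S\<^sub>x - p(v)\<^sub>x\<close> is bounded up to a term controlled by \<open>\<integral> \<parallel>S\<parallel>\<^sub>H\<^sub>2\<^sup>2 dt\<close>. By
  Arzela--Ascoli a subsequence of \<open>(v, u)\<close> converges pointwise, and since \<open>u\<^sub>x\<close> is equi-Hoelder in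
  space, \<open>u\<^sub>x\<close> converges pointwise as well. Weak compactness is not needed: in a Hilbert space a
  bounded sequence converges weakly as soon as it converges on a separating family of functionals.
  For \<open>H\<^sup>2\<close> these are the integrals over subintervals, so \<open>(v, u)\<close> converges weakly at every time, hence
  weakly-* by dominated convergence. For \<open>L\<^sup>2(0,\<infinity>; H\<^sup>2)\<close> they are the integrals over space-time boxes;
  solving \<open>\<tau> S\<^sub>t + v S = \<mu> u\<^sub>x\<close> for \<open>S\<close> and integrating \<open>\<tau> S\<^sub>t / v\<close> by parts in time leaves terms of
  order \<open>sqrt \<tau>\<close>, which identifies the limit of \<open>S\<close> as \<open>\<mu> u\<^sub>x / v\<close> and passes to the limit in the weak
  formulation.
\<close>


text \<open>What is known of \<open>S\<close> is an L^2 bound in time and a pointwise bound on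
  \<open>sqrt \<tau> * S\<close>; neither leaves a pointwise bound on \<open>S\<close> as \<tau>
  tends to 0. Two choices follow. Dividing the third equation by \<open>v\<close>, which stays above
  1/2, isolates \<open>S\<close>, so the product of \<open>v\<close> with a merely weakly convergent
  factor never has to be passed to the limit. And u_t comes with no uniform pointwise bound, so
  equicontinuity of u in time takes the form of a modulus L |t - s| + \<delta> with L depending on
  \<delta>. The other obstacle is representation: elements of the spaces are functions, weak
  derivatives are arbitrary choices up to null sets, and the Bochner spaces ask for approximation by
  simple functions. Hence Hilbert spaces with a seminorm, and a countable separating family of
  functionals in space which, at a fixed time or integrated over time intervals, decides
  measurability, weak convergence of bounded sequences and almost-everywhere equality. The pointwise
  bounds hold at every time including 0, so the limits are defined at every time and initial values
  are plain evaluation.\<close>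

lemma integrable_lebesgue_on_subset:
  fixes f :: "'a::euclidean_space \<Rightarrow> real"
  assumes f: "integrable (lebesgue_on S) f" and "T \<subseteq> S" and S: "S \<in> sets lebesgue" and T: "T \<in> sets lebesgue"
  shows "integrable (lebesgue_on T) f"
proof -
  have "integrable lebesgue (\<lambda>x. indicator T x *\<^sub>R (if x \<in> S then f x else 0))"
    using f S T by (intro integrable_mult_indicator) (simp_all add: Lebesgue_Measure.integrable_restrict_UNIV)
  also have "(\<lambda>x. indicator T x *\<^sub>R (if x \<in> S then f x else 0)) = (\<lambda>x. if x \<in> T then f x else 0)"
    using \<open>T \<subseteq> S\<close> by (auto simp: indicator_def fun_eq_iff)
  finally show ?thesis using T by (simp add: Lebesgue_Measure.integrable_restrict_UNIV)
qed

text \<open>The variance around the mean is nonnegative; expanding it gives the inequality. Total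
  mass zero is treated apart, since there is no mean then.\<close>

lemma integral_power2_le:
  fixes f :: "'a \<Rightarrow> real"
  assumes "finite_measure M" and f: "f \<in> borel_measurable M" and f2: "integrable M (\<lambda>x. (f x)\<^sup>2)"
  shows "(integral\<^sup>L M f)\<^sup>2 \<le> measure M (space M) * (\<integral>x. (f x)\<^sup>2 \<partial>M)"
proof (cases "measure M (space M) = 0")
  case True
  interpret finite_measure M by fact
  have "emeasure M (space M) = 0" using True by (simp add: emeasure_eq_measure)
  then have "AE x in M. f x = 0"
    by (intro AE_I[of _ _ "space M"]) auto
  then have "integral\<^sup>L M f = 0"
    using f by (subst integral_cong_AE[where g = "\<lambda>x. 0"]) auto
  then show ?thesis using True by simp
next
  case False
  interpret finite_measure M by fact
  let ?m = "measure M (space M)"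
  have int: "integrable M f"
    using square_integrable_imp_integrable[OF f f2] .
  let ?c = "integral\<^sup>L M f / ?m"
  have "0 \<le> (\<integral>x. (f x - ?c)\<^sup>2 \<partial>M)" by simp
  also have "(\<integral>x. (f x - ?c)\<^sup>2 \<partial>M) = (\<integral>x. (f x)\<^sup>2 - 2 * ?c * f x + ?c\<^sup>2 \<partial>M)"
    by (intro Bochner_Integration.integral_cong) (auto simp: power2_diff algebra_simps)
  also have "\<dots> = (\<integral>x. (f x)\<^sup>2 \<partial>M) - 2 * ?c * integral\<^sup>L M f + ?c\<^sup>2 * ?m"
    using int f2 by simp
  also have "\<dots> = (\<integral>x. (f x)\<^sup>2 \<partial>M) - (integral\<^sup>L M f)\<^sup>2 / ?m"
    using False by (simp add: field_simps power2_eq_square)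
  finally have "(integral\<^sup>L M f)\<^sup>2 / ?m \<le> (\<integral>x. (f x)\<^sup>2 \<partial>M)" by simp
  moreover have "?m > 0" using False by (simp add: zero_less_measure_iff)
  ultimately show ?thesis by (simp add: field_simps)
qed

text \<open>Half-lines form an intersection-stable generator of the Borel sets, and the sets over
  which \<open>h\<close> integrates to zero are closed under complements (by \<open>total\<close>)
  and countable disjoint unions. So all set integrals agree with those of the zero function, and
  densities are unique.\<close>

lemma AE_zero_if_integral_atMost_zero:
  fixes h :: "real \<Rightarrow> real"
  assumes h: "integrable lborel h" and total: "integral\<^sup>L lborel h = 0"
    and zero: "\<And>x. (LINT y:{..x}|lborel. h y) = 0"
  shows "AE x in lborel. h x = 0"
proof -
  have IS: "Int_stable (range (\<lambda>a::real. {..a}))"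
    by (auto simp: Int_stable_def)
  have PW: "range (\<lambda>a::real. {..a}) \<subseteq> Pow UNIV" by simp
  have borel: "(LINT y:A|lborel. h y) = 0" if "A \<in> sigma_sets UNIV (range (\<lambda>a::real. {..a}))" for A
    using IS PW that
  proof (induction rule: sigma_sets_induct_disjoint)
    case (basic A)
    then show ?case using zero by auto
  next
    case empty
    show ?case by (simp add: set_lebesgue_integral_def)
  next
    case (compl A)
    then have A: "A \<in> sets lborel" by (simp add: borel_eq_atMost)
    have "(LINT y:UNIV - A|lborel. h y) = (\<integral>y. h y - indicator A y *\<^sub>R h y \<partial>lborel)"
      unfolding set_lebesgue_integral_def
      by (intro Bochner_Integration.integral_cong) (auto simp: indicator_def)
    also have "\<dots> = integral\<^sup>L lborel h - (LINT y:A|lborel. h y)"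
      unfolding set_lebesgue_integral_def
      by (intro Bochner_Integration.integral_diff h integrable_mult_indicator A)
    finally show ?case using compl total by simp
  next
    case (union A)
    then have A: "\<And>i. A i \<in> sets lborel" by (auto simp: borel_eq_atMost)
    have "(LINT y:(\<Union>i. A i)|lborel. h y) = (\<Sum>i. LINT y:(A i)|lborel. h y)"
    proof (rule lebesgue_integral_countable_add[OF A])
      have "(\<Union>i. A i) \<in> sets lborel" using A by blast
      then show "set_integrable lborel (\<Union>i. A i) h"
        unfolding set_integrable_def using h by (rule integrable_mult_indicator)
    qed (use union(1) in \<open>auto simp: disjoint_family_on_def\<close>)
    then show ?case using union by simp
  qed
  have "AE x in lborel. h x = (\<lambda>x. 0) x"
  proof (rule density_unique_real[OF h])
    fix A :: "real set" assume "A \<in> sets lborel"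
    then have "A \<in> sigma_sets UNIV (range (\<lambda>a::real. {..a}))" by (simp add: borel_eq_atMost)
    then show "(LINT x:A|lborel. h x) = (LINT x:A|lborel. 0)" using borel by simp
  qed simp
  then show ?thesis by simp
qed

text \<open>Rational end points keep the family of functionals that must vanish countable. The
  indefinite integral is continuous, so its vanishing on a dense set gives all end points.\<close>

lemma AE_zero_if_rational_integrals_zero:
  fixes f :: "real \<Rightarrow> real"
  assumes "a < b" and f: "integrable (lebesgue_on {a..b}) f"
    and total: "integral\<^sup>L (lebesgue_on {a..b}) f = 0"
    and zero: "\<And>x. a < x \<Longrightarrow> x < b \<Longrightarrow> x \<in> \<rat> \<Longrightarrow> integral\<^sup>L (lebesgue_on {a..x}) f = 0"
  shows "AE x in lebesgue_on {a..b}. f x = 0"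
proof -
  have sub: "integrable (lebesgue_on {a..x}) f" if "x \<le> b" for x
    by (rule integrable_lebesgue_on_subset[OF f]) (use that in auto)
  have HK: "integral\<^sup>L (lebesgue_on {a..x}) f = integral {a..x} f" if "x \<le> b" for x
    by (rule lebesgue_integral_eq_integral[OF sub[OF that]]) simp
  have "f integrable_on {a..b}"
    using integrable_on_lebesgue_on[OF f] by simp
  then have cont: "continuous_on {a..b} (\<lambda>x. integral {a..x} f)"
    by (rule indefinite_integral_continuous_1)
  have all: "integral {a..x} f = 0" if x: "x \<in> {a..b}" for x
  proof (rule ccontr)
    let ?S = "closure ({a<..<b} \<inter> \<rat>)"
    assume "integral {a..x} f \<noteq> 0"
    have "{a<..<b} \<subseteq> ?S"
      using open_Int_closure_subset[of "{a<..<b}" "\<rat>"] by (simp add: Rats_closure_real)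
    then have "closure {a<..<b} \<subseteq> ?S" by (intro closure_minimal) auto
    moreover have "?S \<subseteq> closure {a<..<b}" by (intro closure_mono) auto
    ultimately have "?S = {a..b}" using \<open>a < b\<close> by simp
    then have "continuous_on ?S (\<lambda>x. integral {a..x} f)" "x \<in> ?S" using cont x by auto
    then have "integral {a..x} f = 0"
      using continuous_constant_on_closure[of "{a<..<b} \<inter> \<rat>" "\<lambda>x. integral {a..x} f" 0 x] zero HK
      by auto
    then show False using \<open>integral {a..x} f \<noteq> 0\<close> by contradiction
  qed
  define h where "h x = (if x \<in> {a..b} then f x else 0)" for x
  have h: "integrable lebesgue h"
    using f unfolding h_def by (subst Lebesgue_Measure.integrable_restrict_UNIV) auto
  \<comment> \<open>The half-line criterion is about \<open>lborel\<close>; a Borel representative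
    of the zero extension \<open>h\<close> brings the Lebesgue integrable \<open>f\<close> within
    its reach.\<close>
  obtain h' where h': "h' \<in> borel_measurable lborel" and eq: "AE x in lborel. h x = h' x"
    using completion_ex_borel_measurable_real[OF borel_measurable_integrable[OF h]] by blast
  have eq': "AE x in lebesgue. h x = h' x" using eq by (rule AE_completion)
  have h'_int: "integrable lebesgue h'"
    using h integrable_cong_AE[OF borel_measurable_integrable[OF h] _ eq'] h' by (simp add: measurable_completion)
  then have "integrable lborel h'" using h' by (simp add: integrable_completion)
  moreover have set: "(LINT y:{..x}|lborel. h' y) = 0" for x
  proof -
    have "(LINT y:{..x}|lborel. h' y) = (\<integral>y. indicator {..x} y *\<^sub>R h' y \<partial>lebesgue)"
      unfolding set_lebesgue_integral_def using h' by (intro integral_completion[symmetric]) auto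
    also have "\<dots> = (\<integral>y. indicator {..x} y *\<^sub>R h y \<partial>lebesgue)"
    proof (rule integral_cong_AE)
      have "{..x} \<in> sets lebesgue" by simp
      from borel_measurable_integrable[OF integrable_mult_indicator[OF this h'_int]]
        borel_measurable_integrable[OF integrable_mult_indicator[OF this h]]
      show "(\<lambda>y. indicator {..x} y *\<^sub>R h' y) \<in> borel_measurable lebesgue"
        "(\<lambda>y. indicator {..x} y *\<^sub>R h y) \<in> borel_measurable lebesgue" .
    qed (use eq' in \<open>auto elim: eventually_mono\<close>)
    also have "\<dots> = (\<integral>y. (if y \<in> {a..min x b} then f y else 0) \<partial>lebesgue)"
      by (intro Bochner_Integration.integral_cong) (auto simp: h_def indicator_def)
    also have "\<dots> = integral\<^sup>L (lebesgue_on {a..min x b}) f"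
      by (rule Lebesgue_Measure.integral_restrict_UNIV) simp
    also have "\<dots> = integral {a..min x b} f" by (rule HK) simp
    also have "\<dots> = 0" using all[of "min x b"] \<open>a < b\<close> by (cases "a \<le> x") auto
    finally show ?thesis .
  qed
  moreover have "integral\<^sup>L lborel h' = 0"
  proof -
    have "integral\<^sup>L lborel h' = integral\<^sup>L lebesgue h'" using h' by (rule integral_completion[symmetric])
    also have "\<dots> = integral\<^sup>L lebesgue h"
      using h h'_int eq' by (intro integral_cong_AE) auto
    also have "\<dots> = 0" using total unfolding h_def by (subst Lebesgue_Measure.integral_restrict_UNIV) auto
    finally show ?thesis .
  qed
  ultimately have "AE x in lborel. h' x = 0" by (intro AE_zero_if_integral_atMost_zero)
  then have "AE x in lebesgue. h' x = 0" by (rule AE_completion)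
  with eq' have "AE x in lebesgue. x \<in> {a..b} \<longrightarrow> f x = 0"
    by eventually_elim (auto simp: h_def split: if_splits)
  then show ?thesis by (simp add: AE_restrict_space_iff)
qed

text \<open>Completeness of the L^2 spaces rests on this. Weighting the squares by 2^n still leaves
  a convergent series of integrals, so the sum of 2^n d_n^2 is finite almost everywhere, and d_n is
  at most 2^-n + 2^n d_n^2. Total mass does not enter, so the lemma serves on the half-line of times
  as well.\<close>

lemma AE_summable_if_square_integrals_geometric:
  fixes d :: "nat \<Rightarrow> 'a \<Rightarrow> real"
  assumes nonneg: "\<And>n x. x \<in> space M \<Longrightarrow> 0 \<le> d n x"
    and int: "\<And>n. integrable M (\<lambda>x. (d n x)\<^sup>2)" and bound: "\<And>n. (\<integral>x. (d n x)\<^sup>2 \<partial>M) \<le> (1/4) ^ n"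
  shows "AE x in M. summable (\<lambda>n. d n x)"
proof -
  have meas [measurable]: "(\<lambda>x. (d n x)\<^sup>2) \<in> borel_measurable M" for n
    using int by (rule borel_measurable_integrable)
  have "(\<integral>\<^sup>+x. (\<Sum>n. ennreal (2 ^ n * (d n x)\<^sup>2)) \<partial>M) = (\<Sum>n. \<integral>\<^sup>+x. ennreal (2 ^ n * (d n x)\<^sup>2) \<partial>M)"
    by (intro nn_integral_suminf) measurable
  also have "\<dots> \<le> (\<Sum>n. ennreal ((1/2) ^ n))"
  proof (intro suminf_le)
    fix n
    have "(\<integral>\<^sup>+x. ennreal (2 ^ n * (d n x)\<^sup>2) \<partial>M) = ennreal (\<integral>x. 2 ^ n * (d n x)\<^sup>2 \<partial>M)"
      using int by (intro nn_integral_eq_integral) auto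
    also have "\<dots> \<le> ennreal ((1/2) ^ n)"
    proof (rule ennreal_leI)
      have "(\<integral>x. 2 ^ n * (d n x)\<^sup>2 \<partial>M) \<le> 2 ^ n * (1/4) ^ n"
        unfolding integral_mult_right_zero by (intro mult_left_mono bound) simp
      also have "\<dots> = (2 * (1/4)) ^ n" by (rule power_mult_distrib[symmetric])
      also have "2 * (1/4) = (1/2::real)" by simp
      finally show "(\<integral>x. 2 ^ n * (d n x)\<^sup>2 \<partial>M) \<le> (1/2) ^ n" .
    qed
    finally show "(\<integral>\<^sup>+x. ennreal (2 ^ n * (d n x)\<^sup>2) \<partial>M) \<le> ennreal ((1/2) ^ n)" .
  qed (auto intro: summableI)
  also have "\<dots> < \<infinity>"
    by (subst suminf_ennreal2) (simp_all add: summable_geometric del: power_one_over)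
  finally have "(\<integral>\<^sup>+x. (\<Sum>n. ennreal (2 ^ n * (d n x)\<^sup>2)) \<partial>M) \<noteq> \<infinity>" by (rule less_imp_neq)
  moreover have "(\<lambda>x. \<Sum>n. ennreal (2 ^ n * (d n x)\<^sup>2)) \<in> borel_measurable M" by measurable
  ultimately have "AE x in M. (\<Sum>n. ennreal (2 ^ n * (d n x)\<^sup>2)) \<noteq> \<infinity>"
    by (intro nn_integral_PInf_AE)
  then show ?thesis
    using AE_space
  proof eventually_elim
    case (elim x)
    then have "summable (\<lambda>n. 2 ^ n * (d n x)\<^sup>2)"
      by (intro summable_suminf_not_top) auto
    then have sum: "summable (\<lambda>n. (1/2) ^ n + 2 ^ n * (d n x)\<^sup>2)"
      by (intro summable_add) (auto simp: summable_geometric)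
    show ?case
    proof (rule summable_comparison_test'[OF sum])
      fix n
      \<comment> \<open>With y = 2^n d_n this is y \<le> 1 + y^2; division by 2^n gives the
        comparison term.\<close>
      have "0 \<le> (2 ^ n * d n x - 1)\<^sup>2 + 2 ^ n * d n x" using nonneg[of x n] elim by simp
      then have "2 ^ n * d n x \<le> 1 + (2 ^ n * d n x)\<^sup>2"
        by (simp add: power2_diff mult.commute)
      then have "(1/2) ^ n * (2 ^ n * d n x) \<le> (1/2) ^ n * (1 + (2 ^ n * d n x)\<^sup>2)"
        by (intro mult_left_mono) auto
      moreover have "(1/2::real) ^ n * (2 ^ n * c) = c" for c
        by (simp add: power_divide)
      moreover have "(1/2) ^ n * (1 + (2 ^ n * d n x)\<^sup>2) = (1/2) ^ n + (1/2) ^ n * (2 ^ n * (2 ^ n * (d n x)\<^sup>2))"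
        by (simp only: ring_distribs power2_eq_square mult_1_right mult.assoc mult.left_commute[of "d n x"])
      ultimately have "d n x \<le> (1/2) ^ n + 2 ^ n * (d n x)\<^sup>2"
        by simp
      then show "norm (d n x) \<le> (1/2) ^ n + 2 ^ n * (d n x)\<^sup>2" using nonneg[of x n] elim by simp
    qed
  qed
qed

section \<open>Hilbert spaces of functions\<close>


text \<open>First variation: for small t the linear term wins. The test point has a + 1 in the
  denominator so that a = 0 is allowed.\<close>

lemma quadratic_nonneg_imp_zero:
  fixes a c :: real
  assumes "\<And>t. 0 \<le> t\<^sup>2 * a + 2 * t * c" and "0 \<le> a"
  shows "c = 0"
proof (rule ccontr)
  assume "c \<noteq> 0"
  have "a + 1 \<noteq> 0" using assms(2) by simp
  then have "(- c / (a + 1))\<^sup>2 * a + 2 * (- c / (a + 1)) * c = - (c\<^sup>2 * (a + 2)) / (a + 1)\<^sup>2"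
    by (simp add: divide_simps) (simp add: algebra_simps power2_eq_square)
  moreover have "\<dots> < 0"
    using assms(2) \<open>c \<noteq> 0\<close> by (simp add: divide_neg_pos)
  ultimately show False
    using assms(1)[of "- c / (a + 1)"] by linarith
qed

text \<open>Coefficients and indices sit in a list: repetitions are allowed, sums of combinations
  are appended lists, and there are only countably many combinations with rational coefficients over
  a countable index set.\<close>

fun lincomb :: "('i \<Rightarrow> 'b \<Rightarrow> real) \<Rightarrow> (real \<times> 'i) list \<Rightarrow> 'b \<Rightarrow> real" where
  "lincomb e [] = (\<lambda>x. 0)"
| "lincomb e ((c, i) # cs) = (\<lambda>x. c * e i x + lincomb e cs x)"

lemma lincomb_append: "lincomb e (cs @ ds) x = lincomb e cs x + lincomb e ds x"
  by (induction cs) auto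

lemma lincomb_scale: "lincomb e (map (\<lambda>(c, i). (a * c, i)) cs) x = a * lincomb e cs x"
  by (induction cs) (auto simp: algebra_simps)

text \<open>Only a semi-inner product is required, so that spaces of functions need not be divided by
  almost-everywhere equality.\<close>

locale function_prehilbert =
  fixes X :: "('b \<Rightarrow> real) set"
    and B :: "('b \<Rightarrow> real) \<Rightarrow> ('b \<Rightarrow> real) \<Rightarrow> real"
    and N :: "('b \<Rightarrow> real) \<Rightarrow> real"
  assumes zero_in: "(\<lambda>x. 0) \<in> X"
    and comb_in: "f \<in> X \<Longrightarrow> g \<in> X \<Longrightarrow> (\<lambda>x. a * f x + b * g x) \<in> X"
    and B_comb: "f \<in> X \<Longrightarrow> g \<in> X \<Longrightarrow> h \<in> X \<Longrightarrow> B (\<lambda>x. a * f x + b * g x) h = a * B f h + b * B g h"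
    and B_commute: "f \<in> X \<Longrightarrow> g \<in> X \<Longrightarrow> B f g = B g f"
    and B_nonneg: "f \<in> X \<Longrightarrow> 0 \<le> B f f"
    and N_eq: "f \<in> X \<Longrightarrow> N f = sqrt (B f f)"
begin

lemma diff_in: "f \<in> X \<Longrightarrow> g \<in> X \<Longrightarrow> (\<lambda>x. f x - g x) \<in> X"
  using comb_in[of f g 1 "-1"] by simp

lemma B_diff: "f \<in> X \<Longrightarrow> g \<in> X \<Longrightarrow> h \<in> X \<Longrightarrow> B (\<lambda>x. f x - g x) h = B f h - B g h"
  using B_comb[of f g h 1 "-1"] by simp

lemma B_comb2: "f \<in> X \<Longrightarrow> g \<in> X \<Longrightarrow> h \<in> X \<Longrightarrow> B h (\<lambda>x. a * f x + b * g x) = a * B h f + b * B h g"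
  using B_comb[of f g h a b] by (simp add: B_commute comb_in)

lemma B_zero: "h \<in> X \<Longrightarrow> B (\<lambda>x. 0) h = 0"
  using B_comb[of h h h 0 0] by simp

lemma B_quadratic:
  assumes "f \<in> X" "g \<in> X"
  shows "B (\<lambda>x. a * f x + b * g x) (\<lambda>x. a * f x + b * g x) = a\<^sup>2 * B f f + 2 * a * b * B f g + b\<^sup>2 * B g g"
  using assms by (simp add: B_comb B_comb2 comb_in B_commute[of g f] power2_eq_square algebra_simps)

lemma N_nonneg: "f \<in> X \<Longrightarrow> 0 \<le> N f"
  by (simp add: N_eq B_nonneg)

lemma N_power2: "f \<in> X \<Longrightarrow> (N f)\<^sup>2 = B f f"
  by (simp add: N_eq B_nonneg)

lemma N_zero: "N (\<lambda>x. 0) = 0"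
  by (simp add: N_eq B_zero zero_in)

text \<open>The usual discriminant argument, with the degenerate case \<open>B g g = 0\<close> on
  its own: for a semi-inner product it does not force \<open>g\<close> to be zero.\<close>

lemma cauchy_schwarz:
  assumes f: "f \<in> X" and g: "g \<in> X"
  shows "\<bar>B f g\<bar> \<le> N f * N g"
proof -
  have *: "0 \<le> B f f + 2 * t * B f g + t\<^sup>2 * B g g" for t
    using B_nonneg[OF comb_in[OF f g, of 1 t]] B_quadratic[OF f g, of 1 t] by simp
  have "(B f g)\<^sup>2 \<le> B f f * B g g"
  proof (cases "B g g = 0")
    case True
    have "B f g = 0"
    proof (rule ccontr)
      assume "B f g \<noteq> 0"
      \<comment> \<open>This choice of t makes the affine expression
        \<open>B f f + 2 * t * B f g\<close> equal to -1.\<close>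
      then show False
        using *[of "- (B f f + 1) / (2 * B f g)"] True B_nonneg[OF f] by (simp add: field_simps)
    qed
    then show ?thesis using True by simp
  next
    case False
    then have "B g g > 0" using B_nonneg[OF g] by simp
    then show ?thesis
      using *[of "- B f g / B g g"] by (simp add: field_simps power2_eq_square)
  qed
  then have "sqrt ((B f g)\<^sup>2) \<le> sqrt (B f f * B g g)"
    by (rule real_sqrt_le_mono)
  then show ?thesis using f g by (simp add: N_eq real_sqrt_mult)
qed

lemma N_triangle:
  assumes f: "f \<in> X" and g: "g \<in> X"
  shows "N (\<lambda>x. a * f x + b * g x) \<le> \<bar>a\<bar> * N f + \<bar>b\<bar> * N g"
proof (rule power2_le_imp_le)
  have "a * b * B f g \<le> \<bar>a\<bar> * \<bar>b\<bar> * (N f * N g)"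
  proof -
    have "a * b * B f g \<le> \<bar>a * b\<bar> * \<bar>B f g\<bar>"
      using abs_ge_self[of "a * b * B f g"] by (simp only: abs_mult)
    also have "\<dots> \<le> \<bar>a * b\<bar> * (N f * N g)"
      by (intro mult_left_mono cauchy_schwarz[OF f g]) simp
    finally show ?thesis by (simp only: abs_mult)
  qed
  then show "(N (\<lambda>x. a * f x + b * g x))\<^sup>2 \<le> (\<bar>a\<bar> * N f + \<bar>b\<bar> * N g)\<^sup>2"
    using f g by (simp add: N_power2 comb_in B_quadratic power2_sum power_mult_distrib ac_simps)
qed (use f g in \<open>simp add: N_nonneg\<close>)

lemma N_triangle_diff:
  assumes "f \<in> X" "g \<in> X" "h \<in> X"
  shows "N (\<lambda>x. f x - h x) \<le> N (\<lambda>x. f x - g x) + N (\<lambda>x. g x - h x)"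
  using N_triangle[OF diff_in[of f g] diff_in[of g h], of 1 1] assms by simp

lemma N_le_add_diff: "f \<in> X \<Longrightarrow> g \<in> X \<Longrightarrow> N f \<le> N (\<lambda>x. f x - g x) + N g"
  using N_triangle_diff[of f g "\<lambda>x. 0"] by (simp add: zero_in)

lemma N_diff_commute:
  assumes "f \<in> X" "g \<in> X"
  shows "N (\<lambda>x. f x - g x) = N (\<lambda>x. g x - f x)"
  using N_triangle[OF diff_in[OF assms] zero_in, of "-1" 0]
    N_triangle[OF diff_in[OF assms(2,1)] zero_in, of "-1" 0] by simp

lemma N_diff_power2:
  assumes "f \<in> X" "g \<in> X"
  shows "(N (\<lambda>x. f x - g x))\<^sup>2 = B f f - 2 * B f g + B g g"
  using assms B_quadratic[of f g 1 "-1"] by (simp add: N_power2 diff_in)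

lemma dual_comb: "l \<in> dual_space X N \<Longrightarrow> f \<in> X \<Longrightarrow> g \<in> X \<Longrightarrow> l (\<lambda>x. a * f x + b * g x) = a * l f + b * l g"
  by (auto simp: dual_space_def)

lemma dual_diff: "l \<in> dual_space X N \<Longrightarrow> f \<in> X \<Longrightarrow> g \<in> X \<Longrightarrow> l (\<lambda>x. f x - g x) = l f - l g"
  using dual_comb[of l f g 1 "-1"] by simp

lemma dual_zero: "l \<in> dual_space X N \<Longrightarrow> l (\<lambda>x. 0) = 0"
  using dual_comb[of l "\<lambda>x. 0" "\<lambda>x. 0" 0 0] zero_in by simp

lemma dual_bounded:
  assumes "l \<in> dual_space X N"
  shows "\<exists>K\<ge>0. \<forall>f\<in>X. \<bar>l f\<bar> \<le> K * N f"
proof -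
  obtain K where K: "\<forall>f\<in>X. \<bar>l f\<bar> \<le> K * N f"
    using assms by (auto simp: dual_space_def)
  have "\<bar>l f\<bar> \<le> max K 0 * N f" if "f \<in> X" for f
    using K that N_nonneg[OF that] by (smt (verit, best) max.cobounded1 mult_right_mono)
  then show ?thesis by (intro exI[of _ "max K 0"]) auto
qed

lemma dual_tendsto:
  assumes "l \<in> dual_space X N" "\<And>n. F n \<in> X" "f \<in> X" "(\<lambda>n. N (\<lambda>x. F n x - f x)) \<longlonglongrightarrow> 0"
  shows "(\<lambda>n. l (F n)) \<longlonglongrightarrow> l f"
proof -
  obtain K where K: "\<forall>f\<in>X. \<bar>l f\<bar> \<le> K * N f"
    using dual_bounded[OF assms(1)] by blast
  have "(\<lambda>n. l (F n) - l f) \<longlonglongrightarrow> 0"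
  proof (rule Lim_null_comparison)
    show "\<forall>\<^sub>F n in sequentially. norm (l (F n) - l f) \<le> K * N (\<lambda>x. F n x - f x)"
      using bspec[OF K diff_in[OF assms(2,3)]] dual_diff[OF assms(1,2,3)] by simp
    show "(\<lambda>n. K * N (\<lambda>x. F n x - f x)) \<longlonglongrightarrow> 0"
      using tendsto_mult_right_zero[OF assms(4)] by simp
  qed
  then show ?thesis by (simp add: LIM_zero_iff)
qed

lemma B_in_dual: "g \<in> X \<Longrightarrow> (\<lambda>f. B f g) \<in> dual_space X N"
  unfolding dual_space_def using cauchy_schwarz[of _ g]
  by (intro CollectI conjI ballI allI exI[of _ "N g"]) (simp_all add: B_comb mult.commute)

text \<open>Bounded functionals cannot see a difference of seminorm zero, which allows an abstract
  limit to be exchanged for an equivalent representative.\<close>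

lemma N_eq_dual: "l \<in> dual_space X N \<Longrightarrow> f \<in> X \<Longrightarrow> g \<in> X \<Longrightarrow> N (\<lambda>x. f x - g x) = 0 \<Longrightarrow> l f = l g"
  using dual_bounded[of l] diff_in[of f g] dual_diff[of l f g]
  by (metis abs_ge_zero abs_le_zero_iff eq_iff_diff_eq_0 mult_zero_right)

end

text \<open>Limits are unique only up to seminorm zero, so completeness merely asks for some
  limit.\<close>

locale function_hilbert = function_prehilbert +
  assumes complete: "(\<And>n::nat. F n \<in> X) \<Longrightarrow> (\<And>e. e > 0 \<Longrightarrow> \<exists>M. \<forall>m\<ge>M. \<forall>n\<ge>M. N (\<lambda>x. F m x - F n x) < e)
    \<Longrightarrow> \<exists>f\<in>X. (\<lambda>n. N (\<lambda>x. F n x - f x)) \<longlonglongrightarrow> 0"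
begin

text \<open>A minimizing sequence of \<open>N f\<^sup>2 - 2 l f\<close> is a Cauchy sequence by the parallelogram law.
  This gives both the Riesz representation (\<open>V = X\<close>) and orthogonal projections.\<close>

lemma minimize:
  assumes V: "V \<subseteq> X" "(\<lambda>x. 0) \<in> V"
    and V_comb: "\<And>f g a b. f \<in> V \<Longrightarrow> g \<in> V \<Longrightarrow> (\<lambda>x. a * f x + b * g x) \<in> V"
    and l: "l \<in> dual_space X N"
  shows "\<exists>v g. (\<forall>n::nat. v n \<in> V) \<and> g \<in> X \<and> (\<lambda>n. N (\<lambda>x. v n x - g x)) \<longlonglongrightarrow> 0 \<and> (\<forall>w\<in>V. B g w = l w)"
proof -
  define J where "J f = B f f - 2 * l f" for f
  obtain K where K: "\<forall>f\<in>X. \<bar>l f\<bar> \<le> K * N f"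
    using dual_bounded[OF l] by blast
  have J_lower: "J f \<ge> - K\<^sup>2" if "f \<in> X" for f
    using bspec[OF K that] zero_le_power2[of "N f - K"] N_power2[OF that]
    by (simp add: J_def power2_diff algebra_simps)
  define d where "d = (INF f\<in>V. J f)"
  have bdd: "bdd_below (J ` V)"
    using J_lower V(1) by (auto intro!: bdd_belowI[of _ "- K\<^sup>2"])
  have d_le: "d \<le> J f" if "f \<in> V" for f
    unfolding d_def using bdd that by (rule cINF_lower)
  have "\<exists>f\<in>V. J f < d + 1 / (real n + 1)" for n
    using cINF_less_iff[OF _ bdd, of "d + 1 / (real n + 1)"] V(2)
    by (auto simp: d_def)
  then obtain v where v: "\<And>n. v n \<in> V" and Jv: "\<And>n. J (v n) < d + 1 / (real n + 1)"
    by metis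
  have vX: "v n \<in> X" for n using v V by auto
  \<comment> \<open>The midpoint of \<open>v m\<close> and \<open>v n\<close> lies in
    \<open>V\<close>, so its value of \<open>J\<close> is at least \<open>d\<close>; by the
    parallelogram law the distance is controlled by the two excesses over the infimum.\<close>
  have dist: "(N (\<lambda>x. v m x - v n x))\<^sup>2 \<le> 2 * (1 / (real m + 1)) + 2 * (1 / (real n + 1))" for m n
  proof -
    have "d \<le> J (\<lambda>x. (1/2) * v m x + (1/2) * v n x)"
      using d_le V_comb[OF v v] by blast
    also have "\<dots> = (B (v m) (v m) + 2 * B (v m) (v n) + B (v n) (v n)) / 4 - l (v m) - l (v n)"
      unfolding J_def dual_comb[OF l vX vX] B_quadratic[OF vX vX] by (simp add: power2_eq_square)
    finally show ?thesis
      using Jv[of m] Jv[of n] unfolding N_diff_power2[OF vX vX] J_def by argo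
  qed
  have "\<exists>M. \<forall>m\<ge>M. \<forall>n\<ge>M. N (\<lambda>x. v m x - v n x) < e" if "e > 0" for e
  proof -
    obtain M :: nat where M: "4 / e\<^sup>2 < real M"
      using reals_Archimedean2 by blast
    have "N (\<lambda>x. v m x - v n x) < e" if mn: "m \<ge> M" "n \<ge> M" for m n
    proof (rule power2_less_imp_less)
      have "1 / (real k + 1) \<le> 1 / (real M + 1)" if "k \<ge> M" for k
        using that by (intro divide_left_mono) auto
      from this[OF mn(1)] this[OF mn(2)]
      have "(N (\<lambda>x. v m x - v n x))\<^sup>2 \<le> 4 / (real M + 1)"
        using dist[of m n] by linarith
      also have "\<dots> < e\<^sup>2"
        using M \<open>e > 0\<close> by (simp add: field_simps) (smt (verit) zero_less_power2)
      finally show "(N (\<lambda>x. v m x - v n x))\<^sup>2 < e\<^sup>2" .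
    qed (use \<open>e > 0\<close> in simp)
    then show ?thesis by blast
  qed
  from complete[OF vX this] obtain g where g: "g \<in> X" and lim: "(\<lambda>n. N (\<lambda>x. v n x - g x)) \<longlonglongrightarrow> 0"
    by blast
  have "B g w = l w" if w: "w \<in> V" for w
  proof -
    have wX: "w \<in> X" using w V by auto
    \<comment> \<open>\<open>V\<close> need not be closed, so \<open>g\<close> may lie outside it;
      the variation in direction \<open>w\<close> is made along the minimizing sequence and passed
      to the limit.\<close>
    have "0 \<le> t\<^sup>2 * B w w + 2 * t * (B g w - l w)" for t
    proof -
      have "- (1 / (real n + 1)) \<le> t\<^sup>2 * B w w + 2 * t * (B (v n) w - l w)" for n
      proof -
        have "d \<le> J (\<lambda>x. 1 * v n x + t * w x)"
          using d_le V_comb[OF v w] by blast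
        also have "\<dots> = J (v n) + t\<^sup>2 * B w w + 2 * t * (B (v n) w - l w)"
          unfolding J_def dual_comb[OF l vX wX] B_quadratic[OF vX wX]
          by (simp add: algebra_simps)
        finally show ?thesis using Jv[of n] by simp
      qed
      moreover have "(\<lambda>n. - (1 / (real n + 1))) \<longlonglongrightarrow> 0"
        using LIMSEQ_Suc[OF lim_1_over_n[where 'a=real]] tendsto_minus by (fastforce simp: add.commute)
      moreover have "(\<lambda>n. t\<^sup>2 * B w w + 2 * t * (B (v n) w - l w)) \<longlonglongrightarrow> t\<^sup>2 * B w w + 2 * t * (B g w - l w)"
        by (intro tendsto_intros dual_tendsto[OF B_in_dual[OF wX] vX g lim])
      ultimately show ?thesis
        by (meson LIMSEQ_le_const2 LIMSEQ_le)
    qed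
    from quadratic_nonneg_imp_zero[OF this B_nonneg[OF wX]] show ?thesis by simp
  qed
  with v g lim show ?thesis by blast
qed

lemma riesz:
  assumes "l \<in> dual_space X N"
  shows "\<exists>e\<in>X. \<forall>f\<in>X. B f e = l f"
proof -
  obtain g where "g \<in> X" "\<forall>w\<in>X. B g w = l w"
    using minimize[OF order_refl zero_in comb_in assms] by blast
  then show ?thesis by (intro bexI[of _ g]) (simp_all add: B_commute)
qed

lemma lincomb_in:
  assumes "\<And>i. i \<in> I \<Longrightarrow> e i \<in> X" "cs \<in> lists (C \<times> I)"
  shows "lincomb e cs \<in> X"
  using assms(2)
proof (induction cs)
  case Nil
  show ?case by (simp add: zero_in)
next
  case (Cons p cs)
  then show ?case
    using comb_in[of "e (snd p)" "lincomb e cs" "fst p" 1] assms(1) by (cases p) auto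
qed

text \<open>Projecting \<open>f\<close> orthogonally to the span leaves a remainder orthogonal to
  every \<open>e i\<close>, and \<open>sep\<close> makes that remainder null. Since
  \<open>minimize\<close> delivers the projection as a limit of elements of the span, no closure has
  to be formed.\<close>

lemma lincomb_dense:
  assumes e: "\<And>i. i \<in> I \<Longrightarrow> e i \<in> X"
    and sep: "\<And>g. g \<in> X \<Longrightarrow> (\<And>i. i \<in> I \<Longrightarrow> B g (e i) = 0) \<Longrightarrow> N g = 0"
    and f: "f \<in> X" and "\<epsilon> > 0"
  shows "\<exists>cs\<in>lists (UNIV \<times> I). N (\<lambda>x. f x - lincomb e cs x) < \<epsilon>"
proof -
  define V where "V = lincomb e ` lists (UNIV \<times> I)"
  have comb: "(\<lambda>x. a * p x + b * q x) \<in> V" if pq: "p \<in> V" "q \<in> V" for p q a b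
  proof -
    obtain cs ds where cs: "cs \<in> lists (UNIV \<times> I)" "ds \<in> lists (UNIV \<times> I)" "p = lincomb e cs" "q = lincomb e ds"
      using pq by (auto simp: V_def)
    let ?cs = "map (\<lambda>(c, i). (a * c, i)) cs @ map (\<lambda>(c, i). (b * c, i)) ds"
    have "(\<lambda>x. a * p x + b * q x) = lincomb e ?cs"
      by (rule ext) (simp only: cs lincomb_append lincomb_scale)
    moreover have "?cs \<in> lists (UNIV \<times> I)"
      using cs(1,2) by auto
    ultimately show ?thesis
      unfolding V_def by blast
  qed
  have sub: "V \<subseteq> X" unfolding V_def using lincomb_in[of I e, OF e] by blast
  have zero: "(\<lambda>x. 0) \<in> V"
    unfolding V_def by (rule image_eqI[of _ _ "[]"]) auto
  obtain v g where v: "\<And>n::nat. v n \<in> V" and g: "g \<in> X" and lim: "(\<lambda>n. N (\<lambda>x. v n x - g x)) \<longlonglongrightarrow> 0"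
    and orth: "\<forall>w\<in>V. B g w = B w f"
    using minimize[OF sub zero comb B_in_dual[OF f]] by blast
  have vX: "v n \<in> X" for n using v sub by auto
  have "B (\<lambda>x. f x - g x) (e i) = 0" if "i \<in> I" for i
  proof -
    have "e i \<in> V"
      unfolding V_def by (rule image_eqI[of _ _ "[(1, i)]"]) (use that in auto)
    then show ?thesis
      using bspec[OF orth, of "e i"] e[OF that] f g by (simp add: B_diff B_commute)
  qed
  then have "N (\<lambda>x. f x - g x) = 0"
    using sep diff_in f g by blast
  moreover obtain n where "N (\<lambda>x. v n x - g x) < \<epsilon>"
    using order_tendstoD(2)[OF lim \<open>\<epsilon> > 0\<close>] by (auto simp: eventually_sequentially)
  ultimately have "N (\<lambda>x. f x - v n x) < \<epsilon>"
    using N_triangle_diff[OF f g vX, of n] N_diff_commute[OF g vX, of n] by simp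
  then show ?thesis using v[of n] by (auto simp: V_def)
qed

text \<open>The Riesz representers of \<open>L\<close> have a dense span, and boundedness carries
  convergence of the pairings from the span to the whole space. The limit of the pairings is a
  bounded functional, and its representer is the weak limit of the full sequence, without passing to
  a subsequence.\<close>

lemma weak_limit:
  assumes L: "L \<subseteq> dual_space X N"
    and sep: "\<And>g. g \<in> X \<Longrightarrow> (\<And>l. l \<in> L \<Longrightarrow> l g = 0) \<Longrightarrow> N g = 0"
    and F: "\<And>n. F n \<in> X" and bound: "\<And>n. N (F n) \<le> K"
    and conv: "\<And>l. l \<in> L \<Longrightarrow> convergent (\<lambda>n. l (F n))"
  shows "\<exists>g. weakly_converges X N F g \<and> N g \<le> K"
proof -
  have "\<forall>l\<in>L. \<exists>e. e \<in> X \<and> (\<forall>f\<in>X. B f e = l f)"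
    using riesz L by blast
  then obtain e where e: "\<And>l. l \<in> L \<Longrightarrow> e l \<in> X" and Be: "\<And>l f. l \<in> L \<Longrightarrow> f \<in> X \<Longrightarrow> B f (e l) = l f"
    by metis
  have K: "0 \<le> K" using N_nonneg[OF F] bound order_trans by blast
  have conv_lincomb: "convergent (\<lambda>n. B (F n) (lincomb e cs))" if "cs \<in> lists (UNIV \<times> L)" for cs
    using that
  proof (induction cs)
    case Nil
    have "B (F n) (\<lambda>x. 0) = 0" for n using B_commute[OF F zero_in] B_zero[OF F] by simp
    then show ?case by (simp add: convergent_const)
  next
    case (Cons p cs)
    obtain c l where p: "p = (c, l)" by (cases p)
    with Cons have l: "l \<in> L" and cs: "cs \<in> lists (UNIV \<times> L)" by auto
    have "B (F n) (lincomb e (p # cs)) = c * l (F n) + B (F n) (lincomb e cs)" for n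
      using B_comb2[OF e[OF l] lincomb_in[of L e cs UNIV, OF e cs] F, where a = c and b = 1] Be[OF l F] by (simp add: p)
    moreover have "convergent (\<lambda>n. c * l (F n) + B (F n) (lincomb e cs))"
      using conv[OF l] Cons.IH
      by (intro convergent_add) (auto intro: convergent_mult convergent_const)
    ultimately show ?case by simp
  qed
  have conv_all: "convergent (\<lambda>n. B (F n) h)" if h: "h \<in> X" for h
  proof (rule Cauchy_convergent, rule metric_CauchyI)
    fix \<epsilon> :: real assume "\<epsilon> > 0"
    \<comment> \<open>K + 1 in place of K keeps the quotient meaningful for K = 0.\<close>
    define \<delta> where "\<delta> = \<epsilon> / (4 * (K + 1))"
    have "\<delta> > 0" using \<open>\<epsilon> > 0\<close> K by (simp add: \<delta>_def)
    obtain cs where cs: "cs \<in> lists (UNIV \<times> L)" and close: "N (\<lambda>x. h x - lincomb e cs x) < \<delta>"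
      using lincomb_dense[of L e h \<delta>] e Be sep h \<open>\<delta> > 0\<close> by auto
    have d: "lincomb e cs \<in> X" using lincomb_in[of L e cs UNIV] e cs by blast
    have diff: "\<bar>B (F n) h - B (F n) (lincomb e cs)\<bar> \<le> \<epsilon> / 4" for n
    proof -
      have "B (F n) h - B (F n) (lincomb e cs) = B (F n) (\<lambda>x. h x - lincomb e cs x)"
        using B_diff[OF h d F] h d by (simp add: B_commute diff_in F)
      also have "\<bar>\<dots>\<bar> \<le> N (F n) * N (\<lambda>x. h x - lincomb e cs x)"
        using cauchy_schwarz[OF F diff_in[OF h d]] .
      also have "\<dots> \<le> (K + 1) * \<delta>"
        using bound[of n] close K N_nonneg[OF F, of n] N_nonneg[OF diff_in[OF h d]]
        by (intro mult_mono) auto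
      also have "(K + 1) * \<delta> = \<epsilon> / 4"
        using add_nonneg_pos[OF K zero_less_one] by (simp add: \<delta>_def divide_simps)
      finally show ?thesis .
    qed
    obtain M where M: "\<forall>m\<ge>M. \<forall>n\<ge>M. dist (B (F m) (lincomb e cs)) (B (F n) (lincomb e cs)) < \<epsilon> / 4"
      using metric_CauchyD[OF convergent_Cauchy[OF conv_lincomb[OF cs]], of "\<epsilon> / 4"] \<open>\<epsilon> > 0\<close> by auto
    have "dist (B (F m) h) (B (F n) h) < \<epsilon>" if "m \<ge> M" "n \<ge> M" for m n
    proof -
      have "dist (B (F m) (lincomb e cs)) (B (F n) (lincomb e cs)) < \<epsilon> / 4"
        using M that by blast
      then show ?thesis
        using diff[of m] diff[of n] \<open>\<epsilon> > 0\<close> unfolding dist_real_def by linarith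
    qed
    then show "\<exists>M. \<forall>m\<ge>M. \<forall>n\<ge>M. dist (B (F m) h) (B (F n) h) < \<epsilon>" by blast
  qed
  define l0 where "l0 h = lim (\<lambda>n. B (F n) h)" for h
  have l0: "(\<lambda>n. B (F n) h) \<longlonglongrightarrow> l0 h" if "h \<in> X" for h
    using conv_all[OF that] by (simp add: l0_def convergent_LIMSEQ_iff)
  have "l0 \<in> dual_space X N"
    unfolding dual_space_def
  proof (intro CollectI conjI ballI allI exI[of _ K])
    fix f g a b assume fg: "f \<in> X" "g \<in> X"
    have "(\<lambda>n. B (F n) (\<lambda>x. a * f x + b * g x)) \<longlonglongrightarrow> a * l0 f + b * l0 g"
      unfolding B_comb2[OF fg F] using fg by (intro tendsto_intros l0)
    then show "l0 (\<lambda>x. a * f x + b * g x) = a * l0 f + b * l0 g"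
      using l0[OF comb_in[OF fg]] LIMSEQ_unique by blast
  next
    fix f assume f: "f \<in> X"
    have "norm (B (F n) f) \<le> K * N f" for n
      using cauchy_schwarz[OF F f, of n] mult_right_mono[OF bound N_nonneg[OF f], of n] by simp
    then show "\<bar>l0 f\<bar> \<le> K * N f"
      using Lim_bounded[OF tendsto_norm[OF l0[OF f]]] by auto
  qed
  from riesz[OF this] obtain g where g: "g \<in> X" and Bg: "\<And>h. h \<in> X \<Longrightarrow> B h g = l0 h"
    by blast
  have "(\<lambda>n. l (F n)) \<longlonglongrightarrow> l g" if l: "l \<in> dual_space X N" for l
  proof -
    obtain h where h: "h \<in> X" and Bh: "\<And>f. f \<in> X \<Longrightarrow> B f h = l f"
      using riesz[OF l] by blast
    show ?thesis
      using l0[OF h] Bg[OF h] Bh[OF F] Bh[OF g] B_commute[OF h g] by simp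
  qed
  then have "weakly_converges X N F g"
    using F g by (simp add: weakly_converges_def)
  \<comment> \<open>Weak lower semicontinuity of the norm, obtained by testing the convergence with
    \<open>g\<close> itself.\<close>
  moreover have "N g \<le> K"
  proof -
    have "norm (B (F n) g) \<le> K * N g" for n
      using cauchy_schwarz[OF F g, of n] mult_right_mono[OF bound N_nonneg[OF g], of n] by simp
    then have "\<bar>l0 g\<bar> \<le> K * N g"
      using Lim_bounded[OF tendsto_norm[OF l0[OF g]]] by auto
    then have "N g * N g \<le> K * N g"
      using Bg[OF g] N_power2[OF g] by (simp add: power2_eq_square)
    then show ?thesis
      using N_nonneg[OF g] K by (cases "N g = 0") auto
  qed
  ultimately show ?thesis by blast
qed

end

section \<open>Functions of time with values in a Hilbert space\<close>


text \<open>Lebesgue measure is complete, so changing values on a null set cannot destroy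
  measurability.\<close>

lemma borel_measurable_lebesgue_on_AE:
  fixes f g :: "'a::euclidean_space \<Rightarrow> real"
  assumes S: "S \<in> sets lebesgue" and f: "f \<in> borel_measurable (lebesgue_on S)"
    and eq: "AE x in lebesgue_on S. f x = g x"
  shows "g \<in> borel_measurable (lebesgue_on S)"
proof -
  have "AE x in lebesgue. (if x \<in> S then f x else 0) = (if x \<in> S then g x else 0)"
    using eq S by (auto simp: AE_restrict_space_iff elim: eventually_mono)
  with borel_measurable_if_I[OF f S] have "(\<lambda>x. if x \<in> S then g x else 0) \<in> borel_measurable lebesgue"
    by (rule borel_measurable_AE)
  then show ?thesis by (rule borel_measurable_if_D)
qed

lemma borel_measurable_lebesgue_on_AE_limit:
  fixes f :: "'a::euclidean_space \<Rightarrow> real"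
  assumes S: "S \<in> sets lebesgue" and s: "\<And>n. s n \<in> borel_measurable (lebesgue_on S)"
    and lim: "AE x in lebesgue_on S. (\<lambda>n. s n x) \<longlonglongrightarrow> f x"
  shows "f \<in> borel_measurable (lebesgue_on S)"
proof (rule borel_measurable_lebesgue_on_AE[OF S borel_measurable_lim_metric[OF s]])
  show "AE x in lebesgue_on S. lim (\<lambda>n. s n x) = f x"
    using lim by eventually_elim (rule limI)
qed

lemma greaterThan_lebesgue [simp]: "{0::real<..} \<in> sets lebesgue"
  by simp

lemma AE_greaterThan: "AE t in lebesgue_on {0::real<..}. 0 < t"
  using AE_space[of "lebesgue_on {0::real<..}"] by (rule eventually_mono) simp

text \<open>Separability enters through countably many functionals rather than a dense sequence:
  they are the scalar quantities whose measurability in time can be checked, and a dense sequence is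
  built from their representers.\<close>

locale separable_function_hilbert = function_hilbert +
  fixes L :: "(('b \<Rightarrow> real) \<Rightarrow> real) set"
  assumes countable_L: "countable L"
    and L_dual: "L \<subseteq> dual_space X N"
    and L_separating: "g \<in> X \<Longrightarrow> (\<And>l. l \<in> L \<Longrightarrow> l g = 0) \<Longrightarrow> N g = 0"
begin

lemma lincomb_rational:
  assumes e: "\<And>i. i \<in> I \<Longrightarrow> e i \<in> X" and cs: "cs \<in> lists (UNIV \<times> I)"
  shows "\<forall>\<epsilon>>0. \<exists>ds\<in>lists (\<rat> \<times> I). N (\<lambda>x. lincomb e cs x - lincomb e ds x) < \<epsilon>"
  using cs
proof (induction cs)
  case Nil
  show ?case by (intro allI impI bexI[of _ "[]"]) (simp_all add: N_zero)
next
  case (Cons p cs)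
  obtain c i where p: "p = (c, i)" by (cases p)
  with Cons have i: "i \<in> I" and cs: "cs \<in> lists (UNIV \<times> I)" by auto
  show ?case
  proof (intro allI impI)
    fix \<epsilon> :: real assume "\<epsilon> > 0"
    then obtain ds where ds: "ds \<in> lists (\<rat> \<times> I)" "N (\<lambda>x. lincomb e cs x - lincomb e ds x) < \<epsilon> / 2"
      using Cons.IH by (meson half_gt_zero)
    define \<delta> where "\<delta> = \<epsilon> / (2 * (N (e i) + 1))"
    have Ne: "0 \<le> N (e i)" using N_nonneg e i by blast
    then have "\<delta> > 0" using \<open>\<epsilon> > 0\<close> by (simp add: \<delta>_def)
    then obtain q where q: "q \<in> \<rat>" "c - \<delta> < q" "q < c"
      using Rats_dense_in_real[of "c - \<delta>" c] by auto
    have mem: "lincomb e cs \<in> X" "lincomb e ds \<in> X"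
      using lincomb_in[of I e cs UNIV] lincomb_in[of I e ds \<rat>] e cs ds by auto
    have "(\<lambda>x. lincomb e (p # cs) x - lincomb e ((q, i) # ds) x)
        = (\<lambda>x. (c - q) * e i x + 1 * (lincomb e cs x - lincomb e ds x))"
      by (simp add: p algebra_simps)
    then have "N (\<lambda>x. lincomb e (p # cs) x - lincomb e ((q, i) # ds) x)
        \<le> \<bar>c - q\<bar> * N (e i) + N (\<lambda>x. lincomb e cs x - lincomb e ds x)"
      using N_triangle[OF e[OF i] diff_in[OF mem], of "c - q" 1] by simp
    moreover have "\<bar>c - q\<bar> * N (e i) \<le> \<delta> * (N (e i) + 1)"
      using q Ne \<open>\<delta> > 0\<close> by (intro mult_mono) auto
    moreover have "\<delta> * (N (e i) + 1) = \<epsilon> / 2"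
      using add_nonneg_pos[OF Ne zero_less_one] by (simp add: \<delta>_def divide_simps)
    ultimately have "N (\<lambda>x. lincomb e (p # cs) x - lincomb e ((q, i) # ds) x) < \<epsilon>"
      using ds(2) by linarith
    moreover have "(q, i) # ds \<in> lists (\<rat> \<times> I)" using q i ds by auto
    ultimately show "\<exists>ds\<in>lists (\<rat> \<times> I). N (\<lambda>x. lincomb e (p # cs) x - lincomb e ds x) < \<epsilon>"
      by blast
  qed
qed

text \<open>The sequence runs through the rational combinations of the representers of
  \<open>L\<close>. That pairing with a member is a finite combination of functionals from
  \<open>L\<close> is recorded so that measurability of those functionals passes to the
  pairings.\<close>

lemma dense_sequence:
  shows "\<exists>d. (\<forall>n::nat. d n \<in> X \<and> (\<exists>cs\<in>lists (UNIV \<times> L). \<forall>f\<in>X. B f (d n) = (\<Sum>(c, l)\<leftarrow>cs. c * l f)))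
    \<and> (\<forall>f\<in>X. \<forall>\<epsilon>>0. \<exists>n. N (\<lambda>x. f x - d n x) < \<epsilon>)"
proof -
  have "\<forall>l\<in>L. \<exists>e. e \<in> X \<and> (\<forall>f\<in>X. B f e = l f)"
    using riesz L_dual by blast
  then obtain e where e: "\<And>l. l \<in> L \<Longrightarrow> e l \<in> X" and Be: "\<And>l f. l \<in> L \<Longrightarrow> f \<in> X \<Longrightarrow> B f (e l) = l f"
    by metis
  define D where "D = lincomb e ` lists (\<rat> \<times> L)"
  have "countable D"
    unfolding D_def using countable_L countable_rat by (intro countable_image countable_lists countable_SIGMA) auto
  moreover have "D \<noteq> {}" by (auto simp: D_def)
  ultimately have range: "range (from_nat_into D) = D"
    by (rule range_from_nat_into[rotated])
  have D_X: "D \<subseteq> X"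
    unfolding D_def using lincomb_in[of L e _ \<rat>] e by blast
  have rep: "\<forall>f\<in>X. B f (lincomb e cs) = (\<Sum>(c, l)\<leftarrow>cs. c * l f)" if "cs \<in> lists (UNIV \<times> L)" for cs
    using that
  proof (induction cs)
    case Nil
    show ?case using B_commute B_zero zero_in by auto
  next
    case (Cons p cs)
    obtain c l where p: "p = (c, l)" by (cases p)
    with Cons have l: "l \<in> L" and cs: "cs \<in> lists (UNIV \<times> L)" by auto
    show ?case
      using B_comb2[OF e[OF l] lincomb_in[of L e cs UNIV, OF e cs], where a = c and b = 1] Be[OF l] Cons.IH
      by (simp add: p)
  qed
  show ?thesis
  proof (intro exI[of _ "from_nat_into D"] conjI allI ballI impI)
    fix n
    have "from_nat_into D n \<in> D" using range by blast
    then show "from_nat_into D n \<in> X" using D_X by blast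
    obtain cs where cs: "cs \<in> lists (\<rat> \<times> L)" "from_nat_into D n = lincomb e cs"
      using \<open>from_nat_into D n \<in> D\<close> by (auto simp: D_def)
    then have "cs \<in> lists (UNIV \<times> L)" by auto
    with rep cs show "\<exists>cs\<in>lists (UNIV \<times> L). \<forall>f\<in>X. B f (from_nat_into D n) = (\<Sum>(c, l)\<leftarrow>cs. c * l f)"
      by auto
  next
    fix f and \<epsilon> :: real assume f: "f \<in> X" and "\<epsilon> > 0"
    have sep: "N g = 0" if "g \<in> X" "\<And>l. l \<in> L \<Longrightarrow> B g (e l) = 0" for g
      using L_separating[OF that(1)] that Be by auto
    obtain cs where cs: "cs \<in> lists (UNIV \<times> L)" "N (\<lambda>x. f x - lincomb e cs x) < \<epsilon> / 2"
      using lincomb_dense[of L e f "\<epsilon> / 2"] e sep f \<open>\<epsilon> > 0\<close> by auto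
    obtain ds where ds: "ds \<in> lists (\<rat> \<times> L)" "N (\<lambda>x. lincomb e cs x - lincomb e ds x) < \<epsilon> / 2"
      using lincomb_rational[of L e cs] e cs \<open>\<epsilon> > 0\<close> by (meson half_gt_zero)
    have "lincomb e cs \<in> X" "lincomb e ds \<in> X"
      using lincomb_in[of L e cs UNIV] lincomb_in[of L e ds \<rat>] e cs ds by auto
    from N_triangle_diff[OF f this] cs ds have "N (\<lambda>x. f x - lincomb e ds x) < \<epsilon>" by simp
    moreover have "lincomb e ds \<in> range (from_nat_into D)"
      using range ds by (auto simp: D_def)
    ultimately show "\<exists>n. N (\<lambda>x. f x - from_nat_into D n x) < \<epsilon>" by auto
  qed
qed

text \<open>Since N(f - d)^2 is nonnegative and becomes arbitrarily small along the dense sequence,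
  \<open>B f f\<close> is the supremum of \<open>2 * B f (d n) - B (d n) (d n)\<close>, a countable
  supremum of measurable functions.\<close>

lemma N_measurable:
  assumes G: "\<And>t. t \<in> space M \<Longrightarrow> G t \<in> X"
    and meas: "\<And>l. l \<in> L \<Longrightarrow> (\<lambda>t. l (G t)) \<in> borel_measurable M"
  shows "(\<lambda>t. N (G t)) \<in> borel_measurable M"
proof -
  obtain d where D: "\<forall>n::nat. d n \<in> X \<and> (\<exists>cs\<in>lists (UNIV \<times> L). \<forall>f\<in>X. B f (d n) = (\<Sum>(c, l)\<leftarrow>cs. c * l f))"
    and dense: "\<forall>f\<in>X. \<forall>\<epsilon>>0. \<exists>n. N (\<lambda>x. f x - d n x) < \<epsilon>"
    using dense_sequence by blast
  have d: "d n \<in> X" for n using D by blast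
  have Bd: "(\<lambda>t. B (G t) (d n)) \<in> borel_measurable M" for n
  proof -
    obtain cs where cs: "cs \<in> lists (UNIV \<times> L)" and eq: "\<forall>f\<in>X. B f (d n) = (\<Sum>(c, l)\<leftarrow>cs. c * l f)"
      using D by blast
    have "(\<lambda>t. \<Sum>(c, l)\<leftarrow>cs. c * l (G t)) \<in> borel_measurable M"
      using cs
    proof (induction cs)
      case (Cons p cs)
      obtain c l where p: "p = (c, l)" by (cases p)
      have "(\<lambda>t. c * l (G t)) \<in> borel_measurable M"
        using meas[of l] Cons p by (intro borel_measurable_times borel_measurable_const) auto
      from borel_measurable_add[OF this] Cons show ?case by (simp add: p)
    qed simp
    then show ?thesis
      by (rule measurable_cong[THEN iffD1, rotated]) (use eq G in auto)
  qed
  have iff: "B f f \<le> r \<longleftrightarrow> (\<forall>n. 2 * B f (d n) - B (d n) (d n) \<le> r)" if f: "f \<in> X" for f r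
  proof
    show "\<forall>n. 2 * B f (d n) - B (d n) (d n) \<le> r" if "B f f \<le> r"
    proof
      fix n
      show "2 * B f (d n) - B (d n) (d n) \<le> r"
        using N_diff_power2[OF f d, of n] that zero_le_power2[of "N (\<lambda>x. f x - d n x)"] by linarith
    qed
  next
    assume le: "\<forall>n. 2 * B f (d n) - B (d n) (d n) \<le> r"
    show "B f f \<le> r"
    proof (rule field_le_epsilon)
      fix \<epsilon> :: real assume "\<epsilon> > 0"
      then obtain n where n: "N (\<lambda>x. f x - d n x) < sqrt \<epsilon>" using bspec[OF dense f] by (meson real_sqrt_gt_zero)
      then have "(N (\<lambda>x. f x - d n x))\<^sup>2 \<le> \<epsilon>"
        using power_mono[OF less_imp_le[OF n] N_nonneg[OF diff_in[OF f d]], of 2] \<open>\<epsilon> > 0\<close> by simp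
      moreover have "2 * B f (d n) - B (d n) (d n) \<le> r" using le by blast
      ultimately show "B f f \<le> r + \<epsilon>"
        using N_diff_power2[OF f d, of n] by linarith
    qed
  qed
  have "(\<lambda>t. B (G t) (G t)) \<in> borel_measurable M"
    unfolding borel_measurable_iff_le
  proof
    fix r
    have "{t \<in> space M. B (G t) (G t) \<le> r} = {t \<in> space M. \<forall>n. 2 * B (G t) (d n) - B (d n) (d n) \<le> r}"
      using iff G by blast
    also have "\<dots> \<in> sets M"
      using Bd by measurable
    finally show "{t \<in> space M. B (G t) (G t) \<le> r} \<in> sets M" .
  qed
  then have "(\<lambda>t. sqrt (B (G t) (G t))) \<in> borel_measurable M"
    by measurable
  then show ?thesis
    by (rule measurable_cong[THEN iffD1, rotated]) (simp add: N_eq G)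
qed

text \<open>The n-th approximant is a nearest point to \<open>G t\<close> among the first n + 1
  members of a dense sequence. The distances that are compared are measurable by
  \<open>N_measurable\<close>.\<close>

lemma simple_approximation:
  assumes G: "\<And>t. t \<in> space M \<Longrightarrow> G t \<in> X"
    and meas: "\<And>l. l \<in> L \<Longrightarrow> (\<lambda>t. l (G t)) \<in> borel_measurable M"
  shows "\<exists>s :: nat \<Rightarrow> _ \<Rightarrow> 'b \<Rightarrow> real.
    (\<forall>n. finite (s n ` space M) \<and> s n ` space M \<subseteq> X \<and> (\<forall>y. {t \<in> space M. s n t = y} \<in> sets M)) \<and>
    (\<forall>t\<in>space M. (\<lambda>n. N (\<lambda>x. s n t x - G t x)) \<longlonglongrightarrow> 0)"
proof -
  obtain d where d: "\<And>n::nat. d n \<in> X"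
    and dense: "\<forall>f\<in>X. \<forall>\<epsilon>>0. \<exists>n. N (\<lambda>x. f x - d n x) < \<epsilon>"
    using dense_sequence by blast
  define \<rho> where "\<rho> i t = N (\<lambda>x. G t x - d i x)" for i t
  have [measurable]: "\<rho> i \<in> borel_measurable M" for i
    unfolding \<rho>_def
  proof (rule N_measurable)
    fix l assume "l \<in> L"
    then have "(\<lambda>t. l (G t) - l (d i)) \<in> borel_measurable M"
      using meas by measurable
    then show "(\<lambda>t. l (\<lambda>x. G t x - d i x)) \<in> borel_measurable M"
      by (rule measurable_cong[THEN iffD1, rotated])
        (use dual_diff L_dual \<open>l \<in> L\<close> G d in \<open>auto simp: subset_eq\<close>)
  qed (simp add: diff_in G d)
  \<comment> \<open>Taking the least index of a nearest point breaks ties and makes the index a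
    measurable function of \<open>t\<close>.\<close>
  define k where "k n t = (LEAST i. i \<le> n \<and> (\<forall>j\<le>n. \<rho> i t \<le> \<rho> j t))" for n t
  have k: "k n t \<le> n \<and> (\<forall>j\<le>n. \<rho> (k n t) t \<le> \<rho> j t)" for n t
  proof -
    have "Min ((\<lambda>i. \<rho> i t) ` {..n}) \<in> (\<lambda>i. \<rho> i t) ` {..n}" by (rule Min_in) auto
    then obtain i where "i \<le> n" "\<rho> i t = Min ((\<lambda>i. \<rho> i t) ` {..n})" by (metis (no_types, lifting) atMost_iff imageE)
    then have "i \<le> n \<and> (\<forall>j\<le>n. \<rho> i t \<le> \<rho> j t)" by auto
    then show ?thesis unfolding k_def by (rule LeastI)
  qed
  have [measurable]: "k n \<in> measurable M (count_space UNIV)" for n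
    unfolding k_def by measurable
  show ?thesis
  proof (intro exI[of _ "\<lambda>n t. d (k n t)"] conjI allI ballI)
    fix n
    have "(\<lambda>t. d (k n t)) ` space M \<subseteq> d ` {..n}" using k by auto
    then show "finite ((\<lambda>t. d (k n t)) ` space M)" by (rule finite_subset) simp
    show "(\<lambda>t. d (k n t)) ` space M \<subseteq> X" using d by auto
    fix y
    have "k n -` {i. d i = y} \<inter> space M \<in> sets M" by (rule measurable_sets[of "k n" M "count_space UNIV"]) auto
    also have "k n -` {i. d i = y} \<inter> space M = {t \<in> space M. d (k n t) = y}" by auto
    finally show "{t \<in> space M. d (k n t) = y} \<in> sets M" .
  next
    fix t assume t: "t \<in> space M"
    show "(\<lambda>n. N (\<lambda>x. d (k n t) x - G t x)) \<longlonglongrightarrow> 0"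
    proof (rule LIMSEQ_I)
      fix \<epsilon> :: real assume "\<epsilon> > 0"
      then obtain m where m: "\<rho> m t < \<epsilon>" using bspec[OF dense G[OF t]] by (auto simp: \<rho>_def)
      have "norm (N (\<lambda>x. d (k n t) x - G t x) - 0) < \<epsilon>" if "n \<ge> m" for n
      proof -
        have "\<rho> (k n t) t \<le> \<rho> m t" using k that by blast
        then show ?thesis
          using m N_diff_commute[OF d G[OF t], of "k n t"] N_nonneg[OF diff_in[OF d G[OF t]], of "k n t"] by (simp add: \<rho>_def)
      qed
      then show "\<exists>no. \<forall>n\<ge>no. norm (N (\<lambda>x. d (k n t) x - G t x) - 0) < \<epsilon>" by blast
    qed
  qed
qed

text \<open>A version of Pettis' measurability theorem.\<close>

lemma bochner_measurable_iff:
  "bochner_measurable X N F \<longleftrightarrow>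
     (AE t in lebesgue_on {0<..}. (\<lambda>x. F (t, x)) \<in> X) \<and>
     (\<forall>l\<in>L. (\<lambda>t. l (\<lambda>x. F (t, x))) \<in> borel_measurable (lebesgue_on {0<..}))"
proof
  assume "bochner_measurable X N F"
  then obtain s where s: "\<And>n. finite (s n ` {0<..})" "\<And>n. s n ` {0<..} \<subseteq> X"
    "\<And>n y. {t \<in> {0<..}. s n t = y} \<in> sets lebesgue"
    and ae: "AE t in lebesgue_on {0<..}. (\<lambda>x. F (t, x)) \<in> X \<and> (\<lambda>n. N (\<lambda>x. s (n::nat) t x - F (t, x))) \<longlonglongrightarrow> 0"
    unfolding bochner_measurable_def by blast
  show "(AE t in lebesgue_on {0<..}. (\<lambda>x. F (t, x)) \<in> X) \<and>
     (\<forall>l\<in>L. (\<lambda>t. l (\<lambda>x. F (t, x))) \<in> borel_measurable (lebesgue_on {0<..}))"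
  proof (intro conjI ballI)
    show "AE t in lebesgue_on {0<..}. (\<lambda>x. F (t, x)) \<in> X"
      using ae by eventually_elim simp
    fix l assume "l \<in> L"
    then have l: "l \<in> dual_space X N" using L_dual by blast
    show "(\<lambda>t. l (\<lambda>x. F (t, x))) \<in> borel_measurable (lebesgue_on {0<..})"
    proof (rule borel_measurable_lebesgue_on_AE_limit)
      fix n
      have "simple_function (lebesgue_on {0<..}) (\<lambda>t. l (s n t))"
        unfolding simple_function_def
      proof (intro conjI ballI)
        have "(\<lambda>t. l (s n t)) ` {0<..} = l ` s n ` {0<..}" by auto
        then show "finite ((\<lambda>t. l (s n t)) ` space (lebesgue_on {0<..}))" using s(1) by simp
        fix c
        have "(\<lambda>t. l (s n t)) -` {c} \<inter> space (lebesgue_on {0<..})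
            = (\<Union>y\<in>{y \<in> s n ` {0<..}. l y = c}. {t \<in> {0<..}. s n t = y})" by auto
        also have "\<dots> \<in> sets (lebesgue_on {0<..})"
          using s(1)[of n] s(3) by (intro sets.finite_UN) (auto simp: sets_restrict_space_iff)
        finally show "(\<lambda>t. l (s n t)) -` {c} \<inter> space (lebesgue_on {0<..}) \<in> sets (lebesgue_on {0<..})" .
      qed
      then show "(\<lambda>t. l (s n t)) \<in> borel_measurable (lebesgue_on {0<..})"
        by (rule borel_measurable_simple_function)
    next
      show "AE t in lebesgue_on {0<..}. (\<lambda>n. l (s n t)) \<longlonglongrightarrow> l (\<lambda>x. F (t, x))"
        using ae AE_greaterThan
      proof eventually_elim
        case (elim t)
        then have "\<And>n. s n t \<in> X" using s(2) by (auto simp: subset_eq)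
        with elim show ?case by (intro dual_tendsto[OF l]) auto
      qed
    qed simp
  qed
next
  assume R: "(AE t in lebesgue_on {0<..}. (\<lambda>x. F (t, x)) \<in> X) \<and>
     (\<forall>l\<in>L. (\<lambda>t. l (\<lambda>x. F (t, x))) \<in> borel_measurable (lebesgue_on {0<..}))"
  \<comment> \<open>Membership in \<open>X\<close> holds only almost everywhere; the exceptional
    values are replaced by zero so that \<open>simple_approximation\<close> applies.\<close>
  define G where "G t = (if (\<lambda>x. F (t, x)) \<in> X then \<lambda>x. F (t, x) else (\<lambda>x. 0))" for t
  have GX: "G t \<in> X" for t by (simp add: G_def zero_in)
  have ae: "AE t in lebesgue_on {0<..}. (\<lambda>x. F (t, x)) = G t"
    using conjunct1[OF R] by eventually_elim (simp add: G_def)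
  have "(\<lambda>t. l (G t)) \<in> borel_measurable (lebesgue_on {0<..})" if "l \<in> L" for l
  proof (rule borel_measurable_lebesgue_on_AE)
    show "(\<lambda>t. l (\<lambda>x. F (t, x))) \<in> borel_measurable (lebesgue_on {0<..})"
      using R that by blast
    show "AE t in lebesgue_on {0<..}. l (\<lambda>x. F (t, x)) = l (G t)"
      using ae by eventually_elim simp
  qed simp
  from simple_approximation[of "lebesgue_on {0<..}" G, OF GX this]
  obtain s :: "nat \<Rightarrow> real \<Rightarrow> 'b \<Rightarrow> real" where
    s: "\<And>n. finite (s n ` {0<..}) \<and> s n ` {0<..} \<subseteq> X \<and> (\<forall>y. {t \<in> {0<..}. s n t = y} \<in> sets (lebesgue_on {0<..}))"
    and lim: "\<forall>t\<in>{0<..}. (\<lambda>n. N (\<lambda>x. s n t x - G t x)) \<longlonglongrightarrow> 0"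
    unfolding space_lebesgue_on by blast
  show "bochner_measurable X N F"
    unfolding bochner_measurable_def
  proof (intro exI[of _ s] conjI allI)
    fix n y
    show "finite (s n ` {0<..})" "s n ` {0<..} \<subseteq> X" using s by blast+
    have "{t \<in> {0<..}. s n t = y} \<in> sets (lebesgue_on {0<..})" using s by blast
    then show "{t \<in> {0<..}. s n t = y} \<in> sets lebesgue" by (simp add: sets_restrict_space_iff)
  next
    show "AE t in lebesgue_on {0<..}. (\<lambda>x. F (t, x)) \<in> X \<and> (\<lambda>n. N (\<lambda>x. s n t x - F (t, x))) \<longlonglongrightarrow> 0"
      using ae AE_greaterThan
    proof eventually_elim
      case (elim t)
      have "(\<lambda>x. F (t, x)) \<in> X" using GX[of t] elim(1) by simp
      moreover have "(\<lambda>x. s n t x - F (t, x)) = (\<lambda>x. s n t x - G t x)" for n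
        using fun_cong[OF elim(1)] by simp
      ultimately show ?case using lim elim(2) by simp
    qed
  qed
qed

lemma bochner_measurable_N:
  assumes "bochner_measurable X N F"
  shows "(\<lambda>t. N (\<lambda>x. F (t, x))) \<in> borel_measurable (lebesgue_on {0<..})"
proof -
  note R = assms[unfolded bochner_measurable_iff]
  define G where "G t = (if (\<lambda>x. F (t, x)) \<in> X then \<lambda>x. F (t, x) else (\<lambda>x. 0))" for t
  have GX: "G t \<in> X" for t by (simp add: G_def zero_in)
  have ae: "AE t in lebesgue_on {0<..}. (\<lambda>x. F (t, x)) = G t"
    using conjunct1[OF R] by eventually_elim (simp add: G_def)
  have "(\<lambda>t. l (G t)) \<in> borel_measurable (lebesgue_on {0<..})" if "l \<in> L" for l
  proof (rule borel_measurable_lebesgue_on_AE)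
    show "(\<lambda>t. l (\<lambda>x. F (t, x))) \<in> borel_measurable (lebesgue_on {0<..})"
      using R that by blast
    show "AE t in lebesgue_on {0<..}. l (\<lambda>x. F (t, x)) = l (G t)"
      using ae by eventually_elim simp
  qed simp
  note meas = N_measurable[of "lebesgue_on {0<..}" G, OF GX this]
  show ?thesis
  proof (rule borel_measurable_lebesgue_on_AE[OF _ meas])
    show "AE t in lebesgue_on {0<..}. N (G t) = N (\<lambda>x. F (t, x))"
      using ae by eventually_elim simp
  qed simp
qed

lemma bochner_measurable_comb:
  assumes F: "bochner_measurable X N F" and G: "bochner_measurable X N G"
  shows "bochner_measurable X N (\<lambda>p. a * F p + b * G p)"
  unfolding bochner_measurable_iff
proof (intro conjI ballI)
  note F = F[unfolded bochner_measurable_iff] and G = G[unfolded bochner_measurable_iff]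
  have ae: "AE t in lebesgue_on {0<..}. (\<lambda>x. F (t, x)) \<in> X \<and> (\<lambda>x. G (t, x)) \<in> X"
    using F G by auto
  then show "AE t in lebesgue_on {0<..}. (\<lambda>x. a * F (t, x) + b * G (t, x)) \<in> X"
    by eventually_elim (simp add: comb_in)
  fix l assume "l \<in> L"
  then have l: "l \<in> dual_space X N" using L_dual by blast
  show "(\<lambda>t. l (\<lambda>x. a * F (t, x) + b * G (t, x))) \<in> borel_measurable (lebesgue_on {0<..})"
  proof (rule borel_measurable_lebesgue_on_AE)
    show "(\<lambda>t. a * l (\<lambda>x. F (t, x)) + b * l (\<lambda>x. G (t, x))) \<in> borel_measurable (lebesgue_on {0<..})"
      using F G \<open>l \<in> L\<close> by (intro borel_measurable_add borel_measurable_times borel_measurable_const) auto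
    show "AE t in lebesgue_on {0<..}. a * l (\<lambda>x. F (t, x)) + b * l (\<lambda>x. G (t, x)) = l (\<lambda>x. a * F (t, x) + b * G (t, x))"
      using ae by eventually_elim (simp add: dual_comb[OF l])
  qed simp
qed

end

section \<open>Square integrable functions of time as a Hilbert space\<close>

lemma integrable_lebesgue_on_AE:
  fixes f g :: "'a::euclidean_space \<Rightarrow> real"
  assumes "S \<in> sets lebesgue" "integrable (lebesgue_on S) f" "AE x in lebesgue_on S. f x = g x"
  shows "integrable (lebesgue_on S) g"
  using assms borel_measurable_lebesgue_on_AE[OF assms(1) borel_measurable_integrable[OF assms(2)] assms(3)]
    integrable_cong_AE by blast

lemma Cauchy_subsequence_geometric:
  fixes D :: "nat \<Rightarrow> nat \<Rightarrow> real"
  assumes "\<And>e. e > 0 \<Longrightarrow> \<exists>M. \<forall>m\<ge>M. \<forall>n\<ge>M. D m n < e"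
  shows "\<exists>k. strict_mono k \<and> (\<forall>i. \<forall>m\<ge>k i. \<forall>n\<ge>k i. D m n < (1/2) ^ i)"
proof -
  have "\<exists>M. \<forall>m\<ge>M. \<forall>n\<ge>M. D m n < (1/2) ^ i" for i
    using assms by simp
  then obtain M where M: "\<And>i m n. m \<ge> M i \<Longrightarrow> n \<ge> M i \<Longrightarrow> D m n < (1/2) ^ i" by metis
  \<comment> \<open>The sum dominates the threshold \<open>M i\<close>, and the summand i makes the
    sequence strictly increasing.\<close>
  define k where "k i = (\<Sum>j\<le>i. M j) + i" for i
  have "strict_mono k" by (intro strict_mono_Suc_iff[THEN iffD2]) (simp add: k_def)
  moreover have "M i \<le> k i" for i
    unfolding k_def using member_le_sum[of i "{..i}" M] by (simp add: trans_le_add1)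
  ultimately show ?thesis using M by (meson le_trans)
qed

context separable_function_hilbert
begin

definition time_inner :: "(real \<times> 'b \<Rightarrow> real) \<Rightarrow> (real \<times> 'b \<Rightarrow> real) \<Rightarrow> real" where
  "time_inner F G = (\<integral>t. B (\<lambda>x. F (t, x)) (\<lambda>x. G (t, x)) \<partial>lebesgue_on {0<..})"

lemma L2_time_AE_in: "F \<in> L2_time X N \<Longrightarrow> AE t in lebesgue_on {0<..}. (\<lambda>x. F (t, x)) \<in> X"
  by (simp add: L2_time_def bochner_measurable_iff)

lemma L2_time_comb:
  assumes F: "F \<in> L2_time X N" and G: "G \<in> L2_time X N"
  shows "(\<lambda>p. a * F p + b * G p) \<in> L2_time X N"
proof -
  have meas: "bochner_measurable X N (\<lambda>p. a * F p + b * G p)"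
    using F G by (intro bochner_measurable_comb) (auto simp: L2_time_def)
  have int: "integrable (lebesgue_on {0<..}) (\<lambda>t. 2 * a\<^sup>2 * (N (\<lambda>x. F (t, x)))\<^sup>2 + 2 * b\<^sup>2 * (N (\<lambda>x. G (t, x)))\<^sup>2)"
    using F G by (intro Bochner_Integration.integrable_add Bochner_Integration.integrable_mult_right) (auto simp: L2_time_def)
  have "integrable (lebesgue_on {0<..}) (\<lambda>t. (N (\<lambda>x. a * F (t, x) + b * G (t, x)))\<^sup>2)"
  proof (rule Bochner_Integration.integrable_bound[OF int])
    show "(\<lambda>t. (N (\<lambda>x. a * F (t, x) + b * G (t, x)))\<^sup>2) \<in> borel_measurable (lebesgue_on {0<..})"
      using bochner_measurable_N[OF meas] by (intro borel_measurable_power) simp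
    show "AE t in lebesgue_on {0<..}. norm ((N (\<lambda>x. a * F (t, x) + b * G (t, x)))\<^sup>2)
        \<le> norm (2 * a\<^sup>2 * (N (\<lambda>x. F (t, x)))\<^sup>2 + 2 * b\<^sup>2 * (N (\<lambda>x. G (t, x)))\<^sup>2)"
      using L2_time_AE_in[OF F] L2_time_AE_in[OF G]
    proof eventually_elim
      case (elim t)
      let ?p = "\<bar>a\<bar> * N (\<lambda>x. F (t, x))" and ?q = "\<bar>b\<bar> * N (\<lambda>x. G (t, x))"
      have "(N (\<lambda>x. a * F (t, x) + b * G (t, x)))\<^sup>2 \<le> (?p + ?q)\<^sup>2"
        using N_triangle[OF elim] N_nonneg[OF comb_in[OF elim]] by (rule power_mono)
      also have "\<dots> \<le> 2 * ?p\<^sup>2 + 2 * ?q\<^sup>2"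
        using zero_le_power2[of "?p - ?q"] by (simp add: power2_sum power2_diff)
      finally show ?case by (simp add: power_mult_distrib)
    qed
  qed
  with meas show ?thesis by (simp add: L2_time_def)
qed

lemma L2_time_zero: "(\<lambda>p. 0) \<in> L2_time X N"
proof -
  have "bochner_measurable X N (\<lambda>p. 0)"
    unfolding bochner_measurable_iff using zero_in dual_zero L_dual by simp
  then show ?thesis by (simp add: L2_time_def N_zero)
qed

text \<open>Polarization: the pairing is a combination of squared norms, each integrable by the
  definition of the space, so measurability of \<open>B\<close> along two functions comes with
  it.\<close>

lemma time_inner_integrable:
  assumes F: "F \<in> L2_time X N" and G: "G \<in> L2_time X N"
  shows "integrable (lebesgue_on {0<..}) (\<lambda>t. B (\<lambda>x. F (t, x)) (\<lambda>x. G (t, x)))"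
proof (rule integrable_lebesgue_on_AE)
  have FG: "(\<lambda>p. 1 * F p + 1 * G p) \<in> L2_time X N" by (rule L2_time_comb[OF F G])
  show "integrable (lebesgue_on {0<..})
      (\<lambda>t. ((N (\<lambda>x. 1 * F (t, x) + 1 * G (t, x)))\<^sup>2 - (N (\<lambda>x. F (t, x)))\<^sup>2 - (N (\<lambda>x. G (t, x)))\<^sup>2) / 2)"
    using FG F G unfolding L2_time_def
    by (intro Bochner_Integration.integrable_divide Bochner_Integration.integrable_diff) auto
  show "AE t in lebesgue_on {0<..}.
      ((N (\<lambda>x. 1 * F (t, x) + 1 * G (t, x)))\<^sup>2 - (N (\<lambda>x. F (t, x)))\<^sup>2 - (N (\<lambda>x. G (t, x)))\<^sup>2) / 2
      = B (\<lambda>x. F (t, x)) (\<lambda>x. G (t, x))"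
    using L2_time_AE_in[OF F] L2_time_AE_in[OF G]
  proof eventually_elim
    case (elim t)
    then show ?case
      using B_quadratic[OF elim, of 1 1] N_power2[OF comb_in[OF elim, of 1 1]] by (simp add: N_power2)
  qed
qed simp

lemma time_inner_self:
  assumes F: "F \<in> L2_time X N"
  shows "time_inner F F = (\<integral>t. (N (\<lambda>x. F (t, x)))\<^sup>2 \<partial>lebesgue_on {0<..})"
  unfolding time_inner_def
proof (rule integral_cong_AE)
  show "AE t in lebesgue_on {0<..}. B (\<lambda>x. F (t, x)) (\<lambda>x. F (t, x)) = (N (\<lambda>x. F (t, x)))\<^sup>2"
    using L2_time_AE_in[OF F] by eventually_elim (simp add: N_power2)
qed (use time_inner_integrable[OF F F] F in \<open>auto simp: L2_time_def dest: borel_measurable_integrable\<close>)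

lemma L2_time_prehilbert: "function_prehilbert (L2_time X N) time_inner (L2_time_norm N)"
proof
  show "(\<lambda>x. 0) \<in> L2_time X N" by (rule L2_time_zero)
next
  fix F G :: "real \<times> 'b \<Rightarrow> real" and a b assume FG: "F \<in> L2_time X N" "G \<in> L2_time X N"
  then show "(\<lambda>x. a * F x + b * G x) \<in> L2_time X N" by (rule L2_time_comb)
  show "time_inner F G = time_inner G F"
    unfolding time_inner_def
  proof (rule integral_cong_AE)
    show "AE t in lebesgue_on {0<..}. B (\<lambda>x. F (t, x)) (\<lambda>x. G (t, x)) = B (\<lambda>x. G (t, x)) (\<lambda>x. F (t, x))"
      using L2_time_AE_in[OF FG(1)] L2_time_AE_in[OF FG(2)] by eventually_elim (rule B_commute)
  qed (use time_inner_integrable[OF FG] time_inner_integrable[OF FG(2,1)] in \<open>auto dest: borel_measurable_integrable\<close>)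
  fix H assume H: "H \<in> L2_time X N"
  have "time_inner (\<lambda>x. a * F x + b * G x) H
      = (\<integral>t. a * B (\<lambda>x. F (t, x)) (\<lambda>x. H (t, x)) + b * B (\<lambda>x. G (t, x)) (\<lambda>x. H (t, x)) \<partial>lebesgue_on {0<..})"
    unfolding time_inner_def
  proof (rule integral_cong_AE)
    show "AE t in lebesgue_on {0<..}. B (\<lambda>x. a * F (t, x) + b * G (t, x)) (\<lambda>x. H (t, x))
        = a * B (\<lambda>x. F (t, x)) (\<lambda>x. H (t, x)) + b * B (\<lambda>x. G (t, x)) (\<lambda>x. H (t, x))"
      using L2_time_AE_in[OF FG(1)] L2_time_AE_in[OF FG(2)] L2_time_AE_in[OF H]
      by eventually_elim (rule B_comb)
  qed (use time_inner_integrable[OF L2_time_comb[OF FG] H] time_inner_integrable[OF FG(1) H]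
      time_inner_integrable[OF FG(2) H] in \<open>auto dest: borel_measurable_integrable\<close>)
  also have "\<dots> = a * time_inner F H + b * time_inner G H"
    using time_inner_integrable[OF FG(1) H] time_inner_integrable[OF FG(2) H]
    by (simp add: time_inner_def)
  finally show "time_inner (\<lambda>x. a * F x + b * G x) H = a * time_inner F H + b * time_inner G H" .
next
  fix F assume "F \<in> L2_time X N"
  then show "0 \<le> time_inner F F" "L2_time_norm N F = sqrt (time_inner F F)"
    by (simp_all add: time_inner_self L2_time_norm_def)
qed

lemma L2_time_norm_power2: "(L2_time_norm N F)\<^sup>2 = (\<integral>t. (N (\<lambda>x. F (t, x)))\<^sup>2 \<partial>lebesgue_on {0<..})"
  by (simp add: L2_time_norm_def)

text \<open>The Riesz-Fischer scheme with values in \<open>X\<close>: a subsequence with geometric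
  gaps converges in \<open>X\<close> at almost every time, \<open>bochner_measurable_iff\<close>
  makes the limit measurable, and Fatou's lemma upgrades this to convergence in norm. The Cauchy
  property leads back from the subsequence to the sequence.\<close>

lemma L2_time_complete:
  assumes F: "\<And>n::nat. F n \<in> L2_time X N"
    and Cauchy: "\<And>e. e > 0 \<Longrightarrow> \<exists>M. \<forall>m\<ge>M. \<forall>n\<ge>M. L2_time_norm N (\<lambda>x. F m x - F n x) < e"
  shows "\<exists>G\<in>L2_time X N. (\<lambda>n. L2_time_norm N (\<lambda>x. F n x - G x)) \<longlonglongrightarrow> 0"
proof -
  interpret L2: function_prehilbert "L2_time X N" time_inner "L2_time_norm N"
    by (rule L2_time_prehilbert)
  obtain k where k: "strict_mono k"
    and close: "\<forall>i. \<forall>m\<ge>k i. \<forall>n\<ge>k i. L2_time_norm N (\<lambda>x. F m x - F n x) < (1/2) ^ i"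
    using Cauchy_subsequence_geometric[of "\<lambda>m n. L2_time_norm N (\<lambda>x. F m x - F n x)", OF Cauchy] by blast
  have diff_L2: "(\<lambda>x. F m x - F n x) \<in> L2_time X N" for m n by (rule L2.diff_in[OF F F])
  have int: "integrable (lebesgue_on {0<..}) (\<lambda>t. (N (\<lambda>x. F m (t, x) - F n (t, x)))\<^sup>2)" for m n
    using diff_L2 by (simp add: L2_time_def)
  have sq: "(\<integral>t. (N (\<lambda>x. F m (t, x) - F n (t, x)))\<^sup>2 \<partial>lebesgue_on {0<..}) \<le> (1/4) ^ i" if "m \<ge> k i" "n \<ge> k i" for m n i
  proof -
    have "(L2_time_norm N (\<lambda>x. F m x - F n x))\<^sup>2 \<le> ((1/2) ^ i)\<^sup>2"
      using close that L2.N_nonneg[OF diff_L2] by (intro power_mono) (auto intro: less_imp_le)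
    also have "((1/2) ^ i)\<^sup>2 = ((1/2)\<^sup>2::real) ^ i" by (simp only: power_mult[symmetric] mult.commute)
    also have "(1/2)\<^sup>2 = (1/4::real)" by (simp add: power2_eq_square)
    finally show ?thesis by (simp add: L2_time_norm_power2)
  qed
  \<comment> \<open>Nonnegativity of \<open>N\<close> is known only on \<open>X\<close>; the value 0
    off a set of full measure makes it hold at every time.\<close>
  define d where "d i t = (if \<forall>n. (\<lambda>x. F n (t, x)) \<in> X then N (\<lambda>x. F (k (Suc i)) (t, x) - F (k i) (t, x)) else 0)" for i t
  have AE_X: "AE t in lebesgue_on {0<..}. \<forall>n. (\<lambda>x. F n (t, x)) \<in> X"
    unfolding AE_all_countable using L2_time_AE_in[OF F] by blast
  have d_eq: "AE t in lebesgue_on {0<..}. (N (\<lambda>x. F (k (Suc i)) (t, x) - F (k i) (t, x)))\<^sup>2 = (d i t)\<^sup>2" for i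
    using AE_X by eventually_elim (simp add: d_def)
  have mono: "k i \<le> k (Suc i)" for i using k by (simp add: strict_mono_less_eq)
  have int_d: "integrable (lebesgue_on {0<..}) (\<lambda>t. (d i t)\<^sup>2)" for i
    by (rule integrable_lebesgue_on_AE[OF _ int d_eq]) simp
  have "AE t in lebesgue_on {0<..}. summable (\<lambda>i. d i t)"
  proof (rule AE_summable_if_square_integrals_geometric)
    show "0 \<le> d n x" for n x by (simp add: d_def N_nonneg diff_in)
    fix i show "integrable (lebesgue_on {0<..}) (\<lambda>t. (d i t)\<^sup>2)" by (rule int_d)
    have "(\<integral>t. (d i t)\<^sup>2 \<partial>lebesgue_on {0<..}) = (\<integral>t. (N (\<lambda>x. F (k (Suc i)) (t, x) - F (k i) (t, x)))\<^sup>2 \<partial>lebesgue_on {0<..})"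
    proof (rule integral_cong_AE)
      show "AE t in lebesgue_on {0<..}. (d i t)\<^sup>2 = (N (\<lambda>x. F (k (Suc i)) (t, x) - F (k i) (t, x)))\<^sup>2"
        using d_eq[of i] by eventually_elim simp
    qed (use int int_d in \<open>auto dest: borel_measurable_integrable\<close>)
    also have "\<dots> \<le> (1/4) ^ i" by (rule sq) (simp_all add: mono)
    finally show "(\<integral>t. (d i t)\<^sup>2 \<partial>lebesgue_on {0<..}) \<le> (1/4) ^ i" .
  qed
  then have "AE t in lebesgue_on {0<..}. \<exists>g\<in>X. (\<lambda>i. N (\<lambda>x. F (k i) (t, x) - g x)) \<longlonglongrightarrow> 0"
    using AE_X
  proof eventually_elim
    case (elim t)
    then have X: "(\<lambda>x. F n (t, x)) \<in> X" for n by blast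
    let ?f = "\<lambda>i x. F (k i) (t, x)"
    have tele: "N (\<lambda>x. ?f (m + j) x - ?f m x) \<le> (\<Sum>i=m..<m+j. d i t)" for m j
    proof (induction j)
      case 0 show ?case by (simp add: N_zero)
    next
      case (Suc j)
      have "N (\<lambda>x. ?f (m + Suc j) x - ?f m x) \<le> N (\<lambda>x. ?f (Suc (m + j)) x - ?f (m + j) x) + N (\<lambda>x. ?f (m + j) x - ?f m x)"
        using N_triangle_diff[OF X X X] by simp
      also have "\<dots> \<le> d (m + j) t + (\<Sum>i=m..<m+j. d i t)"
        using Suc X by (simp add: d_def)
      finally show ?case by simp
    qed
    show ?case
    proof (rule complete)
      fix e :: real assume "e > 0"
      obtain M where M: "\<forall>m\<ge>M. \<forall>n. norm (\<Sum>i=m..<n. d i t) < e"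
        using elim(1) \<open>e > 0\<close> unfolding summable_Cauchy by blast
      have le: "N (\<lambda>x. ?f n x - ?f m x) < e" if "m \<ge> M" "n \<ge> m" for m n
      proof -
        have "N (\<lambda>x. ?f n x - ?f m x) \<le> (\<Sum>i=m..<n. d i t)"
          using tele[of m "n - m"] that by simp
        moreover have "norm (\<Sum>i=m..<n. d i t) < e" using M that by blast
        ultimately show ?thesis by simp
      qed
      show "\<exists>M. \<forall>m\<ge>M. \<forall>n\<ge>M. N (\<lambda>x. ?f m x - ?f n x) < e"
      proof (intro exI[of _ M] allI impI)
        fix m n assume "m \<ge> M" "n \<ge> M"
        then show "N (\<lambda>x. ?f m x - ?f n x) < e"
          using le[of m n] le[of n m] N_diff_commute[OF X X] by (cases "m \<le> n") auto
      qed
    qed (rule X)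
  qed
  then have ex: "AE t in lebesgue_on {0<..}. \<exists>g. g \<in> X \<and> (\<lambda>i. N (\<lambda>x. F (k i) (t, x) - g x)) \<longlonglongrightarrow> 0"
    by eventually_elim blast
  \<comment> \<open>The choice at each time is arbitrary; measurability does not depend on it,
    because every functional in \<open>L\<close> takes the same value on all admissible
    limits.\<close>
  define g where "g t = (SOME g. g \<in> X \<and> (\<lambda>i. N (\<lambda>x. F (k i) (t, x) - g x)) \<longlonglongrightarrow> 0)" for t
  have g: "AE t in lebesgue_on {0<..}. g t \<in> X \<and> (\<lambda>i. N (\<lambda>x. F (k i) (t, x) - g t x)) \<longlonglongrightarrow> 0"
    using ex
  proof eventually_elim
    case (elim t)
    from someI_ex[OF this] show ?case by (simp only: g_def)
  qed
  define G where "G p = g (fst p) (snd p)" for p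
  have G: "bochner_measurable X N G"
    unfolding bochner_measurable_iff
  proof (intro conjI ballI)
    show "AE t in lebesgue_on {0<..}. (\<lambda>x. G (t, x)) \<in> X"
      using g by eventually_elim (simp add: G_def)
    fix l assume "l \<in> L"
    then have l: "l \<in> dual_space X N" using L_dual by blast
    show "(\<lambda>t. l (\<lambda>x. G (t, x))) \<in> borel_measurable (lebesgue_on {0<..})"
    proof (rule borel_measurable_lebesgue_on_AE_limit)
      show "(\<lambda>t. l (\<lambda>x. F (k i) (t, x))) \<in> borel_measurable (lebesgue_on {0<..})" for i
        using F \<open>l \<in> L\<close> by (simp add: L2_time_def bochner_measurable_iff)
      show "AE t in lebesgue_on {0<..}. (\<lambda>i. l (\<lambda>x. F (k i) (t, x))) \<longlonglongrightarrow> l (\<lambda>x. G (t, x))"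
        using g AE_X by eventually_elim (auto simp: G_def intro!: dual_tendsto[OF l])
    qed simp
  qed
  have FG: "bochner_measurable X N (\<lambda>p. F n p - G p)" for n
    using bochner_measurable_comb[of "F n" G 1 "-1"] F G by (simp add: L2_time_def)
  \<comment> \<open>Fatou's lemma in the second index of the Cauchy estimate
    \<open>sq\<close>.\<close>
  have bound: "(\<integral>\<^sup>+t. ennreal ((N (\<lambda>x. F (k i) (t, x) - G (t, x)))\<^sup>2) \<partial>lebesgue_on {0<..}) \<le> ennreal ((1/4) ^ i)" for i
  proof -
    have meas: "(\<lambda>t. ennreal ((N (\<lambda>x. F (k i) (t, x) - F (k j) (t, x)))\<^sup>2)) \<in> borel_measurable (lebesgue_on {0<..})" for j
      using borel_measurable_integrable[OF int] by measurable
    have "(\<integral>\<^sup>+t. ennreal ((N (\<lambda>x. F (k i) (t, x) - G (t, x)))\<^sup>2) \<partial>lebesgue_on {0<..})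
        = (\<integral>\<^sup>+t. liminf (\<lambda>j. ennreal ((N (\<lambda>x. F (k i) (t, x) - F (k j) (t, x)))\<^sup>2)) \<partial>lebesgue_on {0<..})"
    proof (rule nn_integral_cong_AE)
      show "AE t in lebesgue_on {0<..}. ennreal ((N (\<lambda>x. F (k i) (t, x) - G (t, x)))\<^sup>2)
          = liminf (\<lambda>j. ennreal ((N (\<lambda>x. F (k i) (t, x) - F (k j) (t, x)))\<^sup>2))"
        using g AE_X
      proof eventually_elim
        case (elim t)
        then have X: "\<And>n. (\<lambda>x. F n (t, x)) \<in> X" "(\<lambda>x. G (t, x)) \<in> X"
          and lim: "(\<lambda>j. N (\<lambda>x. F (k j) (t, x) - G (t, x))) \<longlonglongrightarrow> 0" by (auto simp: G_def)
        have "(\<lambda>j. N (\<lambda>x. F (k i) (t, x) - F (k j) (t, x)) - N (\<lambda>x. F (k i) (t, x) - G (t, x))) \<longlonglongrightarrow> 0"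
        proof (rule Lim_null_comparison[OF _ lim], rule always_eventually, rule allI)
          fix j
          have "N (\<lambda>x. F (k i) (t, x) - F (k j) (t, x)) \<le> N (\<lambda>x. F (k i) (t, x) - G (t, x)) + N (\<lambda>x. G (t, x) - F (k j) (t, x))"
            by (rule N_triangle_diff[OF X(1) X(2) X(1)])
          moreover have "N (\<lambda>x. F (k i) (t, x) - G (t, x)) \<le> N (\<lambda>x. F (k i) (t, x) - F (k j) (t, x)) + N (\<lambda>x. F (k j) (t, x) - G (t, x))"
            by (rule N_triangle_diff[OF X(1) X(1) X(2)])
          ultimately show "norm (N (\<lambda>x. F (k i) (t, x) - F (k j) (t, x)) - N (\<lambda>x. F (k i) (t, x) - G (t, x)))
              \<le> N (\<lambda>x. F (k j) (t, x) - G (t, x))"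
            using N_diff_commute[OF X(2) X(1), of "k j"] by simp
        qed
        then have "(\<lambda>j. N (\<lambda>x. F (k i) (t, x) - F (k j) (t, x))) \<longlonglongrightarrow> N (\<lambda>x. F (k i) (t, x) - G (t, x))"
          by (rule LIM_zero_cancel)
        then have "(\<lambda>j. ennreal ((N (\<lambda>x. F (k i) (t, x) - F (k j) (t, x)))\<^sup>2)) \<longlonglongrightarrow> ennreal ((N (\<lambda>x. F (k i) (t, x) - G (t, x)))\<^sup>2)"
          by (intro tendsto_ennrealI tendsto_power)
        then show ?case by (intro lim_imp_Liminf[symmetric]) simp_all
      qed
    qed
    also have "\<dots> \<le> liminf (\<lambda>j. \<integral>\<^sup>+t. ennreal ((N (\<lambda>x. F (k i) (t, x) - F (k j) (t, x)))\<^sup>2) \<partial>lebesgue_on {0<..})"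
      using meas by (rule nn_integral_liminf)
    also have "\<dots> \<le> ennreal ((1/4) ^ i)"
    proof (rule Liminf_le)
      show "\<forall>\<^sub>F j in sequentially. (\<integral>\<^sup>+t. ennreal ((N (\<lambda>x. F (k i) (t, x) - F (k j) (t, x)))\<^sup>2) \<partial>lebesgue_on {0<..}) \<le> ennreal ((1/4) ^ i)"
        using eventually_ge_at_top[of i]
      proof eventually_elim
        case (elim j)
        then have "k i \<le> k j" using k by (simp add: strict_mono_less_eq)
        then show ?case
          using sq[of i "k i" "k j"] int by (subst nn_integral_eq_integral) (auto intro: ennreal_leI)
      qed
    qed simp
    finally show ?thesis .
  qed
  have FG_L2: "(\<lambda>p. F (k i) p - G p) \<in> L2_time X N" for i
  proof -
    have "integrable (lebesgue_on {0<..}) (\<lambda>t. (N (\<lambda>x. F (k i) (t, x) - G (t, x)))\<^sup>2)"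
    proof (rule integrableI_bounded)
      show "(\<lambda>t. (N (\<lambda>x. F (k i) (t, x) - G (t, x)))\<^sup>2) \<in> borel_measurable (lebesgue_on {0<..})"
        using bochner_measurable_N[OF FG] by (intro borel_measurable_power) simp
      have "(\<integral>\<^sup>+t. ennreal (norm ((N (\<lambda>x. F (k i) (t, x) - G (t, x)))\<^sup>2)) \<partial>lebesgue_on {0<..}) \<le> ennreal ((1/4) ^ i)"
        using bound[of i] by simp
      also have "\<dots> < \<infinity>" by simp
      finally show "(\<integral>\<^sup>+t. ennreal (norm ((N (\<lambda>x. F (k i) (t, x) - G (t, x)))\<^sup>2)) \<partial>lebesgue_on {0<..}) < \<infinity>" .
    qed
    with FG show ?thesis by (simp add: L2_time_def)
  qed
  have G_L2: "G \<in> L2_time X N"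
    using L2.diff_in[OF F FG_L2, of "k 0" 0] by simp
  have sub: "L2_time_norm N (\<lambda>p. F (k i) p - G p) \<le> (1/2) ^ i" for i
  proof (rule power2_le_imp_le)
    have "ennreal (\<integral>t. (N (\<lambda>x. F (k i) (t, x) - G (t, x)))\<^sup>2 \<partial>lebesgue_on {0<..}) \<le> ennreal ((1/4) ^ i)"
      using bound[of i] FG_L2[of i] by (subst nn_integral_eq_integral[symmetric]) (auto simp: L2_time_def)
    then have "(L2_time_norm N (\<lambda>p. F (k i) p - G p))\<^sup>2 \<le> (1/4) ^ i" by (simp add: L2_time_norm_power2)
    also have "(1/4::real) = (1/2)\<^sup>2" by (simp add: power2_eq_square)
    also have "((1/2)\<^sup>2::real) ^ i = ((1/2) ^ i)\<^sup>2" by (simp only: power_mult[symmetric] mult.commute)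
    finally show "(L2_time_norm N (\<lambda>p. F (k i) p - G p))\<^sup>2 \<le> ((1/2) ^ i)\<^sup>2" .
  qed simp
  have "(\<lambda>n. L2_time_norm N (\<lambda>x. F n x - G x)) \<longlonglongrightarrow> 0"
  proof (rule LIMSEQ_I)
    fix e :: real assume "e > 0"
    then obtain i where i: "(1/2) ^ i < e / 2"
      using real_arch_pow_inv[of "e / 2" "1/2"] by auto
    have "norm (L2_time_norm N (\<lambda>x. F n x - G x) - 0) < e" if "n \<ge> k i" for n
    proof -
      have "L2_time_norm N (\<lambda>x. F n x - G x) \<le> L2_time_norm N (\<lambda>x. F n x - F (k i) x) + L2_time_norm N (\<lambda>x. F (k i) x - G x)"
        by (rule L2.N_triangle_diff[OF F F G_L2])
      moreover have "L2_time_norm N (\<lambda>x. F n x - F (k i) x) < (1/2) ^ i" using close that by blast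
      ultimately show ?thesis
        using sub[of i] i L2.N_nonneg[OF L2.diff_in[OF F G_L2], of n] by simp
    qed
    then show "\<exists>no. \<forall>n\<ge>no. norm (L2_time_norm N (\<lambda>x. F n x - G x) - 0) < e" by blast
  qed
  with G_L2 show ?thesis by blast
qed

lemma L2_time_hilbert: "function_hilbert (L2_time X N) time_inner (L2_time_norm N)"
proof (intro function_hilbert.intro L2_time_prehilbert function_hilbert_axioms.intro)
  fix F :: "nat \<Rightarrow> real \<times> 'b \<Rightarrow> real"
  assume "\<And>n. F n \<in> L2_time X N" "\<And>e. 0 < e \<Longrightarrow> \<exists>M. \<forall>m\<ge>M. \<forall>n\<ge>M. L2_time_norm N (\<lambda>x. F m x - F n x) < e"
  then show "\<exists>f\<in>L2_time X N. (\<lambda>n. L2_time_norm N (\<lambda>x. F n x - f x)) \<longlonglongrightarrow> 0"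
    by (rule L2_time_complete)
qed

end

section \<open>Weak limits in L^2 of time and weak-star limits in L^infinity of time\<close>

lemma AE_greaterThan_if_AE_Icc:
  assumes "\<And>s t::real. 0 < s \<Longrightarrow> s < t \<Longrightarrow> AE x in lebesgue_on {s..t}. P x"
  shows "AE x in lebesgue_on {0<..}. P x"
proof -
  \<comment> \<open>The right end point is n + 2 because the interval has to be nondegenerate
    already for n = 0.\<close>
  have "AE x in lebesgue. x \<in> {1 / real (Suc n)..real n + 2} \<longrightarrow> P x" for n
  proof -
    have "1 / real (Suc n) \<le> 1" by simp
    then have "1 / real (Suc n) < real n + 2" by linarith
    then show ?thesis
      using assms[of "1 / real (Suc n)" "real n + 2"] by (simp add: AE_restrict_space_iff)
  qed
  then have "AE x in lebesgue. \<forall>n. x \<in> {1 / real (Suc n)..real n + 2} \<longrightarrow> P x"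
    unfolding AE_all_countable by blast
  then have "AE x in lebesgue. x \<in> {0<..} \<longrightarrow> P x"
  proof eventually_elim
    case (elim x)
    show ?case
    proof
      assume "x \<in> {0<..}"
      then obtain m where m: "1 / real (Suc m) < x"
        using nat_approx_posE[of x] by auto
      obtain k where k: "x < real k" using reals_Archimedean2 by blast
      have "1 / real (Suc (max m k)) \<le> 1 / real (Suc m)" by (intro divide_left_mono) auto
      then have "x \<in> {1 / real (Suc (max m k))..real (max m k) + 2}" using m k by auto
      then show "P x" using elim by blast
    qed
  qed
  then show ?thesis by (simp add: AE_restrict_space_iff)
qed

lemma (in function_prehilbert) dual_norm_bound:
  assumes l: "l \<in> dual_space X N" and f: "f \<in> X"
  shows "\<bar>l f\<bar> \<le> dual_norm X N l * N f"
proof -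
  obtain K where K: "K \<ge> 0" "\<forall>f\<in>X. \<bar>l f\<bar> \<le> K * N f" using dual_bounded[OF l] by blast
  show ?thesis
  proof (cases "N f = 0")
    case True
    then show ?thesis using bspec[OF K(2) f] by simp
  next
    case False
    then have pos: "N f > 0" using N_nonneg[OF f] by simp
    \<comment> \<open>The second summand with factor 0 only casts the scaling of \<open>f\<close> in
      the form that \<open>comb_in\<close> and \<open>dual_comb\<close> accept.\<close>
    have g: "(\<lambda>x. (1 / N f) * f x + 0 * f x) \<in> X" by (rule comb_in[OF f f])
    have "N (\<lambda>x. (1 / N f) * f x + 0 * f x) \<le> 1"
      using N_triangle[OF f f, of "1 / N f" 0] pos by simp
    moreover have "l (\<lambda>x. (1 / N f) * f x + 0 * f x) = l f / N f"
      using dual_comb[OF l f f, of "1 / N f" 0] by simp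
    moreover have "bdd_above ((\<lambda>f. \<bar>l f\<bar>) ` {f \<in> X. N f \<le> 1})"
    proof (rule bdd_aboveI2)
      fix h assume "h \<in> {f \<in> X. N f \<le> 1}"
      then show "\<bar>l h\<bar> \<le> K" using K by (auto intro: order_trans mult_left_le)
    qed
    ultimately have "\<bar>l f / N f\<bar> \<le> dual_norm X N l"
      unfolding dual_norm_def using g by (intro cSUP_upper2[where x = "\<lambda>x. (1 / N f) * f x + 0 * f x"]) auto
    then show ?thesis using pos by (simp add: field_simps abs_divide)
  qed
qed

lemma (in function_prehilbert) dual_sub:
  assumes "l \<in> dual_space X N" "l' \<in> dual_space X N"
  shows "(\<lambda>f. l f - l' f) \<in> dual_space X N"
proof -
  obtain K K' where K: "\<forall>f\<in>X. \<bar>l f\<bar> \<le> K * N f" "\<forall>f\<in>X. \<bar>l' f\<bar> \<le> K' * N f"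
    using dual_bounded assms by meson
  have "\<forall>f\<in>X. \<bar>l f - l' f\<bar> \<le> (K + K') * N f"
  proof
    fix f assume f: "f \<in> X"
    show "\<bar>l f - l' f\<bar> \<le> (K + K') * N f"
      using bspec[OF K(1) f] bspec[OF K(2) f] by (simp add: ring_distribs)
  qed
  then show ?thesis
    using dual_comb[OF assms(1)] dual_comb[OF assms(2)] unfolding dual_space_def
    by (intro CollectI conjI exI[of _ "K + K'"]) (simp_all add: algebra_simps)
qed

lemma (in function_prehilbert) dual_norm_nonneg:
  assumes "l \<in> dual_space X N"
  shows "0 \<le> dual_norm X N l"
  unfolding dual_norm_def
proof (rule cSUP_upper2[where x = "\<lambda>x. 0"])
  obtain K where "K \<ge> 0" "\<forall>f\<in>X. \<bar>l f\<bar> \<le> K * N f" using dual_bounded[OF assms] by blast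
  then show "bdd_above ((\<lambda>f. \<bar>l f\<bar>) ` {f \<in> X. N f \<le> 1})"
    by (intro bdd_aboveI2[of _ _ K]) (auto intro: order_trans mult_left_le)
qed (auto simp: zero_in N_zero)

context separable_function_hilbert
begin

text \<open>Compact time intervals away from 0 suffice to separate functions of time. When
  \<open>L\<close> consists of integrals over space intervals, these are integrals over space-time
  rectangles, the quantities in which the limit of \<open>S\<close> is computed.\<close>

definition time_functionals :: "((real \<times> 'b \<Rightarrow> real) \<Rightarrow> real) set" where
  "time_functionals = {\<lambda>F. \<integral>\<tau>. l (\<lambda>x. F (\<tau>, x)) \<partial>lebesgue_on {s..t} | s t l. 0 < s \<and> s < t \<and> l \<in> L}"

text \<open>Cauchy-Schwarz on the bounded time interval, which costs a factor
  \<open>sqrt (t - s)\<close>.\<close>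

lemma time_functional_integrable:
  assumes F: "F \<in> L2_time X N" and l: "l \<in> L" and st: "0 < s" "s < t"
  shows "integrable (lebesgue_on {s..t}) (\<lambda>\<tau>. l (\<lambda>x. F (\<tau>, x)))"
    and "\<exists>K. \<forall>F\<in>L2_time X N. \<bar>\<integral>\<tau>. l (\<lambda>x. F (\<tau>, x)) \<partial>lebesgue_on {s..t}\<bar> \<le> K * L2_time_norm N F"
proof -
  have dual: "l \<in> dual_space X N" using l L_dual by blast
  obtain K where K: "K \<ge> 0" "\<forall>f\<in>X. \<bar>l f\<bar> \<le> K * N f" using dual_bounded[OF dual] by blast
  have int2: "integrable (lebesgue_on {0<..}) (\<lambda>\<tau>. (l (\<lambda>x. F (\<tau>, x)))\<^sup>2)"
    and le2: "(\<integral>\<tau>. (l (\<lambda>x. F (\<tau>, x)))\<^sup>2 \<partial>lebesgue_on {0<..}) \<le> K\<^sup>2 * (L2_time_norm N F)\<^sup>2"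
    if F: "F \<in> L2_time X N" for F
  proof -
    have intN: "integrable (lebesgue_on {0<..}) (\<lambda>\<tau>. K\<^sup>2 * (N (\<lambda>x. F (\<tau>, x)))\<^sup>2)"
      using F by (intro Bochner_Integration.integrable_mult_right) (simp add: L2_time_def)
    have AE: "AE \<tau> in lebesgue_on {0<..}. (l (\<lambda>x. F (\<tau>, x)))\<^sup>2 \<le> K\<^sup>2 * (N (\<lambda>x. F (\<tau>, x)))\<^sup>2"
      using L2_time_AE_in[OF F]
    proof eventually_elim
      case (elim \<tau>)
      have "\<bar>l (\<lambda>x. F (\<tau>, x))\<bar>\<^sup>2 \<le> (K * N (\<lambda>x. F (\<tau>, x)))\<^sup>2"
        using bspec[OF K(2) elim] by (intro power_mono) auto
      then show ?case by (simp add: power_mult_distrib)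
    qed
    show int: "integrable (lebesgue_on {0<..}) (\<lambda>\<tau>. (l (\<lambda>x. F (\<tau>, x)))\<^sup>2)"
    proof (rule Bochner_Integration.integrable_bound[OF intN])
      show "(\<lambda>\<tau>. (l (\<lambda>x. F (\<tau>, x)))\<^sup>2) \<in> borel_measurable (lebesgue_on {0<..})"
        using F l by (intro borel_measurable_power) (simp add: L2_time_def bochner_measurable_iff)
    qed (use AE in \<open>auto elim: eventually_mono\<close>)
    show "(\<integral>\<tau>. (l (\<lambda>x. F (\<tau>, x)))\<^sup>2 \<partial>lebesgue_on {0<..}) \<le> K\<^sup>2 * (L2_time_norm N F)\<^sup>2"
      using integral_mono_AE[OF int intN AE] by (simp add: L2_time_norm_power2)
  qed
  have meas: "(\<lambda>\<tau>. l (\<lambda>x. F (\<tau>, x))) \<in> borel_measurable (lebesgue_on {s..t})" if "F \<in> L2_time X N" for F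
  proof (rule measurable_restrict_mono[of _ lebesgue "{0<..}"])
    show "(\<lambda>\<tau>. l (\<lambda>x. F (\<tau>, x))) \<in> borel_measurable (lebesgue_on {0<..})"
      using that l by (simp add: L2_time_def bochner_measurable_iff)
  qed (use st in auto)
  have int2': "integrable (lebesgue_on {s..t}) (\<lambda>\<tau>. (l (\<lambda>x. F (\<tau>, x)))\<^sup>2)" if "F \<in> L2_time X N" for F
    by (rule integrable_lebesgue_on_subset[OF int2[OF that]]) (use st in auto)
  have fin: "finite_measure (lebesgue_on {s..t})"
    by (rule finite_measure_lebesgue_on) simp
  show "integrable (lebesgue_on {s..t}) (\<lambda>\<tau>. l (\<lambda>x. F (\<tau>, x)))"
    using finite_measure.square_integrable_imp_integrable[OF fin meas[OF F] int2'[OF F]] .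
  have "\<bar>\<integral>\<tau>. l (\<lambda>x. F (\<tau>, x)) \<partial>lebesgue_on {s..t}\<bar> \<le> (sqrt (t - s) * K) * L2_time_norm N F"
    if F: "F \<in> L2_time X N" for F
  proof (rule power2_le_imp_le)
    have "(\<integral>\<tau>. l (\<lambda>x. F (\<tau>, x)) \<partial>lebesgue_on {s..t})\<^sup>2
        \<le> measure (lebesgue_on {s..t}) (space (lebesgue_on {s..t})) * (\<integral>\<tau>. (l (\<lambda>x. F (\<tau>, x)))\<^sup>2 \<partial>lebesgue_on {s..t})"
      by (rule integral_power2_le[OF fin meas[OF F] int2'[OF F]])
    also have "measure (lebesgue_on {s..t}) (space (lebesgue_on {s..t})) = t - s"
      using st by (simp add: measure_restrict_space)
    also have "(\<integral>\<tau>. (l (\<lambda>x. F (\<tau>, x)))\<^sup>2 \<partial>lebesgue_on {s..t}) \<le> (\<integral>\<tau>. (l (\<lambda>x. F (\<tau>, x)))\<^sup>2 \<partial>lebesgue_on {0<..})"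
      by (rule integral_mono_lebesgue_on_AE[OF int2[OF F]]) (use st in auto)
    also have "\<dots> \<le> K\<^sup>2 * (L2_time_norm N F)\<^sup>2" by (rule le2[OF F])
    finally show "\<bar>\<integral>\<tau>. l (\<lambda>x. F (\<tau>, x)) \<partial>lebesgue_on {s..t}\<bar>\<^sup>2 \<le> (sqrt (t - s) * K * L2_time_norm N F)\<^sup>2"
      using st by (simp add: power_mult_distrib mult_left_mono)
  qed (use K st in \<open>simp add: L2_time_norm_def\<close>)
  then show "\<exists>K. \<forall>F\<in>L2_time X N. \<bar>\<integral>\<tau>. l (\<lambda>x. F (\<tau>, x)) \<partial>lebesgue_on {s..t}\<bar> \<le> K * L2_time_norm N F"
    by blast
qed

lemma time_functionals_dual: "time_functionals \<subseteq> dual_space (L2_time X N) (L2_time_norm N)"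
proof
  fix m assume "m \<in> time_functionals"
  then obtain s t l where st: "0 < s" "s < t" and l: "l \<in> L"
    and m: "m = (\<lambda>F. \<integral>\<tau>. l (\<lambda>x. F (\<tau>, x)) \<partial>lebesgue_on {s..t})"
    by (auto simp: time_functionals_def)
  have dual: "l \<in> dual_space X N" using l L_dual by blast
  note int = time_functional_integrable(1)[OF _ l st]
  have "m (\<lambda>x. a * F x + b * G x) = a * m F + b * m G" if FG: "F \<in> L2_time X N" "G \<in> L2_time X N" for F G a b
  proof -
    have "m (\<lambda>x. a * F x + b * G x) = (\<integral>\<tau>. a * l (\<lambda>x. F (\<tau>, x)) + b * l (\<lambda>x. G (\<tau>, x)) \<partial>lebesgue_on {s..t})"
      unfolding m
    proof (rule integral_cong_AE)
      show "(\<lambda>\<tau>. l (\<lambda>x. a * F (\<tau>, x) + b * G (\<tau>, x))) \<in> borel_measurable (lebesgue_on {s..t})"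
        using int[OF L2_time_comb[OF FG, of a b]] by (rule borel_measurable_integrable)
      show "(\<lambda>\<tau>. a * l (\<lambda>x. F (\<tau>, x)) + b * l (\<lambda>x. G (\<tau>, x))) \<in> borel_measurable (lebesgue_on {s..t})"
        using int[OF FG(1)] int[OF FG(2)] by (intro borel_measurable_add borel_measurable_times) (auto dest: borel_measurable_integrable)
      have "AE \<tau> in lebesgue_on {0<..}. l (\<lambda>x. a * F (\<tau>, x) + b * G (\<tau>, x)) = a * l (\<lambda>x. F (\<tau>, x)) + b * l (\<lambda>x. G (\<tau>, x))"
        using L2_time_AE_in[OF FG(1)] L2_time_AE_in[OF FG(2)] by eventually_elim (rule dual_comb[OF dual])
      then show "AE \<tau> in lebesgue_on {s..t}. l (\<lambda>x. a * F (\<tau>, x) + b * G (\<tau>, x)) = a * l (\<lambda>x. F (\<tau>, x)) + b * l (\<lambda>x. G (\<tau>, x))"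
        using st by (auto simp: AE_restrict_space_iff elim: eventually_mono)
    qed
    also have "\<dots> = a * m F + b * m G"
      unfolding m using int[OF FG(1)] int[OF FG(2)] by simp
    finally show ?thesis .
  qed
  moreover have "\<exists>K. \<forall>F\<in>L2_time X N. \<bar>m F\<bar> \<le> K * L2_time_norm N F"
    unfolding m by (rule time_functional_integrable(2)[OF L2_time_zero l st])
  ultimately show "m \<in> dual_space (L2_time X N) (L2_time_norm N)"
    by (simp add: dual_space_def)
qed

text \<open>For fixed \<open>l\<close> the scalar function of time has vanishing integrals over all
  intervals and so is zero almost everywhere. Countability of \<open>L\<close> merges the
  exceptional sets, and \<open>L\<close> separates at each remaining time.\<close>

lemma time_functionals_separating:
  assumes G: "G \<in> L2_time X N" and zero: "\<And>m. m \<in> time_functionals \<Longrightarrow> m G = 0"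
  shows "L2_time_norm N G = 0"
proof -
  have AE_l: "AE t in lebesgue_on {0<..}. l (\<lambda>x. G (t, x)) = 0" if l: "l \<in> L" for l
  proof (rule AE_greaterThan_if_AE_Icc)
    fix s t :: real assume st: "0 < s" "s < t"
    have z: "(\<integral>\<tau>. l (\<lambda>x. G (\<tau>, x)) \<partial>lebesgue_on {s..t'}) = 0" if "s < t'" for t'
    proof -
      have "(\<lambda>F. \<integral>\<tau>. l (\<lambda>x. F (\<tau>, x)) \<partial>lebesgue_on {s..t'}) \<in> time_functionals"
        unfolding time_functionals_def using st that l by blast
      from zero[OF this] show ?thesis .
    qed
    show "AE x in lebesgue_on {s..t}. l (\<lambda>xa. G (x, xa)) = 0"
      by (rule AE_zero_if_rational_integrals_zero[OF st(2) time_functional_integrable(1)[OF G l st]])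
        (use z st in auto)
  qed
  have "AE t in lebesgue_on {0<..}. \<forall>l\<in>L. l (\<lambda>x. G (t, x)) = 0"
    using AE_l countable_L by (subst AE_ball_countable) auto
  then have "AE t in lebesgue_on {0<..}. (N (\<lambda>x. G (t, x)))\<^sup>2 = 0"
    using L2_time_AE_in[OF G] by eventually_elim (use L_separating in auto)
  then have "(\<integral>t. (N (\<lambda>x. G (t, x)))\<^sup>2 \<partial>lebesgue_on {0<..}) = (\<integral>t. 0 \<partial>lebesgue_on {0::real<..})"
    using G by (intro integral_cong_AE) (auto simp: L2_time_def dest: borel_measurable_integrable)
  then show ?thesis by (simp add: L2_time_norm_def)
qed

text \<open>The functions of time form a Hilbert space again, so \<open>weak_limit\<close> applies
  to them. The second conclusion records the integrals over time intervals because they identify the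
  limit later.\<close>

lemma L2_time_weak_limit:
  assumes F: "\<And>n. F n \<in> L2_time X N" and bound: "\<And>n. L2_time_norm N (F n) \<le> K"
    and conv: "\<And>l s t. l \<in> L \<Longrightarrow> 0 < s \<Longrightarrow> s < t \<Longrightarrow>
      (\<lambda>n. \<integral>\<tau>. l (\<lambda>x. F n (\<tau>, x)) \<partial>lebesgue_on {s..t}) \<longlonglongrightarrow> I l s t"
  shows "\<exists>G. weakly_converges (L2_time X N) (L2_time_norm N) F G \<and>
    (\<forall>l\<in>L. \<forall>s>0. \<forall>t>s. (\<integral>\<tau>. l (\<lambda>x. G (\<tau>, x)) \<partial>lebesgue_on {s..t}) = I l s t)"
proof -
  interpret L2: function_hilbert "L2_time X N" time_inner "L2_time_norm N"
    by (rule L2_time_hilbert)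
  have "convergent (\<lambda>n. m (F n))" if "m \<in> time_functionals" for m
    using that conv unfolding time_functionals_def convergent_def by blast
  then have "\<exists>G. weakly_converges (L2_time X N) (L2_time_norm N) F G \<and> L2_time_norm N G \<le> K"
    using L2.weak_limit[of time_functionals F K] time_functionals_dual time_functionals_separating F bound by blast
  then obtain G where G: "weakly_converges (L2_time X N) (L2_time_norm N) F G" by blast
  have "(\<integral>\<tau>. l (\<lambda>x. G (\<tau>, x)) \<partial>lebesgue_on {s..t}) = I l s t" if "l \<in> L" "0 < s" "s < t" for l s t
  proof -
    have "(\<lambda>F. \<integral>\<tau>. l (\<lambda>x. F (\<tau>, x)) \<partial>lebesgue_on {s..t}) \<in> time_functionals"
      unfolding time_functionals_def using that by blast
    then have "(\<lambda>F. \<integral>\<tau>. l (\<lambda>x. F (\<tau>, x)) \<partial>lebesgue_on {s..t}) \<in> dual_space (L2_time X N) (L2_time_norm N)"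
      using time_functionals_dual by blast
    then have "(\<lambda>n. \<integral>\<tau>. l (\<lambda>x. F n (\<tau>, x)) \<partial>lebesgue_on {s..t}) \<longlonglongrightarrow> (\<integral>\<tau>. l (\<lambda>x. G (\<tau>, x)) \<partial>lebesgue_on {s..t})"
      using G unfolding weakly_converges_def by fast
    then show ?thesis using conv[OF that] LIMSEQ_unique by blast
  qed
  with G show ?thesis by blast
qed

text \<open>Both arguments are limits of simple functions, one in the norm and one in the dual norm.
  The pairing of two simple functions is simple because its level sets are finite unions of
  intersections of theirs.\<close>

lemma dual_pairing_measurable:
  assumes G: "bochner_measurable (dual_space X N) (dual_norm X N) G" and F: "bochner_measurable X N F"
  shows "(\<lambda>t. G (t, \<lambda>x. F (t, x))) \<in> borel_measurable (lebesgue_on {0<..})"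
proof -
  obtain s where s: "\<forall>n. finite (s n ` {0<..}) \<and> s n ` {0<..} \<subseteq> dual_space X N \<and>
      (\<forall>y. {t \<in> {0<..}. s n t = y} \<in> sets lebesgue)"
    and s_lim: "AE t in lebesgue_on {0<..}. (\<lambda>f. G (t, f)) \<in> dual_space X N \<and>
      (\<lambda>n. dual_norm X N (\<lambda>f. s (n::nat) t f - G (t, f))) \<longlonglongrightarrow> 0"
    using G unfolding bochner_measurable_def by blast
  obtain r where r: "\<forall>n. finite (r n ` {0<..}) \<and> r n ` {0<..} \<subseteq> X \<and>
      (\<forall>y. {t \<in> {0<..}. r n t = y} \<in> sets lebesgue)"
    and r_lim: "AE t in lebesgue_on {0<..}. (\<lambda>x. F (t, x)) \<in> X \<and>
      (\<lambda>n. N (\<lambda>x. r (n::nat) t x - F (t, x))) \<longlonglongrightarrow> 0"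
    using F unfolding bochner_measurable_def by blast
  show ?thesis
  proof (rule borel_measurable_lebesgue_on_AE_limit)
    fix n
    have "simple_function (lebesgue_on {0<..}) (\<lambda>t. s n t (r n t))"
      unfolding simple_function_def
    proof (intro conjI ballI)
      have fin: "finite (s n ` {0<..})" "finite (r n ` {0<..})" using s r by blast+
      have "(\<lambda>t. s n t (r n t)) ` {0<..} \<subseteq> (\<lambda>(y, z). y z) ` (s n ` {0<..} \<times> r n ` {0<..})" by auto
      then show "finite ((\<lambda>t. s n t (r n t)) ` space (lebesgue_on {0<..}))"
        unfolding space_lebesgue_on by (rule finite_subset) (intro finite_imageI finite_cartesian_product fin)
      fix c
      let ?P = "{p \<in> s n ` {0<..} \<times> r n ` {0<..}. fst p (snd p) = c}"
      have "(\<lambda>t. s n t (r n t)) -` {c} \<inter> space (lebesgue_on {0<..})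
          = (\<Union>p\<in>?P. {t \<in> {0<..}. s n t = fst p} \<inter> {t \<in> {0<..}. r n t = snd p})" (is "?A = ?B")
      proof (intro equalityI subsetI)
        fix t assume "t \<in> ?A"
        then have "(s n t, r n t) \<in> ?P" "t \<in> {0<..}" by simp_all
        then show "t \<in> ?B" by force
      qed fastforce
      also have "\<dots> \<in> sets (lebesgue_on {0<..})"
      proof (rule sets.finite_UN)
        show "finite ?P"
          by (rule finite_subset[of _ "s n ` {0<..} \<times> r n ` {0<..}"]) (use fin in auto)
        fix p
        have "{t \<in> {0<..}. s n t = fst p} \<inter> {t \<in> {0<..}. r n t = snd p} \<in> sets lebesgue"
          using s r by (intro sets.Int) blast+
        moreover have "{t \<in> {0<..}. s n t = fst p} \<inter> {t \<in> {0<..}. r n t = snd p} \<subseteq> {0<..}" by blast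
        ultimately show "{t \<in> {0<..}. s n t = fst p} \<inter> {t \<in> {0<..}. r n t = snd p} \<in> sets (lebesgue_on {0<..})"
          by (subst sets_restrict_space_iff) simp_all
      qed
      finally show "(\<lambda>t. s n t (r n t)) -` {c} \<inter> space (lebesgue_on {0<..}) \<in> sets (lebesgue_on {0<..})" .
    qed
    then show "(\<lambda>t. s n t (r n t)) \<in> borel_measurable (lebesgue_on {0<..})"
      by (rule borel_measurable_simple_function)
  next
    show "AE t in lebesgue_on {0<..}. (\<lambda>n. s n t (r n t)) \<longlonglongrightarrow> G (t, \<lambda>x. F (t, x))"
      using s_lim r_lim AE_greaterThan
    proof eventually_elim
      case (elim t)
      let ?G = "\<lambda>f. G (t, f)" and ?F = "\<lambda>x. F (t, x)"
      have X: "r n t \<in> X" and dual: "s n t \<in> dual_space X N" for n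
      proof -
        have "r n t \<in> r n ` {0<..}" "s n t \<in> s n ` {0<..}" using elim(3) by simp_all
        then show "r n t \<in> X" "s n t \<in> dual_space X N" using r s by blast+
      qed
      let ?a = "\<lambda>n. dual_norm X N (\<lambda>f. s n t f - ?G f)" and ?b = "\<lambda>n. N (\<lambda>x. r n t x - ?F x)"
      \<comment> \<open>The error of the pairing splits into s_n - G applied to r_n and G applied to
        r_n - F, where N(r_n) is bounded by the distance of r_n to F plus N(F).\<close>
      have lim: "(\<lambda>n. ?a n * (?b n + N ?F) + dual_norm X N ?G * ?b n) \<longlonglongrightarrow> 0 * (0 + N ?F) + dual_norm X N ?G * 0"
        using elim by (intro tendsto_intros) auto
      have "(\<lambda>n. s n t (r n t) - ?G ?F) \<longlonglongrightarrow> 0"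
      proof (rule Lim_null_comparison[OF always_eventually[OF allI]])
        fix n
        have "\<bar>s n t (r n t) - ?G (r n t)\<bar> \<le> ?a n * N (r n t)"
          using dual_norm_bound[OF dual_sub[OF dual conjunct1[OF elim(1)]] X] .
        also have "\<dots> \<le> ?a n * (?b n + N ?F)"
        proof (rule mult_left_mono)
          show "N (r n t) \<le> ?b n + N ?F" using N_le_add_diff[OF X] elim by blast
          show "0 \<le> ?a n" by (rule dual_norm_nonneg[OF dual_sub[OF dual conjunct1[OF elim(1)]]])
        qed
        finally have 1: "\<bar>s n t (r n t) - ?G (r n t)\<bar> \<le> ?a n * (?b n + N ?F)" .
        have "\<bar>?G (r n t) - ?G ?F\<bar> \<le> dual_norm X N ?G * ?b n"
          using dual_norm_bound[OF conjunct1[OF elim(1)] diff_in[OF X conjunct1[OF elim(2)]]]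
          unfolding dual_diff[OF conjunct1[OF elim(1)] X conjunct1[OF elim(2)]] .
        with 1 show "norm (s n t (r n t) - ?G ?F) \<le> ?a n * (?b n + N ?F) + dual_norm X N ?G * ?b n"
          by simp
      qed (use lim in simp)
      then show ?case by (rule LIM_zero_cancel)
    qed
  qed simp
qed

text \<open>Weak convergence at almost every time gives convergence of the pairing with
  \<open>G\<close> at almost every time, and the dual norm of \<open>G\<close> times K is an
  integrable majorant.\<close>

lemma weakstar_if_weak_AE:
  assumes F: "\<And>n. bochner_measurable X N (F n)"
    and bound: "\<And>n. AE t in lebesgue_on {0<..}. N (\<lambda>x. F n (t, x)) \<le> K"
    and weak: "AE t in lebesgue_on {0<..}. weakly_converges X N (\<lambda>n x. F n (t, x)) (\<lambda>x. F0 (t, x)) \<and> N (\<lambda>x. F0 (t, x)) \<le> K"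
  shows "weakstar_converges_Linf_time X N F F0"
proof -
  have F_Linf: "F n \<in> Linf_time X N" for n
    using F bound by (auto simp: Linf_time_def)
  have F0_meas: "bochner_measurable X N F0"
    unfolding bochner_measurable_iff
  proof (intro conjI ballI)
    show "AE t in lebesgue_on {0<..}. (\<lambda>x. F0 (t, x)) \<in> X"
      using weak by eventually_elim (simp add: weakly_converges_def)
    fix l assume l: "l \<in> L"
    show "(\<lambda>t. l (\<lambda>x. F0 (t, x))) \<in> borel_measurable (lebesgue_on {0<..})"
    proof (rule borel_measurable_lebesgue_on_AE_limit)
      show "(\<lambda>t. l (\<lambda>x. F n (t, x))) \<in> borel_measurable (lebesgue_on {0<..})" for n
        using F l by (simp add: bochner_measurable_iff)
      show "AE t in lebesgue_on {0<..}. (\<lambda>n. l (\<lambda>x. F n (t, x))) \<longlonglongrightarrow> l (\<lambda>x. F0 (t, x))"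
        using weak by eventually_elim (use l L_dual in \<open>auto simp: weakly_converges_def\<close>)
    qed simp
  qed
  have "AE t in lebesgue_on {0<..}. N (\<lambda>x. F0 (t, x)) \<le> K" using weak by eventually_elim simp
  with F0_meas have F0_Linf: "F0 \<in> Linf_time X N" by (auto simp: Linf_time_def)
  have "(\<lambda>n. integral\<^sup>L (lebesgue_on {0<..}) (\<lambda>t. G (t, \<lambda>x. F n (t, x))))
      \<longlonglongrightarrow> integral\<^sup>L (lebesgue_on {0<..}) (\<lambda>t. G (t, \<lambda>x. F0 (t, x)))"
    if G: "G \<in> L1_time (dual_space X N) (dual_norm X N)" for G
  proof -
    have G_meas: "bochner_measurable (dual_space X N) (dual_norm X N) G"
      and G_int: "integrable (lebesgue_on {0<..}) (\<lambda>t. dual_norm X N (\<lambda>f. G (t, f)))"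
      using G by (auto simp: L1_time_def)
    have G_dual: "AE t in lebesgue_on {0<..}. (\<lambda>f. G (t, f)) \<in> dual_space X N"
      using G_meas unfolding bochner_measurable_def by (auto elim: eventually_mono)
    show ?thesis
    proof (rule integral_dominated_convergence)
      show "(\<lambda>t. G (t, \<lambda>x. F0 (t, x))) \<in> borel_measurable (lebesgue_on {0<..})"
        by (rule dual_pairing_measurable[OF G_meas F0_meas])
      show "(\<lambda>t. G (t, \<lambda>x. F n (t, x))) \<in> borel_measurable (lebesgue_on {0<..})" for n
        by (rule dual_pairing_measurable[OF G_meas F])
      show "integrable (lebesgue_on {0<..}) (\<lambda>t. dual_norm X N (\<lambda>f. G (t, f)) * K)"
        using G_int by simp
      show "AE t in lebesgue_on {0<..}. (\<lambda>n. G (t, \<lambda>x. F n (t, x))) \<longlonglongrightarrow> G (t, \<lambda>x. F0 (t, x))"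
        using G_dual weak by eventually_elim (auto simp: weakly_converges_def)
      show "AE t in lebesgue_on {0<..}. norm (G (t, \<lambda>x. F n (t, x))) \<le> dual_norm X N (\<lambda>f. G (t, f)) * K" for n
        using G_dual weak bound[of n]
      proof eventually_elim
        case (elim t)
        have X: "(\<lambda>x. F n (t, x)) \<in> X" using elim(2) by (simp add: weakly_converges_def)
        have nn: "0 \<le> dual_norm X N (\<lambda>f. G (t, f))" by (rule dual_norm_nonneg[OF elim(1)])
        have "\<bar>G (t, \<lambda>x. F n (t, x))\<bar> \<le> dual_norm X N (\<lambda>f. G (t, f)) * N (\<lambda>x. F n (t, x))"
          by (rule dual_norm_bound[OF elim(1) X])
        also have "\<dots> \<le> dual_norm X N (\<lambda>f. G (t, f)) * K" by (rule mult_left_mono[OF elim(3) nn])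
        finally show ?case by simp
      qed
    qed
  qed
  with F_Linf F0_Linf show ?thesis by (simp add: weakstar_converges_Linf_time_def)
qed

end

section \<open>Test functions and weak derivatives\<close>


text \<open>A concrete certificate, on the line, for the coinductive predicate
  \<open>smooth\<close>.\<close>

definition derivative_family :: "(nat \<Rightarrow> real \<Rightarrow> real) \<Rightarrow> bool" where
  "derivative_family g \<longleftrightarrow> (\<forall>k x. (g k has_real_derivative g (Suc k) x) (at x))"

text \<open>Coinduction. The class of initial members of such sequences is closed under directional
  derivatives: the derivative in direction h starts h times the shifted sequence.\<close>

lemma smooth_if_derivative_family:
  assumes "derivative_family g"
  shows "smooth (g 0)"
proof -
  have "\<exists>g. derivative_family g \<and> g 0 = g0" if "g0 = g 0" for g0 using assms that by blast
  then show ?thesis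
  proof (coinduction arbitrary: g rule: smooth.coinduct)
    case smooth
    then obtain g' where g': "derivative_family g'" "g' 0 = g 0" by blast
    have "((g 0) has_derivative (\<lambda>h. g' 1 x * h)) (at x)" for x
      using g'(1) by (simp add: derivative_family_def has_field_derivative_def flip: g'(2))
    moreover have "derivative_family (\<lambda>k x. g' (Suc k) x * h)" for h
      using g'(1) unfolding derivative_family_def by (auto intro!: derivative_eq_intros)
    ultimately show ?case
      by (intro exI[of _ "g 0"] exI[of _ "\<lambda>x h. g' 1 x * h"]) (auto intro!: exI[of _ "\<lambda>k x. g' (Suc k) x * _"] disjI1)
  qed
qed

lemma smooth_has_derivative:
  assumes "smooth f"
  shows "\<exists>f'. (\<forall>x. (f has_derivative f' x) (at x)) \<and> (\<forall>h. smooth (\<lambda>x. f' x h))"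
  using assms by cases blast

lemma smooth_continuous: "smooth f \<Longrightarrow> continuous_on S f"
  by (meson continuous_at_imp_continuous_on has_derivative_continuous smooth_has_derivative)

lemma smooth_deriv:
  fixes f :: "real \<Rightarrow> real"
  assumes "smooth f"
  shows "(f has_real_derivative deriv f x) (at x)" "smooth (deriv f)"
proof -
  obtain f' where f': "\<And>x. (f has_derivative f' x) (at x)" "\<And>h. smooth (\<lambda>x. f' x h)"
    using smooth_has_derivative[OF assms] by blast
  have D: "(f has_real_derivative f' x 1) (at x)" for x
  proof -
    have "f' x = (*) (f' x 1)"
    proof
      fix h
      show "f' x h = f' x 1 * h"
        using linear_scale[OF has_derivative_linear[OF f'(1)], of x h 1] by (simp add: mult.commute)
    qed
    then show ?thesis using f'(1)[of x] by (metis has_field_derivative_def)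
  qed
  then have "deriv f = (\<lambda>x. f' x 1)" by (auto intro: DERIV_imp_deriv)
  then show "(f has_real_derivative deriv f x) (at x)" "smooth (deriv f)" using D f'(2) by auto
qed

text \<open>In Leibniz' rule for higher derivatives the pair \<open>(i, j)\<close> stands for \<open>f\<^sub>i g\<^sub>j\<close>; terms are not
  collected, so no binomial coefficients appear.\<close>

fun product_eval :: "(nat \<Rightarrow> real \<Rightarrow> real) \<Rightarrow> (nat \<Rightarrow> real \<Rightarrow> real) \<Rightarrow> (nat \<times> nat) list \<Rightarrow> real \<Rightarrow> real" where
  "product_eval f g [] x = 0"
| "product_eval f g ((i, j) # ts) x = f i x * g j x + product_eval f g ts x"

fun product_deriv :: "(nat \<times> nat) list \<Rightarrow> (nat \<times> nat) list" where
  "product_deriv [] = []"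
| "product_deriv ((i, j) # ts) = (Suc i, j) # (i, Suc j) # product_deriv ts"

lemma product_family:
  assumes f: "derivative_family f" and g: "derivative_family g"
  shows "derivative_family (\<lambda>k. product_eval f g ((product_deriv ^^ k) [(0, 0)]))"
proof -
  have "(product_eval f g ts has_real_derivative product_eval f g (product_deriv ts) x) (at x)" for ts x
  proof (induction ts rule: product_deriv.induct)
    case 1
    have "product_eval f g [] = (\<lambda>x. 0)" by auto
    then show ?case by simp
  next
    case (2 i j ts)
    have "product_eval f g ((i, j) # ts) = (\<lambda>x. f i x * g j x + product_eval f g ts x)" by auto
    then show ?case
      using f g 2 unfolding derivative_family_def
      by (auto intro!: derivative_eq_intros)
  qed
  then show ?thesis unfolding derivative_family_def by simp
qed

text \<open>With y = 1/x, the derivative of p(y) exp(-y) with respect to x is y^2 (p(y) - p'(y))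
  exp(-y); iterating this map from the constant 1 gives the polynomial factors in the derivatives of
  exp(-1/x).\<close>

definition flat_exp_poly :: "nat \<Rightarrow> real poly" where
  "flat_exp_poly k = ((\<lambda>p. [:0, 0, 1:] * (p - pderiv p)) ^^ k) 1"

definition flat_exp_family :: "nat \<Rightarrow> real \<Rightarrow> real" where
  "flat_exp_family k x = (if x \<le> 0 then 0 else poly (flat_exp_poly k) (inverse x) * exp (- inverse x))"

lemma poly_times_exp_minus_tendsto_0: "((\<lambda>y. poly p y * exp (- y)) \<longlongrightarrow> (0::real)) at_top"
proof (induction p)
  case 0 show ?case by simp
next
  case (pCons a p)
  have lim: "((\<lambda>y. poly q y * exp (- y)) \<longlongrightarrow> (0::real)) at_top" for q :: "real poly"
  proof -
    have "((\<lambda>y. (\<Sum>i\<le>degree q. coeff q i * (y ^ i / exp y))) \<longlongrightarrow> (\<Sum>i\<le>degree q. coeff q i * 0)) at_top"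
      by (intro tendsto_sum tendsto_mult tendsto_const tendsto_power_div_exp_0)
    then show ?thesis
      by (simp add: poly_altdef sum_distrib_right exp_minus divide_inverse mult.assoc)
  qed
  show ?case by (rule lim)
qed

text \<open>Away from 0 this is the rule encoded in \<open>flat_exp_poly\<close>. At 0 the
  difference quotient vanishes from the left, and from the right it is a polynomial in 1/h times
  exp(-1/h).\<close>

lemma flat_exp_family: "derivative_family flat_exp_family"
  unfolding derivative_family_def
proof (intro allI)
  fix k and x :: real
  have succ: "poly (flat_exp_poly (Suc k)) y = y\<^sup>2 * (poly (flat_exp_poly k) y - poly (pderiv (flat_exp_poly k)) y)" for y
    by (simp add: flat_exp_poly_def power2_eq_square)
  consider "x < 0" | "x > 0" | "x = 0" by linarith
  then show "(flat_exp_family k has_real_derivative flat_exp_family (Suc k) x) (at x)"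
  proof cases
    case 1
    have "((\<lambda>x. 0) has_real_derivative flat_exp_family (Suc k) x) (at x)"
      using 1 by (simp add: flat_exp_family_def)
    then show ?thesis
      by (rule DERIV_cong_ev[THEN iffD1, OF refl _ refl, rotated])
        (use 1 in \<open>auto simp: flat_exp_family_def eventually_nhds intro!: exI[of _ "{..<0}"]\<close>)
  next
    case 2
    have "((\<lambda>x. poly (flat_exp_poly k) (inverse x) * exp (- inverse x)) has_real_derivative flat_exp_family (Suc k) x) (at x)"
      using 2 by (auto intro!: derivative_eq_intros poly_DERIV[THEN DERIV_chain2]
          simp: flat_exp_family_def succ power2_eq_square field_simps)
    then show ?thesis
      by (rule DERIV_cong_ev[THEN iffD1, OF refl _ refl, rotated])
        (use 2 in \<open>auto simp: flat_exp_family_def eventually_nhds intro!: exI[of _ "{0<..}"]\<close>)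
  next
    case 3
    have "((\<lambda>h. flat_exp_family k h / h) \<longlongrightarrow> 0) (at 0)"
    proof (rule filterlim_split_at)
      show "((\<lambda>h. flat_exp_family k h / h) \<longlongrightarrow> 0) (at_left 0)"
        by (rule tendsto_eventually) (auto simp: flat_exp_family_def eventually_at_left_field intro!: exI[of _ "-1"])
      \<comment> \<open>The extra factor \<open>[:0, 1:]\<close> is the 1/h of the difference
        quotient.\<close>
      have "((\<lambda>h. poly ([:0, 1:] * flat_exp_poly k) (inverse h) * exp (- inverse h)) \<longlongrightarrow> 0) (at_right 0)"
        by (rule filterlim_compose[OF poly_times_exp_minus_tendsto_0 filterlim_inverse_at_top_right])
      then show "((\<lambda>h. flat_exp_family k h / h) \<longlongrightarrow> 0) (at_right 0)"
        by (rule Lim_transform_eventually)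
          (auto simp: flat_exp_family_def eventually_at_right_field field_simps intro!: exI[of _ 1])
    qed
    then show ?thesis
      using 3 by (simp add: has_field_derivative_iff flat_exp_family_def)
  qed
qed

lemma derivative_family_reflect:
  assumes "derivative_family g"
  shows "derivative_family (\<lambda>k x. (-1) ^ k * g k (1 - x))"
  unfolding derivative_family_def
proof (intro allI)
  fix k x
  have "(g k has_real_derivative g (Suc k) (1 - x)) (at (1 - x))"
    using assms by (simp add: derivative_family_def)
  then have "((\<lambda>x. g k (1 - x)) has_real_derivative g (Suc k) (1 - x) * (-1)) (at x)"
    by (rule DERIV_chain2) (auto intro!: derivative_eq_intros)
  then show "((\<lambda>x. (-1) ^ k * g k (1 - x)) has_real_derivative (-1) ^ Suc k * g (Suc k) (1 - x)) (at x)"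
    by (auto intro!: derivative_eq_intros)
qed

lemma derivative_family_affine:
  assumes "derivative_family g"
  shows "derivative_family (\<lambda>k x. c ^ k * g k (c * x + d))"
  unfolding derivative_family_def
proof (intro allI)
  fix k x
  have "(g k has_real_derivative g (Suc k) (c * x + d)) (at (c * x + d))"
    using assms by (simp add: derivative_family_def)
  then have "((\<lambda>x. g k (c * x + d)) has_real_derivative g (Suc k) (c * x + d) * c) (at x)"
    by (rule DERIV_chain2) (auto intro!: derivative_eq_intros)
  then show "((\<lambda>x. c ^ k * g k (c * x + d)) has_real_derivative c ^ Suc k * g (Suc k) (c * x + d)) (at x)"
    by (auto intro!: derivative_eq_intros)
qed

text \<open>The product of exp(-1/x) and exp(-1/(1 - x)) is a smooth bump on the unit interval; the
  step is its antiderivative divided by the total mass.\<close>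

lemma smooth_step_exists:
  "\<exists>g. derivative_family g \<and> (\<forall>x\<le>0. g 0 x = 0) \<and> (\<forall>x\<ge>1. g 0 x = 1) \<and> (\<forall>x. 0 \<le> g 1 x) \<and>
     (\<forall>x\<le>0. g 1 x = 0) \<and> (\<forall>x\<ge>1. g 1 x = 0)"
proof -
  define b where "b k = product_eval flat_exp_family (\<lambda>k x. (-1) ^ k * flat_exp_family k (1 - x)) ((product_deriv ^^ k) [(0, 0)])" for k
  have b: "derivative_family b"
    unfolding b_def by (intro product_family derivative_family_reflect flat_exp_family)
  have b0: "b 0 x = flat_exp_family 0 x * flat_exp_family 0 (1 - x)" for x
    by (simp add: b_def)
  have b_pos: "b 0 x > 0" if "0 < x" "x < 1" for x
    using that by (simp add: b0 flat_exp_family_def flat_exp_poly_def)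
  have b_zero: "b 0 x = 0" if "x \<le> 0 \<or> 1 \<le> x" for x
    using that by (auto simp: b0 flat_exp_family_def)
  have b_nonneg: "0 \<le> b 0 x" for x
    using b_pos[of x] b_zero[of x] by (metis linorder_not_le order.refl less_imp_le)
  have cont: "continuous_on S (b 0)" for S
    using b unfolding derivative_family_def by (meson DERIV_isCont continuous_at_imp_continuous_on)
  \<comment> \<open>Integration starts at -1, to the left of the support, so that 0 is an interior
    point and the derivative there is two-sided.\<close>
  define B where "B x = integral {-1..x} (b 0)" for x
  have B_deriv: "(B has_real_derivative b 0 x) (at x)" if "x > -1" for x
  proof -
    have "(B has_real_derivative b 0 x) (at x within {-1..x+1})"
      unfolding B_def by (rule integral_has_real_derivative[OF cont]) (use that in auto)
    then show ?thesis using that by (subst (asm) at_within_interior) auto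
  qed
  have B0: "B 0 = 0"
    unfolding B_def using integral_spike[of "{}" "{-1..0}" "b 0" "\<lambda>x. 0"] b_zero by (simp add: integral_eq_0_iff)
  define I where "I = B 1"
  have "B 0 < B 1"
  proof (rule DERIV_pos_imp_increasing_open[of 0 1 B])
    show "\<exists>y. (B has_real_derivative y) (at x) \<and> 0 < y" if "0 < x" "x < 1" for x
      using B_deriv[of x] b_pos[OF that] that by auto
    show "continuous_on {0..1} B"
      using B_deriv by (intro continuous_at_imp_continuous_on ballI DERIV_isCont[OF B_deriv]) auto
  qed simp
  then have I: "I > 0" using B0 by (simp add: I_def)
  have B1: "B x = I" if "x \<ge> 1" for x
  proof (cases "x = 1")
    case False
    have "B x = B 1"
    proof (rule DERIV_isconst2[of 1 x])
      show "continuous_on {1..x} B"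
        using B_deriv by (intro continuous_at_imp_continuous_on ballI DERIV_isCont[OF B_deriv]) auto
      show "(B has_real_derivative 0) (at y)" if "1 < y" "y < x" for y
        using B_deriv[of y] b_zero[of y] that by auto
    qed (use that False in auto)
    then show ?thesis by (simp add: I_def)
  qed (simp add: I_def)
  \<comment> \<open>\<open>B\<close> is known to be differentiable only to the right of -1;
    continuing it by 0 gives an antiderivative on the whole line.\<close>
  define S where "S x = (if x \<le> 0 then 0 else B x)" for x
  have S_deriv: "(S has_real_derivative b 0 x) (at x)" for x
  proof (cases "x < 0")
    case True
    have "((\<lambda>x. 0) has_real_derivative b 0 x) (at x)" using True b_zero[of x] by simp
    then show ?thesis
      by (rule DERIV_cong_ev[THEN iffD1, OF refl _ refl, rotated])
        (use True in \<open>auto simp: S_def eventually_nhds intro!: exI[of _ "{..<0}"]\<close>)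
  next
    case False
    have eq: "S y = B y" if "y > -1" for y
    proof (cases "y \<le> 0")
      case True
      have "B y = 0"
        unfolding B_def using b_zero True by (intro integral_unique has_integral_is_0) auto
      then show ?thesis using True by (simp add: S_def)
    qed (simp add: S_def)
    have "(B has_real_derivative b 0 x) (at x)" using B_deriv False by simp
    then show ?thesis
      by (rule DERIV_cong_ev[THEN iffD1, OF refl _ refl, rotated])
        (use False eq in \<open>auto simp: eventually_nhds intro!: exI[of _ "{-1<..}"]\<close>)
  qed
  define g where "g k x = (case k of 0 \<Rightarrow> S x / I | Suc k \<Rightarrow> b k x / I)" for k x
  have "derivative_family g"
    unfolding derivative_family_def
  proof (intro allI)
    fix k x
    show "(g k has_real_derivative g (Suc k) x) (at x)"
    proof (cases k)
      case 0
      then show ?thesis using DERIV_cdivide[OF S_deriv[of x], of I] by (simp add: g_def[abs_def])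
    next
      case (Suc j)
      have "(b j has_real_derivative b (Suc j) x) (at x)" using b by (simp add: derivative_family_def)
      then show ?thesis using Suc DERIV_cdivide[of "b j" _ x UNIV I] by (simp add: g_def[abs_def])
    qed
  qed
  moreover have "(\<forall>x\<le>0. g 0 x = 0) \<and> (\<forall>x\<ge>1. g 0 x = 1) \<and> (\<forall>x. 0 \<le> g 1 x) \<and>
     (\<forall>x\<le>0. g 1 x = 0) \<and> (\<forall>x\<ge>1. g 1 x = 0)"
    using I B1 b_nonneg b_zero by (auto simp: g_def S_def)
  ultimately show ?thesis by blast
qed

lemma integral_lebesgue_on_superset:
  fixes f :: "'a::euclidean_space \<Rightarrow> real"
  assumes "S \<subseteq> T" "S \<in> sets lebesgue" "T \<in> sets lebesgue" "\<And>x. x \<in> T - S \<Longrightarrow> f x = 0"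
  shows "integral\<^sup>L (lebesgue_on T) f = integral\<^sup>L (lebesgue_on S) f"
proof -
  have "integral\<^sup>L (lebesgue_on T) f = integral\<^sup>L (lebesgue_on T) (\<lambda>x. if x \<in> S then f x else 0)"
    using assms by (intro Bochner_Integration.integral_cong) auto
  also have "\<dots> = integral\<^sup>L (lebesgue_on S) f" by (rule integral_restrict[OF assms(1-3)])
  finally show ?thesis .
qed

lemma integrable_lebesgue_on_superset:
  fixes f :: "'a::euclidean_space \<Rightarrow> real"
  assumes "S \<subseteq> T" "S \<in> sets lebesgue" "T \<in> sets lebesgue" "\<And>x. x \<in> T - S \<Longrightarrow> f x = 0"
    and "integrable (lebesgue_on S) f"
  shows "integrable (lebesgue_on T) f"
proof -
  have "(\<lambda>x. if x \<in> T then f x else 0) = (\<lambda>x. if x \<in> S then f x else 0)"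
    using assms(1,4) by fastforce
  then show ?thesis
    using assms(5) Lebesgue_Measure.integrable_restrict_UNIV[OF assms(2), of f]
      Lebesgue_Measure.integrable_restrict_UNIV[OF assms(3), of f] by simp
qed

lemma integrable_continuous_lebesgue_on:
  fixes f :: "real \<Rightarrow> real"
  assumes "continuous_on {a..b} f"
  shows "integrable (lebesgue_on {a..b}) f" "integral\<^sup>L (lebesgue_on {a..b}) f = integral {a..b} f"
proof -
  show int: "integrable (lebesgue_on {a..b}) f"
    using absolutely_integrable_continuous_real[OF assms]
    by (simp add: absolutely_integrable_on_def set_integrable_def integrable_restrict_space)
  then show "integral\<^sup>L (lebesgue_on {a..b}) f = integral {a..b} f"
    by (rule lebesgue_integral_eq_integral) simp
qed

definition smooth_step :: "nat \<Rightarrow> real \<Rightarrow> real" where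
  "smooth_step = (SOME g. derivative_family g \<and> (\<forall>x\<le>0. g 0 x = 0) \<and> (\<forall>x\<ge>1. g 0 x = 1) \<and> (\<forall>x. 0 \<le> g 1 x) \<and>
     (\<forall>x\<le>0. g 1 x = 0) \<and> (\<forall>x\<ge>1. g 1 x = 0))"

lemma smooth_step:
  shows "derivative_family smooth_step" "x \<le> 0 \<Longrightarrow> smooth_step 0 x = 0" "x \<ge> 1 \<Longrightarrow> smooth_step 0 x = 1"
    "0 \<le> smooth_step 1 x" "x \<le> 0 \<Longrightarrow> smooth_step 1 x = 0" "x \<ge> 1 \<Longrightarrow> smooth_step 1 x = 0"
  using someI_ex[OF smooth_step_exists, folded smooth_step_def] by auto

lemma smooth_step_deriv: "(smooth_step k has_real_derivative smooth_step (Suc k) x) (at x)"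
  using smooth_step(1) by (simp add: derivative_family_def)

lemma smooth_step_bounds: "0 \<le> smooth_step 0 x \<and> smooth_step 0 x \<le> 1"
proof -
  have mono: "smooth_step 0 x \<le> smooth_step 0 y" if "x \<le> y" for x y
    by (rule DERIV_nonneg_imp_nondecreasing[OF that]) (metis One_nat_def smooth_step_deriv smooth_step(4))
  show ?thesis
    using mono[of "min x 0" x] mono[of x "max x 1"] smooth_step(2)[of "min x 0"] smooth_step(3)[of "max x 1"] by auto
qed

lemma smooth_step_continuous: "continuous_on S (smooth_step k)"
  by (meson smooth_step_deriv DERIV_isCont continuous_at_imp_continuous_on)

text \<open>The k-th derivative of a difference of two steps of width \<delta>, starting at
  \<open>x\<close> and at \<open>y\<close>. As \<delta> shrinks, order 0 tends to the indicator of
  the interval from \<open>x\<close> (excluded) to \<open>y\<close> (included), and order 1 is a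
  difference of two mollifiers. The affine argument has the form required by
  \<open>derivative_family_affine\<close>.\<close>

definition plateau :: "real \<Rightarrow> real \<Rightarrow> real \<Rightarrow> nat \<Rightarrow> real \<Rightarrow> real" where
  "plateau x y \<delta> k s = (1 / \<delta>) ^ k * smooth_step k (1 / \<delta> * s + (- x / \<delta>)) - (1 / \<delta>) ^ k * smooth_step k (1 / \<delta> * s + (- y / \<delta>))"

lemma plateau_family: "derivative_family (plateau x y \<delta>)"
proof -
  have "derivative_family (\<lambda>k s. f k s - g k s)" if "derivative_family f" "derivative_family g" for f g
    using that unfolding derivative_family_def by (auto intro!: derivative_eq_intros)
  then show ?thesis
    using derivative_family_affine[OF smooth_step(1)] unfolding plateau_def[abs_def] by blast
qed

lemma plateau_bound: "\<bar>plateau x y \<delta> 0 s\<bar> \<le> 1"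
  using smooth_step_bounds[of "1 / \<delta> * s + (- x / \<delta>)"] smooth_step_bounds[of "1 / \<delta> * s + (- y / \<delta>)"]
  unfolding plateau_def power_0 mult_1 by linarith

lemma plateau_zero:
  assumes "\<delta> > 0" "x \<le> y" "s \<le> x \<or> y + \<delta> \<le> s"
  shows "plateau x y \<delta> 0 s = 0" "plateau x y \<delta> 1 s = 0"
proof -
  have *: "1 / \<delta> * s + (- z / \<delta>) = (s - z) / \<delta>" for z by (simp add: diff_divide_distrib)
  have "((s - x) / \<delta> \<le> 0 \<and> (s - y) / \<delta> \<le> 0) \<or> ((s - x) / \<delta> \<ge> 1 \<and> (s - y) / \<delta> \<ge> 1)"
    using assms by (auto simp: field_simps)
  then show "plateau x y \<delta> 0 s = 0" "plateau x y \<delta> 1 s = 0"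
    unfolding plateau_def * using smooth_step by auto
qed

lemma plateau_tendsto:
  assumes "\<And>n. \<delta> n > 0" "\<delta> \<longlonglongrightarrow> 0" "x \<le> y"
  shows "(\<lambda>n. plateau x y (\<delta> n) 0 s) \<longlonglongrightarrow> (if x < s \<and> s \<le> y then 1 else 0)"
proof -
  have "(\<lambda>n. smooth_step 0 (1 / \<delta> n * s + (- z / \<delta> n))) \<longlonglongrightarrow> (if z < s then 1 else 0)" for z
  proof (rule tendsto_eventually)
    have *: "1 / \<delta> n * s + (- z / \<delta> n) = (s - z) / \<delta> n" for n by (simp add: diff_divide_distrib)
    show "\<forall>\<^sub>F n in sequentially. smooth_step 0 (1 / \<delta> n * s + (- z / \<delta> n)) = (if z < s then 1 else 0)"
    proof (cases "z < s")
      case True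
      then have "\<forall>\<^sub>F n in sequentially. \<delta> n < s - z" using order_tendstoD(2)[OF assms(2)] by simp
      then show ?thesis
      proof eventually_elim
        case (elim n)
        then have "(s - z) / \<delta> n \<ge> 1" using assms(1)[of n] by (simp add: field_simps)
        then show ?case unfolding * using True smooth_step(3) by simp
      qed
    next
      case False
      then have "(s - z) / \<delta> n \<le> 0" for n using assms(1)[of n] by (simp add: divide_nonpos_pos)
      then show ?thesis unfolding * using False smooth_step(2) by simp
    qed
  qed
  from tendsto_diff[OF this[of x] this[of y]] show ?thesis
    using assms(3) by (auto simp: plateau_def split: if_splits)
qed

text \<open>The kernel is the derivative of a rescaled step: nonnegative, of mass one, and supported
  to the right of \<open>x\<close>. This one-sidedness is why \<open>x\<close> may be the left end
  point of the interval.\<close>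

lemma mollifier_tendsto:
  fixes w :: "real \<Rightarrow> real"
  assumes w: "continuous_on {p..q} w" and x: "p \<le> x" "x < q"
    and \<delta>: "\<And>n. \<delta> n > 0" "\<delta> \<longlonglongrightarrow> 0"
  shows "(\<lambda>n. integral {p..q} (\<lambda>s. w s * (1 / \<delta> n * smooth_step 1 (1 / \<delta> n * s + (- x / \<delta> n))))) \<longlonglongrightarrow> w x"
proof (rule LIMSEQ_I)
  fix e :: real assume "e > 0"
  define k where "k n s = 1 / \<delta> n * smooth_step 1 (1 / \<delta> n * s + (- x / \<delta> n))" for n s
  have "continuous (at x within {p..q}) w" using w x by (simp add: continuous_on_eq_continuous_within)
  then obtain d where d: "d > 0" "\<And>s. s \<in> {p..q} \<Longrightarrow> \<bar>s - x\<bar> < d \<Longrightarrow> \<bar>w s - w x\<bar> < e / 2"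
    using \<open>e > 0\<close> unfolding continuous_within_eps_delta dist_real_def by (meson half_gt_zero)
  have "\<forall>\<^sub>F n in sequentially. \<delta> n < min d (q - x)"
    using order_tendstoD(2)[OF \<delta>(2), of "min d (q - x)"] d x by simp
  then obtain n0 where n0: "\<And>n. n \<ge> n0 \<Longrightarrow> \<delta> n < min d (q - x)" by (auto simp: eventually_sequentially)
  have "norm (integral {p..q} (\<lambda>s. w s * k n s) - w x) < e" if n: "n \<ge> n0" for n
  proof -
    have \<delta>n: "0 < \<delta> n" "\<delta> n < d" "\<delta> n < q - x" using \<delta>(1) n0[OF n] by auto
    have arg: "1 / \<delta> n * s + (- x / \<delta> n) = (s - x) / \<delta> n" for s by (simp add: diff_divide_distrib)
    have k_cont: "continuous_on {p..q} (k n)"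
      unfolding k_def by (intro continuous_intros continuous_on_compose2[OF smooth_step_continuous[of UNIV]]) auto
    have k_nonneg: "0 \<le> k n s" for s
      using \<delta>n smooth_step(4)[of "1 / \<delta> n * s + (- x / \<delta> n)"] by (simp add: k_def)
    have "(k n has_integral smooth_step 0 ((q - x) / \<delta> n) - smooth_step 0 ((p - x) / \<delta> n)) {p..q}"
    proof (rule fundamental_theorem_of_calculus)
      fix s assume "s \<in> {p..q}"
      have "((\<lambda>s. (s - x) / \<delta> n) has_real_derivative 1 / \<delta> n) (at s)"
        using \<delta>n by (auto intro!: derivative_eq_intros)
      from DERIV_chain2[OF smooth_step_deriv this, of 0]
      have "((\<lambda>s. smooth_step 0 ((s - x) / \<delta> n)) has_real_derivative smooth_step 1 ((s - x) / \<delta> n) * (1 / \<delta> n)) (at s)"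
        by simp
      then show "((\<lambda>s. smooth_step 0 ((s - x) / \<delta> n)) has_vector_derivative k n s) (at s within {p..q})"
        unfolding k_def arg has_real_derivative_iff_has_vector_derivative
        by (simp add: mult.commute has_vector_derivative_at_within)
    qed (use x in simp)
    moreover have "smooth_step 0 ((q - x) / \<delta> n) = 1" "smooth_step 0 ((p - x) / \<delta> n) = 0"
      using \<delta>n x by (auto intro!: smooth_step(2,3) simp: field_simps divide_le_0_iff)
    ultimately have k_int: "(k n has_integral 1) {p..q}" by simp
    have k_val: "integral {p..q} (\<lambda>s. c * k n s) = c" for c
      using integral_unique[OF k_int] by simp
    have "integral {p..q} (\<lambda>s. w s * k n s) - w x = integral {p..q} (\<lambda>s. w s * k n s) - integral {p..q} (\<lambda>s. w x * k n s)"
      by (simp only: k_val)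
    also have "\<dots> = integral {p..q} (\<lambda>s. w s * k n s - w x * k n s)"
      by (intro Henstock_Kurzweil_Integration.integral_diff[symmetric] integrable_continuous_real continuous_intros w k_cont)
    also have "norm \<dots> \<le> integral {p..q} (\<lambda>s. (e / 2) * k n s)"
    proof (rule integral_norm_bound_integral)
      show "(\<lambda>s. w s * k n s - w x * k n s) integrable_on {p..q}" "(\<lambda>s. (e / 2) * k n s) integrable_on {p..q}"
        by (intro integrable_continuous_real continuous_intros w k_cont)+
      fix s assume s: "s \<in> {p..q}"
      show "norm (w s * k n s - w x * k n s) \<le> (e / 2) * k n s"
      proof (cases "x < s \<and> s < x + \<delta> n")
        case True
        then have "\<bar>w s - w x\<bar> \<le> e / 2" using d(2)[OF s] \<delta>n by simp
        then have "\<bar>w s - w x\<bar> * k n s \<le> e / 2 * k n s" by (rule mult_right_mono) (rule k_nonneg)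
        then show ?thesis
          unfolding left_diff_distrib[symmetric] real_norm_def abs_mult using k_nonneg[of s] by simp
      next
        case False
        then have "k n s = 0"
          unfolding k_def arg using \<delta>n smooth_step(5)[of "(s - x) / \<delta> n"] smooth_step(6)[of "(s - x) / \<delta> n"]
          by (auto simp: field_simps divide_le_0_iff not_less)
        then show ?thesis by simp
      qed
    qed
    also have "\<dots> = e / 2" by (rule k_val)
    finally show ?thesis using \<open>e > 0\<close> by simp
  qed
  then show "\<exists>no. \<forall>n\<ge>no. norm (integral {p..q} (\<lambda>s. w s * (1 / \<delta> n * smooth_step 1 (1 / \<delta> n * s + (- x / \<delta> n)))) - w x) < e"
    unfolding k_def by blast
qed

lemma shrinking_sequence:
  assumes "(e::real) > 0"
  shows "\<exists>\<delta>::nat \<Rightarrow> real. (\<forall>n. 0 < \<delta> n \<and> \<delta> n < e) \<and> \<delta> \<longlonglongrightarrow> 0"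
\<comment> \<open>The shift by 2 keeps the first term strictly below e.\<close>
proof (intro exI[of _ "\<lambda>n. e / (real n + 2)"] conjI allI)
  fix n
  show "0 < e / (real n + 2)" "e / (real n + 2) < e" using assms by (simp_all add: field_simps add_pos_nonneg)
  show "(\<lambda>n. e / (real n + 2)) \<longlonglongrightarrow> 0"
    using LIMSEQ_ignore_initial_segment[OF lim_const_over_n[of e], of 2] by (simp add: add.commute)
qed

section \<open>Weak derivatives on a bounded interval\<close>

locale bounded_interval =
  fixes \<alpha> \<beta> :: real
  assumes \<alpha>_less_\<beta>: "\<alpha> < \<beta>"
begin

abbreviation "\<Omega> \<equiv> {\<alpha><..<\<beta>}"

lemma finite_measure_\<Omega>: "finite_measure (lebesgue_on \<Omega>)"
  by (rule finite_measure_lebesgue_on) (simp add: lmeasurable_open)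

lemma measure_\<Omega>: "measure (lebesgue_on \<Omega>) \<Omega> = \<beta> - \<alpha>"
  using \<alpha>_less_\<beta> by (simp add: measure_restrict_space)

lemma AE_\<Omega>: "AE x in lebesgue_on \<Omega>. x \<in> \<Omega>"
  using AE_space[of "lebesgue_on \<Omega>"] by simp

lemma test_functionsD:
  assumes "\<phi> \<in> test_functions \<Omega>"
  shows "smooth \<phi>" "\<exists>c d. \<alpha> < c \<and> c < d \<and> d < \<beta> \<and> closure {x. \<phi> x \<noteq> 0} \<subseteq> {c<..<d}"
proof -
  show "smooth \<phi>" using assms by (simp add: test_functions_def)
  let ?K = "closure {x. \<phi> x \<noteq> 0}"
  have K: "compact ?K" "?K \<subseteq> \<Omega>" using assms by (auto simp: test_functions_def)
  show "\<exists>c d. \<alpha> < c \<and> c < d \<and> d < \<beta> \<and> ?K \<subseteq> {c<..<d}"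
  proof (cases "?K = {}")
    case True
    then show ?thesis using \<alpha>_less_\<beta> by (intro exI[of _ "\<alpha> + (\<beta> - \<alpha>) / 3"] exI[of _ "\<beta> - (\<beta> - \<alpha>) / 3"]) (auto simp: field_simps)
  next
    case False
    obtain m where m: "m \<in> ?K" "\<forall>x\<in>?K. m \<le> x" using compact_attains_inf[OF K(1) False] by blast
    obtain M where M: "M \<in> ?K" "\<forall>x\<in>?K. x \<le> M" using compact_attains_sup[OF K(1) False] by blast
    have *: "\<alpha> < m" "M < \<beta>" "m \<le> M" using m M K by auto
    have "?K \<subseteq> {(\<alpha> + m) / 2<..<(M + \<beta>) / 2}"
    proof
      fix z assume "z \<in> ?K"
      then have "m \<le> z" "z \<le> M" using m M by blast+
      then show "z \<in> {(\<alpha> + m) / 2<..<(M + \<beta>) / 2}" using * by simp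
    qed
    then show ?thesis
      using * by (intro exI[of _ "(\<alpha> + m) / 2"] exI[of _ "(M + \<beta>) / 2"]) auto
  qed
qed

lemma test_functions_deriv:
  assumes "\<phi> \<in> test_functions \<Omega>"
  shows "deriv \<phi> \<in> test_functions \<Omega>"
proof -
  let ?K = "closure {x. \<phi> x \<noteq> 0}"
  have "{x. deriv \<phi> x \<noteq> 0} \<subseteq> ?K"
  proof
    fix x assume "x \<in> {x. deriv \<phi> x \<noteq> 0}"
    show "x \<in> ?K"
    proof (rule ccontr)
      assume "x \<notin> ?K"
      have "\<forall>\<^sub>F y in nhds x. y \<in> - ?K"
        using \<open>x \<notin> ?K\<close> by (intro eventually_nhds_in_open) auto
      then have "\<forall>\<^sub>F y in nhds x. \<phi> y = 0"
        by (rule eventually_mono) (use closure_subset[of "{x. \<phi> x \<noteq> 0}"] in auto)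
      then have "deriv \<phi> x = deriv (\<lambda>_. 0) x" by (rule deriv_cong_ev) simp
      then show False using \<open>x \<in> {x. deriv \<phi> x \<noteq> 0}\<close> by simp
    qed
  qed
  then have sub: "closure {x. deriv \<phi> x \<noteq> 0} \<subseteq> ?K" by (rule closure_minimal) simp
  have "compact ?K" "?K \<subseteq> \<Omega>" "smooth \<phi>" using assms by (auto simp: test_functions_def)
  then have "compact (closure {x. deriv \<phi> x \<noteq> 0})"
    using sub by (metis compact_Int_closed closed_closure inf.absorb2)
  with sub \<open>?K \<subseteq> \<Omega>\<close> \<open>smooth \<phi>\<close> show ?thesis by (auto simp: test_functions_def smooth_deriv)
qed

lemma test_functions_deriv_iter: "\<phi> \<in> test_functions \<Omega> \<Longrightarrow> (deriv ^^ k) \<phi> \<in> test_functions \<Omega>"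
  by (induction k) (auto intro: test_functions_deriv)

lemma plateau_test:
  assumes "\<alpha> < x" "x \<le> y" "\<delta> > 0" "y + \<delta> < \<beta>"
  shows "plateau x y \<delta> 0 \<in> test_functions \<Omega>"
proof -
  have "{s. plateau x y \<delta> 0 s \<noteq> 0} \<subseteq> {x..y + \<delta>}"
  proof
    fix s assume "s \<in> {s. plateau x y \<delta> 0 s \<noteq> 0}"
    then show "s \<in> {x..y + \<delta>}" using plateau_zero(1)[OF assms(3,2), of s] by (cases "s \<le> x"; cases "y + \<delta> \<le> s") auto
  qed
  then have sub: "closure {s. plateau x y \<delta> 0 s \<noteq> 0} \<subseteq> {x..y + \<delta>}" by (rule closure_minimal) simp
  then have "compact (closure {s. plateau x y \<delta> 0 s \<noteq> 0})"
    by (meson bounded_closed_interval bounded_subset closed_closure compact_eq_bounded_closed)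
  with sub assms show ?thesis
    by (auto simp: test_functions_def smooth_if_derivative_family[OF plateau_family])
qed

lemma test_bounded:
  assumes "\<phi> \<in> test_functions \<Omega>"
  shows "\<exists>C. \<forall>x. \<bar>\<phi> x\<bar> \<le> C"
proof -
  let ?K = "closure {x. \<phi> x \<noteq> 0}"
  have "compact (\<phi> ` ?K)"
    using assms by (intro compact_continuous_image smooth_continuous) (auto simp: test_functions_def)
  then obtain C where C: "\<forall>y\<in>\<phi> ` ?K. \<bar>y\<bar> \<le> C"
    using compact_imp_bounded bounded_real by metis
  have "\<bar>\<phi> x\<bar> \<le> max C 0" for x
  proof (cases "\<phi> x = 0")
    case False
    then have "x \<in> ?K" using closure_subset[of "{x. \<phi> x \<noteq> 0}"] by blast
    then show ?thesis using C by fastforce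
  qed simp
  then show ?thesis by blast
qed

lemma test_measurable: "\<phi> \<in> test_functions \<Omega> \<Longrightarrow> \<phi> \<in> borel_measurable (lebesgue_on S)"
  using smooth_continuous[of \<phi> UNIV]
  by (auto simp: test_functions_def intro!: measurable_restrict_space1 borel_measurable_continuous_onI measurable_completion)

lemma test_integrable:
  assumes h: "locally_integrable \<Omega> h" and \<phi>: "\<phi> \<in> test_functions \<Omega>"
  shows "integrable (lebesgue_on \<Omega>) (\<lambda>x. h x * \<phi> x)"
proof -
  let ?K = "closure {x. \<phi> x \<noteq> 0}"
  have K: "compact ?K" "?K \<subseteq> \<Omega>" using \<phi> by (auto simp: test_functions_def)
  then have int: "integrable (lebesgue_on ?K) h" using h by (auto simp: locally_integrable_def)
  obtain C where C: "\<forall>x. \<bar>\<phi> x\<bar> \<le> C" using test_bounded[OF \<phi>] by blast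
  have "integrable (lebesgue_on ?K) (\<lambda>x. h x * \<phi> x)"
  proof (rule Bochner_Integration.integrable_bound)
    show "integrable (lebesgue_on ?K) (\<lambda>x. C * h x)" using int by simp
    show "(\<lambda>x. h x * \<phi> x) \<in> borel_measurable (lebesgue_on ?K)"
      using int test_measurable[OF \<phi>] by (intro borel_measurable_times) auto
    show "AE x in lebesgue_on ?K. norm (h x * \<phi> x) \<le> norm (C * h x)"
    proof (intro AE_I2)
      fix x
      have "\<bar>\<phi> x\<bar> \<le> \<bar>C\<bar>" using C by (meson abs_ge_self order_trans)
      then show "norm (h x * \<phi> x) \<le> norm (C * h x)"
        by (simp add: abs_mult mult.commute mult_right_mono)
    qed
  qed
  then show ?thesis
  proof (rule integrable_lebesgue_on_superset[rotated 4])
    show "h x * \<phi> x = 0" if "x \<in> \<Omega> - ?K" for x using that closure_subset[of "{x. \<phi> x \<noteq> 0}"] by auto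
  qed (use K in auto)
qed

text \<open>The premise is asked for rational end points only, because
  \<open>interval_integrals\<close> offers no others; every point of the open interval lies in such
  a subinterval.\<close>

lemma AE_\<Omega>_if_AE_Icc:
  assumes "\<And>c d. c \<in> \<rat> \<Longrightarrow> d \<in> \<rat> \<Longrightarrow> \<alpha> < c \<Longrightarrow> c < d \<Longrightarrow> d < \<beta> \<Longrightarrow> AE x in lebesgue_on {c..d}. P x"
  shows "AE x in lebesgue_on \<Omega>. P x"
proof -
  have "AE x in lebesgue. \<forall>p\<in>\<rat> \<times> \<rat>. \<alpha> < fst p \<and> fst p < snd p \<and> snd p < \<beta> \<and> x \<in> {fst p..snd p} \<longrightarrow> P x"
  proof (subst AE_ball_countable)
    show "countable (\<rat> \<times> \<rat> :: (real \<times> real) set)" by (intro countable_SIGMA countable_rat)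
    show "\<forall>p\<in>\<rat> \<times> \<rat>. AE x in lebesgue. \<alpha> < fst p \<and> fst p < snd p \<and> snd p < \<beta> \<and> x \<in> {fst p..snd p} \<longrightarrow> P x"
    proof
      fix p :: "real \<times> real" assume p: "p \<in> \<rat> \<times> \<rat>"
      show "AE x in lebesgue. \<alpha> < fst p \<and> fst p < snd p \<and> snd p < \<beta> \<and> x \<in> {fst p..snd p} \<longrightarrow> P x"
      proof (cases "\<alpha> < fst p \<and> fst p < snd p \<and> snd p < \<beta>")
        case True
        then have "AE x in lebesgue_on {fst p..snd p}. P x" using assms[of "fst p" "snd p"] p by auto
        then show ?thesis by (auto simp: AE_restrict_space_iff)
      qed auto
    qed
  qed
  then have "AE x in lebesgue. x \<in> \<Omega> \<longrightarrow> P x"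
  proof eventually_elim
    case (elim x)
    show ?case
    proof
      assume "x \<in> \<Omega>"
      then obtain c d where "c \<in> \<rat>" "d \<in> \<rat>" "\<alpha> < c" "c < x" "x < d" "d < \<beta>"
        using Rats_dense_in_real[of \<alpha> x] Rats_dense_in_real[of x \<beta>] by auto
      then show "P x" using bspec[OF elim, of "(c, d)"] by auto
    qed
  qed
  then show ?thesis by (simp add: AE_restrict_space_iff)
qed

lemma locally_integrable_Icc: "locally_integrable \<Omega> h \<Longrightarrow> \<alpha> < c \<Longrightarrow> d < \<beta> \<Longrightarrow> integrable (lebesgue_on {c..d}) h"
proof -
  assume "locally_integrable \<Omega> h" "\<alpha> < c" "d < \<beta>"
  moreover have "compact {c..d}" by simp
  moreover have "{c..d} \<subseteq> \<Omega>" using \<open>\<alpha> < c\<close> \<open>d < \<beta>\<close> by auto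
  ultimately show ?thesis by (simp only: locally_integrable_def)
qed

text \<open>Dominated convergence with majorant |h| on the compact interval up to \<open>q\<close>,
  outside of which all the plateaus vanish. The limit omits the left end point, a null set.\<close>

lemma plateau_integral_tendsto:
  assumes h: "locally_integrable \<Omega> h" and xy: "\<alpha> < x" "x \<le> y" "y < q" "q < \<beta>"
    and \<delta>: "\<And>n. \<delta> n > 0" "\<And>n. y + \<delta> n < q" "\<delta> \<longlonglongrightarrow> 0"
  shows "(\<lambda>n. integral\<^sup>L (lebesgue_on \<Omega>) (\<lambda>s. h s * plateau x y (\<delta> n) 0 s)) \<longlonglongrightarrow> integral\<^sup>L (lebesgue_on {x..y}) h"
proof -
  have eq: "integral\<^sup>L (lebesgue_on \<Omega>) (\<lambda>s. h s * plateau x y (\<delta> n) 0 s) = integral\<^sup>L (lebesgue_on {x..q}) (\<lambda>s. h s * plateau x y (\<delta> n) 0 s)" for n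
  proof (rule integral_lebesgue_on_superset)
    show "h s * plateau x y (\<delta> n) 0 s = 0" if "s \<in> \<Omega> - {x..q}" for s
      using plateau_zero(1)[OF \<delta>(1)[of n] xy(2)] \<delta>(2)[of n] that by auto
  qed (use xy in auto)
  have int: "integrable (lebesgue_on {x..q}) h" by (rule locally_integrable_Icc[OF h]) (use xy in auto)
  have lim_fn: "(\<lambda>n. h s * plateau x y (\<delta> n) 0 s) \<longlonglongrightarrow> h s * (if x < s \<and> s \<le> y then 1 else 0)" for s
    by (intro tendsto_intros plateau_tendsto \<delta> xy)
  have pm: "plateau x y (\<delta> n) 0 \<in> borel_measurable (lebesgue_on {x..q})" for n
    using test_measurable[OF plateau_test[of x y "\<delta> n"]] xy \<delta>(1,2)[of n] by simp
  have sm: "(\<lambda>s. h s * plateau x y (\<delta> n) 0 s) \<in> borel_measurable (lebesgue_on {x..q})" for n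
    using int pm by (intro borel_measurable_times) auto
  have "(\<lambda>n. integral\<^sup>L (lebesgue_on {x..q}) (\<lambda>s. h s * plateau x y (\<delta> n) 0 s))
      \<longlonglongrightarrow> integral\<^sup>L (lebesgue_on {x..q}) (\<lambda>s. h s * (if x < s \<and> s \<le> y then 1 else 0))"
  proof (rule integral_dominated_convergence)
    show "integrable (lebesgue_on {x..q}) (\<lambda>s. norm (h s))" using int by simp
    show "(\<lambda>s. h s * (if x < s \<and> s \<le> y then 1 else 0)) \<in> borel_measurable (lebesgue_on {x..q})"
      by (rule borel_measurable_LIMSEQ_metric[OF sm lim_fn])
    show "AE s in lebesgue_on {x..q}. norm (h s * plateau x y (\<delta> n) 0 s) \<le> norm (h s)" for n
      using plateau_bound[of x y "\<delta> n"] by (intro AE_I2) (simp add: abs_mult mult_left_le)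
  qed (use sm lim_fn in auto)
  also have "integral\<^sup>L (lebesgue_on {x..q}) (\<lambda>s. h s * (if x < s \<and> s \<le> y then 1 else 0))
      = integral\<^sup>L (lebesgue_on {x..q}) (\<lambda>s. if s \<in> {x..y} then h s else 0)"
  proof (rule integral_cong_AE)
    show "(\<lambda>s. h s * (if x < s \<and> s \<le> y then 1 else 0)) \<in> borel_measurable (lebesgue_on {x..q})"
      by (rule borel_measurable_LIMSEQ_metric[OF sm lim_fn])
    have "h \<in> borel_measurable (lebesgue_on {x..y})"
      by (rule borel_measurable_integrable, rule locally_integrable_Icc[OF h]) (use xy in auto)
    then show "(\<lambda>s. if s \<in> {x..y} then h s else 0) \<in> borel_measurable (lebesgue_on {x..q})"
      using xy by (subst borel_measurable_if_lebesgue_on) auto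
    have "AE s in lebesgue. s \<noteq> x" by (rule AE_completion) (rule AE_lborel_singleton)
    then show "AE s in lebesgue_on {x..q}. h s * (if x < s \<and> s \<le> y then 1 else 0) = (if s \<in> {x..y} then h s else 0)"
      by (simp add: AE_restrict_space_iff) (auto elim: eventually_mono)
  qed
  also have "\<dots> = integral\<^sup>L (lebesgue_on {x..y}) h"
    by (rule integral_restrict) (use xy in auto)
  finally show ?thesis unfolding eq .
qed

text \<open>Plateaus are admissible test functions and shrink to indicators, so all integrals of
  \<open>h\<close> over compact subintervals vanish.\<close>

lemma fundamental_lemma:
  assumes h: "locally_integrable \<Omega> h" and zero: "\<And>\<phi>. \<phi> \<in> test_functions \<Omega> \<Longrightarrow> integral\<^sup>L (lebesgue_on \<Omega>) (\<lambda>x. h x * \<phi> x) = 0"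
  shows "AE x in lebesgue_on \<Omega>. h x = 0"
proof (rule AE_\<Omega>_if_AE_Icc)
  fix c d assume cd: "\<alpha> < c" "c < d" "d < \<beta>"
  have "integral\<^sup>L (lebesgue_on {c..y}) h = 0" if y: "c \<le> y" "y \<le> d" for y
  proof -
    define q where "q = (y + \<beta>) / 2"
    have q: "y < q" "q < \<beta>" using y cd by (auto simp: q_def)
    obtain \<delta> where d: "\<forall>n. 0 < \<delta> n \<and> \<delta> n < q - y" and lim: "\<delta> \<longlonglongrightarrow> 0"
      using shrinking_sequence[of "q - y"] q by auto
    have \<delta>: "\<delta> n > 0" "y + \<delta> n < q" for n using spec[OF d, of n] by linarith+
    have "integral\<^sup>L (lebesgue_on \<Omega>) (\<lambda>s. h s * plateau c y (\<delta> n) 0 s) = 0" for n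
      using plateau_test[of c y "\<delta> n"] cd y \<delta>[of n] q by (intro zero) simp
    then have "(\<lambda>n. 0) \<longlonglongrightarrow> integral\<^sup>L (lebesgue_on {c..y}) h"
      using plateau_integral_tendsto[OF h cd(1) y(1) q \<delta> lim] by simp
    then show ?thesis by (simp add: LIMSEQ_const_iff)
  qed
  then show "AE x in lebesgue_on {c..d}. h x = 0"
    using cd locally_integrable_Icc[OF h cd(1,3)] by (intro AE_zero_if_rational_integrals_zero) auto
qed

text \<open>Testing with a plateau: its derivative is the difference of two mollifiers concentrating
  at \<open>x\<close> and \<open>y\<close>, so one side tends to \<open>w x - w y\<close>, while the
  plateau itself yields minus the integral of \<open>g\<close>. This is the fundamental theorem of
  calculus for a merely locally integrable derivative.\<close>

lemma weak_deriv_diff: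
  assumes w: "continuous_on \<Omega> w" and wd: "has_weak_deriv \<Omega> 1 w g" and xy: "\<alpha> < x" "x \<le> y" "y < \<beta>"
  shows "w y - w x = integral\<^sup>L (lebesgue_on {x..y}) g"
proof -
  define q where "q = (y + \<beta>) / 2"
  have q: "y < q" "q < \<beta>" using xy by (auto simp: q_def)
  obtain \<delta> where d: "\<forall>n. 0 < \<delta> n \<and> \<delta> n < q - y" and lim: "\<delta> \<longlonglongrightarrow> 0"
    using shrinking_sequence[of "q - y"] q by auto
  have \<delta>: "\<delta> n > 0" "y + \<delta> n < q" for n using spec[OF d, of n] by linarith+
  have g: "locally_integrable \<Omega> g" using wd by (simp add: has_weak_deriv_def)
  have deriv: "deriv (plateau x y (\<delta> n) 0) = plateau x y (\<delta> n) 1" for n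
    using plateau_family[of x y "\<delta> n"] unfolding derivative_family_def
    by (intro ext DERIV_imp_deriv) (metis One_nat_def)
  have cont: "continuous_on {x..q} w" using w xy q by (auto intro: continuous_on_subset)
  let ?k = "\<lambda>z n s. 1 / \<delta> n * smooth_step 1 (1 / \<delta> n * s + (- z / \<delta> n))"
  have kcont: "continuous_on {x..q} (?k z n)" for z n
    by (intro continuous_intros continuous_on_compose2[OF smooth_step_continuous[of UNIV]]) auto
  have eq: "integral {x..q} (\<lambda>s. w s * ?k x n s) - integral {x..q} (\<lambda>s. w s * ?k y n s)
      = - integral\<^sup>L (lebesgue_on \<Omega>) (\<lambda>s. g s * plateau x y (\<delta> n) 0 s)" for n
  proof -
    have "integral\<^sup>L (lebesgue_on \<Omega>) (\<lambda>s. w s * plateau x y (\<delta> n) 1 s) = - integral\<^sup>L (lebesgue_on \<Omega>) (\<lambda>s. g s * plateau x y (\<delta> n) 0 s)"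
      using wd plateau_test[OF xy(1,2) \<delta>(1), of n] \<delta>(2)[of n] q deriv[of n] by (force simp: has_weak_deriv_def)
    moreover have "integral\<^sup>L (lebesgue_on \<Omega>) (\<lambda>s. w s * plateau x y (\<delta> n) 1 s)
        = integral\<^sup>L (lebesgue_on {x..q}) (\<lambda>s. w s * plateau x y (\<delta> n) 1 s)"
    proof (rule integral_lebesgue_on_superset)
      show "w s * plateau x y (\<delta> n) 1 s = 0" if "s \<in> \<Omega> - {x..q}" for s
        using plateau_zero(2)[OF \<delta>(1)[of n] xy(2)] \<delta>(2)[of n] that by auto
    qed (use xy q in auto)
    moreover have "(\<lambda>s. w s * plateau x y (\<delta> n) 1 s) = (\<lambda>s. w s * ?k x n s - w s * ?k y n s)"
      by (auto simp: plateau_def algebra_simps)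
    moreover have "integral\<^sup>L (lebesgue_on {x..q}) (\<lambda>s. w s * ?k x n s - w s * ?k y n s)
        = integral {x..q} (\<lambda>s. w s * ?k x n s - w s * ?k y n s)"
      by (intro integrable_continuous_lebesgue_on(2) continuous_on_diff continuous_on_mult cont kcont)
    moreover have "\<dots> = integral {x..q} (\<lambda>s. w s * ?k x n s) - integral {x..q} (\<lambda>s. w s * ?k y n s)"
      by (intro Henstock_Kurzweil_Integration.integral_diff integrable_continuous_real continuous_on_mult cont kcont)
    ultimately show ?thesis by simp
  qed
  have "(\<lambda>n. integral {x..q} (\<lambda>s. w s * ?k x n s)) \<longlonglongrightarrow> w x"
    "(\<lambda>n. integral {x..q} (\<lambda>s. w s * ?k y n s)) \<longlonglongrightarrow> w y"
    by (rule mollifier_tendsto[OF cont]; use \<delta> lim xy q in simp)+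
  then have "(\<lambda>n. integral {x..q} (\<lambda>s. w s * ?k x n s) - integral {x..q} (\<lambda>s. w s * ?k y n s)) \<longlonglongrightarrow> w x - w y"
    by (rule tendsto_diff)
  then have "(\<lambda>n. - integral\<^sup>L (lebesgue_on \<Omega>) (\<lambda>s. g s * plateau x y (\<delta> n) 0 s)) \<longlonglongrightarrow> w x - w y"
    by (simp only: eq)
  moreover have "(\<lambda>n. - integral\<^sup>L (lebesgue_on \<Omega>) (\<lambda>s. g s * plateau x y (\<delta> n) 0 s)) \<longlonglongrightarrow> - integral\<^sup>L (lebesgue_on {x..y}) g"
    by (intro tendsto_minus plateau_integral_tendsto[OF g xy(1,2) q \<delta> lim])
  ultimately have "w x - w y = - integral\<^sup>L (lebesgue_on {x..y}) g"
    by (rule LIMSEQ_unique)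
  then show ?thesis by simp
qed

end

section \<open>Sobolev spaces on an interval\<close>


context bounded_interval
begin

definition L2_inner :: "(real \<Rightarrow> real) \<Rightarrow> (real \<Rightarrow> real) \<Rightarrow> real" where
  "L2_inner f g = (\<integral>x. f x * g x \<partial>lebesgue_on \<Omega>)"

definition L2_norm :: "(real \<Rightarrow> real) \<Rightarrow> real" where
  "L2_norm f = sqrt (\<integral>x. (f x)\<^sup>2 \<partial>lebesgue_on \<Omega>)"

lemma L2_measurable: "f \<in> L2_space \<Omega> \<Longrightarrow> f \<in> borel_measurable (lebesgue_on \<Omega>)"
  and L2_integrable_power2: "f \<in> L2_space \<Omega> \<Longrightarrow> integrable (lebesgue_on \<Omega>) (\<lambda>x. (f x)\<^sup>2)"
  by (auto simp: L2_space_def)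

lemma L2_integrable_mult:
  assumes f: "f \<in> L2_space \<Omega>" and g: "g \<in> L2_space \<Omega>"
  shows "integrable (lebesgue_on \<Omega>) (\<lambda>x. f x * g x)"
proof (rule Bochner_Integration.integrable_bound)
  show "integrable (lebesgue_on \<Omega>) (\<lambda>x. (f x)\<^sup>2 + (g x)\<^sup>2)"
    using f g by (intro Bochner_Integration.integrable_add L2_integrable_power2)
  show "(\<lambda>x. f x * g x) \<in> borel_measurable (lebesgue_on \<Omega>)"
    using f g by (intro borel_measurable_times L2_measurable)
  have "\<bar>a * b\<bar> \<le> a\<^sup>2 + b\<^sup>2" for a b :: real
  proof -
    have "2 * (\<bar>a\<bar> * \<bar>b\<bar>) \<le> a\<^sup>2 + b\<^sup>2" "0 \<le> \<bar>a\<bar> * \<bar>b\<bar>"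
      using zero_le_power2[of "\<bar>a\<bar> - \<bar>b\<bar>"] by (simp_all add: power2_diff)
    then show ?thesis unfolding abs_mult by linarith
  qed
  then show "AE x in lebesgue_on \<Omega>. norm (f x * g x) \<le> norm ((f x)\<^sup>2 + (g x)\<^sup>2)"
    by (intro AE_I2) simp
qed

lemma L2_integrable: "f \<in> L2_space \<Omega> \<Longrightarrow> integrable (lebesgue_on \<Omega>) f"
  by (rule finite_measure.square_integrable_imp_integrable[OF finite_measure_\<Omega> L2_measurable L2_integrable_power2])

lemma L2_locally_integrable: "f \<in> L2_space \<Omega> \<Longrightarrow> locally_integrable \<Omega> f"
  unfolding locally_integrable_def
  by (intro allI impI integrable_lebesgue_on_subset[OF L2_integrable]) (auto simp: compact_imp_closed borel_closed)

lemma L2_AE: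
  assumes f: "f \<in> L2_space \<Omega>" and eq: "AE x in lebesgue_on \<Omega>. f x = g x"
  shows "g \<in> L2_space \<Omega>"
proof -
  have "integrable (lebesgue_on \<Omega>) (\<lambda>x. (g x)\<^sup>2)"
  proof (rule integrable_lebesgue_on_AE[OF _ L2_integrable_power2[OF f]])
    show "AE x in lebesgue_on \<Omega>. (f x)\<^sup>2 = (g x)\<^sup>2" using eq by eventually_elim simp
  qed simp
  then show ?thesis
    using borel_measurable_lebesgue_on_AE[OF _ L2_measurable[OF f] eq] by (simp add: L2_space_def)
qed

lemma L2_norm_AE:
  assumes "f \<in> L2_space \<Omega>" "AE x in lebesgue_on \<Omega>. f x = g x"
  shows "L2_norm f = L2_norm g"
proof -
  have "(\<integral>x. (f x)\<^sup>2 \<partial>lebesgue_on \<Omega>) = (\<integral>x. (g x)\<^sup>2 \<partial>lebesgue_on \<Omega>)"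
  proof (rule integral_cong_AE)
    show "AE x in lebesgue_on \<Omega>. (f x)\<^sup>2 = (g x)\<^sup>2" using assms(2) by eventually_elim simp
  qed (use assms L2_AE[OF assms] in \<open>auto dest: L2_integrable_power2 borel_measurable_integrable\<close>)
  then show ?thesis by (simp add: L2_norm_def)
qed

lemma L2_comb:
  assumes f: "f \<in> L2_space \<Omega>" and g: "g \<in> L2_space \<Omega>"
  shows "(\<lambda>x. a * f x + b * g x) \<in> L2_space \<Omega>"
proof -
  have eq: "(\<lambda>x. (a * f x + b * g x)\<^sup>2) = (\<lambda>x. a\<^sup>2 * (f x)\<^sup>2 + 2 * a * b * (f x * g x) + b\<^sup>2 * (g x)\<^sup>2)"
    by (auto simp: power2_sum power_mult_distrib algebra_simps)
  have "integrable (lebesgue_on \<Omega>) (\<lambda>x. (a * f x + b * g x)\<^sup>2)"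
    unfolding eq using f g
    by (intro Bochner_Integration.integrable_add Bochner_Integration.integrable_mult_right L2_integrable_power2 L2_integrable_mult)
  then show ?thesis
    using f g by (auto simp: L2_space_def intro!: borel_measurable_add borel_measurable_times)
qed

lemma L2_prehilbert: "function_prehilbert (L2_space \<Omega>) L2_inner L2_norm"
proof
  show "(\<lambda>x. 0) \<in> L2_space \<Omega>" by (simp add: L2_space_def)
next
  fix f g :: "real \<Rightarrow> real" and a b assume fg: "f \<in> L2_space \<Omega>" "g \<in> L2_space \<Omega>"
  then show "(\<lambda>x. a * f x + b * g x) \<in> L2_space \<Omega>" by (rule L2_comb)
  show "L2_inner f g = L2_inner g f" by (simp add: L2_inner_def mult.commute)
  fix h assume h: "h \<in> L2_space \<Omega>"
  have "L2_inner (\<lambda>x. a * f x + b * g x) h = (\<integral>x. a * (f x * h x) + b * (g x * h x) \<partial>lebesgue_on \<Omega>)"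
    unfolding L2_inner_def by (intro Bochner_Integration.integral_cong) (auto simp: algebra_simps)
  also have "\<dots> = a * L2_inner f h + b * L2_inner g h"
    unfolding L2_inner_def using L2_integrable_mult[OF fg(1) h] L2_integrable_mult[OF fg(2) h] by simp
  finally show "L2_inner (\<lambda>x. a * f x + b * g x) h = a * L2_inner f h + b * L2_inner g h" .
next
  fix f show "0 \<le> L2_inner f f" "L2_norm f = sqrt (L2_inner f f)"
    by (simp_all add: L2_inner_def L2_norm_def power2_eq_square)
qed

sublocale L2: function_prehilbert "L2_space \<Omega>" L2_inner L2_norm
  by (rule L2_prehilbert)

lemma L2_norm_power2: "(L2_norm f)\<^sup>2 = (\<integral>x. (f x)\<^sup>2 \<partial>lebesgue_on \<Omega>)"
  by (simp add: L2_norm_def)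

text \<open>The scheme of \<open>L2_time_complete\<close> for scalar functions: almost-everywhere
  convergence of a rapidly Cauchy subsequence, then Fatou's lemma.\<close>

lemma L2_complete:
  assumes F: "\<And>n::nat. F n \<in> L2_space \<Omega>"
    and Cauchy: "\<And>e. e > 0 \<Longrightarrow> \<exists>M. \<forall>m\<ge>M. \<forall>n\<ge>M. L2_norm (\<lambda>x. F m x - F n x) < e"
  shows "\<exists>f\<in>L2_space \<Omega>. (\<lambda>n. L2_norm (\<lambda>x. F n x - f x)) \<longlonglongrightarrow> 0"
proof -
  obtain k where k: "strict_mono k"
    and close: "\<forall>i. \<forall>m\<ge>k i. \<forall>n\<ge>k i. L2_norm (\<lambda>x. F m x - F n x) < (1/2) ^ i"
    using Cauchy_subsequence_geometric[of "\<lambda>m n. L2_norm (\<lambda>x. F m x - F n x)", OF Cauchy] by blast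
  have diff: "(\<lambda>x. F m x - F n x) \<in> L2_space \<Omega>" for m n by (rule L2.diff_in[OF F F])
  note int = L2_integrable_power2[OF diff]
  have sq: "(\<integral>x. (F m x - F n x)\<^sup>2 \<partial>lebesgue_on \<Omega>) \<le> (1/4) ^ i" if "m \<ge> k i" "n \<ge> k i" for m n i
  proof -
    have "(L2_norm (\<lambda>x. F m x - F n x))\<^sup>2 \<le> ((1/2) ^ i)\<^sup>2"
      using close that L2.N_nonneg[OF diff] by (intro power_mono) (auto intro: less_imp_le)
    also have "((1/2) ^ i)\<^sup>2 = ((1/2)\<^sup>2::real) ^ i" by (simp only: power_mult[symmetric] mult.commute)
    also have "(1/2)\<^sup>2 = (1/4::real)" by (simp add: power2_eq_square)
    finally show ?thesis by (simp add: L2_norm_power2)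
  qed
  have "AE x in lebesgue_on \<Omega>. summable (\<lambda>i. \<bar>F (k (Suc i)) x - F (k i) x\<bar>)"
  proof (rule AE_summable_if_square_integrals_geometric)
    fix i
    show "integrable (lebesgue_on \<Omega>) (\<lambda>x. \<bar>F (k (Suc i)) x - F (k i) x\<bar>\<^sup>2)" using int by simp
    have "k i \<le> k (Suc i)" using k by (simp add: strict_mono_less_eq)
    then show "(\<integral>x. \<bar>F (k (Suc i)) x - F (k i) x\<bar>\<^sup>2 \<partial>lebesgue_on \<Omega>) \<le> (1/4) ^ i"
      using sq[of i "k (Suc i)" "k i"] by simp
  qed simp
  then have conv: "AE x in lebesgue_on \<Omega>. convergent (\<lambda>i. F (k i) x)"
  proof eventually_elim
    case (elim x)
    then have "summable (\<lambda>i. F (k (Suc i)) x - F (k i) x)" by (rule summable_rabs_cancel)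
    then have "convergent (\<lambda>n. \<Sum>i<n. F (k (Suc i)) x - F (k i) x)" by (simp add: summable_iff_convergent)
    then have "convergent (\<lambda>n. (F (k n) x - F (k 0) x) + F (k 0) x)"
      unfolding sum_lessThan_telescope[of "\<lambda>i. F (k i) x"] by (intro convergent_add convergent_const)
    then show ?case by simp
  qed
  define f where "f x = lim (\<lambda>i. F (k i) x)" for x
  have lim: "AE x in lebesgue_on \<Omega>. (\<lambda>i. F (k i) x) \<longlonglongrightarrow> f x"
    using conv by eventually_elim (simp add: f_def convergent_LIMSEQ_iff)
  have f_meas: "f \<in> borel_measurable (lebesgue_on \<Omega>)"
    unfolding f_def using L2_measurable[OF F] by (intro borel_measurable_lim_metric)
  have bound: "(\<integral>\<^sup>+x. ennreal ((F (k i) x - f x)\<^sup>2) \<partial>lebesgue_on \<Omega>) \<le> ennreal ((1/4) ^ i)" for i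
  proof -
    have meas: "(\<lambda>x. ennreal ((F (k i) x - F (k j) x)\<^sup>2)) \<in> borel_measurable (lebesgue_on \<Omega>)" for j
      using borel_measurable_integrable[OF int] by measurable
    have "(\<integral>\<^sup>+x. ennreal ((F (k i) x - f x)\<^sup>2) \<partial>lebesgue_on \<Omega>)
        = (\<integral>\<^sup>+x. liminf (\<lambda>j. ennreal ((F (k i) x - F (k j) x)\<^sup>2)) \<partial>lebesgue_on \<Omega>)"
    proof (rule nn_integral_cong_AE)
      show "AE x in lebesgue_on \<Omega>. ennreal ((F (k i) x - f x)\<^sup>2) = liminf (\<lambda>j. ennreal ((F (k i) x - F (k j) x)\<^sup>2))"
        using lim
      proof eventually_elim
        case (elim x)
        then have "(\<lambda>j. ennreal ((F (k i) x - F (k j) x)\<^sup>2)) \<longlonglongrightarrow> ennreal ((F (k i) x - f x)\<^sup>2)"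
          by (intro tendsto_ennrealI tendsto_power tendsto_diff tendsto_const)
        then show ?case by (intro lim_imp_Liminf[symmetric]) simp_all
      qed
    qed
    also have "\<dots> \<le> liminf (\<lambda>j. \<integral>\<^sup>+x. ennreal ((F (k i) x - F (k j) x)\<^sup>2) \<partial>lebesgue_on \<Omega>)"
      using meas by (rule nn_integral_liminf)
    also have "\<dots> \<le> ennreal ((1/4) ^ i)"
    proof (rule Liminf_le)
      show "\<forall>\<^sub>F j in sequentially. (\<integral>\<^sup>+x. ennreal ((F (k i) x - F (k j) x)\<^sup>2) \<partial>lebesgue_on \<Omega>) \<le> ennreal ((1/4) ^ i)"
        using eventually_ge_at_top[of i]
      proof eventually_elim
        case (elim j)
        then have "k i \<le> k j" using k by (simp add: strict_mono_less_eq)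
        then show ?case
          using sq[of i "k i" "k j"] int by (subst nn_integral_eq_integral) (auto intro: ennreal_leI)
      qed
    qed simp
    finally show ?thesis .
  qed
  have Ff: "(\<lambda>x. F (k i) x - f x) \<in> L2_space \<Omega>" for i
  proof -
    have m: "(\<lambda>x. F (k i) x - f x) \<in> borel_measurable (lebesgue_on \<Omega>)"
      using L2_measurable[OF F] f_meas by (intro borel_measurable_diff)
    have "integrable (lebesgue_on \<Omega>) (\<lambda>x. (F (k i) x - f x)\<^sup>2)"
    proof (rule integrableI_bounded)
      show "(\<lambda>x. (F (k i) x - f x)\<^sup>2) \<in> borel_measurable (lebesgue_on \<Omega>)" using m by (rule borel_measurable_power)
      have "(\<integral>\<^sup>+x. ennreal (norm ((F (k i) x - f x)\<^sup>2)) \<partial>lebesgue_on \<Omega>) \<le> ennreal ((1/4) ^ i)"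
        using bound[of i] by simp
      also have "\<dots> < \<infinity>" by simp
      finally show "(\<integral>\<^sup>+x. ennreal (norm ((F (k i) x - f x)\<^sup>2)) \<partial>lebesgue_on \<Omega>) < \<infinity>" .
    qed
    with m show ?thesis by (simp add: L2_space_def)
  qed
  have f: "f \<in> L2_space \<Omega>" using L2.diff_in[OF F Ff, of "k 0" 0] by simp
  have sub: "L2_norm (\<lambda>x. F (k i) x - f x) \<le> (1/2) ^ i" for i
  proof (rule power2_le_imp_le)
    have "ennreal (\<integral>x. (F (k i) x - f x)\<^sup>2 \<partial>lebesgue_on \<Omega>) \<le> ennreal ((1/4) ^ i)"
      using bound[of i] L2_integrable_power2[OF Ff[of i]] by (subst nn_integral_eq_integral[symmetric]) auto
    then have "(L2_norm (\<lambda>x. F (k i) x - f x))\<^sup>2 \<le> (1/4) ^ i" by (simp add: L2_norm_power2)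
    also have "(1/4::real) = (1/2)\<^sup>2" by (simp add: power2_eq_square)
    also have "((1/2)\<^sup>2::real) ^ i = ((1/2) ^ i)\<^sup>2" by (simp only: power_mult[symmetric] mult.commute)
    finally show "(L2_norm (\<lambda>x. F (k i) x - f x))\<^sup>2 \<le> ((1/2) ^ i)\<^sup>2" .
  qed simp
  have "(\<lambda>n. L2_norm (\<lambda>x. F n x - f x)) \<longlonglongrightarrow> 0"
  proof (rule LIMSEQ_I)
    fix e :: real assume "e > 0"
    then obtain i where i: "(1/2) ^ i < e / 2"
      using real_arch_pow_inv[of "e / 2" "1/2"] by auto
    have "norm (L2_norm (\<lambda>x. F n x - f x) - 0) < e" if "n \<ge> k i" for n
    proof -
      have "L2_norm (\<lambda>x. F n x - f x) \<le> L2_norm (\<lambda>x. F n x - F (k i) x) + L2_norm (\<lambda>x. F (k i) x - f x)"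
        by (rule L2.N_triangle_diff[OF F F f])
      moreover have "L2_norm (\<lambda>x. F n x - F (k i) x) < (1/2) ^ i" using close that by blast
      ultimately show ?thesis
        using sub[of i] i L2.N_nonneg[OF L2.diff_in[OF F f], of n] by simp
    qed
    then show "\<exists>no. \<forall>n\<ge>no. norm (L2_norm (\<lambda>x. F n x - f x) - 0) < e" by blast
  qed
  with f show ?thesis by blast
qed

lemma has_weak_deriv_comb:
  assumes "has_weak_deriv \<Omega> k f f'" "has_weak_deriv \<Omega> k g g'"
  shows "has_weak_deriv \<Omega> k (\<lambda>x. a * f x + b * g x) (\<lambda>x. a * f' x + b * g' x)"
proof -
  have loc: "locally_integrable \<Omega> (\<lambda>x. a * p x + b * q x)" if "locally_integrable \<Omega> p" "locally_integrable \<Omega> q" for p q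
    using that by (auto simp: locally_integrable_def)
  have int: "integral\<^sup>L (lebesgue_on \<Omega>) (\<lambda>x. (a * p x + b * q x) * \<psi> x)
      = a * integral\<^sup>L (lebesgue_on \<Omega>) (\<lambda>x. p x * \<psi> x) + b * integral\<^sup>L (lebesgue_on \<Omega>) (\<lambda>x. q x * \<psi> x)"
    if "locally_integrable \<Omega> p" "locally_integrable \<Omega> q" "\<psi> \<in> test_functions \<Omega>" for p q \<psi>
  proof -
    have "(\<lambda>x. (a * p x + b * q x) * \<psi> x) = (\<lambda>x. a * (p x * \<psi> x) + b * (q x * \<psi> x))"
      by (auto simp: algebra_simps)
    then show ?thesis using test_integrable[OF that(1,3)] test_integrable[OF that(2,3)] by simp
  qed
  show ?thesis
    unfolding has_weak_deriv_def
  proof (intro conjI ballI)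
    fix \<phi> assume \<phi>: "\<phi> \<in> test_functions \<Omega>"
    note \<psi> = test_functions_deriv_iter[OF \<phi>, of k]
    have A: "integral\<^sup>L (lebesgue_on \<Omega>) (\<lambda>x. f x * (deriv ^^ k) \<phi> x) = (- 1) ^ k * integral\<^sup>L (lebesgue_on \<Omega>) (\<lambda>x. f' x * \<phi> x)"
      "integral\<^sup>L (lebesgue_on \<Omega>) (\<lambda>x. g x * (deriv ^^ k) \<phi> x) = (- 1) ^ k * integral\<^sup>L (lebesgue_on \<Omega>) (\<lambda>x. g' x * \<phi> x)"
      using assms \<phi> by (auto simp: has_weak_deriv_def)
    have l: "locally_integrable \<Omega> f" "locally_integrable \<Omega> g" "locally_integrable \<Omega> f'" "locally_integrable \<Omega> g'"
      using assms by (auto simp: has_weak_deriv_def)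
    show "integral\<^sup>L (lebesgue_on \<Omega>) (\<lambda>x. (a * f x + b * g x) * (deriv ^^ k) \<phi> x) =
        (- 1) ^ k * integral\<^sup>L (lebesgue_on \<Omega>) (\<lambda>x. (a * f' x + b * g' x) * \<phi> x)"
      unfolding int[OF l(1,2) \<psi>] int[OF l(3,4) \<phi>] A by (simp only: ring_distribs mult.left_commute)
  qed (use assms in \<open>auto simp: has_weak_deriv_def intro!: loc\<close>)
qed

text \<open>The difference of two weak derivatives annihilates all test functions.\<close>

lemma weak_deriv_unique:
  assumes "has_weak_deriv \<Omega> k f g" "has_weak_deriv \<Omega> k f g'"
  shows "AE x in lebesgue_on \<Omega>. g x = g' x"
proof -
  have wd: "has_weak_deriv \<Omega> k (\<lambda>x. 1 * f x + (-1) * f x) (\<lambda>x. 1 * g x + (-1) * g' x)"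
    by (rule has_weak_deriv_comb[OF assms])
  have "AE x in lebesgue_on \<Omega>. 1 * g x + (-1) * g' x = 0"
  proof (rule fundamental_lemma)
    show "locally_integrable \<Omega> (\<lambda>x. 1 * g x + (-1) * g' x)" using wd by (simp add: has_weak_deriv_def)
    fix \<phi> assume "\<phi> \<in> test_functions \<Omega>"
    then show "integral\<^sup>L (lebesgue_on \<Omega>) (\<lambda>x. (1 * g x + (-1) * g' x) * \<phi> x) = 0"
      using wd by (simp add: has_weak_deriv_def)
  qed
  then show ?thesis by eventually_elim simp
qed

lemma locally_integrable_AE:
  assumes f: "locally_integrable \<Omega> f" and eq: "AE x in lebesgue_on \<Omega>. f x = g x"
  shows "locally_integrable \<Omega> g"
  unfolding locally_integrable_def
proof (intro allI impI)
  fix K assume K: "compact K \<and> K \<subseteq> \<Omega>"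
  then have "K \<in> sets lebesgue" by (auto simp: compact_imp_closed borel_closed)
  moreover have "AE x in lebesgue_on K. f x = g x"
  proof -
    have "AE x in lebesgue. x \<in> \<Omega> \<longrightarrow> f x = g x" using eq by (simp add: AE_restrict_space_iff)
    then have "AE x in lebesgue. x \<in> K \<longrightarrow> f x = g x" by eventually_elim (use K in blast)
    then show ?thesis using \<open>K \<in> sets lebesgue\<close> by (simp add: AE_restrict_space_iff)
  qed
  ultimately show "integrable (lebesgue_on K) g"
    using f K by (intro integrable_lebesgue_on_AE[of K f g]) (auto simp: locally_integrable_def)
qed

lemma test_integral_AE:
  assumes f: "locally_integrable \<Omega> f" and eq: "AE x in lebesgue_on \<Omega>. f x = g x" and \<phi>: "\<phi> \<in> test_functions \<Omega>"
  shows "integral\<^sup>L (lebesgue_on \<Omega>) (\<lambda>x. f x * \<phi> x) = integral\<^sup>L (lebesgue_on \<Omega>) (\<lambda>x. g x * \<phi> x)"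
proof (rule integral_cong_AE)
  show "AE x in lebesgue_on \<Omega>. f x * \<phi> x = g x * \<phi> x" using eq by eventually_elim simp
qed (use test_integrable[OF f \<phi>] test_integrable[OF locally_integrable_AE[OF f eq] \<phi>] in \<open>auto dest: borel_measurable_integrable\<close>)

lemma has_weak_deriv_AE:
  assumes wd: "has_weak_deriv \<Omega> k f g" and ff': "AE x in lebesgue_on \<Omega>. f x = f' x" and gg': "AE x in lebesgue_on \<Omega>. g x = g' x"
  shows "has_weak_deriv \<Omega> k f' g'"
  using wd locally_integrable_AE[OF _ ff'] locally_integrable_AE[OF _ gg']
    test_integral_AE[OF _ ff' test_functions_deriv_iter] test_integral_AE[OF _ gg']
  unfolding has_weak_deriv_def by auto

lemma has_weak_deriv_0: "locally_integrable \<Omega> f \<Longrightarrow> has_weak_deriv \<Omega> 0 f f"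
  by (simp add: has_weak_deriv_def)

lemma has_weak_deriv_wderiv: "has_weak_deriv \<Omega> k f g \<Longrightarrow> has_weak_deriv \<Omega> k f (wderiv \<Omega> k f)"
  unfolding wderiv_def by (rule someI[of "has_weak_deriv \<Omega> k f"])

lemma wderiv_AE: "has_weak_deriv \<Omega> k f g \<Longrightarrow> AE x in lebesgue_on \<Omega>. wderiv \<Omega> k f x = g x"
  using weak_deriv_unique has_weak_deriv_wderiv by blast

lemma H_wderiv:
  assumes "f \<in> H_space \<Omega> m" "k \<le> m"
  shows "has_weak_deriv \<Omega> k f (wderiv \<Omega> k f)" "wderiv \<Omega> k f \<in> L2_space \<Omega>"
proof -
  obtain g where g: "g \<in> L2_space \<Omega>" "has_weak_deriv \<Omega> k f g" using assms by (auto simp: H_space_def)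
  show "has_weak_deriv \<Omega> k f (wderiv \<Omega> k f)" by (rule has_weak_deriv_wderiv[OF g(2)])
  have "AE x in lebesgue_on \<Omega>. g x = wderiv \<Omega> k f x" using wderiv_AE[OF g(2)] by eventually_elim simp
  then show "wderiv \<Omega> k f \<in> L2_space \<Omega>" by (rule L2_AE[OF g(1)])
qed

lemma H_L2: "f \<in> H_space \<Omega> m \<Longrightarrow> f \<in> L2_space \<Omega>"
  by (simp add: H_space_def)

text \<open>Even for order 0 the choice in \<open>wderiv\<close> returns only some representative,
  so the first term of \<open>H_norm\<close> has to be linked to \<open>f\<close> in this
  way.\<close>

lemma wderiv_0_AE: "f \<in> L2_space \<Omega> \<Longrightarrow> AE x in lebesgue_on \<Omega>. wderiv \<Omega> 0 f x = f x"
  by (intro wderiv_AE has_weak_deriv_0 L2_locally_integrable)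

lemma H_comb:
  assumes "f \<in> H_space \<Omega> m" "g \<in> H_space \<Omega> m"
  shows "(\<lambda>x. a * f x + b * g x) \<in> H_space \<Omega> m"
proof -
  have "\<exists>h\<in>L2_space \<Omega>. has_weak_deriv \<Omega> k (\<lambda>x. a * f x + b * g x) h" if "k \<le> m" for k
    using has_weak_deriv_comb[OF H_wderiv(1)[OF assms(1) that] H_wderiv(1)[OF assms(2) that], of a b]
      L2_comb[OF H_wderiv(2)[OF assms(1) that] H_wderiv(2)[OF assms(2) that], of a b] by blast
  then show ?thesis using assms L2_comb by (simp add: H_space_def)
qed

lemma wderiv_comb:
  assumes "f \<in> H_space \<Omega> m" "g \<in> H_space \<Omega> m" "k \<le> m"
  shows "AE x in lebesgue_on \<Omega>. wderiv \<Omega> k (\<lambda>x. a * f x + b * g x) x = a * wderiv \<Omega> k f x + b * wderiv \<Omega> k g x"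
  by (intro wderiv_AE has_weak_deriv_comb H_wderiv(1)[of f m] H_wderiv(1)[of g m] assms)

definition H_inner :: "nat \<Rightarrow> (real \<Rightarrow> real) \<Rightarrow> (real \<Rightarrow> real) \<Rightarrow> real" where
  "H_inner m f g = (\<Sum>k\<le>m. L2_inner (wderiv \<Omega> k f) (wderiv \<Omega> k g))"

lemma L2_inner_AE:
  assumes f: "f \<in> L2_space \<Omega>" and h: "h \<in> L2_space \<Omega>" and eq: "AE x in lebesgue_on \<Omega>. f x = g x"
  shows "L2_inner f h = L2_inner g h"
  unfolding L2_inner_def
proof (rule integral_cong_AE)
  show "AE x in lebesgue_on \<Omega>. f x * h x = g x * h x" using eq by eventually_elim simp
qed (use L2_integrable_mult[OF f h] L2_integrable_mult[OF L2_AE[OF f eq] h] in \<open>auto dest: borel_measurable_integrable\<close>)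

lemma H_prehilbert: "function_prehilbert (H_space \<Omega> m) (H_inner m) (H_norm \<Omega> m)"
proof
  have "has_weak_deriv \<Omega> k (\<lambda>x. 0) (\<lambda>x. 0)" for k
    by (simp add: has_weak_deriv_def locally_integrable_def)
  then show "(\<lambda>x. 0) \<in> H_space \<Omega> m"
    using L2.zero_in by (auto simp: H_space_def)
next
  fix f g :: "real \<Rightarrow> real" and a b assume fg: "f \<in> H_space \<Omega> m" "g \<in> H_space \<Omega> m"
  then show "(\<lambda>x. a * f x + b * g x) \<in> H_space \<Omega> m" by (rule H_comb)
  show "H_inner m f g = H_inner m g f" by (simp add: H_inner_def L2_inner_def mult.commute)
  fix h assume h: "h \<in> H_space \<Omega> m"
  have "L2_inner (wderiv \<Omega> k (\<lambda>x. a * f x + b * g x)) (wderiv \<Omega> k h)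
      = a * L2_inner (wderiv \<Omega> k f) (wderiv \<Omega> k h) + b * L2_inner (wderiv \<Omega> k g) (wderiv \<Omega> k h)" if k: "k \<le> m" for k
    unfolding L2_inner_AE[OF H_wderiv(2)[OF H_comb[OF fg] k] H_wderiv(2)[OF h k] wderiv_comb[OF fg k]]
    by (rule L2.B_comb[OF H_wderiv(2)[OF fg(1) k] H_wderiv(2)[OF fg(2) k] H_wderiv(2)[OF h k]])
  then show "H_inner m (\<lambda>x. a * f x + b * g x) h = a * H_inner m f h + b * H_inner m g h"
    by (simp add: H_inner_def sum.distrib sum_distrib_left)
next
  fix f show "0 \<le> H_inner m f f" "H_norm \<Omega> m f = sqrt (H_inner m f f)"
    by (simp_all add: H_inner_def H_norm_def L2_inner_def power2_eq_square sum_nonneg)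
qed

sublocale H: function_prehilbert "H_space \<Omega> m" "H_inner m" "H_norm \<Omega> m" for m
  by (rule H_prehilbert)

lemma H_norm_power2: "(H_norm \<Omega> m f)\<^sup>2 = (\<Sum>k\<le>m. (L2_norm (wderiv \<Omega> k f))\<^sup>2)"
  by (simp add: H_norm_def L2_norm_power2 sum_nonneg)

lemma L2_norm_nonneg: "0 \<le> L2_norm f"
  by (simp add: L2_norm_def)

lemma H_norm_nonneg: "0 \<le> H_norm \<Omega> m f"
  by (simp add: H_norm_def sum_nonneg)

lemma L2_norm_wderiv_le: "k \<le> m \<Longrightarrow> L2_norm (wderiv \<Omega> k f) \<le> H_norm \<Omega> m f"
  by (rule power2_le_imp_le) (auto simp: H_norm_power2 H_norm_nonneg intro!: member_le_sum[of k "{..m}" "\<lambda>k. (L2_norm (wderiv \<Omega> k f))\<^sup>2"])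

lemma L2_norm_le_H_norm: "f \<in> L2_space \<Omega> \<Longrightarrow> L2_norm f \<le> H_norm \<Omega> m f"
proof -
  assume f: "f \<in> L2_space \<Omega>"
  have "AE x in lebesgue_on \<Omega>. f x = wderiv \<Omega> 0 f x" using wderiv_0_AE[OF f] by eventually_elim simp
  from L2_norm_AE[OF f this] show ?thesis using L2_norm_wderiv_le[of 0 m f] by simp
qed

lemma test_L2: "\<phi> \<in> test_functions \<Omega> \<Longrightarrow> \<phi> \<in> L2_space \<Omega>"
proof -
  assume \<phi>: "\<phi> \<in> test_functions \<Omega>"
  have "locally_integrable \<Omega> \<phi>"
    unfolding locally_integrable_def
  proof (intro allI impI)
    fix K assume K: "compact K \<and> K \<subseteq> \<Omega>"
    obtain C where "\<forall>x. \<bar>\<phi> x\<bar> \<le> C" using test_bounded[OF \<phi>] by blast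
    moreover have "finite_measure (lebesgue_on K)" using K by (intro finite_measure_lebesgue_on lmeasurable_compact) simp
    ultimately show "integrable (lebesgue_on K) \<phi>"
      by (intro finite_measure.integrable_const_bound[where B = C]) (use test_measurable[OF \<phi>] in auto)
  qed
  from test_integrable[OF this \<phi>] show ?thesis
    using test_measurable[OF \<phi>] by (simp add: L2_space_def power2_eq_square)
qed

text \<open>Weak differentiation is closed: the derivatives of each order converge in L^2
  separately, and both sides of the defining identity are L^2 pairings with test functions, hence
  continuous.\<close>

lemma H_complete:
  assumes F: "\<And>n::nat. F n \<in> H_space \<Omega> m"
    and Cauchy: "\<And>e. e > 0 \<Longrightarrow> \<exists>M. \<forall>i\<ge>M. \<forall>n\<ge>M. H_norm \<Omega> m (\<lambda>x. F i x - F n x) < e"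
  shows "\<exists>f\<in>H_space \<Omega> m. (\<lambda>n. H_norm \<Omega> m (\<lambda>x. F n x - f x)) \<longlonglongrightarrow> 0"
proof -
  have D_diff: "AE x in lebesgue_on \<Omega>. wderiv \<Omega> k (\<lambda>x. p x - q x) x = wderiv \<Omega> k p x - wderiv \<Omega> k q x"
    if "p \<in> H_space \<Omega> m" "q \<in> H_space \<Omega> m" "k \<le> m" for p q k
    using wderiv_comb[OF that, of 1 "-1"] by simp
  have "\<exists>g. g \<in> L2_space \<Omega> \<and> (\<lambda>n. L2_norm (\<lambda>x. wderiv \<Omega> k (F n) x - g x)) \<longlonglongrightarrow> 0" if k: "k \<le> m" for k
  proof -
    have "\<exists>g\<in>L2_space \<Omega>. (\<lambda>n. L2_norm (\<lambda>x. wderiv \<Omega> k (F n) x - g x)) \<longlonglongrightarrow> 0"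
    proof (rule L2_complete)
      show "wderiv \<Omega> k (F n) \<in> L2_space \<Omega>" for n by (rule H_wderiv(2)[OF F k])
      fix e :: real assume "e > 0"
      then obtain M where M: "\<forall>i\<ge>M. \<forall>n\<ge>M. H_norm \<Omega> m (\<lambda>x. F i x - F n x) < e" using Cauchy by blast
      have "L2_norm (\<lambda>x. wderiv \<Omega> k (F i) x - wderiv \<Omega> k (F n) x) < e" if "i \<ge> M" "n \<ge> M" for i n
      proof -
        have "L2_norm (\<lambda>x. wderiv \<Omega> k (F i) x - wderiv \<Omega> k (F n) x) = L2_norm (wderiv \<Omega> k (\<lambda>x. F i x - F n x))"
          by (rule L2_norm_AE[OF H_wderiv(2)[OF H.diff_in[OF F F] k] D_diff[OF F F k], symmetric])
        also have "\<dots> \<le> H_norm \<Omega> m (\<lambda>x. F i x - F n x)" by (rule L2_norm_wderiv_le[OF k])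
        also have "\<dots> < e" using M that by blast
        finally show ?thesis .
      qed
      then show "\<exists>M. \<forall>i\<ge>M. \<forall>n\<ge>M. L2_norm (\<lambda>x. wderiv \<Omega> k (F i) x - wderiv \<Omega> k (F n) x) < e" by blast
    qed
    then show ?thesis by blast
  qed
  then have "\<forall>k\<in>{..m}. \<exists>g. g \<in> L2_space \<Omega> \<and> (\<lambda>n. L2_norm (\<lambda>x. wderiv \<Omega> k (F n) x - g x)) \<longlonglongrightarrow> 0"
    by simp
  from bchoice[OF this] obtain g
    where "\<forall>k\<in>{..m}. g k \<in> L2_space \<Omega> \<and> (\<lambda>n. L2_norm (\<lambda>x. wderiv \<Omega> k (F n) x - g k x)) \<longlonglongrightarrow> 0"
    by blast
  then have g: "g k \<in> L2_space \<Omega>"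
    and lim: "(\<lambda>n. L2_norm (\<lambda>x. wderiv \<Omega> k (F n) x - g k x)) \<longlonglongrightarrow> 0" if "k \<le> m" for k
    using that by simp_all
  \<comment> \<open>The limit of the derivatives of order 0 is the candidate; it is compared with
    \<open>F n\<close> through \<open>wderiv_0_AE\<close>.\<close>
  define f where "f = g 0"
  have f: "f \<in> L2_space \<Omega>" using g by (simp add: f_def)
  have conv: "(\<lambda>n. L2_inner (wderiv \<Omega> k (F n)) \<phi>) \<longlonglongrightarrow> L2_inner (g k) \<phi>" if "k \<le> m" "\<phi> \<in> test_functions \<Omega>" for k \<phi>
    by (rule L2.dual_tendsto[OF L2.B_in_dual[OF test_L2[OF that(2)]] H_wderiv(2)[OF F that(1)] g[OF that(1)] lim[OF that(1)]])
  have wd: "has_weak_deriv \<Omega> k f (g k)" if k: "k \<le> m" for k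
    unfolding has_weak_deriv_def
  proof (intro conjI ballI L2_locally_integrable f g k)
    fix \<phi> assume \<phi>: "\<phi> \<in> test_functions \<Omega>"
    note \<psi> = test_functions_deriv_iter[OF \<phi>, of k]
    have "L2_inner (wderiv \<Omega> 0 (F n)) ((deriv ^^ k) \<phi>) = (-1) ^ k * L2_inner (wderiv \<Omega> k (F n)) \<phi>" for n
    proof -
      have "L2_inner (wderiv \<Omega> 0 (F n)) ((deriv ^^ k) \<phi>) = L2_inner (F n) ((deriv ^^ k) \<phi>)"
        by (rule L2_inner_AE[OF H_wderiv(2)[OF F] test_L2[OF \<psi>] wderiv_0_AE[OF H_L2[OF F]]]) simp
      also have "\<dots> = (-1) ^ k * L2_inner (wderiv \<Omega> k (F n)) \<phi>"
        using H_wderiv(1)[OF F k, of n] \<phi> by (simp add: has_weak_deriv_def L2_inner_def)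
      finally show ?thesis .
    qed
    then have "(\<lambda>n. L2_inner (wderiv \<Omega> 0 (F n)) ((deriv ^^ k) \<phi>)) \<longlonglongrightarrow> (-1) ^ k * L2_inner (g k) \<phi>"
      using tendsto_mult[OF tendsto_const conv[OF k \<phi>]] by simp
    moreover have "(\<lambda>n. L2_inner (wderiv \<Omega> 0 (F n)) ((deriv ^^ k) \<phi>)) \<longlonglongrightarrow> L2_inner f ((deriv ^^ k) \<phi>)"
      unfolding f_def by (rule conv[OF _ \<psi>]) simp
    ultimately have "L2_inner f ((deriv ^^ k) \<phi>) = (-1) ^ k * L2_inner (g k) \<phi>"
      using LIMSEQ_unique by blast
    then show "integral\<^sup>L (lebesgue_on \<Omega>) (\<lambda>x. f x * (deriv ^^ k) \<phi> x) = (- 1) ^ k * integral\<^sup>L (lebesgue_on \<Omega>) (\<lambda>x. g k x * \<phi> x)"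
      by (simp add: L2_inner_def)
  qed
  have fH: "f \<in> H_space \<Omega> m" using f wd g by (auto simp: H_space_def)
  have "(\<lambda>n. H_norm \<Omega> m (\<lambda>x. F n x - f x)) \<longlonglongrightarrow> 0"
  proof -
    have "H_norm \<Omega> m (\<lambda>x. F n x - f x) = sqrt (\<Sum>k\<le>m. (L2_norm (\<lambda>x. wderiv \<Omega> k (F n) x - g k x))\<^sup>2)" for n
    proof -
      have "L2_norm (wderiv \<Omega> k (\<lambda>x. F n x - f x)) = L2_norm (\<lambda>x. wderiv \<Omega> k (F n) x - g k x)" if k: "k \<le> m" for k
      proof (rule L2_norm_AE[OF H_wderiv(2)[OF H.diff_in[OF F fH] k]])
        show "AE x in lebesgue_on \<Omega>. wderiv \<Omega> k (\<lambda>x. F n x - f x) x = wderiv \<Omega> k (F n) x - g k x"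
          using D_diff[OF F fH k, of n] wderiv_AE[OF wd[OF k]] by eventually_elim simp
      qed
      then have "(H_norm \<Omega> m (\<lambda>x. F n x - f x))\<^sup>2 = (\<Sum>k\<le>m. (L2_norm (\<lambda>x. wderiv \<Omega> k (F n) x - g k x))\<^sup>2)"
        by (simp add: H_norm_power2)
      from real_sqrt_unique[OF this H_norm_nonneg] show ?thesis by simp
    qed
    moreover have "(\<lambda>n. sqrt (\<Sum>k\<le>m. (L2_norm (\<lambda>x. wderiv \<Omega> k (F n) x - g k x))\<^sup>2)) \<longlonglongrightarrow> sqrt (\<Sum>k\<le>m. 0\<^sup>2)"
      by (intro tendsto_real_sqrt tendsto_sum tendsto_power lim) simp
    ultimately show ?thesis by simp
  qed
  with fH show ?thesis by blast
qed

text \<open>These functionals are bounded in every \<open>H_norm\<close>, separate functions up to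
  null sets, and depend continuously on time for jointly continuous functions. Rational end points
  make the family countable.\<close>

definition interval_integrals :: "((real \<Rightarrow> real) \<Rightarrow> real) set" where
  "interval_integrals = {\<lambda>f. integral\<^sup>L (lebesgue_on {c..d}) f | c d. c \<in> \<rat> \<and> d \<in> \<rat> \<and> \<alpha> < c \<and> c < d \<and> d < \<beta>}"

lemma interval_integral_bound:
  assumes f: "f \<in> L2_space \<Omega>" and cd: "\<alpha> < c" "c \<le> d" "d < \<beta>"
  shows "\<bar>integral\<^sup>L (lebesgue_on {c..d}) f\<bar> \<le> sqrt (d - c) * L2_norm f"
proof (rule power2_le_imp_le)
  have sub: "{c..d} \<subseteq> \<Omega>" using cd by auto
  have f2: "integrable (lebesgue_on {c..d}) (\<lambda>x. (f x)\<^sup>2)"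
    by (rule integrable_lebesgue_on_subset[OF L2_integrable_power2[OF f] sub]) auto
  have fm: "f \<in> borel_measurable (lebesgue_on {c..d})"
    by (rule measurable_restrict_mono[OF L2_measurable[OF f] sub])
  have "(integral\<^sup>L (lebesgue_on {c..d}) f)\<^sup>2 \<le> measure (lebesgue_on {c..d}) (space (lebesgue_on {c..d})) * (\<integral>x. (f x)\<^sup>2 \<partial>lebesgue_on {c..d})"
    by (intro integral_power2_le finite_measure_lebesgue_on fm f2) simp
  also have "measure (lebesgue_on {c..d}) (space (lebesgue_on {c..d})) = d - c"
    using cd by (simp add: measure_restrict_space)
  also have "(\<integral>x. (f x)\<^sup>2 \<partial>lebesgue_on {c..d}) \<le> (L2_norm f)\<^sup>2"
    unfolding L2_norm_power2
    by (rule integral_mono_lebesgue_on_AE[OF L2_integrable_power2[OF f]]) (use sub in auto)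
  finally show "\<bar>integral\<^sup>L (lebesgue_on {c..d}) f\<bar>\<^sup>2 \<le> (sqrt (d - c) * L2_norm f)\<^sup>2"
    using cd by (simp add: power_mult_distrib mult_left_mono)
qed (use cd in \<open>simp add: L2_norm_nonneg\<close>)

text \<open>For the separation, vanishing interval integrals make \<open>g\<close> zero almost
  everywhere; then 0 is a weak derivative of every order, and all terms of the norm vanish.\<close>

lemma H_separable_hilbert: "separable_function_hilbert (H_space \<Omega> m) (H_inner m) (H_norm \<Omega> m) interval_integrals"
proof (intro separable_function_hilbert.intro function_hilbert.intro H_prehilbert function_hilbert_axioms.intro
    separable_function_hilbert_axioms.intro)
  fix F :: "nat \<Rightarrow> real \<Rightarrow> real"
  assume "\<And>n. F n \<in> H_space \<Omega> m" "\<And>e. 0 < e \<Longrightarrow> \<exists>M. \<forall>i\<ge>M. \<forall>n\<ge>M. H_norm \<Omega> m (\<lambda>x. F i x - F n x) < e"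
  then show "\<exists>f\<in>H_space \<Omega> m. (\<lambda>n. H_norm \<Omega> m (\<lambda>x. F n x - f x)) \<longlonglongrightarrow> 0" by (rule H_complete)
next
  have "interval_integrals \<subseteq> (\<lambda>(c, d) f. integral\<^sup>L (lebesgue_on {c..d}) f) ` (\<rat> \<times> \<rat>)"
    by (auto simp: interval_integrals_def)
  moreover have "countable (\<rat> \<times> \<rat> :: (real \<times> real) set)" by (intro countable_SIGMA countable_rat)
  ultimately show "countable interval_integrals" by (meson countable_image countable_subset)
next
  show "interval_integrals \<subseteq> dual_space (H_space \<Omega> m) (H_norm \<Omega> m)"
  proof
    fix l assume "l \<in> interval_integrals"
    then obtain c d where l: "l = (\<lambda>f. integral\<^sup>L (lebesgue_on {c..d}) f)" and cd: "\<alpha> < c" "c < d" "d < \<beta>"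
      by (auto simp: interval_integrals_def)
    have int: "integrable (lebesgue_on {c..d}) f" if "f \<in> H_space \<Omega> m" for f
      by (rule locally_integrable_Icc[OF L2_locally_integrable[OF H_L2[OF that]]]) (use cd in auto)
    have "\<bar>l f\<bar> \<le> sqrt (d - c) * H_norm \<Omega> m f" if f: "f \<in> H_space \<Omega> m" for f
    proof -
      have "\<bar>l f\<bar> \<le> sqrt (d - c) * L2_norm f"
        unfolding l by (rule interval_integral_bound[OF H_L2[OF f]]) (use cd in auto)
      also have "\<dots> \<le> sqrt (d - c) * H_norm \<Omega> m f"
        by (intro mult_left_mono L2_norm_le_H_norm H_L2[OF f]) (use cd in auto)
      finally show ?thesis .
    qed
    then show "l \<in> dual_space (H_space \<Omega> m) (H_norm \<Omega> m)"
      unfolding dual_space_def using int by (auto simp: l)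
  qed
next
  fix g assume g: "g \<in> H_space \<Omega> m" and zero: "\<And>l. l \<in> interval_integrals \<Longrightarrow> l g = 0"
  have "AE x in lebesgue_on \<Omega>. g x = 0"
  proof (rule AE_\<Omega>_if_AE_Icc)
    fix c d assume cd: "c \<in> \<rat>" "d \<in> \<rat>" "\<alpha> < c" "c < d" "d < \<beta>"
    have z: "integral\<^sup>L (lebesgue_on {c..y}) g = 0" if "c < y" "y < \<beta>" "y \<in> \<rat>" for y
    proof -
      have "(\<lambda>f. integral\<^sup>L (lebesgue_on {c..y}) f) \<in> interval_integrals"
        unfolding interval_integrals_def using cd that by blast
      from zero[OF this] show ?thesis .
    qed
    show "AE x in lebesgue_on {c..d}. g x = 0"
      using cd by (intro AE_zero_if_rational_integrals_zero z locally_integrable_Icc[OF L2_locally_integrable[OF H_L2[OF g]]]) auto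
  qed
  then have g0: "AE x in lebesgue_on \<Omega>. 0 = g x" by eventually_elim simp
  have "has_weak_deriv \<Omega> k g (\<lambda>x. 0)" for k
    by (rule has_weak_deriv_AE[OF _ g0, of k "\<lambda>x. 0"]) (simp_all add: has_weak_deriv_def locally_integrable_def)
  then have D0: "AE x in lebesgue_on \<Omega>. wderiv \<Omega> k g x = 0" for k by (rule wderiv_AE)
  have "L2_norm (wderiv \<Omega> k g) = 0" if "k \<le> m" for k
    using L2_norm_AE[OF H_wderiv(2)[OF g that] D0] by (simp add: L2_norm_def)
  then have "(H_norm \<Omega> m g)\<^sup>2 = 0" by (simp add: H_norm_power2)
  then show "H_norm \<Omega> m g = 0" by simp
qed

sublocale H: separable_function_hilbert "H_space \<Omega> m" "H_inner m" "H_norm \<Omega> m" interval_integrals for m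
  by (rule H_separable_hilbert)

end

section \<open>Sobolev embedding and identification of weak limits\<close>

context bounded_interval
begin

text \<open>With L the length of the interval and G the squared L^2 norm of w', averaging |w(x)|^2
  \<le> 2 |w(y)|^2 + 2 L G over y gives the factor 2/L for the function and 2 L for the derivative;
  their sum serves for both.\<close>

definition sobolev_const :: real where
  "sobolev_const = sqrt (2 / (\<beta> - \<alpha>) + 2 * (\<beta> - \<alpha>))"

lemma sobolev_const_pos: "sobolev_const > 0"
  using \<alpha>_less_\<beta> by (simp add: sobolev_const_def add_pos_pos)

text \<open>Cauchy-Schwarz for the representation of increments in
  \<open>weak_deriv_diff\<close>.\<close>

lemma sobolev_hoelder:
  assumes w: "continuous_on \<Omega> w" and wd: "has_weak_deriv \<Omega> 1 w g" and g: "g \<in> L2_space \<Omega>"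
    and xy: "x \<in> \<Omega>" "y \<in> \<Omega>"
  shows "\<bar>w y - w x\<bar> \<le> sqrt \<bar>y - x\<bar> * L2_norm g"
proof -
  have *: "\<bar>w y - w x\<bar> \<le> sqrt \<bar>y - x\<bar> * L2_norm g" if "x \<le> y" "\<alpha> < x" "y < \<beta>" for x y
    using weak_deriv_diff[OF w wd that(2,1,3)] interval_integral_bound[OF g that(2,1,3)] that by simp
  show ?thesis
    using *[of x y] *[of y x] xy by (cases "x \<le> y") (auto simp: abs_minus_commute)
qed

lemma sobolev_sup:
  assumes w: "continuous_on \<Omega> w" "w \<in> L2_space \<Omega>" and wd: "has_weak_deriv \<Omega> 1 w g" and g: "g \<in> L2_space \<Omega>"
    and x: "x \<in> \<Omega>" and N: "(L2_norm w)\<^sup>2 + (L2_norm g)\<^sup>2 \<le> N\<^sup>2" "0 \<le> N"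
  shows "\<bar>w x\<bar> \<le> sobolev_const * N"
proof (rule power2_le_imp_le)
  define L where "L = \<beta> - \<alpha>"
  have L: "L > 0" using \<alpha>_less_\<beta> by (simp add: L_def)
  define G where "G = (L2_norm g)\<^sup>2"
  define W where "W = (L2_norm w)\<^sup>2"
  have nn: "0 \<le> G" "0 \<le> W" by (simp_all add: G_def W_def)
  have pt: "(w x)\<^sup>2 \<le> 2 * (w y)\<^sup>2 + 2 * (L * G)" if y: "y \<in> \<Omega>" for y
  proof -
    have "sqrt \<bar>y - x\<bar> * L2_norm g \<le> sqrt L * L2_norm g"
      by (intro mult_right_mono real_sqrt_le_mono L2_norm_nonneg) (use x y in \<open>auto simp: L_def\<close>)
    then have "\<bar>w y - w x\<bar> \<le> sqrt L * L2_norm g"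
      using sobolev_hoelder[OF w(1) wd g x y] by linarith
    then have "(w y - w x)\<^sup>2 \<le> (sqrt L * L2_norm g)\<^sup>2"
      using power_mono[of "\<bar>w y - w x\<bar>" "sqrt L * L2_norm g" 2] by simp
    then have "(w y - w x)\<^sup>2 \<le> L * G" using L by (simp add: power_mult_distrib G_def)
    \<comment> \<open>Rearranged, this says that the square of 2 w(y) - w(x) is nonnegative.\<close>
    moreover have "(w x)\<^sup>2 \<le> 2 * (w y)\<^sup>2 + 2 * (w y - w x)\<^sup>2"
      using zero_le_power2[of "2 * w y - w x"] by (simp add: power2_eq_square algebra_simps)
    ultimately show ?thesis by linarith
  qed
  have fin: "integrable (lebesgue_on \<Omega>) (\<lambda>y. c::real)" for c
    using finite_measure.integrable_const[OF finite_measure_\<Omega>] by blast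
  have "L * (w x)\<^sup>2 = (\<integral>y. (w x)\<^sup>2 \<partial>lebesgue_on \<Omega>)"
    using measure_\<Omega> by (simp add: L_def)
  also have "\<dots> \<le> (\<integral>y. 2 * (w y)\<^sup>2 + 2 * (L * G) \<partial>lebesgue_on \<Omega>)"
    using pt fin L2_integrable_power2[OF w(2)] by (intro integral_mono) auto
  also have "\<dots> = 2 * W + L * (2 * (L * G))"
    using fin L2_integrable_power2[OF w(2)] measure_\<Omega> by (simp add: L2_norm_power2 W_def L_def)
  finally have "(w x)\<^sup>2 \<le> (2 * W + L * (2 * (L * G))) / L"
    using L by (simp add: pos_le_divide_eq mult.commute)
  also have "\<dots> = 2 / L * W + 2 * L * G" using L by (simp add: field_simps)
  also have "\<dots> \<le> (2 / L + 2 * L) * (W + G)"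
  proof -
    have "0 \<le> 2 / L * G" "0 \<le> 2 * L * W" using L nn by simp_all
    then show ?thesis by (simp add: ring_distribs)
  qed
  also have "\<dots> \<le> (2 / L + 2 * L) * N\<^sup>2"
    using L N by (intro mult_left_mono) (auto simp: W_def G_def)
  also have "\<dots> = (sobolev_const * N)\<^sup>2"
    using L by (simp add: sobolev_const_def power_mult_distrib flip: L_def)
  finally show "\<bar>w x\<bar>\<^sup>2 \<le> (sobolev_const * N)\<^sup>2" by simp
qed (use sobolev_const_pos N in simp)

lemma continuous_locally_integrable:
  assumes "continuous_on \<Omega> f"
  shows "locally_integrable \<Omega> f"
  unfolding locally_integrable_def
proof (intro allI impI)
  fix K assume K: "compact K \<and> K \<subseteq> \<Omega>"
  then have "continuous_on K f" using assms continuous_on_subset by blast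
  then have "set_integrable lborel K f"
    unfolding set_integrable_def using borel_integrable_compact[of K f] K by simp
  then have "set_integrable lebesgue K f"
    unfolding set_integrable_def by (subst integrable_completion) (auto dest: borel_measurable_integrable)
  then show "integrable (lebesgue_on K) f"
    using K by (simp add: set_integrable_def integrable_restrict_space compact_imp_closed borel_closed)
qed

lemma integration_by_parts_zero:
  fixes f g :: "real \<Rightarrow> real"
  assumes "a \<le> b" and f: "\<And>x. x \<in> {a..b} \<Longrightarrow> (f has_real_derivative f' x) (at x within {a..b})"
    and g: "\<And>x. x \<in> {a..b} \<Longrightarrow> (g has_real_derivative g' x) (at x within {a..b})"
    and cont: "continuous_on {a..b} f'" "continuous_on {a..b} g'" and zero: "g a = 0" "g b = 0"
  shows "integral {a..b} (\<lambda>x. f x * g' x) = - integral {a..b} (\<lambda>x. f' x * g x)"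
proof -
  have fc: "continuous_on {a..b} f" "continuous_on {a..b} g"
    using DERIV_continuous_on[OF f] DERIV_continuous_on[OF g] by blast+
  have "((\<lambda>x. f x * g' x + f' x * g x) has_integral f b * g b - f a * g a) {a..b}"
  proof (rule fundamental_theorem_of_calculus[OF \<open>a \<le> b\<close>])
    fix x assume x: "x \<in> {a..b}"
    show "((\<lambda>x. f x * g x) has_vector_derivative f x * g' x + f' x * g x) (at x within {a..b})"
      using DERIV_mult[OF f[OF x] g[OF x]] unfolding has_real_derivative_iff_has_vector_derivative
      by (simp add: algebra_simps)
  qed
  then have "integral {a..b} (\<lambda>x. f x * g' x + f' x * g x) = 0" using zero by (simp add: integral_unique)
  moreover have "integral {a..b} (\<lambda>x. f x * g' x + f' x * g x) = integral {a..b} (\<lambda>x. f x * g' x) + integral {a..b} (\<lambda>x. f' x * g x)"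
    by (intro Henstock_Kurzweil_Integration.integral_add integrable_continuous_real continuous_on_mult fc cont)
  ultimately show ?thesis by simp
qed

lemma test_vanish:
  assumes "closure {x. \<phi> x \<noteq> (0::real)} \<subseteq> T" "x \<notin> T"
  shows "\<phi> x = 0"
  using assms closure_subset[of "{x. \<phi> x \<noteq> 0}"] by blast

text \<open>Connects classical derivatives, which the solutions have, with the arbitrary choices
  made by \<open>wderiv\<close>.\<close>

lemma classical_weak_deriv:
  assumes f': "continuous_on \<Omega> f'" and D: "\<And>x. x \<in> \<Omega> \<Longrightarrow> (f has_real_derivative f' x) (at x)"
  shows "has_weak_deriv \<Omega> 1 f f'"
proof -
  have f: "continuous_on \<Omega> f"
    using D by (meson DERIV_isCont continuous_at_imp_continuous_on)
  have "integral\<^sup>L (lebesgue_on \<Omega>) (\<lambda>x. f x * deriv \<phi> x) = - integral\<^sup>L (lebesgue_on \<Omega>) (\<lambda>x. f' x * \<phi> x)"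
    if \<phi>: "\<phi> \<in> test_functions \<Omega>" for \<phi>
  proof -
    obtain c d where cd: "\<alpha> < c" "c < d" "d < \<beta>" and supp: "closure {x. \<phi> x \<noteq> 0} \<subseteq> {c<..<d}"
      using test_functionsD(2)[OF \<phi>] by blast
    have dphi: "(\<phi> has_real_derivative deriv \<phi> x) (at x)" for x
      by (rule smooth_deriv(1)[OF test_functionsD(1)[OF \<phi>]])
    have dcont: "continuous_on T (deriv \<phi>)" for T
      by (rule smooth_continuous[OF smooth_deriv(2)[OF test_functionsD(1)[OF \<phi>]]])
    have z: "\<phi> x = 0" if "x \<notin> {c<..<d}" for x using test_vanish[OF supp that] .
    have dz: "deriv \<phi> x = 0" if x: "x \<notin> {c..d}" for x
    proof -
      have "\<forall>\<^sub>F y in nhds x. y \<in> - {c..d}" using x by (intro eventually_nhds_in_open) auto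
      then have "\<forall>\<^sub>F y in nhds x. \<phi> y = 0" by (rule eventually_mono) (use z in auto)
      then have "deriv \<phi> x = deriv (\<lambda>_. 0) x" by (rule deriv_cong_ev) simp
      then show ?thesis by simp
    qed
    have sub: "{c..d} \<subseteq> \<Omega>" using cd by auto
    have c1: "continuous_on {c..d} f" "continuous_on {c..d} f'" using f f' sub continuous_on_subset by blast+
    have c2: "continuous_on {c..d} \<phi>" by (rule smooth_continuous[OF test_functionsD(1)[OF \<phi>]])
    have "integral\<^sup>L (lebesgue_on \<Omega>) (\<lambda>x. f x * deriv \<phi> x) = integral\<^sup>L (lebesgue_on {c..d}) (\<lambda>x. f x * deriv \<phi> x)"
      by (rule integral_lebesgue_on_superset) (use sub dz in auto)
    also have "\<dots> = integral {c..d} (\<lambda>x. f x * deriv \<phi> x)"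
      by (intro integrable_continuous_lebesgue_on(2) continuous_on_mult c1 dcont)
    also have "\<dots> = - integral {c..d} (\<lambda>x. f' x * \<phi> x)"
    proof (rule integration_by_parts_zero)
      show "(f has_real_derivative f' x) (at x within {c..d})" if "x \<in> {c..d}" for x
        by (rule has_field_derivative_at_within[OF D]) (use that sub in blast)
      show "(\<phi> has_real_derivative deriv \<phi> x) (at x within {c..d})" for x
        by (rule has_field_derivative_at_within[OF dphi])
    qed (use cd c1 dcont z in auto)
    also have "integral {c..d} (\<lambda>x. f' x * \<phi> x) = integral\<^sup>L (lebesgue_on {c..d}) (\<lambda>x. f' x * \<phi> x)"
      by (intro integrable_continuous_lebesgue_on(2)[symmetric] continuous_on_mult c1 c2)
    also have "\<dots> = integral\<^sup>L (lebesgue_on \<Omega>) (\<lambda>x. f' x * \<phi> x)"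
      by (rule integral_lebesgue_on_superset[symmetric]) (use sub z in auto)
    finally show ?thesis .
  qed
  then show ?thesis
    using continuous_locally_integrable[OF f] continuous_locally_integrable[OF f'] by (simp add: has_weak_deriv_def)
qed

text \<open>In \<open>H_space\<close> the second derivative is tested against second derivatives of
  test functions. Inserting derivatives of test functions into the first-order identity shows that
  it is the derivative of the first one, so that the Sobolev bounds apply to that one as
  well.\<close>

lemma has_weak_deriv_2_1:
  assumes "has_weak_deriv \<Omega> 1 f f'" "has_weak_deriv \<Omega> 2 f g"
  shows "has_weak_deriv \<Omega> 1 f' g"
  unfolding has_weak_deriv_def
proof (intro conjI ballI)
  fix \<phi> assume \<phi>: "\<phi> \<in> test_functions \<Omega>"
  have "integral\<^sup>L (lebesgue_on \<Omega>) (\<lambda>x. f x * deriv (deriv \<phi>) x) = - integral\<^sup>L (lebesgue_on \<Omega>) (\<lambda>x. f' x * deriv \<phi> x)"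
    using assms(1) test_functions_deriv[OF \<phi>] by (simp add: has_weak_deriv_def)
  moreover have "integral\<^sup>L (lebesgue_on \<Omega>) (\<lambda>x. f x * deriv (deriv \<phi>) x) = integral\<^sup>L (lebesgue_on \<Omega>) (\<lambda>x. g x * \<phi> x)"
    using assms(2) \<phi> by (simp add: has_weak_deriv_def numeral_2_eq_2)
  ultimately show "integral\<^sup>L (lebesgue_on \<Omega>) (\<lambda>x. f' x * (deriv ^^ 1) \<phi> x) = (- 1) ^ 1 * integral\<^sup>L (lebesgue_on \<Omega>) (\<lambda>x. g x * \<phi> x)"
    by simp
qed (use assms in \<open>auto simp: has_weak_deriv_def\<close>)

text \<open>\<open>sobolev_sup\<close> for \<open>f\<close> and for its derivative,
  \<open>sobolev_hoelder\<close> for the last bound. The classical derivative is part of the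
  hypotheses so that the bounds hold at every point and not just for some representative.\<close>

lemma H2_C1_bounds:
  assumes f: "f \<in> H_space \<Omega> 2" and f': "continuous_on \<Omega> f'" and D: "\<And>x. x \<in> \<Omega> \<Longrightarrow> (f has_real_derivative f' x) (at x)"
    and N: "H_norm \<Omega> 2 f \<le> N"
  shows "x \<in> \<Omega> \<Longrightarrow> \<bar>f x\<bar> \<le> sobolev_const * N" "x \<in> \<Omega> \<Longrightarrow> \<bar>f' x\<bar> \<le> sobolev_const * N"
    "x \<in> \<Omega> \<Longrightarrow> y \<in> \<Omega> \<Longrightarrow> \<bar>f' y - f' x\<bar> \<le> sqrt \<bar>y - x\<bar> * N"
proof -
  have fc: "continuous_on \<Omega> f"
    using D by (meson DERIV_isCont continuous_at_imp_continuous_on)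
  have wd1: "has_weak_deriv \<Omega> 1 f f'" by (rule classical_weak_deriv[OF f' D])
  let ?f1 = "wderiv \<Omega> 1 f" and ?f2 = "wderiv \<Omega> 2 f"
  have f1: "AE x in lebesgue_on \<Omega>. ?f1 x = f' x" by (rule wderiv_AE[OF wd1])
  have L2: "?f1 \<in> L2_space \<Omega>" "?f2 \<in> L2_space \<Omega>" using H_wderiv(2)[OF f] by auto
  have f'_L2: "f' \<in> L2_space \<Omega>" by (rule L2_AE[OF L2(1) f1])
  have eq1: "L2_norm f' = L2_norm ?f1" using L2_norm_AE[OF L2(1) f1] by simp
  have "AE x in lebesgue_on \<Omega>. f x = wderiv \<Omega> 0 f x" using wderiv_0_AE[OF H_L2[OF f]] by eventually_elim simp
  from L2_norm_AE[OF H_L2[OF f] this] have eq0: "L2_norm f = L2_norm (wderiv \<Omega> 0 f)" .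
  have wd2: "has_weak_deriv \<Omega> 1 f' ?f2" using has_weak_deriv_2_1[OF wd1] H_wderiv(1)[OF f, of 2] by simp
  have "(L2_norm f)\<^sup>2 + (L2_norm f')\<^sup>2 + (L2_norm ?f2)\<^sup>2 = (H_norm \<Omega> 2 f)\<^sup>2"
  proof -
    have "{..2::nat} = {0, 1, 2}" by auto
    then show ?thesis by (simp add: H_norm_power2 eq0 eq1)
  qed
  also have "\<dots> \<le> N\<^sup>2" using N H_norm_nonneg by (intro power_mono)
  finally have le: "(L2_norm f)\<^sup>2 + (L2_norm f')\<^sup>2 + (L2_norm ?f2)\<^sup>2 \<le> N\<^sup>2" .
  have N0: "0 \<le> N" using N H_norm_nonneg order_trans by blast
  have le1: "(L2_norm f)\<^sup>2 + (L2_norm f')\<^sup>2 \<le> N\<^sup>2" "(L2_norm f')\<^sup>2 + (L2_norm ?f2)\<^sup>2 \<le> N\<^sup>2"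
    using le zero_le_power2[of "L2_norm f"] zero_le_power2[of "L2_norm ?f2"] by linarith+
  show "x \<in> \<Omega> \<Longrightarrow> \<bar>f x\<bar> \<le> sobolev_const * N"
    by (rule sobolev_sup[OF fc H_L2[OF f] wd1 f'_L2 _ le1(1) N0])
  show "x \<in> \<Omega> \<Longrightarrow> \<bar>f' x\<bar> \<le> sobolev_const * N"
    by (rule sobolev_sup[OF f' f'_L2 wd2 L2(2) _ le1(2) N0])
  show "\<bar>f' y - f' x\<bar> \<le> sqrt \<bar>y - x\<bar> * N" if "x \<in> \<Omega>" "y \<in> \<Omega>"
  proof -
    have "L2_norm ?f2 \<le> N" using L2_norm_wderiv_le[of 2 2 f] N by simp
    then show ?thesis
      using sobolev_hoelder[OF f' wd2 L2(2) that] mult_left_mono[of "L2_norm ?f2" N "sqrt \<bar>y - x\<bar>"] by simp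
  qed
qed

text \<open>Transport between representatives. The weak derivatives of \<open>f\<close> also serve
  \<open>g\<close>, and separation by \<open>interval_integrals\<close> shows that the difference is
  null in the seminorm.\<close>

lemma H_AE:
  assumes f: "f \<in> H_space \<Omega> m" and eq: "AE x in lebesgue_on \<Omega>. f x = g x"
  shows "g \<in> H_space \<Omega> m" "H_norm \<Omega> m (\<lambda>x. f x - g x) = 0" "H_norm \<Omega> m g = H_norm \<Omega> m f"
proof -
  have wd: "has_weak_deriv \<Omega> k g (wderiv \<Omega> k f)" if "k \<le> m" for k
    by (rule has_weak_deriv_AE[OF H_wderiv(1)[OF f that] eq]) simp
  show g: "g \<in> H_space \<Omega> m"
    using L2_AE[OF H_L2[OF f] eq] wd H_wderiv(2)[OF f] by (auto simp: H_space_def)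
  have z: "AE x in lebesgue_on \<Omega>. f x - g x = 0" using eq by eventually_elim simp
  show "H_norm \<Omega> m (\<lambda>x. f x - g x) = 0"
  proof (rule H.L_separating[OF H.diff_in[OF f g]])
    fix l assume "l \<in> interval_integrals"
    then obtain c d where l: "l = (\<lambda>f. integral\<^sup>L (lebesgue_on {c..d}) f)" and cd: "\<alpha> < c" "c < d" "d < \<beta>"
      by (auto simp: interval_integrals_def)
    have int: "integrable (lebesgue_on {c..d}) (\<lambda>x. f x - g x)"
      by (rule locally_integrable_Icc[OF L2_locally_integrable[OF H_L2[OF H.diff_in[OF f g]]]]) (use cd in auto)
    have "AE x in lebesgue. x \<in> \<Omega> \<longrightarrow> f x - g x = 0" using z by (simp add: AE_restrict_space_iff)
    then have "AE x in lebesgue. x \<in> {c..d} \<longrightarrow> f x - g x = 0" by eventually_elim (use cd in auto)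
    then have "AE x in lebesgue_on {c..d}. f x - g x = 0" by (simp add: AE_restrict_space_iff)
    then have "integral\<^sup>L (lebesgue_on {c..d}) (\<lambda>x. f x - g x) = integral\<^sup>L (lebesgue_on {c..d}) (\<lambda>x. 0)"
      using int by (intro integral_cong_AE) auto
    then show "l (\<lambda>x. f x - g x) = 0" by (simp add: l)
  qed
  then show "H_norm \<Omega> m g = H_norm \<Omega> m f"
    using H.N_le_add_diff[OF f g] H.N_le_add_diff[OF g f] H.N_diff_commute[OF f g] by simp
qed

text \<open>Bounded pointwise convergence gives convergence of all interval integrals, hence a weak
  limit \<open>g0\<close> by \<open>H.weak_limit\<close>. It has the same interval integrals as
  \<open>g\<close>, so both agree almost everywhere; the regularity of \<open>g\<close> is a
  consequence.\<close>

lemma H_weak_limit_pointwise: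
  assumes F: "\<And>n::nat. F n \<in> H_space \<Omega> m" and K: "\<And>n. H_norm \<Omega> m (F n) \<le> K"
    and C: "\<And>n x. x \<in> \<Omega> \<Longrightarrow> \<bar>F n x\<bar> \<le> C" and lim: "\<And>x. x \<in> \<Omega> \<Longrightarrow> (\<lambda>n. F n x) \<longlonglongrightarrow> g x"
  shows "weakly_converges (H_space \<Omega> m) (H_norm \<Omega> m) F g" "H_norm \<Omega> m g \<le> K"
proof -
  have Fm: "F n \<in> borel_measurable (lebesgue_on {c..d})" if "{c..d} \<subseteq> \<Omega>" for n c d
    by (rule measurable_restrict_mono[OF L2_measurable[OF H_L2[OF F]] that])
  have dom: "(\<lambda>n. integral\<^sup>L (lebesgue_on {c..d}) (F n)) \<longlonglongrightarrow> integral\<^sup>L (lebesgue_on {c..d}) g"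
    "integrable (lebesgue_on {c..d}) g" if cd: "\<alpha> < c" "d < \<beta>" for c d
  proof -
    have sub: "{c..d} \<subseteq> \<Omega>" using cd by auto
    have gm: "g \<in> borel_measurable (lebesgue_on {c..d})"
      by (rule borel_measurable_LIMSEQ_metric[of F, OF Fm[OF sub]]) (use lim sub in auto)
    have int: "integrable (lebesgue_on {c..d}) (\<lambda>x. C)"
      by (intro finite_measure.integrable_const finite_measure_lebesgue_on) simp
    have AE1: "AE x in lebesgue_on {c..d}. (\<lambda>n. F n x) \<longlonglongrightarrow> g x" by (rule AE_I2) (use lim sub in auto)
    have AE2: "AE x in lebesgue_on {c..d}. norm (F n x) \<le> C" for n by (rule AE_I2) (use C sub in auto)
    show "(\<lambda>n. integral\<^sup>L (lebesgue_on {c..d}) (F n)) \<longlonglongrightarrow> integral\<^sup>L (lebesgue_on {c..d}) g"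
      by (rule integral_dominated_convergence[OF gm Fm[OF sub] int AE1 AE2])
    show "integrable (lebesgue_on {c..d}) g"
      by (rule integrable_dominated_convergence[OF gm Fm[OF sub] int AE1 AE2])
  qed
  have "convergent (\<lambda>n. l (F n))" if "l \<in> interval_integrals" for l
    using that dom(1) unfolding interval_integrals_def convergent_def by blast
  then obtain g0 where g0: "weakly_converges (H_space \<Omega> m) (H_norm \<Omega> m) F g0" and K0: "H_norm \<Omega> m g0 \<le> K"
    using H.weak_limit[OF H.L_dual H.L_separating, of m F K] F K by blast
  have g0H: "g0 \<in> H_space \<Omega> m" using g0 by (simp add: weakly_converges_def)
  have "AE x in lebesgue_on \<Omega>. g0 x - g x = 0"
  proof (rule AE_\<Omega>_if_AE_Icc)
    fix c d assume cd: "c \<in> \<rat>" "d \<in> \<rat>" "\<alpha> < c" "c < d" "d < \<beta>"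
    have int0: "integrable (lebesgue_on {c..y}) g0" if "y < \<beta>" for y
      by (rule locally_integrable_Icc[OF L2_locally_integrable[OF H_L2[OF g0H]] cd(3) that])
    have z: "integral\<^sup>L (lebesgue_on {c..y}) (\<lambda>x. g0 x - g x) = 0" if "c < y" "y < \<beta>" "y \<in> \<rat>" for y
    proof -
      have "(\<lambda>f. integral\<^sup>L (lebesgue_on {c..y}) f) \<in> interval_integrals"
        unfolding interval_integrals_def using cd that by blast
      then have "(\<lambda>f. integral\<^sup>L (lebesgue_on {c..y}) f) \<in> dual_space (H_space \<Omega> m) (H_norm \<Omega> m)"
        using H.L_dual by blast
      then have "(\<lambda>n. integral\<^sup>L (lebesgue_on {c..y}) (F n)) \<longlonglongrightarrow> integral\<^sup>L (lebesgue_on {c..y}) g0"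
        using g0 unfolding weakly_converges_def by fast
      then have "integral\<^sup>L (lebesgue_on {c..y}) g0 = integral\<^sup>L (lebesgue_on {c..y}) g"
        using dom(1)[OF cd(3) that(2)] LIMSEQ_unique by blast
      then show ?thesis using int0[OF that(2)] dom(2)[OF cd(3) that(2)] by simp
    qed
    show "AE x in lebesgue_on {c..d}. g0 x - g x = 0"
      using cd z int0 dom(2) by (intro AE_zero_if_rational_integrals_zero Bochner_Integration.integrable_diff) auto
  qed
  then have eq: "AE x in lebesgue_on \<Omega>. g0 x = g x" by eventually_elim simp
  note g = H_AE[OF g0H eq]
  show "H_norm \<Omega> m g \<le> K" using g(3) K0 by simp
  have l_eq: "l g0 = l g" if "l \<in> dual_space (H_space \<Omega> m) (H_norm \<Omega> m)" for l
    by (rule H.N_eq_dual[OF that g0H g(1,2)])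
  show "weakly_converges (H_space \<Omega> m) (H_norm \<Omega> m) F g"
    unfolding weakly_converges_def
  proof (intro conjI allI ballI F g(1))
    fix l assume l: "l \<in> dual_space (H_space \<Omega> m) (H_norm \<Omega> m)"
    then show "(\<lambda>n. l (F n)) \<longlonglongrightarrow> l g"
      using g0 l_eq[OF l] by (simp only: weakly_converges_def) metis
  qed
qed

end

text \<open>Arzela-Ascoli with a diagonal sequence over a countable dense subset. Only pointwise
  convergence is claimed, so \<open>S\<close> may be noncompact, as the half-strip of times and
  positions is.\<close>

lemma pointwise_convergent_subsequence:
  fixes f :: "nat \<Rightarrow> 'a::{metric_space, second_countable_topology} \<Rightarrow> real"
  assumes bounded: "\<And>p. p \<in> S \<Longrightarrow> \<exists>C. \<forall>n. \<bar>f n p\<bar> \<le> C"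
    and equicont: "\<And>p e. p \<in> S \<Longrightarrow> e > 0 \<Longrightarrow> \<exists>d>0. \<forall>n. \<forall>q\<in>S. dist q p < d \<longrightarrow> \<bar>f n q - f n p\<bar> < e"
  shows "\<exists>r. strict_mono r \<and> (\<forall>p\<in>S. convergent (\<lambda>n. f (r n) p))"
proof (cases "S = {}")
  case True
  then show ?thesis using strict_mono_id by blast
next
  case False
  obtain T where T: "countable T" "T \<subseteq> S" "S \<subseteq> closure T"
    using separable[of S] by blast
  then have "T \<noteq> {}" using False by auto
  then have dT: "from_nat_into T i \<in> T" for i by (rule from_nat_into)
  interpret subseqs "\<lambda>i s. convergent (\<lambda>n. f (s n) (from_nat_into T i))"
  proof
    fix i and s :: "nat \<Rightarrow> nat" assume "strict_mono s"
    obtain C where "\<forall>n. \<bar>f n (from_nat_into T i)\<bar> \<le> C" using bounded dT T(2) by blast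
    then have "bounded (range (\<lambda>n. f (s n) (from_nat_into T i)))"
      by (auto simp: bounded_real)
    then obtain l r where "strict_mono r" "((\<lambda>n. f (s n) (from_nat_into T i)) \<circ> r) \<longlonglongrightarrow> l"
      using bounded_imp_convergent_subsequence by blast
    then show "\<exists>r. strict_mono r \<and> convergent (\<lambda>n. f ((s \<circ> r) n) (from_nat_into T i))"
      by (auto simp: convergent_def o_def)
  qed
  \<comment> \<open>The diagonal sequence is handled as a subsequence of the i-th extracted one from
    index \<open>Suc i\<close> on; the shift is removed afterwards.\<close>
  have conv_T: "convergent (\<lambda>n. f (diagseq n) (from_nat_into T i))" for i
  proof -
    have "convergent (\<lambda>n. f ((diagseq \<circ> (+) (Suc i)) n) (from_nat_into T i))"
    proof (rule diagseq_holds)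
      fix s r :: "nat \<Rightarrow> nat" and k
      assume "strict_mono r" "convergent (\<lambda>n. f (s n) (from_nat_into T k))"
      then show "convergent (\<lambda>n. f ((s \<circ> r) n) (from_nat_into T k))"
        using convergent_subseq_convergent[of "\<lambda>n. f (s n) (from_nat_into T k)" r] by (simp add: o_def)
    qed
    then show ?thesis
      using convergent_ignore_initial_segment[of "\<lambda>n. f (diagseq n) (from_nat_into T i)" "Suc i"]
      by (simp add: o_def add.commute)
  qed
  have "convergent (\<lambda>n. f (diagseq n) p)" if p: "p \<in> S" for p
  proof (rule Cauchy_convergent, rule metric_CauchyI)
    fix e :: real assume "e > 0"
    then obtain d where d: "d > 0" "\<forall>n. \<forall>q\<in>S. dist q p < d \<longrightarrow> \<bar>f n q - f n p\<bar> < e / 3"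
      using equicont[OF p, of "e / 3"] by auto
    obtain q where q: "q \<in> T" "dist q p < d" using T(3) p d(1) closure_approachable[of p T] by blast
    obtain i where i: "from_nat_into T i = q" using from_nat_into_surj[OF T(1) q(1)] by blast
    obtain M where M: "\<forall>m\<ge>M. \<forall>n\<ge>M. dist (f (diagseq m) q) (f (diagseq n) q) < e / 3"
      using metric_CauchyD[OF convergent_Cauchy[OF conv_T[of i]], of "e / 3"] \<open>e > 0\<close> i by auto
    have "dist (f (diagseq m) p) (f (diagseq n) p) < e" if "m \<ge> M" "n \<ge> M" for m n
    proof -
      have "\<bar>f (diagseq m) q - f (diagseq m) p\<bar> < e / 3" "\<bar>f (diagseq n) q - f (diagseq n) p\<bar> < e / 3"
        using d(2) q T(2) by blast+
      moreover have "dist (f (diagseq m) q) (f (diagseq n) q) < e / 3" using M that by blast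
      ultimately show ?thesis unfolding dist_real_def by linarith
    qed
    then show "\<exists>M. \<forall>m\<ge>M. \<forall>n\<ge>M. dist (f (diagseq m) p) (f (diagseq n) p) < e" by blast
  qed
  then show ?thesis using subseq_diagseq by blast
qed

section \<open>Integration over space-time boxes\<close>


text \<open>The time derivative is one-sided at t = 0; the space derivative is two-sided, as the
  space domains that occur are open.\<close>

definition partials :: "real set \<Rightarrow> (real \<times> real \<Rightarrow> real) \<Rightarrow> (real \<times> real \<Rightarrow> real) \<Rightarrow> (real \<times> real \<Rightarrow> real) \<Rightarrow> bool" where
  "partials \<Omega> f ft fx \<longleftrightarrow>
     continuous_on ({0..} \<times> \<Omega>) f \<and> continuous_on ({0..} \<times> \<Omega>) ft \<and> continuous_on ({0..} \<times> \<Omega>) fx \<and>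
     (\<forall>t\<ge>0. \<forall>x\<in>\<Omega>. ((\<lambda>s. f (s, x)) has_real_derivative ft (t, x)) (at t within {0..}) \<and>
        ((\<lambda>y. f (t, y)) has_real_derivative fx (t, x)) (at x))"

lemma C1_spacetime_partials:
  assumes f: "C1_spacetime \<Omega> f" and \<Omega>: "open \<Omega>"
  shows "\<exists>ft fx. partials \<Omega> f ft fx"
proof -
  obtain ft fx where cont: "continuous_on ({0..} \<times> \<Omega>) ft" "continuous_on ({0..} \<times> \<Omega>) fx"
    and D: "\<forall>p\<in>{0..} \<times> \<Omega>. (f has_derivative (\<lambda>h. fst h * ft p + snd h * fx p)) (at p within {0..} \<times> \<Omega>)"
    using f unfolding C1_spacetime_def by blast
  have "continuous_on ({0..} \<times> \<Omega>) f"
    using D by (meson continuous_on_eq_continuous_within has_derivative_continuous)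
  moreover have "((\<lambda>s. f (s, x)) has_real_derivative ft (t, x)) (at t within {0..})"
    and "((\<lambda>y. f (t, y)) has_real_derivative fx (t, x)) (at x)" if tx: "t \<ge> 0" "x \<in> \<Omega>" for t x
  proof -
    have D': "(f has_derivative (\<lambda>h. fst h * ft (t, x) + snd h * fx (t, x))) (at (t, x) within {0..} \<times> \<Omega>)"
      using D tx by auto
    have "((\<lambda>s. f (s, x)) has_derivative (\<lambda>h. fst (h, 0::real) * ft (t, x) + snd (h, 0) * fx (t, x))) (at t within {0..})"
    proof (rule has_derivative_in_compose[where f = "\<lambda>s. (s, x)"])
      show "((\<lambda>s. (s, x)) has_derivative (\<lambda>h. (h, 0))) (at t within {0..})"
        by (auto intro!: derivative_eq_intros)
      show "(f has_derivative (\<lambda>h. fst h * ft (t, x) + snd h * fx (t, x))) (at (t, x) within (\<lambda>s. (s, x)) ` {0..})"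
        by (rule has_derivative_subset[OF D']) (use tx in auto)
    qed
    then show "((\<lambda>s. f (s, x)) has_real_derivative ft (t, x)) (at t within {0..})"
      by (simp add: has_field_derivative_def mult_commute_abs)
    have "((\<lambda>y. f (t, y)) has_derivative (\<lambda>h. fst (0::real, h) * ft (t, x) + snd (0::real, h) * fx (t, x))) (at x within \<Omega>)"
    proof (rule has_derivative_in_compose[where f = "\<lambda>y. (t, y)"])
      show "((\<lambda>y. (t, y)) has_derivative (\<lambda>h. (0, h))) (at x within \<Omega>)"
        by (auto intro!: derivative_eq_intros)
      show "(f has_derivative (\<lambda>h. fst h * ft (t, x) + snd h * fx (t, x))) (at (t, x) within (\<lambda>y. (t, y)) ` \<Omega>)"
        by (rule has_derivative_subset[OF D']) (use tx in auto)
    qed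
    then show "((\<lambda>y. f (t, y)) has_real_derivative fx (t, x)) (at x)"
      using at_within_open[OF tx(2) \<Omega>] by (simp add: has_field_derivative_def mult_commute_abs)
  qed
  ultimately show ?thesis using cont unfolding partials_def by blast
qed

definition time_partial :: "real set \<Rightarrow> (real \<times> real \<Rightarrow> real) \<Rightarrow> real \<times> real \<Rightarrow> real" where
  "time_partial \<Omega> f = (SOME ft. \<exists>fx. partials \<Omega> f ft fx)"

definition space_partial :: "real set \<Rightarrow> (real \<times> real \<Rightarrow> real) \<Rightarrow> real \<times> real \<Rightarrow> real" where
  "space_partial \<Omega> f = (SOME fx. partials \<Omega> f (time_partial \<Omega> f) fx)"

lemma partials_partial:
  assumes "C1_spacetime \<Omega> f" "open \<Omega>"
  shows "partials \<Omega> f (time_partial \<Omega> f) (space_partial \<Omega> f)"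
proof -
  have "\<exists>ft fx. partials \<Omega> f ft fx" by (rule C1_spacetime_partials[OF assms])
  then have "\<exists>fx. partials \<Omega> f (time_partial \<Omega> f) fx" unfolding time_partial_def by (rule someI_ex)
  then show ?thesis unfolding space_partial_def by (rule someI_ex)
qed

text \<open>Iterated Lebesgue integrals, in the shape in which both the weak formulation and
  \<open>H.time_functionals\<close> contain them. For continuous integrands they turn into gauge
  integrals, where interchange of the order and integration by parts are carried out.\<close>

definition box_integral :: "real \<Rightarrow> real \<Rightarrow> real \<Rightarrow> real \<Rightarrow> (real \<times> real \<Rightarrow> real) \<Rightarrow> real" where
  "box_integral s t c d h = (\<integral>r. (\<integral>y. h (r, y) \<partial>lebesgue_on {c..d}) \<partial>lebesgue_on {s..t})"

lemma continuous_on_section: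
  assumes "continuous_on ({s..t} \<times> {c..d}) h"
  shows "r \<in> {s..t} \<Longrightarrow> continuous_on {c..d} (\<lambda>y. h (r, y))" "y \<in> {c..d} \<Longrightarrow> continuous_on {s..t} (\<lambda>r. h (r, y))"
  by (auto intro!: continuous_on_compose2[OF assms] continuous_intros)

lemma continuous_on_integral_section:
  fixes h :: "real \<times> real \<Rightarrow> real"
  assumes "continuous_on (T \<times> {c..d}) h"
  shows "continuous_on T (\<lambda>r. integral {c..d} (\<lambda>y. h (r, y)))"
proof -
  have "continuous_on (T \<times> cbox c d) (\<lambda>(r, y). h (r, y))" using assms by simp
  from integral_continuous_on_param[OF this] show ?thesis by simp
qed

lemma box_integral_HK:
  assumes h: "continuous_on ({s..t} \<times> {c..d}) h"
  shows "box_integral s t c d h = integral {s..t} (\<lambda>r. integral {c..d} (\<lambda>y. h (r, y)))"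
proof -
  have "box_integral s t c d h = (\<integral>r. integral {c..d} (\<lambda>y. h (r, y)) \<partial>lebesgue_on {s..t})"
    unfolding box_integral_def
    by (intro Bochner_Integration.integral_cong integrable_continuous_lebesgue_on(2) continuous_on_section(1)[OF h]) auto
  also have "\<dots> = integral {s..t} (\<lambda>r. integral {c..d} (\<lambda>y. h (r, y)))"
    by (intro integrable_continuous_lebesgue_on(2) continuous_on_integral_section h)
  finally show ?thesis .
qed

lemma box_integral_swap:
  assumes h: "continuous_on ({s..t} \<times> {c..d}) h"
  shows "box_integral s t c d h = integral {c..d} (\<lambda>y. integral {s..t} (\<lambda>r. h (r, y)))"
proof -
  have "continuous_on (cbox (s, c) (t, d)) (\<lambda>(r, y). h (r, y))" using h by (simp add: cbox_Pair_eq)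
  from integral_swap_continuous[OF this] show ?thesis by (simp add: box_integral_HK[OF h])
qed

lemma box_integral_add:
  assumes "continuous_on ({s..t} \<times> {c..d}) f" "continuous_on ({s..t} \<times> {c..d}) g"
  shows "box_integral s t c d (\<lambda>p. f p + g p) = box_integral s t c d f + box_integral s t c d g"
proof -
  have "box_integral s t c d (\<lambda>p. f p + g p) = integral {s..t} (\<lambda>r. integral {c..d} (\<lambda>y. f (r, y) + g (r, y)))"
    by (rule box_integral_HK) (intro continuous_intros assms)
  also have "\<dots> = integral {s..t} (\<lambda>r. integral {c..d} (\<lambda>y. f (r, y)) + integral {c..d} (\<lambda>y. g (r, y)))"
    by (intro Henstock_Kurzweil_Integration.integral_cong Henstock_Kurzweil_Integration.integral_add
        integrable_continuous_real continuous_on_section(1)[OF assms(1)] continuous_on_section(1)[OF assms(2)])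
  also have "\<dots> = integral {s..t} (\<lambda>r. integral {c..d} (\<lambda>y. f (r, y))) + integral {s..t} (\<lambda>r. integral {c..d} (\<lambda>y. g (r, y)))"
    by (intro Henstock_Kurzweil_Integration.integral_add integrable_continuous_real continuous_on_integral_section assms)
  finally show ?thesis by (simp add: box_integral_HK assms)
qed

lemma box_integral_cong:
  assumes "\<And>r y. r \<in> {s..t} \<Longrightarrow> y \<in> {c..d} \<Longrightarrow> f (r, y) = g (r, y)"
  shows "box_integral s t c d f = box_integral s t c d g"
  unfolding box_integral_def using assms by (intro Bochner_Integration.integral_cong) auto

text \<open>Dominated convergence in space and then in time. Nothing is known of \<open>g\<close>
  beyond the pointwise convergence, so measurability of its sections and of its inner integral is
  obtained along the way.\<close>

lemma box_integral_tendsto: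
  assumes h: "\<And>n. continuous_on ({s..t} \<times> {c..d}) (h n)"
    and lim: "\<And>p. p \<in> {s..t} \<times> {c..d} \<Longrightarrow> (\<lambda>n. h n p) \<longlonglongrightarrow> g p"
    and bound: "\<And>n p. p \<in> {s..t} \<times> {c..d} \<Longrightarrow> \<bar>h n p\<bar> \<le> C"
  shows "(\<lambda>n. box_integral s t c d (h n)) \<longlonglongrightarrow> box_integral s t c d g"
proof -
  let ?I = "\<lambda>n r. integral {c..d} (\<lambda>y. h n (r, y))"
  have const: "integrable (lebesgue_on {p..q}) (\<lambda>x. c::real)" for p q c :: real
    by (intro finite_measure.integrable_const finite_measure_lebesgue_on) simp
  have inner_eq: "(\<integral>y. h n (r, y) \<partial>lebesgue_on {c..d}) = ?I n r" if "r \<in> {s..t}" for n r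
    by (intro integrable_continuous_lebesgue_on(2) continuous_on_section(1)[OF h] that)
  have inner: "(\<lambda>n. ?I n r) \<longlonglongrightarrow> (\<integral>y. g (r, y) \<partial>lebesgue_on {c..d})" if r: "r \<in> {s..t}" for r
  proof -
    have hm: "(\<lambda>y. h n (r, y)) \<in> borel_measurable (lebesgue_on {c..d})" for n
      by (intro borel_measurable_integrable integrable_continuous_lebesgue_on(1) continuous_on_section(1)[OF h] r)
    have gm: "(\<lambda>y. g (r, y)) \<in> borel_measurable (lebesgue_on {c..d})"
      by (rule borel_measurable_LIMSEQ_metric[of "\<lambda>n y. h n (r, y)", OF hm]) (use lim r in auto)
    have "(\<lambda>n. \<integral>y. h n (r, y) \<partial>lebesgue_on {c..d}) \<longlonglongrightarrow> (\<integral>y. g (r, y) \<partial>lebesgue_on {c..d})"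
      by (rule integral_dominated_convergence[OF gm hm const[of c d C]]; rule AE_I2) (use lim bound r in auto)
    then show ?thesis using inner_eq[OF r] by simp
  qed
  have inner_bound: "\<bar>?I n r\<bar> \<le> \<bar>C\<bar> * \<bar>d - c\<bar>" if r: "r \<in> {s..t}" for n r
  proof (cases "c \<le> d")
    case True
    have "norm (integral {c..d} (\<lambda>y. h n (r, y))) \<le> integral {c..d} (\<lambda>y. \<bar>C\<bar>)"
      by (intro integral_norm_bound_integral integrable_continuous_real continuous_on_section(1)[OF h] r continuous_on_const)
        (use bound r in \<open>fastforce intro: order_trans\<close>)
    then show ?thesis using True by (simp add: mult.commute)
  qed simp
  have Im: "?I n \<in> borel_measurable (lebesgue_on {s..t})" for n
    by (intro borel_measurable_integrable integrable_continuous_lebesgue_on(1) continuous_on_integral_section h)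
  have Gm: "(\<lambda>r. \<integral>y. g (r, y) \<partial>lebesgue_on {c..d}) \<in> borel_measurable (lebesgue_on {s..t})"
    by (rule borel_measurable_LIMSEQ_metric[of ?I, OF Im]) (use inner in auto)
  have "(\<lambda>n. integral\<^sup>L (lebesgue_on {s..t}) (?I n)) \<longlonglongrightarrow> box_integral s t c d g"
    unfolding box_integral_def
    by (rule integral_dominated_convergence[OF Gm Im const[of s t "\<bar>C\<bar> * \<bar>d - c\<bar>"]]; rule AE_I2)
      (use inner inner_bound in auto)
  moreover have "integral\<^sup>L (lebesgue_on {s..t}) (?I n) = box_integral s t c d (h n)" for n
    unfolding box_integral_def using inner_eq by (intro Bochner_Integration.integral_cong) auto
  ultimately show ?thesis by simp
qed

lemma LINT_eq_box_integral:
  fixes h :: "real \<times> real \<Rightarrow> real"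
  assumes box: "0 < s" "c \<le> d" "{c..d} \<subseteq> \<Omega>" and \<Omega>: "\<Omega> \<in> sets lebesgue"
    and zero: "\<And>p. p \<notin> {s..t} \<times> {c..d} \<Longrightarrow> h p = 0"
  shows "(\<integral>r. (\<integral>y. h (r, y) \<partial>lebesgue_on \<Omega>) \<partial>lebesgue_on {0<..}) = box_integral s t c d h"
proof -
  have "(\<integral>y. h (r, y) \<partial>lebesgue_on \<Omega>) = (\<integral>y. h (r, y) \<partial>lebesgue_on {c..d})" for r
    by (rule integral_lebesgue_on_superset) (use box \<Omega> zero in auto)
  moreover have "(\<integral>r. (\<integral>y. h (r, y) \<partial>lebesgue_on {c..d}) \<partial>lebesgue_on {0<..}) = box_integral s t c d h"
    unfolding box_integral_def
  proof (rule integral_lebesgue_on_superset)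
    show "(\<integral>y. h (r, y) \<partial>lebesgue_on {c..d}) = 0" if "r \<in> {0<..} - {s..t}" for r
    proof -
      have "h (r, y) = 0" for y using zero[of "(r, y)"] that by auto
      then show ?thesis by simp
    qed
  qed (use box in auto)
  ultimately show ?thesis by simp
qed

text \<open>The mixed derivative \<open>\<phi>xt\<close> is included because \<open>S\<close> is
  paired with \<open>\<phi>x\<close>, and integrating the relaxation term by parts in time
  differentiates that weight. Everything vanishes outside an open box, hence on the boundary of the
  closed box of integration.\<close>

definition space_time_test :: "real \<Rightarrow> real \<Rightarrow> real \<Rightarrow> real \<Rightarrow> (real \<times> real \<Rightarrow> real) \<Rightarrow> (real \<times> real \<Rightarrow> real) \<Rightarrow> (real \<times> real \<Rightarrow> real) \<Rightarrow> (real \<times> real \<Rightarrow> real) \<Rightarrow> bool" where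
  "space_time_test s t c d \<phi> \<phi>t \<phi>x \<phi>xt \<longleftrightarrow>
     continuous_on UNIV \<phi> \<and> continuous_on UNIV \<phi>t \<and> continuous_on UNIV \<phi>x \<and> continuous_on UNIV \<phi>xt \<and>
     (\<forall>r y. ((\<lambda>r. \<phi> (r, y)) has_real_derivative \<phi>t (r, y)) (at r) \<and>
       ((\<lambda>y. \<phi> (r, y)) has_real_derivative \<phi>x (r, y)) (at y) \<and>
       ((\<lambda>r. \<phi>x (r, y)) has_real_derivative \<phi>xt (r, y)) (at r)) \<and>
     (\<forall>p. p \<notin> {s<..<t} \<times> {c<..<d} \<longrightarrow> \<phi> p = 0 \<and> \<phi>t p = 0 \<and> \<phi>x p = 0 \<and> \<phi>xt p = 0)"

lemma smooth_partials:
  fixes \<phi> :: "real \<times> real \<Rightarrow> real"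
  assumes "smooth \<phi>"
  shows "\<exists>\<phi>t \<phi>x. smooth \<phi>t \<and> smooth \<phi>x \<and>
    (\<forall>r y. ((\<lambda>r. \<phi> (r, y)) has_real_derivative \<phi>t (r, y)) (at r) \<and> ((\<lambda>y. \<phi> (r, y)) has_real_derivative \<phi>x (r, y)) (at y)) \<and>
    {p. \<phi>t p \<noteq> 0} \<subseteq> closure {p. \<phi> p \<noteq> 0} \<and> {p. \<phi>x p \<noteq> 0} \<subseteq> closure {p. \<phi> p \<noteq> 0}"
proof -
  obtain \<phi>' where D: "\<And>p. (\<phi> has_derivative \<phi>' p) (at p)" and sm: "\<And>h. smooth (\<lambda>p. \<phi>' p h)"
    using smooth_has_derivative[OF assms] by blast
  have lin: "linear (\<phi>' p)" for p by (rule has_derivative_linear[OF D])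
  have "((\<lambda>r. \<phi> (r, y)) has_real_derivative \<phi>' (r, y) (1, 0)) (at r)" for r y
  proof -
    have "((\<lambda>r. (r, y)) has_derivative (\<lambda>h. (h, 0))) (at r)" by (auto intro!: derivative_eq_intros)
    from has_derivative_compose[OF this D] have "((\<lambda>r. \<phi> (r, y)) has_derivative (\<lambda>h. \<phi>' (r, y) (h, 0))) (at r)" .
    moreover have "(\<lambda>h. \<phi>' (r, y) (h, 0)) = (*) (\<phi>' (r, y) (1, 0))"
    proof
      fix h
      have "\<phi>' (r, y) (h, 0) = \<phi>' (r, y) (h *\<^sub>R (1, 0))" by simp
      also have "\<dots> = h *\<^sub>R \<phi>' (r, y) (1, 0)" by (rule linear_scale[OF lin])
      finally show "\<phi>' (r, y) (h, 0) = \<phi>' (r, y) (1, 0) * h" by (simp only: real_scaleR_def mult.commute)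
    qed
    ultimately show ?thesis by (simp only: has_field_derivative_def)
  qed
  moreover have "((\<lambda>y. \<phi> (r, y)) has_real_derivative \<phi>' (r, y) (0, 1)) (at y)" for r y
  proof -
    have "((\<lambda>y. (r, y)) has_derivative (\<lambda>h. (0, h))) (at y)" by (auto intro!: derivative_eq_intros)
    from has_derivative_compose[OF this D] have "((\<lambda>y. \<phi> (r, y)) has_derivative (\<lambda>h. \<phi>' (r, y) (0, h))) (at y)" .
    moreover have "(\<lambda>h. \<phi>' (r, y) (0, h)) = (*) (\<phi>' (r, y) (0, 1))"
    proof
      fix h
      have "\<phi>' (r, y) (0, h) = \<phi>' (r, y) (h *\<^sub>R (0, 1))" by simp
      also have "\<dots> = h *\<^sub>R \<phi>' (r, y) (0, 1)" by (rule linear_scale[OF lin])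
      finally show "\<phi>' (r, y) (0, h) = \<phi>' (r, y) (0, 1) * h" by (simp only: real_scaleR_def mult.commute)
    qed
    ultimately show ?thesis by (simp only: has_field_derivative_def)
  qed
  moreover have "{p. \<phi>' p h \<noteq> 0} \<subseteq> closure {p. \<phi> p \<noteq> 0}" for h
  proof
    fix p assume p: "p \<in> {p. \<phi>' p h \<noteq> 0}"
    show "p \<in> closure {p. \<phi> p \<noteq> 0}"
    proof (rule ccontr)
      assume out: "p \<notin> closure {p. \<phi> p \<noteq> 0}"
      have "(\<phi> has_derivative (\<lambda>h. 0)) (at p)"
      proof (rule has_derivative_transform_within_open[of "\<lambda>_. 0" _ _ _ "- closure {p. \<phi> p \<noteq> 0}"])
        show "0 = \<phi> q" if "q \<in> - closure {p. \<phi> p \<noteq> 0}" for q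
          using that closure_subset[of "{p. \<phi> p \<noteq> 0}"] by auto
      qed (use out in auto)
      then have "\<phi>' p = (\<lambda>h. 0)" using D has_derivative_unique by blast
      then show False using p by simp
    qed
  qed
  ultimately show ?thesis using sm by blast
qed

text \<open>The projections of the compact support to both axes are compact, so they leave room
  inside the open time half-line and the open interval.\<close>

lemma (in bounded_interval) space_time_test_exists:
  assumes \<phi>: "\<phi> \<in> test_functions ({0<..} \<times> \<Omega>)"
  shows "\<exists>s t c d \<phi>t \<phi>x \<phi>xt. 0 < s \<and> s < t \<and> \<alpha> < c \<and> c < d \<and> d < \<beta> \<and> space_time_test s t c d \<phi> \<phi>t \<phi>x \<phi>xt"
proof -
  let ?K = "closure {p. \<phi> p \<noteq> 0}"
  have sm: "smooth \<phi>" and K: "compact ?K" "?K \<subseteq> {0<..} \<times> \<Omega>" using \<phi> by (auto simp: test_functions_def)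
  obtain \<phi>t \<phi>x where 1: "smooth \<phi>t" "smooth \<phi>x"
    "\<And>r y. ((\<lambda>r. \<phi> (r, y)) has_real_derivative \<phi>t (r, y)) (at r)" "\<And>r y. ((\<lambda>y. \<phi> (r, y)) has_real_derivative \<phi>x (r, y)) (at y)"
    "{p. \<phi>t p \<noteq> 0} \<subseteq> ?K" "{p. \<phi>x p \<noteq> 0} \<subseteq> ?K"
    using smooth_partials[OF sm] by blast
  obtain \<phi>xt where 2: "smooth \<phi>xt" "\<And>r y. ((\<lambda>r. \<phi>x (r, y)) has_real_derivative \<phi>xt (r, y)) (at r)"
    "{p. \<phi>xt p \<noteq> 0} \<subseteq> closure {p. \<phi>x p \<noteq> 0}"
    using smooth_partials[OF 1(2)] by blast
  have "closure {p. \<phi>x p \<noteq> 0} \<subseteq> ?K" using 1(6) by (rule closure_minimal) simp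
  with 2(3) have 3: "{p. \<phi>xt p \<noteq> 0} \<subseteq> ?K" by blast
  have bounds: "\<exists>s t. l < s \<and> s < t \<and> t < u \<and> A \<subseteq> {s<..<t}" if A: "compact A" "A \<subseteq> {l<..<u}" "l < u" for A and l u :: real
  proof (cases "A = {}")
    case True
    then show ?thesis using \<open>l < u\<close> by (intro exI[of _ "l + (u - l) / 3"] exI[of _ "u - (u - l) / 3"]) (auto simp: field_simps)
  next
    case False
    obtain m where m: "m \<in> A" "\<forall>x\<in>A. m \<le> x" using compact_attains_inf[OF A(1) False] by blast
    obtain M where M: "M \<in> A" "\<forall>x\<in>A. x \<le> M" using compact_attains_sup[OF A(1) False] by blast
    have *: "l < m" "M < u" "m \<le> M" using m M A(2) by auto
    have "A \<subseteq> {(l + m) / 2<..<(M + u) / 2}"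
    proof
      fix z assume "z \<in> A"
      then have "m \<le> z" "z \<le> M" using m M by blast+
      then show "z \<in> {(l + m) / 2<..<(M + u) / 2}" using * by simp
    qed
    then show ?thesis using * by (intro exI[of _ "(l + m) / 2"] exI[of _ "(M + u) / 2"]) auto
  qed
  have cK: "compact (fst ` ?K)" "compact (snd ` ?K)"
    using K(1) by (auto intro!: compact_continuous_image continuous_intros)
  obtain B where B: "\<forall>r\<in>fst ` ?K. \<bar>r\<bar> \<le> B" using compact_imp_bounded[OF cK(1)] bounded_real by metis
  have "fst ` ?K \<subseteq> {0<..<\<bar>B\<bar> + 1}"
  proof
    fix r assume r: "r \<in> fst ` ?K"
    then have "0 < r" using K(2) by auto
    then show "r \<in> {0<..<\<bar>B\<bar> + 1}" using B r by fastforce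
  qed
  moreover have "0 < \<bar>B\<bar> + 1" by simp
  ultimately obtain s t where st: "0 < s" "s < t" "fst ` ?K \<subseteq> {s<..<t}" using bounds[OF cK(1)] by meson
  have "snd ` ?K \<subseteq> {\<alpha><..<\<beta>}" using K(2) by auto
  from bounds[OF cK(2) this \<alpha>_less_\<beta>] obtain c d where cd: "\<alpha> < c" "c < d" "d < \<beta>" "snd ` ?K \<subseteq> {c<..<d}" by auto
  have sub: "?K \<subseteq> {s<..<t} \<times> {c<..<d}"
  proof
    fix p assume "p \<in> ?K"
    then have "fst p \<in> {s<..<t}" "snd p \<in> {c<..<d}" using st(3) cd(4) by blast+
    then show "p \<in> {s<..<t} \<times> {c<..<d}" by (simp add: mem_Times_iff)
  qed
  have zero: "f p = 0" if "{p. f p \<noteq> 0} \<subseteq> ?K" "p \<notin> {s<..<t} \<times> {c<..<d}" for f :: "real \<times> real \<Rightarrow> real" and p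
    using that sub by blast
  have "space_time_test s t c d \<phi> \<phi>t \<phi>x \<phi>xt"
    unfolding space_time_test_def
    using smooth_continuous[OF sm] smooth_continuous[OF 1(1)] smooth_continuous[OF 1(2)] smooth_continuous[OF 2(1)]
      1(3,4) 2(2) zero[OF closure_subset] zero[OF 1(5)] zero[OF 1(6)] zero[OF 3] by blast
  then show ?thesis using st cd by blast
qed

context bounded_interval
begin

lemma box_parts_time:
  assumes test: "space_time_test s t c d \<phi> \<phi>t \<phi>x \<phi>xt" and box: "0 < s" "s < t" "\<alpha> < c" "d < \<beta>"
    and w: "partials \<Omega> w wt wx"
  shows "box_integral s t c d (\<lambda>p. w p * \<phi>t p) = - box_integral s t c d (\<lambda>p. wt p * \<phi> p)"
proof -
  have sub: "{s..t} \<times> {c..d} \<subseteq> {0..} \<times> \<Omega>" using box by auto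
  have cw: "continuous_on ({s..t} \<times> {c..d}) w" "continuous_on ({s..t} \<times> {c..d}) wt"
    using w sub unfolding partials_def by (blast intro: continuous_on_subset)+
  have c\<phi>: "continuous_on ({s..t} \<times> {c..d}) \<phi>" "continuous_on ({s..t} \<times> {c..d}) \<phi>t"
    using test unfolding space_time_test_def by (blast intro: continuous_on_subset)+
  have parts: "integral {s..t} (\<lambda>r. w (r, y) * \<phi>t (r, y)) = - integral {s..t} (\<lambda>r. wt (r, y) * \<phi> (r, y))" if y: "y \<in> {c..d}" for y
  proof (rule integration_by_parts_zero)
    show "((\<lambda>r. w (r, y)) has_real_derivative wt (r, y)) (at r within {s..t})" if r: "r \<in> {s..t}" for r
    proof (rule DERIV_subset)
      show "((\<lambda>r. w (r, y)) has_real_derivative wt (r, y)) (at r within {0..})"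
        using w r y box unfolding partials_def by auto
    qed (use box in auto)
    show "((\<lambda>r. \<phi> (r, y)) has_real_derivative \<phi>t (r, y)) (at r within {s..t})" for r
      using test unfolding space_time_test_def by (blast intro: has_field_derivative_at_within)
    show "\<phi> (s, y) = 0" "\<phi> (t, y) = 0" using test unfolding space_time_test_def by auto
    show "continuous_on {s..t} (\<lambda>r. wt (r, y))" "continuous_on {s..t} (\<lambda>r. \<phi>t (r, y))"
      by (rule continuous_on_section(2)[OF cw(2) y], rule continuous_on_section(2)[OF c\<phi>(2) y])
  qed (use box in simp)
  have "integral {c..d} (\<lambda>y. integral {s..t} (\<lambda>r. w (r, y) * \<phi>t (r, y)))
      = integral {c..d} (\<lambda>y. - integral {s..t} (\<lambda>r. wt (r, y) * \<phi> (r, y)))"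
    by (rule Henstock_Kurzweil_Integration.integral_cong) (rule parts)
  then show ?thesis
    by (simp add: box_integral_swap continuous_on_mult cw c\<phi>)
qed

lemma box_parts_space:
  assumes test: "space_time_test s t c d \<phi> \<phi>t \<phi>x \<phi>xt" and box: "0 < s" "\<alpha> < c" "c < d" "d < \<beta>"
    and w: "continuous_on ({0..} \<times> \<Omega>) w" "continuous_on ({0..} \<times> \<Omega>) wx"
    and D: "\<And>r y. r \<ge> 0 \<Longrightarrow> y \<in> \<Omega> \<Longrightarrow> ((\<lambda>y. w (r, y)) has_real_derivative wx (r, y)) (at y)"
  shows "box_integral s t c d (\<lambda>p. w p * \<phi>x p) = - box_integral s t c d (\<lambda>p. wx p * \<phi> p)"
proof -
  have sub: "{s..t} \<times> {c..d} \<subseteq> {0..} \<times> \<Omega>" using box by auto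
  have cw: "continuous_on ({s..t} \<times> {c..d}) w" "continuous_on ({s..t} \<times> {c..d}) wx"
    using w sub by (blast intro: continuous_on_subset)+
  have c\<phi>: "continuous_on ({s..t} \<times> {c..d}) \<phi>" "continuous_on ({s..t} \<times> {c..d}) \<phi>x"
    using test unfolding space_time_test_def by (blast intro: continuous_on_subset)+
  have parts: "integral {c..d} (\<lambda>y. w (r, y) * \<phi>x (r, y)) = - integral {c..d} (\<lambda>y. wx (r, y) * \<phi> (r, y))" if r: "r \<in> {s..t}" for r
  proof (rule integration_by_parts_zero)
    show "((\<lambda>y. w (r, y)) has_real_derivative wx (r, y)) (at y within {c..d})" if y: "y \<in> {c..d}" for y
      by (rule has_field_derivative_at_within[OF D]) (use r y box in auto)
    show "((\<lambda>y. \<phi> (r, y)) has_real_derivative \<phi>x (r, y)) (at y within {c..d})" for y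
      using test unfolding space_time_test_def by (blast intro: has_field_derivative_at_within)
    show "\<phi> (r, c) = 0" "\<phi> (r, d) = 0" using test unfolding space_time_test_def by auto
    show "continuous_on {c..d} (\<lambda>y. wx (r, y))" "continuous_on {c..d} (\<lambda>y. \<phi>x (r, y))"
      by (rule continuous_on_section(1)[OF cw(2) r], rule continuous_on_section(1)[OF c\<phi>(2) r])
  qed (use box in simp)
  have "integral {s..t} (\<lambda>r. integral {c..d} (\<lambda>y. w (r, y) * \<phi>x (r, y)))
      = integral {s..t} (\<lambda>r. - integral {c..d} (\<lambda>y. wx (r, y) * \<phi> (r, y)))"
    by (rule Henstock_Kurzweil_Integration.integral_cong) (rule parts)
  then show ?thesis
    by (simp add: box_integral_HK continuous_on_mult cw c\<phi>)
qed

end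

section \<open>Estimates for the relaxed problem, uniform in the relaxation parameter\<close>


text \<open>\<open>relaxed_problem\<close> states the equations for positive times only; continuity
  extends them to t = 0, where the estimates start.\<close>

lemma eq_at_0_if_eq_positive:
  fixes f g :: "real \<times> real \<Rightarrow> real"
  assumes cont: "continuous_on ({0..} \<times> \<Omega>) f" "continuous_on ({0..} \<times> \<Omega>) g" and x: "x \<in> \<Omega>"
    and eq: "\<And>t. t > 0 \<Longrightarrow> f (t, x) = g (t, x)" and t: "t \<ge> 0"
  shows "f (t, x) = g (t, x)"
proof -
  have sec: "continuous_on {0..} (\<lambda>t. h (t, x))" if "continuous_on ({0..} \<times> \<Omega>) h" for h :: "real \<times> real \<Rightarrow> real"
    by (rule continuous_on_compose2[OF that]) (use x in \<open>auto intro!: continuous_intros\<close>)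
  have "continuous_on (closure {0<..}) (\<lambda>t. f (t, x) - g (t, x))"
    using sec[OF cont(1)] sec[OF cont(2)] by (simp add: continuous_on_diff)
  from continuous_constant_on_closure[OF this, of 0 t] have "f (t, x) - g (t, x) = 0"
    using eq t by simp
  then show ?thesis by simp
qed

text \<open>One solution for one fixed \<tau>. The bounds derived from these hypotheses depend on
  \<tau> only through explicit factors \<open>sqrt \<tau>\<close>; \<open>small\<close> is the
  condition under which the Sobolev embedding yields pointwise bounds by 1/2.\<close>

locale relaxed_solution = bounded_interval +
  fixes \<mu> a \<gamma> C \<tau> \<epsilon> :: real and v\<^sub>0 u\<^sub>0 S\<^sub>0 :: "real \<Rightarrow> real" and v u S :: "real \<times> real \<Rightarrow> real"
  assumes sol: "global_solution \<alpha> \<beta> \<mu> a \<gamma> C \<tau> v\<^sub>0 u\<^sub>0 S\<^sub>0 v u S"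
    and \<mu>_pos: "\<mu> > 0" and a_pos: "a > 0" and \<gamma>_gt_1: "\<gamma> > 1" and C_pos: "C > 0"
    and \<tau>_pos: "0 < \<tau>" and \<tau>_le_1: "\<tau> \<le> 1"
    and E_less: "E_init \<Omega> \<mu> a \<gamma> \<tau> v\<^sub>0 u\<^sub>0 S\<^sub>0 < \<epsilon>"
    and small: "sobolev_const * sqrt (C * \<epsilon>) \<le> 1 / 2"
begin

text \<open>The square of \<open>K\<close> dominates the right-hand side of the energy estimate,
  hence each squared norm on its left.\<close>

definition "K = sqrt (C * \<epsilon>)"

abbreviation "v\<^sub>t \<equiv> time_partial \<Omega> v"
abbreviation "v\<^sub>x \<equiv> space_partial \<Omega> v"
abbreviation "u\<^sub>t \<equiv> time_partial \<Omega> u"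
abbreviation "u\<^sub>x \<equiv> space_partial \<Omega> u"
abbreviation "S\<^sub>t \<equiv> time_partial \<Omega> S"
abbreviation "S\<^sub>x \<equiv> space_partial \<Omega> S"

abbreviation "p\<^sub>x p \<equiv> - a * \<gamma> * v p powr (- \<gamma> - 1) * v\<^sub>x p"

lemma problem: "relaxed_problem \<alpha> \<beta> \<mu> a \<gamma> \<tau> v\<^sub>0 u\<^sub>0 S\<^sub>0 v u S"
  using sol by (simp add: global_solution_def Let_def)

lemma partials: "partials \<Omega> v v\<^sub>t v\<^sub>x" "partials \<Omega> u u\<^sub>t u\<^sub>x" "partials \<Omega> S S\<^sub>t S\<^sub>x"
proof -
  have "C1_spacetime \<Omega> v \<and> C1_spacetime \<Omega> u \<and> C1_spacetime \<Omega> S"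
    using sol by (simp add: global_solution_def Let_def)
  then show "partials \<Omega> v v\<^sub>t v\<^sub>x" "partials \<Omega> u u\<^sub>t u\<^sub>x" "partials \<Omega> S S\<^sub>t S\<^sub>x"
    using partials_partial open_greaterThanLessThan by blast+
qed

lemma cont:
  "continuous_on ({0..} \<times> \<Omega>) v" "continuous_on ({0..} \<times> \<Omega>) v\<^sub>t" "continuous_on ({0..} \<times> \<Omega>) v\<^sub>x"
  "continuous_on ({0..} \<times> \<Omega>) u" "continuous_on ({0..} \<times> \<Omega>) u\<^sub>t" "continuous_on ({0..} \<times> \<Omega>) u\<^sub>x"
  "continuous_on ({0..} \<times> \<Omega>) S" "continuous_on ({0..} \<times> \<Omega>) S\<^sub>t" "continuous_on ({0..} \<times> \<Omega>) S\<^sub>x"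
  using partials by (auto simp: partials_def)

lemma D_time:
  assumes "t \<ge> 0" "x \<in> \<Omega>"
  shows "((\<lambda>s. v (s, x)) has_real_derivative v\<^sub>t (t, x)) (at t within {0..})"
    "((\<lambda>s. u (s, x)) has_real_derivative u\<^sub>t (t, x)) (at t within {0..})"
    "((\<lambda>s. S (s, x)) has_real_derivative S\<^sub>t (t, x)) (at t within {0..})"
  using partials assms by (auto simp: partials_def)

lemma D_space:
  assumes "t \<ge> 0" "x \<in> \<Omega>"
  shows "((\<lambda>y. v (t, y)) has_real_derivative v\<^sub>x (t, x)) (at x)"
    "((\<lambda>y. u (t, y)) has_real_derivative u\<^sub>x (t, x)) (at x)"
    "((\<lambda>y. S (t, y)) has_real_derivative S\<^sub>x (t, x)) (at x)"
  using partials assms by (auto simp: partials_def)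

lemma v_pos: "t \<ge> 0 \<Longrightarrow> x \<in> \<Omega> \<Longrightarrow> v (t, x) > 0"
  using problem by (simp add: relaxed_problem_def)

lemma D_pressure:
  assumes "t \<ge> 0" "x \<in> \<Omega>"
  shows "((\<lambda>y. pressure a \<gamma> (v (t, y))) has_real_derivative p\<^sub>x (t, x)) (at x)"
proof -
  have "((\<lambda>w. w powr (- \<gamma>)) has_real_derivative - \<gamma> * v (t, x) powr (- \<gamma> - 1)) (at (v (t, x)))"
    by (rule has_real_derivative_powr[OF v_pos[OF assms]])
  from DERIV_chain2[OF this D_space(1)[OF assms]]
  have "((\<lambda>y. v (t, y) powr (- \<gamma>)) has_real_derivative - \<gamma> * v (t, x) powr (- \<gamma> - 1) * v\<^sub>x (t, x)) (at x)" .
  from DERIV_cmult[OF this, of a] show ?thesis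
    unfolding pressure_def by (simp add: mult.assoc)
qed

lemma cont_pressure:
  "continuous_on ({0..} \<times> \<Omega>) (\<lambda>p. pressure a \<gamma> (v p))" "continuous_on ({0..} \<times> \<Omega>) (\<lambda>p. p\<^sub>x p)"
  unfolding pressure_def using v_pos
  by (intro continuous_intros cont; fastforce)+

lemma equations_positive:
  assumes t: "t > 0" and x: "x \<in> \<Omega>"
  shows "v\<^sub>t (t, x) = u\<^sub>x (t, x)" "u\<^sub>t (t, x) + p\<^sub>x (t, x) = S\<^sub>x (t, x)"
    "\<tau> * S\<^sub>t (t, x) + v (t, x) * S (t, x) = \<mu> * u\<^sub>x (t, x)"
proof -
  have "t \<in> interior {0..}" using t by simp
  then have at: "at t within {0..} = at t" by (rule at_within_interior)
  have time: "deriv (\<lambda>s. v (s, x)) t = v\<^sub>t (t, x)" "deriv (\<lambda>s. u (s, x)) t = u\<^sub>t (t, x)" "deriv (\<lambda>s. S (s, x)) t = S\<^sub>t (t, x)"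
    using D_time[of t x] t x at by (auto intro!: DERIV_imp_deriv)
  have space: "deriv (\<lambda>y. u (t, y)) x = u\<^sub>x (t, x)" "deriv (\<lambda>y. S (t, y)) x = S\<^sub>x (t, x)"
    "deriv (\<lambda>y. pressure a \<gamma> (v (t, y))) x = p\<^sub>x (t, x)"
    using D_space[of t x] D_pressure[of t x] t x by (auto intro!: DERIV_imp_deriv)
  have "deriv (\<lambda>s. v (s, x)) t = deriv (\<lambda>y. u (t, y)) x \<and>
        deriv (\<lambda>s. u (s, x)) t + deriv (\<lambda>y. pressure a \<gamma> (v (t, y))) x = deriv (\<lambda>y. S (t, y)) x \<and>
        \<tau> * deriv (\<lambda>s. S (s, x)) t + v (t, x) * S (t, x) = \<mu> * deriv (\<lambda>y. u (t, y)) x"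
    using problem t x by (simp add: relaxed_problem_def)
  then show "v\<^sub>t (t, x) = u\<^sub>x (t, x)" "u\<^sub>t (t, x) + p\<^sub>x (t, x) = S\<^sub>x (t, x)"
    "\<tau> * S\<^sub>t (t, x) + v (t, x) * S (t, x) = \<mu> * u\<^sub>x (t, x)"
    unfolding time space by blast+
qed

lemma equations:
  assumes t: "t \<ge> 0" and x: "x \<in> \<Omega>"
  shows "v\<^sub>t (t, x) = u\<^sub>x (t, x)" "u\<^sub>t (t, x) + p\<^sub>x (t, x) = S\<^sub>x (t, x)"
    "\<tau> * S\<^sub>t (t, x) + v (t, x) * S (t, x) = \<mu> * u\<^sub>x (t, x)"
proof -
  show "v\<^sub>t (t, x) = u\<^sub>x (t, x)"
    by (rule eq_at_0_if_eq_positive[OF cont(2,6) x equations_positive(1)[OF _ x] t])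
  show "u\<^sub>t (t, x) + p\<^sub>x (t, x) = S\<^sub>x (t, x)"
    using eq_at_0_if_eq_positive[OF continuous_on_add[OF cont(5) cont_pressure(2)] cont(9) x equations_positive(2)[OF _ x] t] .
  show "\<tau> * S\<^sub>t (t, x) + v (t, x) * S (t, x) = \<mu> * u\<^sub>x (t, x)"
    using eq_at_0_if_eq_positive[OF continuous_on_add[OF continuous_on_mult[OF continuous_on_const cont(8)] continuous_on_mult[OF cont(1,7)]]
        continuous_on_mult[OF continuous_on_const cont(6)] x equations_positive(3)[OF _ x] t] .
qed

lemma E_nonneg: "0 \<le> E_init \<Omega> \<mu> a \<gamma> \<tau> v\<^sub>0 u\<^sub>0 S\<^sub>0"
  unfolding E_init_def by (intro sum_nonneg) (auto split: prod.split)

lemma \<epsilon>_pos: "\<epsilon> > 0"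
  using E_less E_nonneg by linarith

lemma K_pos: "K > 0"
  unfolding K_def using C_pos \<epsilon>_pos by simp

lemma CE_le: "C * E_init \<Omega> \<mu> a \<gamma> \<tau> v\<^sub>0 u\<^sub>0 S\<^sub>0 \<le> K\<^sup>2"
  unfolding K_def using C_pos \<epsilon>_pos E_less by simp

lemma in_H2:
  assumes "t \<ge> 0"
  shows "(\<lambda>x. v (t, x) - 1) \<in> H_space \<Omega> 2" "(\<lambda>x. u (t, x)) \<in> H_space \<Omega> 2" "(\<lambda>x. sqrt \<tau> * S (t, x)) \<in> H_space \<Omega> 2"
  using sol assms by (auto simp: global_solution_def Let_def)

lemma energy:
  "(SUP t\<in>{0..}. ennreal ((H_norm \<Omega> 2 (\<lambda>x. v (t, x) - 1))\<^sup>2 + (H_norm \<Omega> 2 (\<lambda>x. u (t, x)))\<^sup>2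
                              + (H_norm \<Omega> 2 (\<lambda>x. sqrt \<tau> * S (t, x)))\<^sup>2)) \<le> ennreal (K\<^sup>2)"
  "(\<integral>\<^sup>+ t. ennreal ((H_norm \<Omega> 2 (\<lambda>x. S (t, x)))\<^sup>2) \<partial>lebesgue_on {0<..}) \<le> ennreal (K\<^sup>2)"
proof -
  let ?A = "SUP t\<in>{0..}. ennreal ((H_norm \<Omega> 2 (\<lambda>x. v (t, x) - 1))\<^sup>2 + (H_norm \<Omega> 2 (\<lambda>x. u (t, x)))\<^sup>2
                              + (H_norm \<Omega> 2 (\<lambda>x. sqrt \<tau> * S (t, x)))\<^sup>2)"
  let ?B = "\<integral>\<^sup>+ t. ennreal ((H_norm \<Omega> 1 (wderiv \<Omega> 1 (\<lambda>x. v (t, x))))\<^sup>2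
                          + (H_norm \<Omega> 1 (wderiv \<Omega> 1 (\<lambda>x. u (t, x))))\<^sup>2
                          + (H_norm \<Omega> 2 (\<lambda>x. S (t, x)))\<^sup>2) \<partial>lebesgue_on {0<..}"
  have "?A + ?B \<le> ennreal (C * E_init \<Omega> \<mu> a \<gamma> \<tau> v\<^sub>0 u\<^sub>0 S\<^sub>0)"
    using sol by (simp add: global_solution_def Let_def)
  also have "\<dots> \<le> ennreal (K\<^sup>2)" by (rule ennreal_leI[OF CE_le])
  finally have le: "?A + ?B \<le> ennreal (K\<^sup>2)" .
  have "?A \<le> ?A + ?B" by simp
  with le show "?A \<le> ennreal (K\<^sup>2)" by (rule order_trans[rotated])
  have "(\<integral>\<^sup>+ t. ennreal ((H_norm \<Omega> 2 (\<lambda>x. S (t, x)))\<^sup>2) \<partial>lebesgue_on {0<..}) \<le> ?B"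
    by (intro nn_integral_mono ennreal_leI) simp
  also have "\<dots> \<le> ?A + ?B" by simp
  finally show "(\<integral>\<^sup>+ t. ennreal ((H_norm \<Omega> 2 (\<lambda>x. S (t, x)))\<^sup>2) \<partial>lebesgue_on {0<..}) \<le> ennreal (K\<^sup>2)"
    using le by (rule order_trans)
qed

text \<open>The supremum in the energy estimate runs over every time and not just almost every time,
  so the bounds hold at each t, including t = 0.\<close>

lemma H2_bounds:
  assumes t: "t \<ge> 0"
  shows "H_norm \<Omega> 2 (\<lambda>x. v (t, x) - 1) \<le> K" "H_norm \<Omega> 2 (\<lambda>x. u (t, x)) \<le> K" "H_norm \<Omega> 2 (\<lambda>x. sqrt \<tau> * S (t, x)) \<le> K"
proof -
  let ?f = "\<lambda>t. (H_norm \<Omega> 2 (\<lambda>x. v (t, x) - 1))\<^sup>2 + (H_norm \<Omega> 2 (\<lambda>x. u (t, x)))\<^sup>2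
                              + (H_norm \<Omega> 2 (\<lambda>x. sqrt \<tau> * S (t, x)))\<^sup>2"
  have "ennreal (?f t) \<le> (SUP t\<in>{0..}. ennreal (?f t))" by (rule SUP_upper) (use t in simp)
  also have "\<dots> \<le> ennreal (K\<^sup>2)" by (rule energy(1))
  finally have "?f t \<le> K\<^sup>2" by (subst (asm) ennreal_le_iff) simp_all
  then have "(H_norm \<Omega> 2 (\<lambda>x. v (t, x) - 1))\<^sup>2 \<le> K\<^sup>2" "(H_norm \<Omega> 2 (\<lambda>x. u (t, x)))\<^sup>2 \<le> K\<^sup>2" "(H_norm \<Omega> 2 (\<lambda>x. sqrt \<tau> * S (t, x)))\<^sup>2 \<le> K\<^sup>2"
    using zero_le_power2[of "H_norm \<Omega> 2 (\<lambda>x. v (t, x) - 1)"] zero_le_power2[of "H_norm \<Omega> 2 (\<lambda>x. u (t, x))"]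
      zero_le_power2[of "H_norm \<Omega> 2 (\<lambda>x. sqrt \<tau> * S (t, x))"] by linarith+
  then show "H_norm \<Omega> 2 (\<lambda>x. v (t, x) - 1) \<le> K" "H_norm \<Omega> 2 (\<lambda>x. u (t, x)) \<le> K" "H_norm \<Omega> 2 (\<lambda>x. sqrt \<tau> * S (t, x)) \<le> K"
    using K_pos by (auto intro: power2_le_imp_le)
qed

lemma section_continuous:
  assumes "continuous_on ({0..} \<times> \<Omega>) f" "t \<ge> 0"
  shows "continuous_on \<Omega> (\<lambda>x. f (t, x))"
  by (rule continuous_on_compose2[OF assms(1)]) (use assms(2) in \<open>auto intro!: continuous_intros\<close>)

lemma C1_bounds:
  assumes t: "t \<ge> 0" and x: "x \<in> \<Omega>"
  shows "\<bar>v (t, x) - 1\<bar> \<le> 1 / 2" "\<bar>v\<^sub>x (t, x)\<bar> \<le> 1 / 2" "\<bar>u (t, x)\<bar> \<le> 1 / 2" "\<bar>u\<^sub>x (t, x)\<bar> \<le> 1 / 2" "sqrt \<tau> * \<bar>S (t, x)\<bar> \<le> 1 / 2"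
proof -
  have Dv: "((\<lambda>y. v (t, y) - 1) has_real_derivative v\<^sub>x (t, x)) (at x)" if "x \<in> \<Omega>" for x
    using D_space(1)[OF t that] by (auto intro!: derivative_eq_intros)
  have DS: "((\<lambda>y. sqrt \<tau> * S (t, y)) has_real_derivative sqrt \<tau> * S\<^sub>x (t, x)) (at x)" if "x \<in> \<Omega>" for x
    using D_space(3)[OF t that] by (auto intro!: derivative_eq_intros)
  have small': "sobolev_const * K \<le> 1 / 2" using small by (simp add: K_def)
  have "\<bar>v (t, x) - 1\<bar> \<le> sobolev_const * K"
    by (rule H2_C1_bounds(1)[OF in_H2(1)[OF t] section_continuous[OF cont(3) t] Dv H2_bounds(1)[OF t] x])
  then show "\<bar>v (t, x) - 1\<bar> \<le> 1 / 2" using small' by linarith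
  have "\<bar>v\<^sub>x (t, x)\<bar> \<le> sobolev_const * K"
    by (rule H2_C1_bounds(2)[OF in_H2(1)[OF t] section_continuous[OF cont(3) t] Dv H2_bounds(1)[OF t] x])
  then show "\<bar>v\<^sub>x (t, x)\<bar> \<le> 1 / 2" using small' by linarith
  have "\<bar>u (t, x)\<bar> \<le> sobolev_const * K"
    by (rule H2_C1_bounds(1)[OF in_H2(2)[OF t] section_continuous[OF cont(6) t] D_space(2)[OF t] H2_bounds(2)[OF t] x])
  then show "\<bar>u (t, x)\<bar> \<le> 1 / 2" using small' by linarith
  have "\<bar>u\<^sub>x (t, x)\<bar> \<le> sobolev_const * K"
    by (rule H2_C1_bounds(2)[OF in_H2(2)[OF t] section_continuous[OF cont(6) t] D_space(2)[OF t] H2_bounds(2)[OF t] x])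
  then show "\<bar>u\<^sub>x (t, x)\<bar> \<le> 1 / 2" using small' by linarith
  have "\<bar>sqrt \<tau> * S (t, x)\<bar> \<le> sobolev_const * K"
    by (rule H2_C1_bounds(1)[OF in_H2(3)[OF t] continuous_on_mult[OF continuous_on_const section_continuous[OF cont(9) t]] DS H2_bounds(3)[OF t] x])
  then show "sqrt \<tau> * \<bar>S (t, x)\<bar> \<le> 1 / 2" using small' \<tau>_pos by (simp add: abs_mult)
qed

lemma v_bounds: "t \<ge> 0 \<Longrightarrow> x \<in> \<Omega> \<Longrightarrow> 1 / 2 \<le> v (t, x) \<and> v (t, x) \<le> 3 / 2"
  by (drule (1) C1_bounds(1)) linarith

lemma u\<^sub>x_hoelder:
  assumes "t \<ge> 0" "x \<in> \<Omega>" "y \<in> \<Omega>"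
  shows "\<bar>u\<^sub>x (t, y) - u\<^sub>x (t, x)\<bar> \<le> sqrt \<bar>y - x\<bar> * K"
  using H2_C1_bounds(3)[OF in_H2(2) section_continuous[OF cont(6)] D_space(2) H2_bounds(2), of t x y] assms by blast

lemma S_in_H2: "t \<ge> 0 \<Longrightarrow> (\<lambda>x. S (t, x)) \<in> H_space \<Omega> 2"
  using H.comb_in[OF in_H2(3) in_H2(3), of t t "1 / sqrt \<tau>" 0] \<tau>_pos by simp

text \<open>The energy estimate controls v - 1, whereas the limits concern v; on a bounded interval
  the constants belong to every Sobolev space.\<close>

lemma one_in_H: "(\<lambda>x. 1) \<in> H_space \<Omega> m"
proof -
  have "has_weak_deriv \<Omega> k (\<lambda>x. 1) (if k = 0 then (\<lambda>x. 1) else (\<lambda>x. 0))" for k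
  proof (cases k)
    case 0
    then show ?thesis using continuous_locally_integrable[OF continuous_on_const] by (auto intro: has_weak_deriv_0)
  next
    case (Suc j)
    have one: "has_weak_deriv \<Omega> 1 (\<lambda>x. 1) (\<lambda>x. 0)"
      by (rule classical_weak_deriv) auto
    have "integral\<^sup>L (lebesgue_on \<Omega>) ((deriv ^^ Suc j) \<phi>) = 0" if "\<phi> \<in> test_functions \<Omega>" for \<phi>
      using one test_functions_deriv_iter[OF that, of j] by (simp add: has_weak_deriv_def)
    then show ?thesis using Suc one by (simp add: has_weak_deriv_def)
  qed
  moreover have "(\<lambda>x. 1) \<in> L2_space \<Omega>" "(\<lambda>x. 0) \<in> L2_space \<Omega>"
    using finite_measure.integrable_const[OF finite_measure_\<Omega>, of "1::real"] by (auto simp: L2_space_def)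
  ultimately have "\<exists>g\<in>L2_space \<Omega>. has_weak_deriv \<Omega> k (\<lambda>x. 1) g" for k
    by (intro bexI[of _ "if k = 0 then (\<lambda>x. 1) else (\<lambda>x. 0)"]) auto
  then show ?thesis using \<open>(\<lambda>x. 1) \<in> L2_space \<Omega>\<close> by (simp add: H_space_def)
qed

lemma v_in_H2: "t \<ge> 0 \<Longrightarrow> (\<lambda>x. v (t, x)) \<in> H_space \<Omega> 2"
  using H.comb_in[OF in_H2(1) one_in_H, of t 1 1] by simp

lemma v_H2_bound: "t \<ge> 0 \<Longrightarrow> H_norm \<Omega> 2 (\<lambda>x. v (t, x)) \<le> K + H_norm \<Omega> 2 (\<lambda>x. 1)"
  using H.N_le_add_diff[OF v_in_H2 one_in_H, of t] H2_bounds(1)[of t] by simp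

text \<open>By \<open>H.bochner_measurable_iff\<close> it suffices that integrals over intervals
  depend measurably on time, and joint continuity makes them continuous. Continuity in time with
  values in \<open>H_space\<close> is not asked for; \<open>global_solution\<close> provides it only
  for orders below 2.\<close>

lemma bochner_measurable_continuous:
  assumes F: "continuous_on ({0..} \<times> \<Omega>) F" and H: "\<And>t. t > 0 \<Longrightarrow> (\<lambda>x. F (t, x)) \<in> H_space \<Omega> m"
  shows "bochner_measurable (H_space \<Omega> m) (H_norm \<Omega> m) F"
  unfolding H.bochner_measurable_iff
proof (intro conjI ballI)
  show "AE t in lebesgue_on {0<..}. (\<lambda>x. F (t, x)) \<in> H_space \<Omega> m"
    using AE_greaterThan by eventually_elim (rule H)
  fix l assume "l \<in> interval_integrals"
  then obtain c d where l: "l = (\<lambda>f. integral\<^sup>L (lebesgue_on {c..d}) f)" and cd: "\<alpha> < c" "c < d" "d < \<beta>"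
    by (auto simp: interval_integrals_def)
  have sub: "{0::real<..} \<times> {c..d} \<subseteq> {0..} \<times> \<Omega>" using cd by auto
  then have "continuous_on ({0<..} \<times> {c..d}) F" using F continuous_on_subset by blast
  then have "continuous_on {0<..} (\<lambda>t. integral {c..d} (\<lambda>x. F (t, x)))"
    by (rule continuous_on_integral_section)
  then have "(\<lambda>t. integral {c..d} (\<lambda>x. F (t, x))) \<in> borel_measurable (lebesgue_on {0<..})"
    by (rule continuous_imp_measurable_on_sets_lebesgue) simp
  moreover have "l (\<lambda>x. F (t, x)) = integral {c..d} (\<lambda>x. F (t, x))" if "t \<in> {0<..}" for t
    unfolding l
    by (intro integrable_continuous_lebesgue_on(2) continuous_on_subset[OF section_continuous[OF F]]) (use that cd in auto)
  ultimately show "(\<lambda>t. l (\<lambda>x. F (t, x))) \<in> borel_measurable (lebesgue_on {0<..})"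
    by (subst measurable_lebesgue_cong) auto
qed

lemma bochner_measurable_solution:
  "bochner_measurable (H_space \<Omega> 2) (H_norm \<Omega> 2) v"
  "bochner_measurable (H_space \<Omega> 2) (H_norm \<Omega> 2) u"
  "bochner_measurable (H_space \<Omega> 2) (H_norm \<Omega> 2) S"
  by (intro bochner_measurable_continuous cont v_in_H2 in_H2(2) S_in_H2; simp)+

lemma S_L2_time: "S \<in> L2_time (H_space \<Omega> 2) (H_norm \<Omega> 2)" "L2_time_norm (H_norm \<Omega> 2) S \<le> K"
proof -
  have meas: "(\<lambda>t. (H_norm \<Omega> 2 (\<lambda>x. S (t, x)))\<^sup>2) \<in> borel_measurable (lebesgue_on {0<..})"
    by (intro borel_measurable_power H.bochner_measurable_N bochner_measurable_solution)
  have "(\<integral>\<^sup>+ t. ennreal ((H_norm \<Omega> 2 (\<lambda>x. S (t, x)))\<^sup>2) \<partial>lebesgue_on {0<..}) < \<infinity>"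
    using energy(2) by (rule le_less_trans) simp
  then have int: "integrable (lebesgue_on {0<..}) (\<lambda>t. (H_norm \<Omega> 2 (\<lambda>x. S (t, x)))\<^sup>2)"
    using meas by (intro integrableI_bounded) simp_all
  then show L2: "S \<in> L2_time (H_space \<Omega> 2) (H_norm \<Omega> 2)"
    using bochner_measurable_solution by (simp add: L2_time_def)
  have "ennreal (\<integral>t. (H_norm \<Omega> 2 (\<lambda>x. S (t, x)))\<^sup>2 \<partial>lebesgue_on {0<..}) \<le> ennreal (K\<^sup>2)"
    using energy(2) by (subst (asm) nn_integral_eq_integral[OF int]) simp_all
  then have "(\<integral>t. (H_norm \<Omega> 2 (\<lambda>x. S (t, x)))\<^sup>2 \<partial>lebesgue_on {0<..}) \<le> K\<^sup>2"
    by (subst (asm) ennreal_le_iff) simp_all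
  then show "L2_time_norm (H_norm \<Omega> 2) S \<le> K"
    unfolding L2_time_norm_def using K_pos by (intro real_le_lsqrt) simp_all
qed

lemma space_lipschitz:
  assumes "t \<ge> 0" "x \<in> \<Omega>" "y \<in> \<Omega>"
  shows "\<bar>v (t, y) - v (t, x)\<bar> \<le> \<bar>y - x\<bar>" "\<bar>u (t, y) - u (t, x)\<bar> \<le> \<bar>y - x\<bar>"
proof -
  have *: "\<bar>f y - f x\<bar> \<le> \<bar>y - x\<bar>"
    if D: "\<And>z. z \<in> \<Omega> \<Longrightarrow> (f has_real_derivative f' z) (at z)" and b: "\<And>z. z \<in> \<Omega> \<Longrightarrow> \<bar>f' z\<bar> \<le> 1 / 2" for f f'
  proof -
    have "norm (f y - f x) \<le> 1 / 2 * norm (y - x)"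
      by (rule field_differentiable_bound[where S = \<Omega> and f' = f'])
        (use assms b in \<open>auto intro: has_field_derivative_at_within[OF D]\<close>)
    also have "\<dots> \<le> \<bar>y - x\<bar>" by simp
    finally show ?thesis by simp
  qed
  show "\<bar>v (t, y) - v (t, x)\<bar> \<le> \<bar>y - x\<bar>"
    by (rule *[OF D_space(1)[OF assms(1)] C1_bounds(2)[OF assms(1)]])
  show "\<bar>u (t, y) - u (t, x)\<bar> \<le> \<bar>y - x\<bar>"
    by (rule *[OF D_space(2)[OF assms(1)] C1_bounds(4)[OF assms(1)]])
qed

lemma v_time_lipschitz:
  assumes "s \<ge> 0" "t \<ge> 0" "x \<in> \<Omega>"
  shows "\<bar>v (t, x) - v (s, x)\<bar> \<le> \<bar>t - s\<bar>"
proof -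
  have "norm (v (t, x) - v (s, x)) \<le> 1 / 2 * norm (t - s)"
  proof (rule field_differentiable_bound[where S = "{0..}"])
    show "((\<lambda>s. v (s, x)) has_real_derivative v\<^sub>t (r, x)) (at r within {0..})" if "r \<in> {0..}" for r
      using D_time(1) that assms(3) by simp
    show "norm (v\<^sub>t (r, x)) \<le> 1 / 2" if "r \<in> {0..}" for r
      using equations(1)[of r x] C1_bounds(4)[of r x] that assms(3) by simp
  qed (use assms in auto)
  also have "\<dots> \<le> \<bar>t - s\<bar>" by simp
  finally show ?thesis by simp
qed

text \<open>The bound for |p(v)_x| that follows from v \<ge> 1/2, with |v_x| \<le> 1/2 rounded up to
  1.\<close>

definition "pressure_bound = a * \<gamma> * (1 / 2) powr (- \<gamma> - 1)"

lemma pressure_bounds: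
  assumes "t \<ge> 0" "x \<in> \<Omega>"
  shows "\<bar>p\<^sub>x (t, x)\<bar> \<le> pressure_bound" "\<bar>pressure a \<gamma> (v (t, x))\<bar> \<le> a * (1 / 2) powr (- \<gamma>)"
proof -
  have v: "1 / 2 \<le> v (t, x)" using v_bounds[OF assms] by simp
  have "v (t, x) powr (- \<gamma> - 1) \<le> (1 / 2) powr (- \<gamma> - 1)"
    by (rule powr_mono2') (use v \<gamma>_gt_1 in auto)
  moreover have "\<bar>v\<^sub>x (t, x)\<bar> \<le> 1" using C1_bounds(2)[OF assms] by simp
  ultimately have "v (t, x) powr (- \<gamma> - 1) * \<bar>v\<^sub>x (t, x)\<bar> \<le> (1 / 2) powr (- \<gamma> - 1) * 1"
    by (intro mult_mono) auto
  then have "a * \<gamma> * (v (t, x) powr (- \<gamma> - 1) * \<bar>v\<^sub>x (t, x)\<bar>) \<le> pressure_bound"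
    unfolding pressure_bound_def using a_pos \<gamma>_gt_1 by (intro mult_left_mono) auto
  then show "\<bar>p\<^sub>x (t, x)\<bar> \<le> pressure_bound"
    using a_pos \<gamma>_gt_1 by (simp add: abs_mult mult.assoc)
  have "v (t, x) powr (- \<gamma>) \<le> (1 / 2) powr (- \<gamma>)"
    by (rule powr_mono2') (use v \<gamma>_gt_1 in auto)
  then show "\<bar>pressure a \<gamma> (v (t, x))\<bar> \<le> a * (1 / 2) powr (- \<gamma>)"
    unfolding pressure_def using a_pos by (simp add: abs_mult)
qed

text \<open>Young's inequality \<open>\<bar>S\<^sub>x\<bar> \<le> (\<delta> S\<^sub>x\<^sup>2 + 1 / \<delta>) / 2\<close> turns the \<open>L\<^sup>2\<close> bound of \<open>S\<close> in time into
  equicontinuity of \<open>u\<close>, uniformly in \<open>\<tau>\<close>.\<close>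

lemma u_time_estimate:
  assumes st: "0 \<le> s" "s \<le> t" and x: "x \<in> \<Omega>" and \<delta>: "\<delta> > 0"
  shows "\<bar>u (t, x) - u (s, x)\<bar> \<le> (pressure_bound + 1 / \<delta>) * (t - s) + \<delta>"
proof -
  \<comment> \<open>Positive s first, because the L^2 bound of \<open>S\<close> is an integral over
    the open half-line; continuity of \<open>u\<close> then reaches s = 0.\<close>
  have pos: "\<bar>u (t, x) - u (s, x)\<bar> \<le> (pressure_bound + 1 / \<delta>) * (t - s) + \<delta>" if st: "0 < s" "s < t" for s t
  proof -
    have sub: "{s..t} \<times> {x} \<subseteq> {0..} \<times> \<Omega>" using st x by auto
    have ct: "continuous_on {s..t} (\<lambda>r. f (r, x))" if "continuous_on ({0..} \<times> \<Omega>) f" for f :: "real \<times> real \<Rightarrow> real"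
      by (rule continuous_on_compose2[OF that]) (use st x in \<open>auto intro!: continuous_intros\<close>)
    have "((\<lambda>r. u\<^sub>t (r, x)) has_integral u (t, x) - u (s, x)) {s..t}"
    proof (rule fundamental_theorem_of_calculus)
      show "((\<lambda>r. u (r, x)) has_vector_derivative u\<^sub>t (r, x)) (at r within {s..t})" if "r \<in> {s..t}" for r
        unfolding has_real_derivative_iff_has_vector_derivative[symmetric]
        by (rule DERIV_subset[OF D_time(2)]) (use that st x in auto)
    qed (use st in simp)
    then have "u (t, x) - u (s, x) = integral {s..t} (\<lambda>r. u\<^sub>t (r, x))" by (simp add: integral_unique)
    also have "norm \<dots> \<le> integral {s..t} (\<lambda>r. \<delta> * (S\<^sub>x (r, x))\<^sup>2 + (pressure_bound + 1 / \<delta>))"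
    proof (rule integral_norm_bound_integral)
      show "(\<lambda>r. u\<^sub>t (r, x)) integrable_on {s..t}" by (intro integrable_continuous_real ct cont)
      show "(\<lambda>r. \<delta> * (S\<^sub>x (r, x))\<^sup>2 + (pressure_bound + 1 / \<delta>)) integrable_on {s..t}"
        by (intro integrable_continuous_real continuous_intros ct cont)
      fix r assume r: "r \<in> {s..t}"
      then have r0: "r \<ge> 0" using st by simp
      \<comment> \<open>A cruder form of Young's inequality, without the factor 1/2, is what enters
        the final bound.\<close>
      have "0 \<le> (\<delta> * \<bar>S\<^sub>x (r, x)\<bar> - 1)\<^sup>2 + \<delta> * \<bar>S\<^sub>x (r, x)\<bar>" using \<delta> by simp
      then have "\<delta> * \<bar>S\<^sub>x (r, x)\<bar> \<le> (\<delta> * \<bar>S\<^sub>x (r, x)\<bar>)\<^sup>2 + 1" by (simp add: power2_diff)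
      moreover have "(\<delta> * \<bar>S\<^sub>x (r, x)\<bar>)\<^sup>2 = \<delta> * (\<delta> * (S\<^sub>x (r, x))\<^sup>2)"
        by (simp add: power_mult_distrib power2_eq_square[of \<delta>])
      ultimately have "\<delta> * \<bar>S\<^sub>x (r, x)\<bar> \<le> \<delta> * (\<delta> * (S\<^sub>x (r, x))\<^sup>2 + 1 / \<delta>)"
        using \<delta> by (simp add: ring_distribs)
      then have "\<bar>S\<^sub>x (r, x)\<bar> \<le> \<delta> * (S\<^sub>x (r, x))\<^sup>2 + 1 / \<delta>" using \<delta> by (simp only: mult_le_cancel_left_pos)
      moreover have "u\<^sub>t (r, x) = S\<^sub>x (r, x) - p\<^sub>x (r, x)" using equations(2)[OF r0 x] by simp
      ultimately show "norm (u\<^sub>t (r, x)) \<le> \<delta> * (S\<^sub>x (r, x))\<^sup>2 + (pressure_bound + 1 / \<delta>)"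
        using pressure_bounds(1)[OF r0 x] unfolding real_norm_def by linarith
    qed
    also have "\<dots> = \<delta> * integral {s..t} (\<lambda>r. (S\<^sub>x (r, x))\<^sup>2) + (pressure_bound + 1 / \<delta>) * (t - s)"
    proof -
      have "integral {s..t} (\<lambda>r. \<delta> * (S\<^sub>x (r, x))\<^sup>2 + (pressure_bound + 1 / \<delta>))
          = integral {s..t} (\<lambda>r. \<delta> * (S\<^sub>x (r, x))\<^sup>2) + integral {s..t} (\<lambda>r. pressure_bound + 1 / \<delta>)"
        by (intro Henstock_Kurzweil_Integration.integral_add integrable_continuous_real continuous_intros ct cont)
      then show ?thesis using st by simp
    qed
    \<comment> \<open>\<open>sobolev_const\<close> times the L^2 norm of \<open>S\<close> in time is
      at most \<open>sobolev_const * K\<close>, which \<open>small\<close> keeps below 1.\<close>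
    also have "integral {s..t} (\<lambda>r. (S\<^sub>x (r, x))\<^sup>2) \<le> 1"
    proof -
      have intS: "integrable (lebesgue_on {0<..}) (\<lambda>r. sobolev_const\<^sup>2 * (H_norm \<Omega> 2 (\<lambda>x. S (r, x)))\<^sup>2)"
        using S_L2_time(1) by (intro Bochner_Integration.integrable_mult_right) (simp add: L2_time_def)
      have "integral {s..t} (\<lambda>r. (S\<^sub>x (r, x))\<^sup>2) = (\<integral>r. (S\<^sub>x (r, x))\<^sup>2 \<partial>lebesgue_on {s..t})"
        by (intro integrable_continuous_lebesgue_on(2)[symmetric] continuous_intros ct cont)
      also have "\<dots> \<le> (\<integral>r. sobolev_const\<^sup>2 * (H_norm \<Omega> 2 (\<lambda>x. S (r, x)))\<^sup>2 \<partial>lebesgue_on {0<..})"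
      proof (rule integral_mono_lebesgue_on_AE[OF intS])
        show "AE r in lebesgue_on {s..t}. (S\<^sub>x (r, x))\<^sup>2 \<le> sobolev_const\<^sup>2 * (H_norm \<Omega> 2 (\<lambda>x. S (r, x)))\<^sup>2"
        proof (rule AE_I2)
          fix r assume "r \<in> space (lebesgue_on {s..t})"
          then have r0: "r \<ge> 0" using st by simp
          have "\<bar>S\<^sub>x (r, x)\<bar> \<le> sobolev_const * H_norm \<Omega> 2 (\<lambda>x. S (r, x))"
            by (rule H2_C1_bounds(2)[OF S_in_H2[OF r0] section_continuous[OF cont(9) r0] D_space(3)[OF r0] order_refl x])
          then have "\<bar>S\<^sub>x (r, x)\<bar>\<^sup>2 \<le> (sobolev_const * H_norm \<Omega> 2 (\<lambda>x. S (r, x)))\<^sup>2" by (rule power_mono) simp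
          then show "(S\<^sub>x (r, x))\<^sup>2 \<le> sobolev_const\<^sup>2 * (H_norm \<Omega> 2 (\<lambda>x. S (r, x)))\<^sup>2" by (simp add: power_mult_distrib)
        qed
      qed (use st in auto)
      also have "\<dots> = (sobolev_const * L2_time_norm (H_norm \<Omega> 2) S)\<^sup>2"
        by (simp add: power_mult_distrib H.L2_time_norm_power2)
      also have "\<dots> \<le> 1\<^sup>2"
      proof (rule power_mono)
        have "sobolev_const * L2_time_norm (H_norm \<Omega> 2) S \<le> sobolev_const * K"
          using S_L2_time(2) sobolev_const_pos by (intro mult_left_mono) auto
        then show "sobolev_const * L2_time_norm (H_norm \<Omega> 2) S \<le> 1" using small by (simp add: K_def)
        show "0 \<le> sobolev_const * L2_time_norm (H_norm \<Omega> 2) S"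
          using sobolev_const_pos by (simp add: L2_time_norm_def)
      qed
      finally show ?thesis by simp
    qed
    finally show ?thesis using \<delta> by simp
  qed
  show ?thesis
  proof (cases "s < t")
    case True
    let ?f = "\<lambda>r. \<bar>u (t, x) - u (r, x)\<bar> - (pressure_bound + 1 / \<delta>) * (t - r)"
    have "?f s \<le> \<delta>"
    proof (rule continuous_le_on_closure[of "{s<..<t}" ?f s \<delta>])
      show "continuous_on (closure {s<..<t}) ?f"
        using True st x by (auto intro!: continuous_intros continuous_on_compose2[OF cont(4)])
      show "s \<in> closure {s<..<t}" using True by simp
      show "?f r \<le> \<delta>" if "r \<in> {s<..<t}" for r using pos[of r t] that st by simp
    qed
    then show ?thesis by simp
  next
    case False
    then show ?thesis using st \<delta> by simp
  qed
qed

end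

section \<open>Weak form of the relaxed equations and asymptotics of the stress\<close>

context relaxed_solution
begin

lemma weak_formulation:
  assumes test: "space_time_test s t c d \<phi> \<phi>t \<phi>x \<phi>xt" and box: "0 < s" "s < t" "\<alpha> < c" "c < d" "d < \<beta>"
  shows "box_integral s t c d (\<lambda>p. v p * \<phi>t p) = box_integral s t c d (\<lambda>p. u p * \<phi>x p)"
    "box_integral s t c d (\<lambda>p. u p * \<phi>t p + pressure a \<gamma> (v p) * \<phi>x p) = box_integral s t c d (\<lambda>p. S p * \<phi>x p)"
proof -
  have sub: "{s..t} \<times> {c..d} \<subseteq> {0..} \<times> \<Omega>" using box by auto
  have cb: "continuous_on ({s..t} \<times> {c..d}) f" if "continuous_on ({0..} \<times> \<Omega>) f" for f :: "real \<times> real \<Rightarrow> real"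
    using that sub by (rule continuous_on_subset)
  have c\<phi>: "continuous_on ({s..t} \<times> {c..d}) \<phi>" "continuous_on ({s..t} \<times> {c..d}) \<phi>t" "continuous_on ({s..t} \<times> {c..d}) \<phi>x"
    using test unfolding space_time_test_def by (blast intro: continuous_on_subset)+
  note time = box_parts_time[OF test box(1,2,3,5)]
  note space = box_parts_space[OF test box(1,3,4,5)]
  have in_dom: "r \<ge> 0" "y \<in> \<Omega>" if "r \<in> {s..t}" "y \<in> {c..d}" for r y using that box by auto
  have "box_integral s t c d (\<lambda>p. v p * \<phi>t p) = - box_integral s t c d (\<lambda>p. v\<^sub>t p * \<phi> p)"
    by (rule time[OF partials(1)])
  also have "box_integral s t c d (\<lambda>p. v\<^sub>t p * \<phi> p) = box_integral s t c d (\<lambda>p. u\<^sub>x p * \<phi> p)"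
  proof (rule box_integral_cong)
    fix r y assume ry: "r \<in> {s..t}" "y \<in> {c..d}"
    show "v\<^sub>t (r, y) * \<phi> (r, y) = u\<^sub>x (r, y) * \<phi> (r, y)" by (simp only: equations(1)[OF in_dom[OF ry]])
  qed
  also have "- box_integral s t c d (\<lambda>p. u\<^sub>x p * \<phi> p) = box_integral s t c d (\<lambda>p. u p * \<phi>x p)"
    using space[OF cont(4,6), OF D_space(2)] by (rule sym)
  finally show "box_integral s t c d (\<lambda>p. v p * \<phi>t p) = box_integral s t c d (\<lambda>p. u p * \<phi>x p)" .
  have A1: "box_integral s t c d (\<lambda>p. u p * \<phi>t p) = - box_integral s t c d (\<lambda>p. u\<^sub>t p * \<phi> p)"
    by (rule time[OF partials(2)])
  have A2: "box_integral s t c d (\<lambda>p. pressure a \<gamma> (v p) * \<phi>x p) = - box_integral s t c d (\<lambda>p. p\<^sub>x p * \<phi> p)"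
  proof (rule box_parts_space[where w = "\<lambda>p. pressure a \<gamma> (v p)" and wx = "\<lambda>p. p\<^sub>x p", OF test box(1,3,4,5) cont_pressure])
    show "((\<lambda>y. pressure a \<gamma> (v (r, y))) has_real_derivative p\<^sub>x (r, y)) (at y)" if "r \<ge> 0" "y \<in> \<Omega>" for r y
      using that by (rule D_pressure)
  qed
  have "box_integral s t c d (\<lambda>p. u p * \<phi>t p + pressure a \<gamma> (v p) * \<phi>x p)
      = box_integral s t c d (\<lambda>p. u p * \<phi>t p) + box_integral s t c d (\<lambda>p. pressure a \<gamma> (v p) * \<phi>x p)"
    by (intro box_integral_add continuous_on_mult cb cont cont_pressure c\<phi>)
  also have "\<dots> = - (box_integral s t c d (\<lambda>p. u\<^sub>t p * \<phi> p) + box_integral s t c d (\<lambda>p. p\<^sub>x p * \<phi> p))"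
    unfolding A1 A2 by (simp only: minus_add_distrib)
  also have "box_integral s t c d (\<lambda>p. u\<^sub>t p * \<phi> p) + box_integral s t c d (\<lambda>p. p\<^sub>x p * \<phi> p)
      = box_integral s t c d (\<lambda>p. u\<^sub>t p * \<phi> p + p\<^sub>x p * \<phi> p)"
    by (intro box_integral_add[symmetric] continuous_on_mult[OF cb[OF cont(5)]] continuous_on_mult[OF cb[OF cont_pressure(2)]] c\<phi>)
  also have "\<dots> = box_integral s t c d (\<lambda>p. S\<^sub>x p * \<phi> p)"
  proof (rule box_integral_cong)
    fix r y assume ry: "r \<in> {s..t}" "y \<in> {c..d}"
    show "u\<^sub>t (r, y) * \<phi> (r, y) + p\<^sub>x (r, y) * \<phi> (r, y) = S\<^sub>x (r, y) * \<phi> (r, y)"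
      by (simp only: equations(2)[OF in_dom[OF ry], symmetric] ring_distribs)
  qed
  also have "- box_integral s t c d (\<lambda>p. S\<^sub>x p * \<phi> p) = box_integral s t c d (\<lambda>p. S p * \<phi>x p)"
    using space[OF cont(7,9), OF D_space(3)] by (rule sym)
  finally show "box_integral s t c d (\<lambda>p. u p * \<phi>t p + pressure a \<gamma> (v p) * \<phi>x p) = box_integral s t c d (\<lambda>p. S p * \<phi>x p)" .
qed

text \<open>The term \<open>\<tau> S\<^sub>t\<close> is integrated by parts in time; \<open>\<tau> \<bar>S\<bar> \<le> sqrt \<tau> / 2\<close> makes all the
  remaining terms vanish with \<open>\<tau>\<close>.\<close>

lemma S_relaxation_estimate:
  assumes st: "0 \<le> s" "s \<le> t" and x: "x \<in> \<Omega>"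
    and D: "\<And>r. r \<in> {s..t} \<Longrightarrow> (\<psi> has_real_derivative \<psi>t r) (at r within {s..t})"
    and c\<psi>: "continuous_on {s..t} \<psi>t"
    and bound: "\<And>r. r \<in> {s..t} \<Longrightarrow> \<bar>\<psi> r\<bar> \<le> B" "\<And>r. r \<in> {s..t} \<Longrightarrow> \<bar>\<psi>t r\<bar> \<le> B"
  shows "\<bar>integral {s..t} (\<lambda>r. S (r, x) * \<psi> r) - integral {s..t} (\<lambda>r. \<mu> * u\<^sub>x (r, x) / v (r, x) * \<psi> r)\<bar>
    \<le> sqrt \<tau> * (2 * B + 2 * B * (t - s))"
proof -
  have c: "continuous_on {s..t} (\<lambda>r. f (r, x))" if "continuous_on ({0..} \<times> \<Omega>) f" for f :: "real \<times> real \<Rightarrow> real"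
    by (rule continuous_on_compose2[OF that]) (use st x in \<open>auto intro!: continuous_intros\<close>)
  have c\<psi>0: "continuous_on {s..t} \<psi>" using D by (rule DERIV_continuous_on)
  have nonneg: "r \<ge> 0" if "r \<in> {s..t}" for r using that st by simp
  have v: "1 / 2 \<le> v (r, x)" if "r \<in> {s..t}" for r using v_bounds[OF nonneg[OF that] x] by simp
  have v0: "v (r, x) \<noteq> 0" if "r \<in> {s..t}" for r using v[OF that] by auto
  have B: "0 \<le> B" using bound(1)[of s] st by (auto intro: order_trans[OF abs_ge_zero])
  have \<tau>S: "\<tau> * \<bar>S (r, x)\<bar> \<le> sqrt \<tau> / 2" if "r \<in> {s..t}" for r
  proof -
    have "sqrt \<tau> * (sqrt \<tau> * \<bar>S (r, x)\<bar>) \<le> sqrt \<tau> * (1 / 2)"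
      using C1_bounds(5)[OF nonneg[OF that] x] \<tau>_pos by (intro mult_left_mono) auto
    then show ?thesis using \<tau>_pos by (simp flip: mult.assoc)
  qed
  have inv: "1 / v (r, x) \<le> 2" "0 \<le> 1 / v (r, x)" if "r \<in> {s..t}" for r
    using v[OF that] by (auto simp: field_simps)
  \<comment> \<open>Dividing the third equation by v shows that S - \<mu> u_x / v equals -\<tau> S_t
    / v. Multiplied by \<psi>, this is the derivative of -\<tau> G plus \<open>R1\<close> minus
    \<open>R2\<close>, the terms that come from differentiating \<psi> and 1 / v.\<close>
  define G where "G r = S (r, x) * \<psi> r / v (r, x)" for r
  define R1 where "R1 r = \<tau> * (S (r, x) * \<psi>t r / v (r, x))" for r
  define R2 where "R2 r = \<tau> * (S (r, x) * \<psi> r * v\<^sub>t (r, x) / (v (r, x) * v (r, x)))" for r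
  have prod: "\<tau> * \<bar>S (r, x)\<bar> * (b * (1 / v (r, x))) \<le> sqrt \<tau> / 2 * (B * 2)" if "r \<in> {s..t}" "0 \<le> b" "b \<le> B" for r b
    using \<tau>S[OF that(1)] inv[OF that(1)] that B \<tau>_pos by (intro mult_mono) auto
  have G_bound: "\<bar>\<tau> * G r\<bar> \<le> sqrt \<tau> * B" if r: "r \<in> {s..t}" for r
    using prod[OF r abs_ge_zero bound(1)[OF r]] v[OF r] \<tau>_pos by (simp add: G_def abs_mult abs_divide mult.assoc)
  have R1_bound: "\<bar>R1 r\<bar> \<le> sqrt \<tau> * B" if r: "r \<in> {s..t}" for r
    using prod[OF r abs_ge_zero bound(2)[OF r]] v[OF r] \<tau>_pos by (simp add: R1_def abs_mult abs_divide mult.assoc)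
  have R2_bound: "\<bar>R2 r\<bar> \<le> sqrt \<tau> * B" if r: "r \<in> {s..t}" for r
  proof -
    have "\<bar>v\<^sub>t (r, x)\<bar> \<le> 1 / 2" using equations(1)[OF nonneg[OF r] x] C1_bounds(4)[OF nonneg[OF r] x] by simp
    then have "\<bar>v\<^sub>t (r, x)\<bar> * (1 / v (r, x)) \<le> 1 / 2 * 2" using inv[OF r] by (intro mult_mono) auto
    then have "\<tau> * \<bar>S (r, x)\<bar> * (\<bar>\<psi> r\<bar> * (1 / v (r, x))) * (\<bar>v\<^sub>t (r, x)\<bar> * (1 / v (r, x))) \<le> (sqrt \<tau> / 2 * (B * 2)) * (1 / 2 * 2)"
    proof (rule mult_mono[OF prod[OF r abs_ge_zero bound(1)[OF r]]])
      show "0 \<le> \<bar>v\<^sub>t (r, x)\<bar> * (1 / v (r, x))" by (rule mult_nonneg_nonneg[OF abs_ge_zero inv(2)[OF r]])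
    qed (use B \<tau>_pos in simp)
    moreover have "\<bar>R2 r\<bar> = \<tau> * \<bar>S (r, x)\<bar> * (\<bar>\<psi> r\<bar> * (1 / v (r, x))) * (\<bar>v\<^sub>t (r, x)\<bar> * (1 / v (r, x)))"
      using v[OF r] \<tau>_pos by (simp add: R2_def abs_mult abs_divide)
    ultimately show ?thesis by simp
  qed
  have "((\<lambda>r. S (r, x) * \<psi> r - \<mu> * u\<^sub>x (r, x) / v (r, x) * \<psi> r - R1 r + R2 r) has_integral (- \<tau> * G t) - (- \<tau> * G s)) {s..t}"
  proof (rule fundamental_theorem_of_calculus[OF st(2)])
    fix r assume r: "r \<in> {s..t}"
    have DS: "((\<lambda>r. S (r, x)) has_real_derivative S\<^sub>t (r, x)) (at r within {s..t})"
      and Dv: "((\<lambda>r. v (r, x)) has_real_derivative v\<^sub>t (r, x)) (at r within {s..t})"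
      by (rule DERIV_subset[OF D_time(3)] DERIV_subset[OF D_time(1)]; use nonneg r st x in auto)+
    have \<tau>S\<^sub>t: "\<tau> * S\<^sub>t (r, x) = \<mu> * u\<^sub>x (r, x) - v (r, x) * S (r, x)" using equations(3)[OF nonneg[OF r] x] by simp
    have alg: "- \<tau> * (((s' * p + q * z) * w - z * p * w') / (w * w)) = - (\<tau> * s') * (p / w) - \<tau> * (z * q / w) + \<tau> * (z * p * w' / (w * w))"
      if "w \<noteq> 0" for s' p q z w w' :: real
      using that by (simp add: diff_divide_distrib add_divide_distrib ring_distribs) (simp add: mult.commute mult.left_commute)
    have eq: "- \<tau> * (((S\<^sub>t (r, x) * \<psi> r + \<psi>t r * S (r, x)) * v (r, x) - S (r, x) * \<psi> r * v\<^sub>t (r, x)) / (v (r, x) * v (r, x)))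
        = S (r, x) * \<psi> r - \<mu> * u\<^sub>x (r, x) / v (r, x) * \<psi> r - R1 r + R2 r"
      unfolding alg[OF v0[OF r]] \<tau>S\<^sub>t R1_def R2_def using v0[OF r] by (simp add: left_diff_distrib diff_divide_distrib)
    have "((\<lambda>r. - \<tau> * G r) has_real_derivative
        - \<tau> * (((S\<^sub>t (r, x) * \<psi> r + \<psi>t r * S (r, x)) * v (r, x) - S (r, x) * \<psi> r * v\<^sub>t (r, x)) / (v (r, x) * v (r, x)))) (at r within {s..t})"
      unfolding G_def by (intro DERIV_cmult DERIV_divide DERIV_mult DS D r Dv v0)
    then show "((\<lambda>r. - \<tau> * G r) has_vector_derivative S (r, x) * \<psi> r - \<mu> * u\<^sub>x (r, x) / v (r, x) * \<psi> r - R1 r + R2 r) (at r within {s..t})"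
      unfolding eq has_real_derivative_iff_has_vector_derivative .
  qed
  then have total: "integral {s..t} (\<lambda>r. S (r, x) * \<psi> r - \<mu> * u\<^sub>x (r, x) / v (r, x) * \<psi> r - R1 r + R2 r) = \<tau> * G s - \<tau> * G t"
    by (simp add: integral_unique)
  have cR: "continuous_on {s..t} R1" "continuous_on {s..t} R2"
    unfolding R1_def R2_def by (intro continuous_intros c cont c\<psi> c\<psi>0; use v0 in auto)+
  have cA: "continuous_on {s..t} (\<lambda>r. S (r, x) * \<psi> r)" "continuous_on {s..t} (\<lambda>r. \<mu> * u\<^sub>x (r, x) / v (r, x) * \<psi> r)"
    by (intro continuous_intros c cont c\<psi>0; use v0 in auto)+
  have split: "integral {s..t} (\<lambda>r. S (r, x) * \<psi> r - \<mu> * u\<^sub>x (r, x) / v (r, x) * \<psi> r - R1 r + R2 r)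
      = integral {s..t} (\<lambda>r. S (r, x) * \<psi> r) - integral {s..t} (\<lambda>r. \<mu> * u\<^sub>x (r, x) / v (r, x) * \<psi> r)
        - integral {s..t} R1 + integral {s..t} R2"
  proof -
    have "integral {s..t} (\<lambda>r. f r - g r - h r + k r) = integral {s..t} f - integral {s..t} g - integral {s..t} h + integral {s..t} k"
      if "f integrable_on {s..t}" "g integrable_on {s..t}" "h integrable_on {s..t}" "k integrable_on {s..t}" for f g h k :: "real \<Rightarrow> real"
      using that by (simp add: Henstock_Kurzweil_Integration.integral_add Henstock_Kurzweil_Integration.integral_diff
          Henstock_Kurzweil_Integration.integrable_diff)
    from this[OF integrable_continuous_real[OF cA(1)] integrable_continuous_real[OF cA(2)]
        integrable_continuous_real[OF cR(1)] integrable_continuous_real[OF cR(2)]]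
    show ?thesis .
  qed
  have RI: "\<bar>integral {s..t} R\<bar> \<le> sqrt \<tau> * B * (t - s)" if "continuous_on {s..t} R" "\<And>r. r \<in> {s..t} \<Longrightarrow> \<bar>R r\<bar> \<le> sqrt \<tau> * B" for R
  proof -
    have "norm (integral {s..t} R) \<le> integral {s..t} (\<lambda>r. sqrt \<tau> * B)"
      by (rule integral_norm_bound_integral) (use that in \<open>auto intro: integrable_continuous_real\<close>)
    then show ?thesis using st by (simp add: ac_simps)
  qed
  have G: "\<bar>\<tau> * G s\<bar> \<le> sqrt \<tau> * B" "\<bar>\<tau> * G t\<bar> \<le> sqrt \<tau> * B" using G_bound st by auto
  \<comment> \<open>Two boundary values and two remainder integrals make up the two parts of the
    bound.\<close>
  have "\<bar>p - q\<bar> \<le> 2 * b + 2 * e"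
    if "p - q - r1 + r2 = gs - gt" "\<bar>gs\<bar> \<le> b" "\<bar>gt\<bar> \<le> b" "\<bar>r1\<bar> \<le> e" "\<bar>r2\<bar> \<le> e"
    for p q r1 r2 gs gt b e :: real
    using that by linarith
  from this[OF total[unfolded split] G RI[OF cR(1) R1_bound] RI[OF cR(2) R2_bound]]
  show ?thesis by (simp only: ring_distribs ac_simps)
qed

text \<open>The estimate on time segments is integrated over space, so the time integral has to be
  moved inside first.\<close>

lemma S_box_estimate:
  assumes box: "0 \<le> s" "s \<le> t" "\<alpha> < c" "c \<le> d" "d < \<beta>"
    and c\<psi>: "continuous_on ({s..t} \<times> {c..d}) \<psi>" "continuous_on ({s..t} \<times> {c..d}) \<psi>t"
    and D: "\<And>r y. r \<in> {s..t} \<Longrightarrow> y \<in> {c..d} \<Longrightarrow> ((\<lambda>r. \<psi> (r, y)) has_real_derivative \<psi>t (r, y)) (at r within {s..t})"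
    and bound: "\<And>p. p \<in> {s..t} \<times> {c..d} \<Longrightarrow> \<bar>\<psi> p\<bar> \<le> B" "\<And>p. p \<in> {s..t} \<times> {c..d} \<Longrightarrow> \<bar>\<psi>t p\<bar> \<le> B"
  shows "\<bar>box_integral s t c d (\<lambda>p. S p * \<psi> p) - box_integral s t c d (\<lambda>p. \<mu> * u\<^sub>x p / v p * \<psi> p)\<bar>
    \<le> sqrt \<tau> * ((2 * B + 2 * B * (t - s)) * (d - c))"
proof -
  have sub: "{s..t} \<times> {c..d} \<subseteq> {0..} \<times> \<Omega>" using box by auto
  have cb: "continuous_on ({s..t} \<times> {c..d}) f" if "continuous_on ({0..} \<times> \<Omega>) f" for f :: "real \<times> real \<Rightarrow> real"
    using that sub by (rule continuous_on_subset)
  have v0: "\<forall>p\<in>{s..t} \<times> {c..d}. v p \<noteq> 0"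
  proof
    fix p assume "p \<in> {s..t} \<times> {c..d}"
    then have "v (fst p, snd p) > 0" using box by (intro v_pos) auto
    then show "v p \<noteq> 0" by simp
  qed
  have c1: "continuous_on ({s..t} \<times> {c..d}) (\<lambda>p. S p * \<psi> p)"
    by (rule continuous_on_mult[OF cb[OF cont(7)] c\<psi>(1)])
  have c2: "continuous_on ({s..t} \<times> {c..d}) (\<lambda>p. \<mu> * u\<^sub>x p / v p * \<psi> p)"
    by (rule continuous_on_mult[OF continuous_on_divide[OF continuous_on_mult[OF continuous_on_const cb[OF cont(6)]] cb[OF cont(1)] v0] c\<psi>(1)])
  let ?I = "\<lambda>h y. integral {s..t} (\<lambda>r. h (r, y))"
  have ci: "continuous_on {c..d} (?I h)" if h: "continuous_on ({s..t} \<times> {c..d}) h" for h :: "real \<times> real \<Rightarrow> real"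
  proof -
    have "continuous_on ({c..d} \<times> {s..t}) (\<lambda>q. h (snd q, fst q))"
      by (rule continuous_on_compose2[OF h]) (auto intro!: continuous_intros)
    from continuous_on_integral_section[OF this] show ?thesis by simp
  qed
  have eq: "box_integral s t c d (\<lambda>p. S p * \<psi> p) - box_integral s t c d (\<lambda>p. \<mu> * u\<^sub>x p / v p * \<psi> p)
      = integral {c..d} (\<lambda>y. ?I (\<lambda>p. S p * \<psi> p) y - ?I (\<lambda>p. \<mu> * u\<^sub>x p / v p * \<psi> p) y)"
    unfolding box_integral_swap[OF c1] box_integral_swap[OF c2]
    by (rule Henstock_Kurzweil_Integration.integral_diff[OF integrable_continuous_real[OF ci[OF c1]] integrable_continuous_real[OF ci[OF c2]], symmetric])
  have "norm (integral {c..d} (\<lambda>y. ?I (\<lambda>p. S p * \<psi> p) y - ?I (\<lambda>p. \<mu> * u\<^sub>x p / v p * \<psi> p) y)) \<le> integral {c..d} (\<lambda>y. sqrt \<tau> * (2 * B + 2 * B * (t - s)))"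
  proof (rule integral_norm_bound_integral)
    show "(\<lambda>y. ?I (\<lambda>p. S p * \<psi> p) y - ?I (\<lambda>p. \<mu> * u\<^sub>x p / v p * \<psi> p) y) integrable_on {c..d}"
      by (rule integrable_continuous_real[OF continuous_on_diff[OF ci[OF c1] ci[OF c2]]])
    fix y assume y: "y \<in> {c..d}"
    have cy: "continuous_on {s..t} (\<lambda>r. \<psi>t (r, y))" by (rule continuous_on_section(2)[OF c\<psi>(2) y])
    have Dy: "((\<lambda>r. \<psi> (r, y)) has_real_derivative \<psi>t (r, y)) (at r within {s..t})" if "r \<in> {s..t}" for r
      by (rule D[OF that y])
    have By: "\<bar>\<psi> (r, y)\<bar> \<le> B" "\<bar>\<psi>t (r, y)\<bar> \<le> B" if "r \<in> {s..t}" for r using that y by (simp_all add: bound)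
    have "y \<in> \<Omega>" using y box by auto
    note est = S_relaxation_estimate[of s t y "\<lambda>r. \<psi> (r, y)" "\<lambda>r. \<psi>t (r, y)" B, OF box(1,2) this Dy cy By]
    show "norm (?I (\<lambda>p. S p * \<psi> p) y - ?I (\<lambda>p. \<mu> * u\<^sub>x p / v p * \<psi> p) y) \<le> sqrt \<tau> * (2 * B + 2 * B * (t - s))"
      using est by simp
  qed (rule integrable_continuous_real[OF continuous_on_const])
  also have "\<dots> = sqrt \<tau> * ((2 * B + 2 * B * (t - s)) * (d - c))" using box by simp
  finally show ?thesis unfolding eq real_norm_def .
qed

end

section \<open>The relaxation limit\<close>


lemma (in bounded_interval) H_space_mono:
  assumes "k \<le> m" "f \<in> H_space \<Omega> m" shows "f \<in> H_space \<Omega> k"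
  using assms by (auto simp: H_space_def)

text \<open>Pointwise convergence of \<open>v\<close> and \<open>u\<close> is the only compactness
  assumed; the behaviour of u_x, of \<open>S\<close> and of the data follows for the same sequence,
  with no further extraction.\<close>

locale relaxation_limit = bounded_interval +
  fixes \<mu> a \<gamma> C \<epsilon> :: real and \<tau> :: "nat \<Rightarrow> real" and v\<^sub>0 u\<^sub>0 S\<^sub>0 :: "nat \<Rightarrow> real \<Rightarrow> real"
    and v u S :: "nat \<Rightarrow> real \<times> real \<Rightarrow> real" and v' u' :: "real \<times> real \<Rightarrow> real"
  assumes solution: "\<And>n. relaxed_solution \<alpha> \<beta> \<mu> a \<gamma> C (\<tau> n) \<epsilon> (v\<^sub>0 n) (u\<^sub>0 n) (S\<^sub>0 n) (v n) (u n) (S n)"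
    and \<tau>_lim: "\<tau> \<longlonglongrightarrow> 0"
    and v_lim: "\<And>t x. t \<ge> 0 \<Longrightarrow> x \<in> \<Omega> \<Longrightarrow> (\<lambda>n. v n (t, x)) \<longlonglongrightarrow> v' (t, x)"
    and u_lim: "\<And>t x. t \<ge> 0 \<Longrightarrow> x \<in> \<Omega> \<Longrightarrow> (\<lambda>n. u n (t, x)) \<longlonglongrightarrow> u' (t, x)"
begin

abbreviation "K \<equiv> relaxed_solution.K C \<epsilon>"

lemmas cont_n = relaxed_solution.cont[OF solution]
lemmas D_space_n = relaxed_solution.D_space[OF solution]
lemmas C1_bounds_n = relaxed_solution.C1_bounds[OF solution]
lemmas v_bounds_n = relaxed_solution.v_bounds[OF solution]
lemmas K_pos = relaxed_solution.K_pos[OF solution]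

lemma \<mu>_pos: "\<mu> > 0" and a_pos: "a > 0" and \<gamma>_gt_1: "\<gamma> > 1"
  using relaxed_solution.\<mu>_pos[OF solution] relaxed_solution.a_pos[OF solution] relaxed_solution.\<gamma>_gt_1[OF solution] .

lemma v'_bounds: "t \<ge> 0 \<Longrightarrow> x \<in> \<Omega> \<Longrightarrow> 1 / 2 \<le> v' (t, x) \<and> v' (t, x) \<le> 3 / 2"
proof -
  assume tx: "t \<ge> 0" "x \<in> \<Omega>"
  have "1 / 2 \<le> v n (t, x)" "v n (t, x) \<le> 3 / 2" for n using v_bounds_n[OF tx, of n] by auto
  then show ?thesis
    using LIMSEQ_le_const[OF v_lim[OF tx], of "1 / 2"] LIMSEQ_le_const2[OF v_lim[OF tx], of "3 / 2"] by blast
qed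

text \<open>The derivatives \<open>u\<^sub>x\<close> are equi-Hoelder continuous in space; comparing with difference
  quotients of the convergent sequence \<open>u\<close> shows that they converge as well.\<close>

lemma u\<^sub>x_convergent:
  assumes t: "t \<ge> 0" and x: "x \<in> \<Omega>"
  shows "convergent (\<lambda>n. space_partial \<Omega> (u n) (t, x))"
proof (rule Cauchy_convergent, rule metric_CauchyI)
  fix e :: real assume e: "e > 0"
  \<comment> \<open>The first term keeps \<open>x + h\<close> inside \<Omega>; the second makes the
    Hoelder bound \<open>sqrt h * K\<close> at most e / 4.\<close>
  define h where "h = min ((\<beta> - x) / 2) ((e / (4 * K))\<^sup>2)"
  have h: "h > 0" using x e K_pos by (simp add: h_def)
  have xh: "x + h \<in> \<Omega>"
  proof -
    have "h \<le> (\<beta> - x) / 2" unfolding h_def by (rule min.cobounded1)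
    then have "x + h < \<beta>" using x by simp
    then show ?thesis using x h by simp
  qed
  have hK: "sqrt h * K \<le> e / 4"
  proof -
    have "sqrt h \<le> sqrt ((e / (4 * K))\<^sup>2)" unfolding h_def by (intro real_sqrt_le_mono min.cobounded2)
    also have "\<dots> = e / (4 * K)" using e K_pos by simp
    finally have "sqrt h * K \<le> e / (4 * K) * K" using K_pos by (intro mult_right_mono) auto
    then show ?thesis using K_pos by simp
  qed
  let ?q = "\<lambda>n. (u n (t, x + h) - u n (t, x)) / h"
  have diff: "\<bar>?q n - space_partial \<Omega> (u n) (t, x)\<bar> \<le> e / 4" for n
  proof -
    have "\<exists>z>x. z < x + h \<and> u n (t, x + h) - u n (t, x) = (x + h - x) * space_partial \<Omega> (u n) (t, z)"
    proof (rule MVT2)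
      show "((\<lambda>y. u n (t, y)) has_real_derivative space_partial \<Omega> (u n) (t, z)) (at z)" if "x \<le> z" "z \<le> x + h" for z
        by (rule D_space_n(2)[OF t]) (use that x xh in auto)
    qed (use h in simp)
    then obtain z where z: "x < z" "z < x + h" and eq: "u n (t, x + h) - u n (t, x) = (x + h - x) * space_partial \<Omega> (u n) (t, z)"
      by blast
    have "?q n = space_partial \<Omega> (u n) (t, z)" using eq h by simp
    moreover have "\<bar>space_partial \<Omega> (u n) (t, z) - space_partial \<Omega> (u n) (t, x)\<bar> \<le> sqrt \<bar>z - x\<bar> * K"
      by (rule relaxed_solution.u\<^sub>x_hoelder[OF solution t x]) (use z x xh in auto)
    moreover have "sqrt \<bar>z - x\<bar> * K \<le> sqrt h * K"
      using z K_pos by (intro mult_right_mono real_sqrt_le_mono) auto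
    ultimately show ?thesis using hK by simp
  qed
  have "?q \<longlonglongrightarrow> (u' (t, x + h) - u' (t, x)) / h"
    using h by (intro tendsto_intros u_lim t x xh) simp
  then have "Cauchy ?q" by (rule LIMSEQ_imp_Cauchy)
  then obtain M where M: "\<forall>m\<ge>M. \<forall>n\<ge>M. dist (?q m) (?q n) < e / 4"
    using metric_CauchyD[of ?q "e / 4"] e by auto
  have "dist (space_partial \<Omega> (u m) (t, x)) (space_partial \<Omega> (u n) (t, x)) < e" if "m \<ge> M" "n \<ge> M" for m n
  proof -
    have "dist (?q m) (?q n) < e / 4" using M that by blast
    then show ?thesis using diff[of m] diff[of n] e unfolding dist_real_def by linarith
  qed
  then show "\<exists>M. \<forall>m\<ge>M. \<forall>n\<ge>M. dist (space_partial \<Omega> (u m) (t, x)) (space_partial \<Omega> (u n) (t, x)) < e" by blast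
qed

text \<open>The pointwise limit of the classical space derivatives. It has a value at every point,
  which is convenient under box integrals; \<open>wderiv_limit\<close> ties it to the weak
  derivative that the theorem mentions.\<close>

definition q :: "real \<times> real \<Rightarrow> real" where
  "q p = lim (\<lambda>n. space_partial \<Omega> (u n) p)"

lemma q_lim: "t \<ge> 0 \<Longrightarrow> x \<in> \<Omega> \<Longrightarrow> (\<lambda>n. space_partial \<Omega> (u n) (t, x)) \<longlonglongrightarrow> q (t, x)"
  using u\<^sub>x_convergent[of t x] by (simp add: q_def convergent_LIMSEQ_iff)

text \<open>Both sides of the test identity for \<open>u n\<close> converge by dominated
  convergence, since the solutions and their space derivatives are bounded by 1.\<close>

lemma limit_weak_deriv:
  assumes t: "t \<ge> 0"
  shows "has_weak_deriv \<Omega> 1 (\<lambda>x. u' (t, x)) (\<lambda>x. q (t, x))"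
proof -
  let ?M = "lebesgue_on \<Omega>"
  have meas: "(\<lambda>x. f n (t, x)) \<in> borel_measurable ?M" if "\<And>n. continuous_on ({0..} \<times> \<Omega>) (f n)" for f :: "nat \<Rightarrow> real \<times> real \<Rightarrow> real" and n
    by (rule continuous_imp_measurable_on_sets_lebesgue[OF relaxed_solution.section_continuous[OF solution that t]]) simp
  have meas_lim: "(\<lambda>x. g (t, x)) \<in> borel_measurable ?M"
    if "\<And>n. continuous_on ({0..} \<times> \<Omega>) (f n)" "\<And>x. x \<in> \<Omega> \<Longrightarrow> (\<lambda>n. f n (t, x)) \<longlonglongrightarrow> g (t, x)" for f :: "nat \<Rightarrow> real \<times> real \<Rightarrow> real" and g
  proof (rule borel_measurable_LIMSEQ_metric[where f = "\<lambda>n x. f n (t, x)"])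
    show "(\<lambda>x. f n (t, x)) \<in> borel_measurable ?M" for n by (rule meas[of f n]) (rule that(1))
    show "(\<lambda>n. f n (t, x)) \<longlonglongrightarrow> g (t, x)" if "x \<in> space ?M" for x
      by (rule \<open>\<And>x. x \<in> \<Omega> \<Longrightarrow> (\<lambda>n. f n (t, x)) \<longlonglongrightarrow> g (t, x)\<close>) (use that in simp)
  qed
  have loc: "locally_integrable \<Omega> (\<lambda>x. g (t, x))"
    if "(\<lambda>x. g (t, x)) \<in> borel_measurable ?M" "\<And>x. x \<in> \<Omega> \<Longrightarrow> \<bar>g (t, x)\<bar> \<le> 1" for g
  proof (rule L2_locally_integrable)
    have "integrable ?M (\<lambda>x. (g (t, x))\<^sup>2)"
    proof (rule finite_measure.integrable_const_bound[OF finite_measure_\<Omega>, of _ 1])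
      show "AE x in ?M. norm ((g (t, x))\<^sup>2) \<le> 1"
        using AE_\<Omega> by eventually_elim (use that(2) in \<open>simp add: abs_square_le_1\<close>)
      show "(\<lambda>x. (g (t, x))\<^sup>2) \<in> borel_measurable ?M" using that(1) by (rule borel_measurable_power)
    qed
    then show "(\<lambda>x. g (t, x)) \<in> L2_space \<Omega>" using that(1) by (simp add: L2_space_def)
  qed
  have dom: "(\<lambda>n. integral\<^sup>L ?M (\<lambda>x. f n (t, x) * \<psi> x)) \<longlonglongrightarrow> integral\<^sup>L ?M (\<lambda>x. g (t, x) * \<psi> x)"
    if c: "\<And>n. continuous_on ({0..} \<times> \<Omega>) (f n)" and l: "\<And>x. x \<in> \<Omega> \<Longrightarrow> (\<lambda>n. f n (t, x)) \<longlonglongrightarrow> g (t, x)"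
      and b: "\<And>n x. x \<in> \<Omega> \<Longrightarrow> \<bar>f n (t, x)\<bar> \<le> 1" and \<psi>: "\<psi> \<in> test_functions \<Omega>"
    for f :: "nat \<Rightarrow> real \<times> real \<Rightarrow> real" and g \<psi>
  proof (rule integral_dominated_convergence)
    show "(\<lambda>x. g (t, x) * \<psi> x) \<in> borel_measurable ?M"
      by (rule borel_measurable_times[OF meas_lim[OF c l] test_measurable[OF \<psi>]])
    show "(\<lambda>x. f n (t, x) * \<psi> x) \<in> borel_measurable ?M" for n
      by (rule borel_measurable_times[OF meas[OF c] test_measurable[OF \<psi>]])
    show "integrable ?M (\<lambda>x. \<bar>\<psi> x\<bar>)" using L2_integrable[OF test_L2[OF \<psi>]] by simp
    show "AE x in ?M. (\<lambda>n. f n (t, x) * \<psi> x) \<longlonglongrightarrow> g (t, x) * \<psi> x"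
      using AE_\<Omega> by eventually_elim (intro tendsto_mult tendsto_const l)
    show "AE x in ?M. norm (f n (t, x) * \<psi> x) \<le> \<bar>\<psi> x\<bar>" for n
      using AE_\<Omega>
    proof eventually_elim
      case (elim x)
      show ?case using mult_right_mono[OF b[OF elim, of n] abs_ge_zero[of "\<psi> x"]] by (simp add: abs_mult)
    qed
  qed
  have bu: "\<bar>u n (t, x)\<bar> \<le> 1" and bq: "\<bar>space_partial \<Omega> (u n) (t, x)\<bar> \<le> 1" if "x \<in> \<Omega>" for n x
    using C1_bounds_n(3)[OF t that, of n] C1_bounds_n(4)[OF t that, of n] by simp_all
  have bu': "\<bar>u' (t, x)\<bar> \<le> 1" if "x \<in> \<Omega>" for x
    by (rule LIMSEQ_le_const2[OF tendsto_rabs[OF u_lim[OF t that]]]) (use bu that in auto)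
  have bq': "\<bar>q (t, x)\<bar> \<le> 1" if "x \<in> \<Omega>" for x
    by (rule LIMSEQ_le_const2[OF tendsto_rabs[OF q_lim[OF t that]]]) (use bq that in auto)
  show ?thesis
    unfolding has_weak_deriv_def
  proof (intro conjI ballI)
    show "locally_integrable \<Omega> (\<lambda>x. u' (t, x))"
      by (rule loc[OF meas_lim[of u u', OF cont_n(4) u_lim[OF t]] bu'])
    show "locally_integrable \<Omega> (\<lambda>x. q (t, x))"
      by (rule loc[OF meas_lim[of "\<lambda>n. space_partial \<Omega> (u n)" q, OF cont_n(6) q_lim[OF t]] bq'])
    fix \<phi> assume \<phi>: "\<phi> \<in> test_functions \<Omega>"
    have "has_weak_deriv \<Omega> 1 (\<lambda>x. u n (t, x)) (\<lambda>x. space_partial \<Omega> (u n) (t, x))" for n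
      by (rule classical_weak_deriv[OF relaxed_solution.section_continuous[OF solution cont_n(6) t] D_space_n(2)[OF t]])
    then have "integral\<^sup>L ?M (\<lambda>x. u n (t, x) * deriv \<phi> x) = - integral\<^sup>L ?M (\<lambda>x. space_partial \<Omega> (u n) (t, x) * \<phi> x)" for n
      using \<phi> by (simp add: has_weak_deriv_def)
    moreover have "(\<lambda>n. integral\<^sup>L ?M (\<lambda>x. u n (t, x) * deriv \<phi> x)) \<longlonglongrightarrow> integral\<^sup>L ?M (\<lambda>x. u' (t, x) * deriv \<phi> x)"
      by (rule dom[of u u', OF cont_n(4) u_lim[OF t] bu test_functions_deriv[OF \<phi>]])
    moreover have "(\<lambda>n. - integral\<^sup>L ?M (\<lambda>x. space_partial \<Omega> (u n) (t, x) * \<phi> x)) \<longlonglongrightarrow> - integral\<^sup>L ?M (\<lambda>x. q (t, x) * \<phi> x)"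
      by (rule tendsto_minus[OF dom[of "\<lambda>n. space_partial \<Omega> (u n)" q, OF cont_n(6) q_lim[OF t] bq \<phi>]])
    ultimately have "integral\<^sup>L ?M (\<lambda>x. u' (t, x) * deriv \<phi> x) = - integral\<^sup>L ?M (\<lambda>x. q (t, x) * \<phi> x)"
      using LIMSEQ_unique by simp
    then show "integral\<^sup>L ?M (\<lambda>x. u' (t, x) * (deriv ^^ 1) \<phi> x) = (- 1) ^ 1 * integral\<^sup>L ?M (\<lambda>x. q (t, x) * \<phi> x)"
      by simp
  qed
qed

lemma wderiv_limit:
  assumes "t \<ge> 0"
  shows "AE x in lebesgue_on \<Omega>. wderiv \<Omega> 1 (\<lambda>y. u' (t, y)) x = q (t, x)"
  by (rule wderiv_AE[OF limit_weak_deriv[OF assms]])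

text \<open>Available at every time, t = 0 included, because the energy bound and the pointwise
  convergence are.\<close>

lemma weak_at_time:
  assumes t: "t \<ge> 0"
  shows "weakly_converges (H_space \<Omega> 2) (H_norm \<Omega> 2) (\<lambda>n x. v n (t, x)) (\<lambda>x. v' (t, x))"
    "H_norm \<Omega> 2 (\<lambda>x. v' (t, x)) \<le> K + H_norm \<Omega> 2 (\<lambda>x. 1)"
    "weakly_converges (H_space \<Omega> 2) (H_norm \<Omega> 2) (\<lambda>n x. u n (t, x)) (\<lambda>x. u' (t, x))"
    "H_norm \<Omega> 2 (\<lambda>x. u' (t, x)) \<le> K"
proof -
  have bv: "\<bar>v n (t, x)\<bar> \<le> 3 / 2" if "x \<in> \<Omega>" for n x using v_bounds_n[OF t that, of n] by auto
  note V = H_weak_limit_pointwise[of "\<lambda>n x. v n (t, x)" 2 "K + H_norm \<Omega> 2 (\<lambda>x. 1)" "3 / 2" "\<lambda>x. v' (t, x)",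
    OF relaxed_solution.v_in_H2[OF solution t] relaxed_solution.v_H2_bound[OF solution t] bv v_lim[OF t]]
  note U = H_weak_limit_pointwise[of "\<lambda>n x. u n (t, x)" 2 K "1 / 2" "\<lambda>x. u' (t, x)",
    OF relaxed_solution.in_H2(2)[OF solution t] relaxed_solution.H2_bounds(2)[OF solution t] C1_bounds_n(3)[OF t] u_lim[OF t]]
  show "weakly_converges (H_space \<Omega> 2) (H_norm \<Omega> 2) (\<lambda>n x. v n (t, x)) (\<lambda>x. v' (t, x))" by (rule V(1))
  show "H_norm \<Omega> 2 (\<lambda>x. v' (t, x)) \<le> K + H_norm \<Omega> 2 (\<lambda>x. 1)" by (rule V(2))
  show "weakly_converges (H_space \<Omega> 2) (H_norm \<Omega> 2) (\<lambda>n x. u n (t, x)) (\<lambda>x. u' (t, x))" by (rule U(1))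
  show "H_norm \<Omega> 2 (\<lambda>x. u' (t, x)) \<le> K" by (rule U(2))
qed

lemma limit_in_H2:
  assumes "t \<ge> 0"
  shows "(\<lambda>x. v' (t, x)) \<in> H_space \<Omega> 2" "(\<lambda>x. u' (t, x)) \<in> H_space \<Omega> 2"
  using weak_at_time(1,3)[OF assms] by (simp_all add: weakly_converges_def)

lemma weakstar:
  "weakstar_converges_Linf_time (H_space \<Omega> 2) (H_norm \<Omega> 2) v v'"
  "weakstar_converges_Linf_time (H_space \<Omega> 2) (H_norm \<Omega> 2) u u'"
proof -
  show "weakstar_converges_Linf_time (H_space \<Omega> 2) (H_norm \<Omega> 2) v v'"
  proof (rule H.weakstar_if_weak_AE[where K = "K + H_norm \<Omega> 2 (\<lambda>x. 1)"])
    show "bochner_measurable (H_space \<Omega> 2) (H_norm \<Omega> 2) (v n)" for n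
      by (rule relaxed_solution.bochner_measurable_solution[OF solution])
    show "AE t in lebesgue_on {0<..}. H_norm \<Omega> 2 (\<lambda>x. v n (t, x)) \<le> K + H_norm \<Omega> 2 (\<lambda>x. 1)" for n
      using AE_greaterThan by eventually_elim (rule relaxed_solution.v_H2_bound[OF solution], simp)
    show "AE t in lebesgue_on {0<..}. weakly_converges (H_space \<Omega> 2) (H_norm \<Omega> 2) (\<lambda>n x. v n (t, x)) (\<lambda>x. v' (t, x)) \<and>
        H_norm \<Omega> 2 (\<lambda>x. v' (t, x)) \<le> K + H_norm \<Omega> 2 (\<lambda>x. 1)"
      using AE_greaterThan by eventually_elim (intro conjI weak_at_time(1,2); simp)
  qed
  show "weakstar_converges_Linf_time (H_space \<Omega> 2) (H_norm \<Omega> 2) u u'"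
  proof (rule H.weakstar_if_weak_AE[where K = K])
    show "bochner_measurable (H_space \<Omega> 2) (H_norm \<Omega> 2) (u n)" for n
      by (rule relaxed_solution.bochner_measurable_solution[OF solution])
    show "AE t in lebesgue_on {0<..}. H_norm \<Omega> 2 (\<lambda>x. u n (t, x)) \<le> K" for n
      using AE_greaterThan by eventually_elim (rule relaxed_solution.H2_bounds[OF solution], simp)
    show "AE t in lebesgue_on {0<..}. weakly_converges (H_space \<Omega> 2) (H_norm \<Omega> 2) (\<lambda>n x. u n (t, x)) (\<lambda>x. u' (t, x)) \<and>
        H_norm \<Omega> 2 (\<lambda>x. u' (t, x)) \<le> K"
      using AE_greaterThan by eventually_elim (intro conjI weak_at_time(3,4); simp)
  qed
qed

lemma flux_continuous:
  assumes box: "0 \<le> s" "\<alpha> < c" "d < \<beta>"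
  shows "continuous_on ({s..t} \<times> {c..d}) (\<lambda>p. \<mu> * space_partial \<Omega> (u n) p / v n p)"
proof -
  have sub: "{s..t} \<times> {c..d} \<subseteq> {0..} \<times> \<Omega>" using box by auto
  have v0: "\<forall>p\<in>{s..t} \<times> {c..d}. v n p \<noteq> 0"
  proof
    fix p assume "p \<in> {s..t} \<times> {c..d}"
    then have "1 / 2 \<le> v n (fst p, snd p)" using v_bounds_n[of "fst p" "snd p" n] box by auto
    then show "v n p \<noteq> 0" by auto
  qed
  show ?thesis
    by (rule continuous_on_divide[OF continuous_on_mult[OF continuous_on_const continuous_on_subset[OF cont_n(6) sub]]
        continuous_on_subset[OF cont_n(1) sub] v0])
qed

text \<open>The constant is \<mu> itself because |u_x| \<le> 1/2 \<le> v.\<close>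

lemma flux_bound:
  assumes "t \<ge> 0" "x \<in> \<Omega>"
  shows "\<bar>\<mu> * space_partial \<Omega> (u n) (t, x) / v n (t, x)\<bar> \<le> \<mu>"
proof -
  have v: "1 / 2 \<le> v n (t, x)" using v_bounds_n[OF assms, of n] by simp
  have "\<bar>space_partial \<Omega> (u n) (t, x)\<bar> \<le> v n (t, x)" using C1_bounds_n(4)[OF assms, of n] v by simp
  then have "\<mu> * \<bar>space_partial \<Omega> (u n) (t, x)\<bar> \<le> \<mu> * v n (t, x)" using \<mu>_pos by (intro mult_left_mono) auto
  then show ?thesis using v \<mu>_pos by (simp add: abs_mult abs_divide pos_divide_le_eq)
qed

lemma flux_lim:
  assumes "t \<ge> 0" "x \<in> \<Omega>"
  shows "(\<lambda>n. \<mu> * space_partial \<Omega> (u n) (t, x) / v n (t, x)) \<longlonglongrightarrow> \<mu> * q (t, x) / v' (t, x)"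
  using v'_bounds[OF assms] by (intro tendsto_divide tendsto_mult tendsto_const q_lim v_lim assms) auto

text \<open>By \<open>S_box_estimate\<close> the box integrals of \<open>S\<close> and of \<mu> u_x
  / v differ by a multiple of \<open>sqrt (\<tau> n)\<close>, and the latter converge by dominated
  convergence. The weight is differentiated in time only.\<close>

lemma S_box_tendsto:
  assumes box: "0 \<le> s" "s \<le> t" "\<alpha> < c" "c \<le> d" "d < \<beta>"
    and c\<psi>: "continuous_on ({s..t} \<times> {c..d}) \<psi>" "continuous_on ({s..t} \<times> {c..d}) \<psi>t"
    and D: "\<And>r y. r \<in> {s..t} \<Longrightarrow> y \<in> {c..d} \<Longrightarrow> ((\<lambda>r. \<psi> (r, y)) has_real_derivative \<psi>t (r, y)) (at r within {s..t})"
  shows "(\<lambda>n. box_integral s t c d (\<lambda>p. S n p * \<psi> p)) \<longlonglongrightarrow> box_integral s t c d (\<lambda>p. \<mu> * q p / v' p * \<psi> p)"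
proof -
  have "compact ({s..t} \<times> {c..d})" by (intro compact_Times) auto
  then have "bounded (\<psi> ` ({s..t} \<times> {c..d}))" "bounded (\<psi>t ` ({s..t} \<times> {c..d}))"
    using c\<psi> by (auto intro!: compact_imp_bounded compact_continuous_image)
  then obtain B1 B2 where "\<forall>y\<in>\<psi> ` ({s..t} \<times> {c..d}). \<bar>y\<bar> \<le> B1" "\<forall>y\<in>\<psi>t ` ({s..t} \<times> {c..d}). \<bar>y\<bar> \<le> B2"
    unfolding bounded_real by blast
  then have b: "\<bar>\<psi> p\<bar> \<le> max B1 B2" "\<bar>\<psi>t p\<bar> \<le> max B1 B2" if "p \<in> {s..t} \<times> {c..d}" for p
    using that by (meson imageI max.coboundedI1 max.coboundedI2)+
  define B where "B = max B1 B2"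
  have b: "\<bar>\<psi> p\<bar> \<le> B" "\<bar>\<psi>t p\<bar> \<le> B" if "p \<in> {s..t} \<times> {c..d}" for p
    using b[OF that] by (simp_all add: B_def)
  let ?F = "\<lambda>n. box_integral s t c d (\<lambda>p. \<mu> * space_partial \<Omega> (u n) p / v n p * \<psi> p)"
  have in_dom: "fst p \<ge> 0" "snd p \<in> \<Omega>" if "p \<in> {s..t} \<times> {c..d}" for p using that box by auto
  have F: "?F \<longlonglongrightarrow> box_integral s t c d (\<lambda>p. \<mu> * q p / v' p * \<psi> p)"
  proof (rule box_integral_tendsto[where C = "\<mu> * B"])
    show "continuous_on ({s..t} \<times> {c..d}) (\<lambda>p. \<mu> * space_partial \<Omega> (u n) p / v n p * \<psi> p)" for n
      by (rule continuous_on_mult[OF flux_continuous[OF box(1,3,5)] c\<psi>(1)])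
    fix p assume p: "p \<in> {s..t} \<times> {c..d}"
    show "(\<lambda>n. \<mu> * space_partial \<Omega> (u n) p / v n p * \<psi> p) \<longlonglongrightarrow> \<mu> * q p / v' p * \<psi> p"
      using tendsto_mult[OF flux_lim[OF in_dom[OF p]] tendsto_const[of "\<psi> p"]] by simp
    show "\<bar>\<mu> * space_partial \<Omega> (u n) p / v n p * \<psi> p\<bar> \<le> \<mu> * B" for n
      using mult_mono[OF flux_bound[OF in_dom[OF p], of n] b(1)[OF p]] \<mu>_pos unfolding abs_mult[of _ "\<psi> p"] by simp
  qed
  have "(\<lambda>n. box_integral s t c d (\<lambda>p. S n p * \<psi> p) - ?F n) \<longlonglongrightarrow> 0"
  proof (rule Lim_null_comparison)
    show "\<forall>\<^sub>F n in sequentially. norm (box_integral s t c d (\<lambda>p. S n p * \<psi> p) - ?F n)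
        \<le> sqrt (\<tau> n) * ((2 * B + 2 * B * (t - s)) * (d - c))"
      unfolding real_norm_def
      by (intro always_eventually allI relaxed_solution.S_box_estimate[OF solution box c\<psi> D b])
    have "(\<lambda>n. sqrt (\<tau> n)) \<longlonglongrightarrow> 0" using tendsto_real_sqrt[OF \<tau>_lim] by simp
    then show "(\<lambda>n. sqrt (\<tau> n) * ((2 * B + 2 * B * (t - s)) * (d - c))) \<longlonglongrightarrow> 0"
      by (rule tendsto_mult_left_zero)
  qed
  from tendsto_add[OF this F] show ?thesis by simp
qed

text \<open>Convergence of the rectangle integrals together with the L^2 bound produces the weak
  limit. It shares its rectangle integrals with \<mu> q / v', and the two are identified in stages:
  for each space interval at almost all times, then for all rational intervals at once, then almost
  everywhere in space.\<close>

lemma S_weak_limit: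
  "\<exists>S'. weakly_converges (L2_time (H_space \<Omega> 2) (H_norm \<Omega> 2)) (L2_time_norm (H_norm \<Omega> 2)) S S' \<and>
    (AE t in lebesgue_on {0<..}. AE x in lebesgue_on \<Omega>. S' (t, x) = \<mu> * wderiv \<Omega> 1 (\<lambda>y. u' (t, y)) x / v' (t, x))"
proof -
  let ?X = "H_space \<Omega> 2" and ?N = "H_norm \<Omega> 2"
  let ?g = "\<lambda>p. \<mu> * q p / v' p"
  \<comment> \<open>\<open>q\<close> and \<open>v'\<close> are known only as pointwise limits, so
    integrability of the quotient is inherited from the continuous approximations.\<close>
  have section_int: "integrable (lebesgue_on {c..d}) (\<lambda>x. ?g (t, x))" if t: "t \<ge> 0" and cd: "\<alpha> < c" "d < \<beta>" for t c d
  proof (rule integrable_dominated_convergence)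
    show m: "(\<lambda>x. \<mu> * space_partial \<Omega> (u n) (t, x) / v n (t, x)) \<in> borel_measurable (lebesgue_on {c..d})" for n
    proof -
      have "continuous_on {c..d} (\<lambda>x. \<mu> * space_partial \<Omega> (u n) (t, x) / v n (t, x))"
        using continuous_on_section(1)[OF flux_continuous[OF t cd, of t n], of t] by simp
      then show ?thesis by (rule borel_measurable_integrable[OF integrable_continuous_lebesgue_on(1)])
    qed
    show "integrable (lebesgue_on {c..d}) (\<lambda>x. \<mu>)"
      by (intro finite_measure.integrable_const finite_measure_lebesgue_on) simp
    show "AE x in lebesgue_on {c..d}. (\<lambda>n. \<mu> * space_partial \<Omega> (u n) (t, x) / v n (t, x)) \<longlonglongrightarrow> ?g (t, x)"
      by (rule AE_I2) (use flux_lim[OF t] cd in auto)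
    show "AE x in lebesgue_on {c..d}. norm (\<mu> * space_partial \<Omega> (u n) (t, x) / v n (t, x)) \<le> \<mu>" for n
      by (rule AE_I2) (use flux_bound[OF t] cd in auto)
    show "(\<lambda>x. ?g (t, x)) \<in> borel_measurable (lebesgue_on {c..d})"
      by (rule borel_measurable_LIMSEQ_metric[of "\<lambda>n x. \<mu> * space_partial \<Omega> (u n) (t, x) / v n (t, x)", OF m])
        (use flux_lim[OF t] cd in auto)
  qed
  have time_int: "integrable (lebesgue_on {s..t}) (\<lambda>r. \<integral>x. ?g (r, x) \<partial>lebesgue_on {c..d})"
    if st: "0 < s" "s < t" and cd: "\<alpha> < c" "c < d" "d < \<beta>" for s t c d
  proof (rule integrable_dominated_convergence)
    let ?G = "\<lambda>n r. integral {c..d} (\<lambda>x. \<mu> * space_partial \<Omega> (u n) (r, x) / v n (r, x))"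
    have cont: "continuous_on ({s..t} \<times> {c..d}) (\<lambda>p. \<mu> * space_partial \<Omega> (u n) p / v n p)" for n
      using st cd by (intro flux_continuous) auto
    show m: "?G n \<in> borel_measurable (lebesgue_on {s..t})" for n
      using continuous_on_integral_section[OF cont, of n] by (rule borel_measurable_integrable[OF integrable_continuous_lebesgue_on(1)])
    have lim: "(\<lambda>n. ?G n r) \<longlonglongrightarrow> (\<integral>x. ?g (r, x) \<partial>lebesgue_on {c..d})" if r: "r \<in> {s..t}" for r
    proof -
      have r0: "r \<ge> 0" using r st by simp
      have cs: "continuous_on {c..d} (\<lambda>x. \<mu> * space_partial \<Omega> (u n) (r, x) / v n (r, x))" for n
        using continuous_on_section(1)[OF cont r] by simp
      have "(\<lambda>n. \<integral>x. \<mu> * space_partial \<Omega> (u n) (r, x) / v n (r, x) \<partial>lebesgue_on {c..d}) \<longlonglongrightarrow> (\<integral>x. ?g (r, x) \<partial>lebesgue_on {c..d})"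
      proof (rule integral_dominated_convergence[where w = "\<lambda>x. \<mu>"])
        show "(\<lambda>x. ?g (r, x)) \<in> borel_measurable (lebesgue_on {c..d})"
          by (rule borel_measurable_integrable[OF section_int[OF r0 cd(1,3)]])
        show "(\<lambda>x. \<mu> * space_partial \<Omega> (u n) (r, x) / v n (r, x)) \<in> borel_measurable (lebesgue_on {c..d})" for n
          by (rule borel_measurable_integrable[OF integrable_continuous_lebesgue_on(1)[OF cs]])
        show "integrable (lebesgue_on {c..d}) (\<lambda>x. \<mu>)"
          by (intro finite_measure.integrable_const finite_measure_lebesgue_on) simp
        show "AE x in lebesgue_on {c..d}. (\<lambda>n. \<mu> * space_partial \<Omega> (u n) (r, x) / v n (r, x)) \<longlonglongrightarrow> ?g (r, x)"
          by (rule AE_I2) (use flux_lim[OF r0] cd in auto)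
        show "AE x in lebesgue_on {c..d}. norm (\<mu> * space_partial \<Omega> (u n) (r, x) / v n (r, x)) \<le> \<mu>" for n
          by (rule AE_I2) (use flux_bound[OF r0] cd in auto)
      qed
      then show ?thesis by (simp only: integrable_continuous_lebesgue_on(2)[OF cs])
    qed
    show "(\<lambda>r. \<integral>x. ?g (r, x) \<partial>lebesgue_on {c..d}) \<in> borel_measurable (lebesgue_on {s..t})"
      by (rule borel_measurable_LIMSEQ_metric[of ?G, OF m]) (use lim in auto)
    show "integrable (lebesgue_on {s..t}) (\<lambda>x. \<mu> * (d - c))"
      by (intro finite_measure.integrable_const finite_measure_lebesgue_on) simp
    show "AE r in lebesgue_on {s..t}. (\<lambda>n. ?G n r) \<longlonglongrightarrow> (\<integral>x. ?g (r, x) \<partial>lebesgue_on {c..d})"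
      by (rule AE_I2) (use lim in auto)
    show "AE r in lebesgue_on {s..t}. norm (?G n r) \<le> \<mu> * (d - c)" for n
    proof (rule AE_I2)
      fix r assume "r \<in> space (lebesgue_on {s..t})"
      then have r: "r \<in> {s..t}" "r \<ge> 0" using st by auto
      have "norm (?G n r) \<le> integral {c..d} (\<lambda>x. \<mu>)"
      proof (rule integral_norm_bound_integral)
        show "(\<lambda>x. \<mu> * space_partial \<Omega> (u n) (r, x) / v n (r, x)) integrable_on {c..d}"
          using integrable_continuous_real[OF continuous_on_section(1)[OF cont r(1)]] by simp
      qed (use flux_bound[OF r(2)] cd in auto)
      then show "norm (?G n r) \<le> \<mu> * (d - c)" using cd by (simp add: mult.commute)
    qed
  qed
  have conv: "(\<lambda>n. \<integral>r. l (\<lambda>x. S n (r, x)) \<partial>lebesgue_on {s..t}) \<longlonglongrightarrow> (\<integral>r. l (\<lambda>x. ?g (r, x)) \<partial>lebesgue_on {s..t})"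
    if l: "l \<in> interval_integrals" and st: "0 < s" "s < t" for l s t
  proof -
    obtain c d where l: "l = (\<lambda>f. integral\<^sup>L (lebesgue_on {c..d}) f)" and cd: "\<alpha> < c" "c < d" "d < \<beta>"
      using l by (auto simp: interval_integrals_def)
    \<comment> \<open>The constant weight 1, with time derivative 0, turns the weighted limit into
      plain rectangle integrals.\<close>
    have "(\<lambda>n. box_integral s t c d (\<lambda>p. S n p * 1)) \<longlonglongrightarrow> box_integral s t c d (\<lambda>p. \<mu> * q p / v' p * 1)"
      by (rule S_box_tendsto[where \<psi> = "\<lambda>p. 1" and \<psi>t = "\<lambda>p. 0"]) (use st cd in auto)
    then show ?thesis by (simp add: box_integral_def l)
  qed
  obtain S' where S': "weakly_converges (L2_time ?X ?N) (L2_time_norm ?N) S S'"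
    and eq: "\<forall>l\<in>interval_integrals. \<forall>s>0. \<forall>t>s. (\<integral>r. l (\<lambda>x. S' (r, x)) \<partial>lebesgue_on {s..t}) = (\<integral>r. l (\<lambda>x. ?g (r, x)) \<partial>lebesgue_on {s..t})"
    using H.L2_time_weak_limit[of S 2 K, OF relaxed_solution.S_L2_time(1)[OF solution] relaxed_solution.S_L2_time(2)[OF solution] conv]
    by blast
  have S'_L2: "S' \<in> L2_time ?X ?N" using S' by (simp add: weakly_converges_def)
  have AE_l: "AE r in lebesgue_on {0<..}. l (\<lambda>x. S' (r, x)) - l (\<lambda>x. ?g (r, x)) = 0" if l: "l \<in> interval_integrals" for l
  proof (rule AE_greaterThan_if_AE_Icc)
    fix s t :: real assume st: "0 < s" "s < t"
    obtain c d where lcd: "l = (\<lambda>f. integral\<^sup>L (lebesgue_on {c..d}) f)" and cd: "\<alpha> < c" "c < d" "d < \<beta>"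
      using l by (auto simp: interval_integrals_def)
    have i1: "integrable (lebesgue_on {s..t'}) (\<lambda>r. l (\<lambda>x. S' (r, x)))" if "s < t'" for t'
      by (rule H.time_functional_integrable(1)[OF S'_L2 l st(1) that])
    have i2: "integrable (lebesgue_on {s..t'}) (\<lambda>r. l (\<lambda>x. ?g (r, x)))" if "s < t'" for t'
      unfolding lcd by (rule time_int[OF st(1) that cd])
    have z: "(\<integral>r. l (\<lambda>x. S' (r, x)) - l (\<lambda>x. ?g (r, x)) \<partial>lebesgue_on {s..t'}) = 0" if "s < t'" for t'
      using i1[OF that] i2[OF that] eq l st that by simp
    show "AE r in lebesgue_on {s..t}. l (\<lambda>x. S' (r, x)) - l (\<lambda>x. ?g (r, x)) = 0"
      by (rule AE_zero_if_rational_integrals_zero[OF st(2) Bochner_Integration.integrable_diff[OF i1[OF st(2)] i2[OF st(2)]] z[OF st(2)] z])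
  qed
  have "AE r in lebesgue_on {0<..}. \<forall>l\<in>interval_integrals. l (\<lambda>x. S' (r, x)) - l (\<lambda>x. ?g (r, x)) = 0"
    using AE_l H.countable_L by (subst AE_ball_countable) auto
  then have "AE t in lebesgue_on {0<..}. AE x in lebesgue_on \<Omega>. S' (t, x) = \<mu> * wderiv \<Omega> 1 (\<lambda>y. u' (t, y)) x / v' (t, x)"
    using H.L2_time_AE_in[OF S'_L2] AE_greaterThan
  proof eventually_elim
    case (elim r)
    then have r0: "r \<ge> 0" and H2: "(\<lambda>x. S' (r, x)) \<in> H_space \<Omega> 2" by simp_all
    have "AE x in lebesgue_on \<Omega>. S' (r, x) - ?g (r, x) = 0"
    proof (rule AE_\<Omega>_if_AE_Icc)
      fix c d assume cd: "c \<in> \<rat>" "d \<in> \<rat>" "\<alpha> < c" "c < d" "d < \<beta>"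
      have i1: "integrable (lebesgue_on {c..y}) (\<lambda>x. S' (r, x))" if "y < \<beta>" for y
        by (rule locally_integrable_Icc[OF L2_locally_integrable[OF H_L2[OF H2]] cd(3) that])
      have z: "(\<integral>x. S' (r, x) - ?g (r, x) \<partial>lebesgue_on {c..y}) = 0" if "c < y" "y < \<beta>" "y \<in> \<rat>" for y
      proof -
        have "(\<lambda>f. integral\<^sup>L (lebesgue_on {c..y}) f) \<in> interval_integrals"
          unfolding interval_integrals_def using cd that by blast
        from bspec[OF elim(1) this] show ?thesis
          using i1[OF that(2)] section_int[OF r0 cd(3) that(2)] by simp
      qed
      show "AE x in lebesgue_on {c..d}. S' (r, x) - ?g (r, x) = 0"
        using cd z by (intro AE_zero_if_rational_integrals_zero Bochner_Integration.integrable_diff[OF i1 section_int[OF r0]]) auto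
    qed
    with wderiv_limit[OF r0] show ?case by eventually_elim simp
  qed
  with S' show ?thesis by blast
qed

end

section \<open>Boundary values, continuity in time and equations of the limit\<close>

context bounded_interval
begin

text \<open>The set where the two functions differ is open and null, hence empty.\<close>

lemma AE_eq_continuous:
  fixes f g :: "real \<Rightarrow> real"
  assumes "continuous_on \<Omega> f" "continuous_on \<Omega> g" "AE x in lebesgue_on \<Omega>. f x = g x" and x: "x \<in> \<Omega>"
  shows "f x = g x"
proof (rule ccontr)
  assume ne: "f x \<noteq> g x"
  let ?U = "{x \<in> \<Omega>. f x - g x \<in> - {0}}"
  have "open ?U"
    using continuous_open_preimage[of \<Omega> "\<lambda>x. f x - g x" "- {0}"] assms(1,2)
    by (simp add: continuous_on_diff vimage_def Int_def open_Compl)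
  moreover have "AE x in lebesgue. x \<in> \<Omega> \<longrightarrow> f x = g x" using assms(3) by (simp add: AE_restrict_space_iff)
  then have "AE x \<in> ?U in lebesgue. x \<in> {}" by eventually_elim simp
  ultimately have "x \<in> {}" by (rule mem_closed_if_AE_lebesgue_open[OF _ closed_empty]) (use x ne in simp)
  then show False by simp
qed

lemma H_norm_0_le:
  assumes f: "f \<in> H_space \<Omega> 0" and b: "\<And>x. x \<in> \<Omega> \<Longrightarrow> \<bar>f x\<bar> \<le> B"
  shows "H_norm \<Omega> 0 f \<le> sqrt (\<beta> - \<alpha>) * B"
proof -
  have "(\<alpha> + \<beta>) / 2 \<in> \<Omega>" using \<alpha>_less_\<beta> by (simp add: field_simps)
  from b[OF this] have B: "B \<ge> 0" by linarith
  have "AE x in lebesgue_on \<Omega>. f x = wderiv \<Omega> 0 f x" using wderiv_0_AE[OF H_L2[OF f]] by eventually_elim simp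
  from L2_norm_AE[OF H_L2[OF f] this] have "(H_norm \<Omega> 0 f)\<^sup>2 = (\<integral>x. (f x)\<^sup>2 \<partial>lebesgue_on \<Omega>)"
    by (simp add: H_norm_power2 L2_norm_power2[symmetric])
  also have "\<dots> \<le> (\<integral>x. B\<^sup>2 \<partial>lebesgue_on \<Omega>)"
  proof (rule integral_mono_AE)
    show "integrable (lebesgue_on \<Omega>) (\<lambda>x. B\<^sup>2)" by (rule finite_measure.integrable_const[OF finite_measure_\<Omega>])
    show "AE x in lebesgue_on \<Omega>. (f x)\<^sup>2 \<le> B\<^sup>2"
      using AE_\<Omega> by eventually_elim (use b B in \<open>simp add: abs_le_square_iff[symmetric]\<close>)
  qed (rule L2_integrable_power2[OF H_L2[OF f]])
  also have "\<dots> = (sqrt (\<beta> - \<alpha>) * B)\<^sup>2" using measure_\<Omega> \<alpha>_less_\<beta> by (simp add: power_mult_distrib)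
  finally show ?thesis using B \<alpha>_less_\<beta> by (auto intro: power2_le_imp_le)
qed

text \<open>For functions with Lipschitz constant 1 a zero boundary value amounts to domination by
  the distance to each end point, a condition that survives pointwise limits. Conversely, that
  condition makes the extension by zero Lipschitz and hence continuous up to the boundary.\<close>

lemma zero_trace_lipschitz:
  assumes f: "\<And>x y. x \<in> \<Omega> \<Longrightarrow> y \<in> \<Omega> \<Longrightarrow> \<bar>f y - f x\<bar> \<le> \<bar>y - x\<bar>"
  shows "zero_trace \<alpha> \<beta> f \<longleftrightarrow> (\<forall>x\<in>\<Omega>. \<bar>f x\<bar> \<le> x - \<alpha> \<and> \<bar>f x\<bar> \<le> \<beta> - x)"
proof
  assume "zero_trace \<alpha> \<beta> f"
  then obtain w where w: "continuous_on {\<alpha>..\<beta>} w" "w \<alpha> = 0" "w \<beta> = 0" "AE x in lebesgue_on \<Omega>. w x = f x"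
    by (auto simp: zero_trace_def)
  have "continuous_on \<Omega> f"
  proof (rule continuous_onI)
    fix x e :: real assume "x \<in> \<Omega>" "0 < e"
    then show "\<exists>d>0. \<forall>y\<in>\<Omega>. dist y x < d \<longrightarrow> dist (f y) (f x) \<le> e"
      using f[of x] by (intro exI[of _ e]) (force simp: dist_real_def)
  qed
  moreover have "continuous_on \<Omega> w" by (rule continuous_on_subset[OF w(1)]) auto
  ultimately have eq: "w x = f x" if "x \<in> \<Omega>" for x using AE_eq_continuous[OF _ _ w(4) that] by simp
  show "\<forall>x\<in>\<Omega>. \<bar>f x\<bar> \<le> x - \<alpha> \<and> \<bar>f x\<bar> \<le> \<beta> - x"
  proof
    fix x assume x: "x \<in> \<Omega>"
    have "\<bar>w x - w y\<bar> - \<bar>x - y\<bar> \<le> 0" if "y \<in> {\<alpha>..\<beta>}" for y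
    proof (rule continuous_le_on_closure[of \<Omega> "\<lambda>y. \<bar>w x - w y\<bar> - \<bar>x - y\<bar>" y 0])
      show "continuous_on (closure \<Omega>) (\<lambda>y. \<bar>w x - w y\<bar> - \<bar>x - y\<bar>)"
        using \<alpha>_less_\<beta> w(1) by (auto intro!: continuous_intros)
      show "y \<in> closure \<Omega>" using that \<alpha>_less_\<beta> by simp
      show "\<bar>w x - w y\<bar> - \<bar>x - y\<bar> \<le> 0" if "y \<in> \<Omega>" for y using f[OF that x] eq[OF that] eq[OF x] by simp
    qed
    from this[of \<alpha>] this[of \<beta>] show "\<bar>f x\<bar> \<le> x - \<alpha> \<and> \<bar>f x\<bar> \<le> \<beta> - x"
      using \<alpha>_less_\<beta> w(2,3) eq[OF x] x by simp
  qed
next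
  assume b: "\<forall>x\<in>\<Omega>. \<bar>f x\<bar> \<le> x - \<alpha> \<and> \<bar>f x\<bar> \<le> \<beta> - x"
  let ?w = "\<lambda>x. if x \<in> \<Omega> then f x else 0"
  have lip: "\<bar>?w y - ?w x\<bar> \<le> \<bar>y - x\<bar>" if "x \<in> {\<alpha>..\<beta>}" "y \<in> {\<alpha>..\<beta>}" for x y
  proof (cases "x \<in> \<Omega>"; cases "y \<in> \<Omega>")
    assume "x \<in> \<Omega>" "y \<in> \<Omega>"
    then show ?thesis using f by simp
  next
    assume x: "x \<in> \<Omega>" "y \<notin> \<Omega>"
    then have "y = \<alpha> \<or> y = \<beta>" using that by auto
    then show ?thesis using b x by auto
  next
    assume y: "x \<notin> \<Omega>" "y \<in> \<Omega>"
    then have "x = \<alpha> \<or> x = \<beta>" using that by auto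
    then show ?thesis using b y by auto
  qed auto
  have "continuous_on {\<alpha>..\<beta>} ?w"
    unfolding continuous_on_iff
  proof (intro ballI allI impI)
    fix x e :: real assume x: "x \<in> {\<alpha>..\<beta>}" and e: "0 < e"
    show "\<exists>d>0. \<forall>x'\<in>{\<alpha>..\<beta>}. dist x' x < d \<longrightarrow> dist (?w x') (?w x) < e"
      using lip[OF x] e by (intro exI[of _ e]) (auto simp only: dist_real_def intro: le_less_trans)
  qed
  moreover have "AE x in lebesgue_on \<Omega>. ?w x = f x" using AE_\<Omega> by eventually_elim simp
  ultimately show "zero_trace \<alpha> \<beta> f" unfolding zero_trace_def by (intro exI[of _ ?w]) simp
qed

end

context relaxation_limit
begin

lemma limit_space_lipschitz:
  assumes "t \<ge> 0" "x \<in> \<Omega>" "y \<in> \<Omega>"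
  shows "\<bar>u' (t, y) - u' (t, x)\<bar> \<le> \<bar>y - x\<bar>"
proof (rule LIMSEQ_le_const2)
  show "(\<lambda>n. \<bar>u n (t, y) - u n (t, x)\<bar>) \<longlonglongrightarrow> \<bar>u' (t, y) - u' (t, x)\<bar>"
    by (intro tendsto_intros u_lim assms)
  show "\<exists>N. \<forall>n\<ge>N. \<bar>u n (t, y) - u n (t, x)\<bar> \<le> \<bar>y - x\<bar>"
    using relaxed_solution.space_lipschitz(2)[OF solution assms] by blast
qed

lemma limit_zero_trace:
  assumes t: "t > 0"
  shows "zero_trace \<alpha> \<beta> (\<lambda>x. u' (t, x))"
proof -
  have t0: "t \<ge> 0" using t by simp
  have "zero_trace \<alpha> \<beta> (\<lambda>x. u n (t, x))" for n
    using relaxed_solution.problem[OF solution, of n] t by (simp add: relaxed_problem_def)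
  then have n: "\<bar>u n (t, x)\<bar> \<le> x - \<alpha> \<and> \<bar>u n (t, x)\<bar> \<le> \<beta> - x" if "x \<in> \<Omega>" for n x
    using zero_trace_lipschitz[of "\<lambda>x. u n (t, x)", OF relaxed_solution.space_lipschitz(2)[OF solution t0]] that by simp
  have "\<bar>u' (t, x)\<bar> \<le> x - \<alpha> \<and> \<bar>u' (t, x)\<bar> \<le> \<beta> - x" if x: "x \<in> \<Omega>" for x
    using LIMSEQ_le_const2[OF tendsto_rabs[OF u_lim[OF t0 x]]] n[OF x] by blast
  then show ?thesis
    using zero_trace_lipschitz[of "\<lambda>x. u' (t, x)", OF limit_space_lipschitz[OF t0]] by simp
qed

lemma limit_in_H0: "t \<ge> 0 \<Longrightarrow> (\<lambda>x. v' (t, x)) \<in> H_space \<Omega> 0" "t \<ge> 0 \<Longrightarrow> (\<lambda>x. u' (t, x)) \<in> H_space \<Omega> 0"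
  by (rule H_space_mono[OF _ limit_in_H2(1)], simp_all) (rule H_space_mono[OF _ limit_in_H2(2)], simp_all)

text \<open>The bound L |s - t| + \<delta> passes to pointwise limits, and a uniform bound in space
  controls the L^2 norm at the cost of a factor \<open>sqrt (\<beta> - \<alpha>)\<close>. For
  \<open>v'\<close> the choice L = 1 serves every \<delta>; for \<open>u'\<close> the constant L
  grows like 1 / \<delta>.\<close>

lemma limit_C0_time:
  "v' \<in> C0_time (H_space \<Omega> 0) (H_norm \<Omega> 0)"
  "u' \<in> C0_time (H_space \<Omega> 0) (H_norm \<Omega> 0)"
proof -
  have C0: "F \<in> C0_time (H_space \<Omega> 0) (H_norm \<Omega> 0)"
    if H: "\<And>t. t \<ge> 0 \<Longrightarrow> (\<lambda>x. F (t, x)) \<in> H_space \<Omega> 0"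
      and b: "\<And>\<delta>. \<delta> > 0 \<Longrightarrow> \<exists>L\<ge>0. \<forall>s\<ge>0. \<forall>t\<ge>0. \<forall>x\<in>\<Omega>. \<bar>F (s, x) - F (t, x)\<bar> \<le> L * \<bar>s - t\<bar> + \<delta>"
    for F :: "real \<times> real \<Rightarrow> real"
    unfolding C0_time_def
  proof (intro CollectI allI impI conjI H)
    fix t :: real assume t: "0 \<le> t"
    show "((\<lambda>s. H_norm \<Omega> 0 (\<lambda>x. F (s, x) - F (t, x))) \<longlongrightarrow> 0) (at t within {0..})"
      unfolding Lim_within
    proof (intro allI impI)
      fix e :: real assume e: "e > 0"
      \<comment> \<open>Chosen such that the factor \<open>sqrt (\<beta> - \<alpha>)\<close> times 2
        \<delta> is e; time steps below the later \<open>d\<close> contribute less than one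
        \<delta>.\<close>
      define \<delta> where "\<delta> = e / (2 * sqrt (\<beta> - \<alpha>))"
      have sq: "sqrt (\<beta> - \<alpha>) > 0" using \<alpha>_less_\<beta> by simp
      then have \<delta>: "\<delta> > 0" and \<delta>': "sqrt (\<beta> - \<alpha>) * \<delta> = e / 2" using e by (simp_all add: \<delta>_def)
      obtain L where L: "L \<ge> 0" "\<forall>s\<ge>0. \<forall>t\<ge>0. \<forall>x\<in>\<Omega>. \<bar>F (s, x) - F (t, x)\<bar> \<le> L * \<bar>s - t\<bar> + \<delta>" using b[OF \<delta>] by blast
      define d where "d = \<delta> / (L + 1)"
      have d: "d > 0" using \<delta> L by (simp add: d_def)
      have "H_norm \<Omega> 0 (\<lambda>x. F (s, x) - F (t, x)) < e" if s: "s \<ge> 0" "\<bar>s - t\<bar> < d" for s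
      proof -
        have "L * \<bar>s - t\<bar> \<le> L * d" using s L by (intro mult_left_mono) auto
        also have "\<dots> < (L + 1) * d" using d by simp
        also have "\<dots> = \<delta>" using L by (simp add: d_def)
        finally have lt: "L * \<bar>s - t\<bar> + \<delta> < 2 * \<delta>" by simp
        have "H_norm \<Omega> 0 (\<lambda>x. F (s, x) - F (t, x)) \<le> sqrt (\<beta> - \<alpha>) * (L * \<bar>s - t\<bar> + \<delta>)"
          by (rule H_norm_0_le[OF H.diff_in[OF H[OF s(1)] H[OF t]]]) (use L s t in blast)
        also have "\<dots> < sqrt (\<beta> - \<alpha>) * (2 * \<delta>)" using lt sq by (rule mult_strict_left_mono)
        also have "\<dots> = e" using \<delta>' by simp
        finally show ?thesis .
      qed
      then show "\<exists>d>0. \<forall>s\<in>{0..}. 0 < dist s t \<and> dist s t < d \<longrightarrow> dist (H_norm \<Omega> 0 (\<lambda>x. F (s, x) - F (t, x))) 0 < e"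
        using d H_norm_nonneg by (intro exI[of _ d]) (auto simp: dist_real_def)
    qed
  qed
  show "v' \<in> C0_time (H_space \<Omega> 0) (H_norm \<Omega> 0)"
  proof (rule C0[OF limit_in_H0(1)])
    fix \<delta> :: real assume \<delta>: "\<delta> > 0"
    have "\<bar>v' (s, x) - v' (t, x)\<bar> \<le> 1 * \<bar>s - t\<bar> + \<delta>" if "s \<ge> 0" "t \<ge> 0" "x \<in> \<Omega>" for s t x
    proof (rule LIMSEQ_le_const2)
      show "(\<lambda>n. \<bar>v n (s, x) - v n (t, x)\<bar>) \<longlonglongrightarrow> \<bar>v' (s, x) - v' (t, x)\<bar>"
        by (intro tendsto_intros v_lim that)
      have "\<bar>v n (s, x) - v n (t, x)\<bar> \<le> 1 * \<bar>s - t\<bar> + \<delta>" for n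
        using relaxed_solution.v_time_lipschitz[OF solution that(2,1,3), of n] \<delta> by simp
      then show "\<exists>N. \<forall>n\<ge>N. \<bar>v n (s, x) - v n (t, x)\<bar> \<le> 1 * \<bar>s - t\<bar> + \<delta>" by blast
    qed
    then show "\<exists>L\<ge>0. \<forall>s\<ge>0. \<forall>t\<ge>0. \<forall>x\<in>\<Omega>. \<bar>v' (s, x) - v' (t, x)\<bar> \<le> L * \<bar>s - t\<bar> + \<delta>"
      by (intro exI[of _ 1]) auto
  qed
  show "u' \<in> C0_time (H_space \<Omega> 0) (H_norm \<Omega> 0)"
  proof (rule C0[OF limit_in_H0(2)])
    fix \<delta> :: real assume \<delta>: "\<delta> > 0"
    define L where "L = relaxed_solution.pressure_bound a \<gamma> + 1 / \<delta>"
    have est: "\<bar>u n (t, x) - u n (s, x)\<bar> \<le> L * \<bar>t - s\<bar> + \<delta>" if "0 \<le> s" "s \<le> t" "x \<in> \<Omega>" for s t x n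
      using relaxed_solution.u_time_estimate[OF solution that \<delta>, of n] that unfolding L_def by simp
    have est: "\<bar>u n (s, x) - u n (t, x)\<bar> \<le> L * \<bar>s - t\<bar> + \<delta>" if "s \<ge> 0" "t \<ge> 0" "x \<in> \<Omega>" for s t x n
    proof (cases "s \<le> t")
      case True
      then show ?thesis using est[OF that(1) True that(3), of n] by (simp only: abs_minus_commute)
    next
      case False
      then show ?thesis using est[of t s x n] that by simp
    qed
    have "\<bar>u' (s, x) - u' (t, x)\<bar> \<le> L * \<bar>s - t\<bar> + \<delta>" if "s \<ge> 0" "t \<ge> 0" "x \<in> \<Omega>" for s t x
    proof (rule LIMSEQ_le_const2)
      show "(\<lambda>n. \<bar>u n (s, x) - u n (t, x)\<bar>) \<longlonglongrightarrow> \<bar>u' (s, x) - u' (t, x)\<bar>"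
        by (intro tendsto_intros u_lim that)
      show "\<exists>N. \<forall>n\<ge>N. \<bar>u n (s, x) - u n (t, x)\<bar> \<le> L * \<bar>s - t\<bar> + \<delta>" using est[OF that] by blast
    qed
    moreover have "L \<ge> 0"
      using \<delta> a_pos \<gamma>_gt_1 by (simp add: L_def relaxed_solution.pressure_bound_def[OF solution])
    ultimately show "\<exists>L\<ge>0. \<forall>s\<ge>0. \<forall>t\<ge>0. \<forall>x\<in>\<Omega>. \<bar>u' (s, x) - u' (t, x)\<bar> \<le> L * \<bar>s - t\<bar> + \<delta>"
      by (intro exI[of _ L]) auto
  qed
qed

text \<open>Time 0 is included in the pointwise convergence. The data are tied to the solutions at
  time 0 only on \<Omega>, so membership and norms are transported by \<open>H_AE\<close>.\<close>

lemma initial_weak_limit: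
  "weakly_converges (H_space \<Omega> 2) (H_norm \<Omega> 2) v\<^sub>0 (\<lambda>x. v' (0, x))"
  "weakly_converges (H_space \<Omega> 2) (H_norm \<Omega> 2) u\<^sub>0 (\<lambda>x. u' (0, x))"
proof -
  have eq: "v n (0, x) = v\<^sub>0 n x" "u n (0, x) = u\<^sub>0 n x" if "x \<in> \<Omega>" for n x
    using relaxed_solution.problem[OF solution, of n] that by (simp_all add: relaxed_problem_def)
  have AE: "AE x in lebesgue_on \<Omega>. v n (0, x) = v\<^sub>0 n x" "AE x in lebesgue_on \<Omega>. u n (0, x) = u\<^sub>0 n x" for n
    using AE_\<Omega> by (eventually_elim, simp add: eq)+
  note v_H2 = relaxed_solution.v_in_H2[OF solution order_refl]
  note u_H2 = relaxed_solution.in_H2(2)[OF solution order_refl]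
  have lim: "(\<lambda>n. v\<^sub>0 n x) \<longlonglongrightarrow> v' (0, x)" "(\<lambda>n. u\<^sub>0 n x) \<longlonglongrightarrow> u' (0, x)" if "x \<in> \<Omega>" for x
    using v_lim[OF order_refl that] u_lim[OF order_refl that] by (simp_all add: eq[OF that])
  have b: "\<bar>v\<^sub>0 n x\<bar> \<le> 3 / 2" "\<bar>u\<^sub>0 n x\<bar> \<le> 1 / 2" if "x \<in> \<Omega>" for n x
    using v_bounds_n[OF order_refl that, of n] C1_bounds_n(3)[OF order_refl that, of n] by (auto simp: eq[OF that])
  have nv: "H_norm \<Omega> 2 (v\<^sub>0 n) \<le> K + H_norm \<Omega> 2 (\<lambda>x. 1)" for n
    using relaxed_solution.v_H2_bound[OF solution order_refl, of n] by (simp only: H_AE(3)[OF v_H2 AE(1)])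
  have nu: "H_norm \<Omega> 2 (u\<^sub>0 n) \<le> K" for n
    using relaxed_solution.H2_bounds(2)[OF solution order_refl, of n] by (simp only: H_AE(3)[OF u_H2 AE(2)])
  show "weakly_converges (H_space \<Omega> 2) (H_norm \<Omega> 2) v\<^sub>0 (\<lambda>x. v' (0, x))"
    by (rule H_weak_limit_pointwise(1)[of v\<^sub>0 2 _ "3 / 2" "\<lambda>x. v' (0, x)", OF H_AE(1)[OF v_H2 AE(1)] nv b(1) lim(1)])
  show "weakly_converges (H_space \<Omega> 2) (H_norm \<Omega> 2) u\<^sub>0 (\<lambda>x. u' (0, x))"
    by (rule H_weak_limit_pointwise(1)[of u\<^sub>0 2 _ "1 / 2" "\<lambda>x. u' (0, x)", OF H_AE(1)[OF u_H2 AE(2)] nu b(2) lim(2)])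
qed

text \<open>All terms converge by dominated convergence except the stress term, which goes through
  \<open>S_box_tendsto\<close> with weight \<open>\<phi>x\<close> and time derivative
  \<open>\<phi>xt\<close>.\<close>

lemma limit_equations:
  assumes test: "space_time_test s t c d \<phi> \<phi>t \<phi>x \<phi>xt" and box: "0 < s" "s < t" "\<alpha> < c" "c < d" "d < \<beta>"
  shows "box_integral s t c d (\<lambda>p. v' p * \<phi>t p) = box_integral s t c d (\<lambda>p. u' p * \<phi>x p)"
    "box_integral s t c d (\<lambda>p. u' p * \<phi>t p + pressure a \<gamma> (v' p) * \<phi>x p) = box_integral s t c d (\<lambda>p. \<mu> * q p / v' p * \<phi>x p)"
proof -
  let ?B = "{s..t} \<times> {c..d}"
  have sub: "?B \<subseteq> {0..} \<times> \<Omega>" using box by auto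
  have c\<phi>: "continuous_on ?B \<phi>t" "continuous_on ?B \<phi>x" "continuous_on ?B \<phi>xt"
    using test unfolding space_time_test_def by (blast intro: continuous_on_subset)+
  have "compact ?B" by (intro compact_Times) auto
  then have "bounded (\<phi>t ` ?B)" "bounded (\<phi>x ` ?B)"
    using c\<phi> by (auto intro!: compact_imp_bounded compact_continuous_image)
  then obtain M1 M2 where M: "\<bar>\<phi>t p\<bar> \<le> M1" "\<bar>\<phi>x p\<bar> \<le> M2" if "p \<in> ?B" for p
    unfolding bounded_real by (metis imageI)
  have lim: "(\<lambda>n. box_integral s t c d (\<lambda>p. f n p * \<psi> p)) \<longlonglongrightarrow> box_integral s t c d (\<lambda>p. g p * \<psi> p)"
    if c: "\<And>n. continuous_on ({0..} \<times> \<Omega>) (f n)" and l: "\<And>r x. r \<ge> 0 \<Longrightarrow> x \<in> \<Omega> \<Longrightarrow> (\<lambda>n. f n (r, x)) \<longlonglongrightarrow> g (r, x)"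
      and b: "\<And>n r x. r \<ge> 0 \<Longrightarrow> x \<in> \<Omega> \<Longrightarrow> \<bar>f n (r, x)\<bar> \<le> L" and \<psi>: "continuous_on ?B \<psi>" "\<And>p. p \<in> ?B \<Longrightarrow> \<bar>\<psi> p\<bar> \<le> M"
    for f :: "nat \<Rightarrow> real \<times> real \<Rightarrow> real" and g \<psi> L M
  proof (rule box_integral_tendsto[where C = "L * M"])
    show "continuous_on ?B (\<lambda>p. f n p * \<psi> p)" for n
      by (rule continuous_on_mult[OF continuous_on_subset[OF c sub] \<psi>(1)])
    fix p assume p: "p \<in> ?B"
    then have p': "fst p \<ge> 0" "snd p \<in> \<Omega>" using box by auto
    show "(\<lambda>n. f n p * \<psi> p) \<longlonglongrightarrow> g p * \<psi> p"
      using tendsto_mult_right[OF l[OF p'], of "\<psi> p"] by simp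
    show "\<bar>f n p * \<psi> p\<bar> \<le> L * M" for n
    proof -
      have f: "\<bar>f n p\<bar> \<le> L" using b[OF p', of n] by simp
      then have "0 \<le> L" by linarith
      then show ?thesis unfolding abs_mult by (intro mult_mono f \<psi>(2)[OF p]) auto
    qed
  qed
  have bv: "\<bar>v n (r, x)\<bar> \<le> 3 / 2" if "r \<ge> 0" "x \<in> \<Omega>" for n r x using v_bounds_n[OF that, of n] by auto
  have lv: "(\<lambda>n. box_integral s t c d (\<lambda>p. v n p * \<phi>t p)) \<longlonglongrightarrow> box_integral s t c d (\<lambda>p. v' p * \<phi>t p)"
    by (rule lim[OF cont_n(1) v_lim bv c\<phi>(1) M(1)])
  have lu: "(\<lambda>n. box_integral s t c d (\<lambda>p. u n p * \<phi>x p)) \<longlonglongrightarrow> box_integral s t c d (\<lambda>p. u' p * \<phi>x p)"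
    by (rule lim[OF cont_n(4) u_lim C1_bounds_n(3) c\<phi>(2) M(2)])
  note weak = relaxed_solution.weak_formulation[OF solution test box]
  show "box_integral s t c d (\<lambda>p. v' p * \<phi>t p) = box_integral s t c d (\<lambda>p. u' p * \<phi>x p)"
    by (rule LIMSEQ_unique[OF lv]) (simp only: weak(1) lu)
  have lut: "(\<lambda>n. box_integral s t c d (\<lambda>p. u n p * \<phi>t p)) \<longlonglongrightarrow> box_integral s t c d (\<lambda>p. u' p * \<phi>t p)"
    by (rule lim[OF cont_n(4) u_lim C1_bounds_n(3) c\<phi>(1) M(1)])
  have pl: "(\<lambda>n. pressure a \<gamma> (v n (r, x))) \<longlonglongrightarrow> pressure a \<gamma> (v' (r, x))" if "r \<ge> 0" "x \<in> \<Omega>" for r x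
    unfolding pressure_def using v'_bounds[OF that]
    by (intro tendsto_mult tendsto_const tendsto_powr v_lim that) auto
  let ?L = "a * (1 / 2) powr (- \<gamma>)"
  have cp: "continuous_on ({0..} \<times> \<Omega>) (\<lambda>p. pressure a \<gamma> (v n p))" for n
    by (rule relaxed_solution.cont_pressure(1)[OF solution])
  have bp: "\<bar>pressure a \<gamma> (v n (r, x))\<bar> \<le> ?L" if "r \<ge> 0" "x \<in> \<Omega>" for n r x
    by (rule relaxed_solution.pressure_bounds(2)[OF solution that])
  let ?f = "\<lambda>n p. u n p * \<phi>t p + pressure a \<gamma> (v n p) * \<phi>x p"
  have "(\<lambda>n. box_integral s t c d (?f n)) \<longlonglongrightarrow> box_integral s t c d (\<lambda>p. u' p * \<phi>t p + pressure a \<gamma> (v' p) * \<phi>x p)"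
  proof (rule box_integral_tendsto[where C = "1 / 2 * M1 + ?L * M2"])
    show "continuous_on ?B (?f n)" for n
      by (rule continuous_on_add[OF continuous_on_mult[OF continuous_on_subset[OF cont_n(4) sub] c\<phi>(1)]
        continuous_on_mult[OF continuous_on_subset[OF cp sub] c\<phi>(2)]])
    fix p assume p: "p \<in> ?B"
    then have p': "fst p \<ge> 0" "snd p \<in> \<Omega>" using box by auto
    show "(\<lambda>n. ?f n p) \<longlonglongrightarrow> u' p * \<phi>t p + pressure a \<gamma> (v' p) * \<phi>x p"
      using tendsto_add[OF tendsto_mult_right[OF u_lim[OF p'], of "\<phi>t p"] tendsto_mult_right[OF pl[OF p'], of "\<phi>x p"]] by simp
    show "\<bar>?f n p\<bar> \<le> 1 / 2 * M1 + ?L * M2" for n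
    proof -
      have "\<bar>u n p\<bar> * \<bar>\<phi>t p\<bar> \<le> 1 / 2 * M1"
        using C1_bounds_n(3)[OF p', of n] by (intro mult_mono M(1)[OF p]) auto
      moreover have "\<bar>pressure a \<gamma> (v n p)\<bar> * \<bar>\<phi>x p\<bar> \<le> ?L * M2"
        using bp[OF p', of n] a_pos by (intro mult_mono M(2)[OF p]) auto
      ultimately show ?thesis
        using abs_triangle_ineq[of "u n p * \<phi>t p" "pressure a \<gamma> (v n p) * \<phi>x p"] unfolding abs_mult by linarith
    qed
  qed
  moreover have "(\<lambda>n. box_integral s t c d (?f n)) \<longlonglongrightarrow> box_integral s t c d (\<lambda>p. \<mu> * q p / v' p * \<phi>x p)"
    unfolding weak(2)
  proof (rule S_box_tendsto[where \<psi>t = \<phi>xt])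
    show "((\<lambda>r. \<phi>x (r, y)) has_real_derivative \<phi>xt (r, y)) (at r within {s..t})" for r y
      using test unfolding space_time_test_def by (blast intro: has_field_derivative_at_within)
  qed (use box c\<phi> in auto)
  ultimately show "box_integral s t c d (\<lambda>p. u' p * \<phi>t p + pressure a \<gamma> (v' p) * \<phi>x p) = box_integral s t c d (\<lambda>p. \<mu> * q p / v' p * \<phi>x p)"
    by (rule LIMSEQ_unique)
qed

lemma limit_weak_formulation:
  assumes \<phi>: "\<phi> \<in> test_functions ({0<..} \<times> \<Omega>)"
  shows "(LINT t|lebesgue_on {0<..}. LINT x|lebesgue_on \<Omega>. v' (t, x) * deriv (\<lambda>s. \<phi> (s, x)) t) =
      (LINT t|lebesgue_on {0<..}. LINT x|lebesgue_on \<Omega>. u' (t, x) * deriv (\<lambda>y. \<phi> (t, y)) x)"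
    "(LINT t|lebesgue_on {0<..}. LINT x|lebesgue_on \<Omega>.
        u' (t, x) * deriv (\<lambda>s. \<phi> (s, x)) t + pressure a \<gamma> (v' (t, x)) * deriv (\<lambda>y. \<phi> (t, y)) x) =
      (LINT t|lebesgue_on {0<..}. LINT x|lebesgue_on \<Omega>.
        \<mu> * wderiv \<Omega> 1 (\<lambda>y. u' (t, y)) x / v' (t, x) * deriv (\<lambda>y. \<phi> (t, y)) x)"
proof -
  obtain s t c d \<phi>t \<phi>x \<phi>xt where box: "0 < s" "s < t" "\<alpha> < c" "c < d" "d < \<beta>"
    and test: "space_time_test s t c d \<phi> \<phi>t \<phi>x \<phi>xt"
    using space_time_test_exists[OF \<phi>] by blast
  have D: "deriv (\<lambda>s. \<phi> (s, x)) r = \<phi>t (r, x)" "deriv (\<lambda>y. \<phi> (r, y)) x = \<phi>x (r, x)" for r x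
    using test unfolding space_time_test_def by (blast intro: DERIV_imp_deriv)+
  have zero: "\<phi>t p = 0" "\<phi>x p = 0" if "p \<notin> {s..t} \<times> {c..d}" for p
  proof -
    have "p \<notin> {s<..<t} \<times> {c<..<d}" using that by auto
    then show "\<phi>t p = 0" "\<phi>x p = 0" using test unfolding space_time_test_def by blast+
  qed
  have \<Omega>: "\<Omega> \<in> sets lebesgue" by simp
  have cd: "c \<le> d" "{c..d} \<subseteq> \<Omega>" using box by auto
  note L = LINT_eq_box_integral[OF box(1) cd \<Omega>]
  have 1: "(LINT t|lebesgue_on {0<..}. LINT x|lebesgue_on \<Omega>. v' (t, x) * \<phi>t (t, x)) = box_integral s t c d (\<lambda>p. v' p * \<phi>t p)"
    by (rule L[of t "\<lambda>p. v' p * \<phi>t p"]) (simp add: zero)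
  have 2: "(LINT t|lebesgue_on {0<..}. LINT x|lebesgue_on \<Omega>. u' (t, x) * \<phi>x (t, x)) = box_integral s t c d (\<lambda>p. u' p * \<phi>x p)"
    by (rule L[of t "\<lambda>p. u' p * \<phi>x p"]) (simp add: zero)
  show "(LINT t|lebesgue_on {0<..}. LINT x|lebesgue_on \<Omega>. v' (t, x) * deriv (\<lambda>s. \<phi> (s, x)) t) =
      (LINT t|lebesgue_on {0<..}. LINT x|lebesgue_on \<Omega>. u' (t, x) * deriv (\<lambda>y. \<phi> (t, y)) x)"
    unfolding D 1 2 by (rule limit_equations(1)[OF test box])
  have 3: "(LINT t|lebesgue_on {0<..}. LINT x|lebesgue_on \<Omega>. u' (t, x) * \<phi>t (t, x) + pressure a \<gamma> (v' (t, x)) * \<phi>x (t, x))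
      = box_integral s t c d (\<lambda>p. u' p * \<phi>t p + pressure a \<gamma> (v' p) * \<phi>x p)"
    by (rule L[of t "\<lambda>p. u' p * \<phi>t p + pressure a \<gamma> (v' p) * \<phi>x p"]) (simp add: zero)
  \<comment> \<open>At each time \<open>q\<close> replaces the weak derivative that
    \<open>navier_stokes_solution\<close> mentions; the two agree almost everywhere in
    space.\<close>
  have inner: "(LINT x|lebesgue_on \<Omega>. \<mu> * wderiv \<Omega> 1 (\<lambda>y. u' (r, y)) x / v' (r, x) * \<phi>x (r, x))
      = (LINT x|lebesgue_on \<Omega>. \<mu> * q (r, x) / v' (r, x) * \<phi>x (r, x))" if r: "r \<ge> 0" for r
  proof (rule integral_cong_AE)
    note AE = wderiv_limit[OF r]
    have w: "wderiv \<Omega> 1 (\<lambda>y. u' (r, y)) \<in> borel_measurable (lebesgue_on \<Omega>)"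
      using L2_measurable[OF H_wderiv(2)[OF limit_in_H2(2)[OF r], of 1]] by simp
    have qm: "(\<lambda>x. q (r, x)) \<in> borel_measurable (lebesgue_on \<Omega>)"
      by (rule borel_measurable_lebesgue_on_AE[OF \<Omega> w AE])
    have vm: "(\<lambda>x. v' (r, x)) \<in> borel_measurable (lebesgue_on \<Omega>)"
      by (rule L2_measurable[OF H_L2[OF limit_in_H2(1)[OF r]]])
    have "continuous_on UNIV \<phi>x" using test unfolding space_time_test_def by blast
    then have "continuous_on \<Omega> (\<lambda>x. \<phi>x (r, x))"
      by (rule continuous_on_compose2) (auto intro!: continuous_intros)
    then have \<phi>m: "(\<lambda>x. \<phi>x (r, x)) \<in> borel_measurable (lebesgue_on \<Omega>)"
      by (rule continuous_imp_measurable_on_sets_lebesgue) simp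
    show "(\<lambda>x. \<mu> * wderiv \<Omega> 1 (\<lambda>y. u' (r, y)) x / v' (r, x) * \<phi>x (r, x)) \<in> borel_measurable (lebesgue_on \<Omega>)"
      by (intro borel_measurable_times borel_measurable_divide borel_measurable_const w vm \<phi>m)
    show "(\<lambda>x. \<mu> * q (r, x) / v' (r, x) * \<phi>x (r, x)) \<in> borel_measurable (lebesgue_on \<Omega>)"
      by (intro borel_measurable_times borel_measurable_divide borel_measurable_const qm vm \<phi>m)
    show "AE x in lebesgue_on \<Omega>. \<mu> * wderiv \<Omega> 1 (\<lambda>y. u' (r, y)) x / v' (r, x) * \<phi>x (r, x) = \<mu> * q (r, x) / v' (r, x) * \<phi>x (r, x)"
      using AE by eventually_elim simp
  qed
  have "(LINT t|lebesgue_on {0<..}. LINT x|lebesgue_on \<Omega>. \<mu> * wderiv \<Omega> 1 (\<lambda>y. u' (t, y)) x / v' (t, x) * \<phi>x (t, x))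
      = (LINT t|lebesgue_on {0<..}. LINT x|lebesgue_on \<Omega>. \<mu> * q (t, x) / v' (t, x) * \<phi>x (t, x))"
    by (rule Bochner_Integration.integral_cong[OF refl]) (rule inner, simp)
  also have "\<dots> = box_integral s t c d (\<lambda>p. \<mu> * q p / v' p * \<phi>x p)"
    by (rule L[of t "\<lambda>p. \<mu> * q p / v' p * \<phi>x p"]) (simp add: zero)
  finally have 4: "(LINT t|lebesgue_on {0<..}. LINT x|lebesgue_on \<Omega>. \<mu> * wderiv \<Omega> 1 (\<lambda>y. u' (t, y)) x / v' (t, x) * \<phi>x (t, x))
      = box_integral s t c d (\<lambda>p. \<mu> * q p / v' p * \<phi>x p)" .
  show "(LINT t|lebesgue_on {0<..}. LINT x|lebesgue_on \<Omega>.
        u' (t, x) * deriv (\<lambda>s. \<phi> (s, x)) t + pressure a \<gamma> (v' (t, x)) * deriv (\<lambda>y. \<phi> (t, y)) x) =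
      (LINT t|lebesgue_on {0<..}. LINT x|lebesgue_on \<Omega>.
        \<mu> * wderiv \<Omega> 1 (\<lambda>y. u' (t, y)) x / v' (t, x) * deriv (\<lambda>y. \<phi> (t, y)) x)"
    unfolding D 3 4 by (rule limit_equations(2)[OF test box])
qed

lemma limit_Linf:
  "v' \<in> Linf_time (H_space \<Omega> 2) (H_norm \<Omega> 2)" "u' \<in> Linf_time (H_space \<Omega> 2) (H_norm \<Omega> 2)"
  using weakstar by (simp_all add: weakstar_converges_Linf_time_def)

text \<open>The initial values are those of the limit functions themselves;
  \<open>initial_weak_limit\<close> recognizes them as the weak limits of the data. The uniform
  bound 1/2 from below excludes vacuum.\<close>

lemma limit_navier_stokes:
  "navier_stokes_solution \<alpha> \<beta> \<mu> a \<gamma> (\<lambda>x. v' (0, x)) (\<lambda>x. u' (0, x)) v' u'"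
proof -
  have "AE x in lebesgue_on \<Omega>. 1 / 2 \<le> v' (t, x)" if "t > 0" for t
    using AE_\<Omega> by eventually_elim (use v'_bounds[of t] that in auto)
  then have "AE t in lebesgue_on {0<..}. AE x in lebesgue_on \<Omega>. 1 / 2 \<le> v' (t, x)"
    using AE_greaterThan by (rule eventually_mono[rotated])
  then have "\<exists>c>0. AE t in lebesgue_on {0<..}. AE x in lebesgue_on \<Omega>. c \<le> v' (t, x)"
    by (intro exI[of _ "1 / 2"]) simp
  moreover have "AE t in lebesgue_on {0<..}. zero_trace \<alpha> \<beta> (\<lambda>x. u' (t, x))"
    using AE_greaterThan by eventually_elim (rule limit_zero_trace)
  ultimately show ?thesis
    unfolding navier_stokes_solution_def Let_def
    using limit_Linf limit_C0_time limit_weak_formulation by auto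
qed

end

section \<open>Choice of the smallness threshold and extraction of the subsequence\<close>

lemma space_time_dist:
  fixes p q :: "real \<times> real"
  shows "\<bar>fst p - fst q\<bar> \<le> dist p q" "\<bar>snd p - snd q\<bar> \<le> dist p q"
  using dist_fst_le[of p q] dist_snd_le[of p q] by (simp_all add: dist_real_def)

text \<open>The solutions enter as a family subject to \<open>global_solution\<close>, C being the
  constant of their energy estimate, and the threshold found depends only on C and the length of the
  interval. Convergence up to subsequences is expressed by quantifying over all parameter sequences
  that tend to 0.\<close>

theorem theorem1p3:
  fixes \<alpha> \<beta> \<mu> a \<gamma> C :: real
  assumes "\<alpha> < \<beta>" and "\<mu> > 0" and "a > 0" and "\<gamma> > 1" and "C > 0"
  defines "\<Omega> \<equiv> {\<alpha><..<\<beta>}"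
  shows "\<exists>\<epsilon>\<^sub>0>0. \<forall>(v\<^sub>0 :: real \<Rightarrow> real \<Rightarrow> real) u\<^sub>0 S\<^sub>0 (v :: real \<Rightarrow> real \<times> real \<Rightarrow> real) u S.
    assumption_A \<alpha> \<beta> \<mu> a \<gamma> v\<^sub>0 u\<^sub>0 S\<^sub>0 \<and>
    (\<forall>\<tau>\<in>{0<..1}.
       E_init \<Omega> \<mu> a \<gamma> \<tau> (v\<^sub>0 \<tau>) (u\<^sub>0 \<tau>) (S\<^sub>0 \<tau>) < \<epsilon>\<^sub>0 \<and>
       global_solution \<alpha> \<beta> \<mu> a \<gamma> C \<tau> (v\<^sub>0 \<tau>) (u\<^sub>0 \<tau>) (S\<^sub>0 \<tau>) (v \<tau>) (u \<tau>) (S \<tau>)) \<longrightarrow>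
    (\<forall>\<theta> :: nat \<Rightarrow> real. range \<theta> \<subseteq> {0<..1} \<and> \<theta> \<longlonglongrightarrow> 0 \<longrightarrow>
      (\<exists>(r :: nat \<Rightarrow> nat) v' u' S' v\<^sub>0' u\<^sub>0'.
         strict_mono r \<and>
         v' \<in> Linf_time (H_space \<Omega> 2) (H_norm \<Omega> 2) \<and>
         u' \<in> Linf_time (H_space \<Omega> 2) (H_norm \<Omega> 2) \<and>
         S' \<in> L2_time (H_space \<Omega> 2) (H_norm \<Omega> 2) \<and>
         weakstar_converges_Linf_time (H_space \<Omega> 2) (H_norm \<Omega> 2) (\<lambda>n. v (\<theta> (r n))) v' \<and>
         weakstar_converges_Linf_time (H_space \<Omega> 2) (H_norm \<Omega> 2) (\<lambda>n. u (\<theta> (r n))) u' \<and>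
         weakly_converges (L2_time (H_space \<Omega> 2) (H_norm \<Omega> 2)) (L2_time_norm (H_norm \<Omega> 2))
           (\<lambda>n. S (\<theta> (r n))) S' \<and>
         weakly_converges (H_space \<Omega> 2) (H_norm \<Omega> 2) (\<lambda>n. v\<^sub>0 (\<theta> (r n))) v\<^sub>0' \<and>
         weakly_converges (H_space \<Omega> 2) (H_norm \<Omega> 2) (\<lambda>n. u\<^sub>0 (\<theta> (r n))) u\<^sub>0' \<and>
         navier_stokes_solution \<alpha> \<beta> \<mu> a \<gamma> v\<^sub>0' u\<^sub>0' v' u' \<and>
         (AE t in lebesgue_on {0<..}. AE x in lebesgue_on \<Omega>.
            S' (t, x) = \<mu> * wderiv \<Omega> 1 (\<lambda>y. u' (t, y)) x / v' (t, x))))"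
proof -
  interpret bounded_interval \<alpha> \<beta> by unfold_locales fact
  \<comment> \<open>The solution of
    \<open>sobolev_const * sqrt (C * \<epsilon>) = 1 / 2\<close>.\<close>
  define \<epsilon> where "\<epsilon> = (1 / (2 * sobolev_const))\<^sup>2 / C"
  have sob: "sobolev_const > 0" by (rule sobolev_const_pos)
  have \<epsilon>: "\<epsilon> > 0" using sob assms(5) by (simp add: \<epsilon>_def)
  have "sqrt (C * \<epsilon>) = 1 / (2 * sobolev_const)"
    using sob assms(5) by (simp add: \<epsilon>_def real_sqrt_divide real_sqrt_mult)
  then have small: "sobolev_const * sqrt (C * \<epsilon>) \<le> 1 / 2" using sob by simp
  show ?thesis
  proof (intro exI[of _ \<epsilon>] conjI \<epsilon> allI impI, goal_cases)
    case (1 v\<^sub>0 u\<^sub>0 S\<^sub>0 v u S \<theta>)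
    then have sol: "\<forall>\<tau>\<in>{0<..1}. E_init \<Omega> \<mu> a \<gamma> \<tau> (v\<^sub>0 \<tau>) (u\<^sub>0 \<tau>) (S\<^sub>0 \<tau>) < \<epsilon> \<and>
        global_solution \<alpha> \<beta> \<mu> a \<gamma> C \<tau> (v\<^sub>0 \<tau>) (u\<^sub>0 \<tau>) (S\<^sub>0 \<tau>) (v \<tau>) (u \<tau>) (S \<tau>)"
      and \<theta>: "range \<theta> \<subseteq> {0<..1}" "\<theta> \<longlonglongrightarrow> 0" by blast+
    have solution: "relaxed_solution \<alpha> \<beta> \<mu> a \<gamma> C (\<theta> n) \<epsilon> (v\<^sub>0 (\<theta> n)) (u\<^sub>0 (\<theta> n)) (S\<^sub>0 (\<theta> n)) (v (\<theta> n)) (u (\<theta> n)) (S (\<theta> n))" for n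
    proof -
      have "\<theta> n \<in> {0<..1}" using \<theta>(1) by blast
      with sol show ?thesis using assms(2-5) small by unfold_locales (auto simp: \<Omega>_def)
    qed
    let ?D = "{0::real..} \<times> {\<alpha><..<\<beta>}"
    have "\<exists>r. strict_mono r \<and> (\<forall>p\<in>?D. convergent (\<lambda>n. v (\<theta> (r n)) p))"
    proof (rule pointwise_convergent_subsequence[where f = "\<lambda>n. v (\<theta> n)"])
      fix p assume p: "p \<in> ?D"
      have b: "\<bar>v (\<theta> n) p\<bar> \<le> 3 / 2" for n
        using relaxed_solution.v_bounds[OF solution, of "fst p" "snd p" n] p by auto
      then show "\<exists>C. \<forall>n. \<bar>v (\<theta> n) p\<bar> \<le> C" by blast
      fix e :: real assume e: "e > 0"
      \<comment> \<open>\<open>v\<close> has Lipschitz constant 1 in each variable separately, so a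
        distance below e / 2 suffices.\<close>
      have "\<bar>v (\<theta> n) p' - v (\<theta> n) p\<bar> < e" if p': "p' \<in> ?D" "dist p' p < e / 2" for p' n
        using space_time_dist[of p' p]
          relaxed_solution.space_lipschitz(1)[OF solution, of "fst p'" "snd p" "snd p'" n]
          relaxed_solution.v_time_lipschitz[OF solution, of "fst p" "fst p'" "snd p" n] p p' by auto
      then show "\<exists>d>0. \<forall>n. \<forall>p'\<in>?D. dist p' p < d \<longrightarrow> \<bar>v (\<theta> n) p' - v (\<theta> n) p\<bar> < e"
        using e by (intro exI[of _ "e / 2"]) auto
    qed
    then obtain r1 :: "nat \<Rightarrow> nat" where r1: "strict_mono r1" "\<forall>p\<in>?D. convergent (\<lambda>n. v (\<theta> (r1 n)) p)" by blast
    have "\<exists>r. strict_mono r \<and> (\<forall>p\<in>?D. convergent (\<lambda>n. u (\<theta> (r1 (r n))) p))"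
    proof (rule pointwise_convergent_subsequence[where f = "\<lambda>n. u (\<theta> (r1 n))"])
      fix p assume p: "p \<in> ?D"
      have b: "\<bar>u (\<theta> (r1 n)) p\<bar> \<le> 1 / 2" for n
        using relaxed_solution.C1_bounds(3)[OF solution, of "fst p" "snd p" "r1 n"] p by auto
      then show "\<exists>C. \<forall>n. \<bar>u (\<theta> (r1 n)) p\<bar> \<le> C" by blast
      fix e :: real assume e: "e > 0"
      \<comment> \<open>The constant of \<open>u_time_estimate\<close> for \<delta> = e / 3.\<close>
      define L where "L = relaxed_solution.pressure_bound a \<gamma> + 1 / (e / 3)"
      have L: "L > 0"
        using e assms(3,4) by (simp add: L_def relaxed_solution.pressure_bound_def[OF solution] add_nonneg_pos)
      have est: "\<bar>u (\<theta> n) (t, x) - u (\<theta> n) (s, x)\<bar> \<le> L * \<bar>t - s\<bar> + e / 3" if "0 \<le> s" "0 \<le> t" "x \<in> {\<alpha><..<\<beta>}" for s t x n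
      proof (cases "s \<le> t")
        case True
        then show ?thesis
          using relaxed_solution.u_time_estimate[OF solution that(1) True that(3), of "e / 3" n] e unfolding L_def by simp
      next
        case False
        then have ts: "t \<le> s" by simp
        show ?thesis
          using relaxed_solution.u_time_estimate[OF solution that(2) ts that(3), of "e / 3" n] e ts
          unfolding L_def abs_minus_commute[of "u (\<theta> n) (t, x)"] abs_minus_commute[of t] by simp
      qed
      \<comment> \<open>Increments in time and space together contribute less than L d + d = e / 3,
        and the additive term of the modulus another e / 3.\<close>
      define d where "d = e / (3 * (L + 1))"
      have d: "d > 0" "L * d + d = e / 3" using L e by (simp_all add: d_def divide_simps) (simp add: algebra_simps)
      have "\<bar>u (\<theta> n) p' - u (\<theta> n) p\<bar> < e" if p': "p' \<in> ?D" "dist p' p < d" for p' n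
      proof -
        have t: "\<bar>fst p' - fst p\<bar> < d" and x: "\<bar>snd p' - snd p\<bar> < d" using space_time_dist[of p' p] p'(2) by auto
        have "L * \<bar>fst p' - fst p\<bar> \<le> L * d" using t L by (intro mult_left_mono) auto
        moreover have "\<bar>u (\<theta> n) (fst p', snd p') - u (\<theta> n) (fst p', snd p)\<bar> \<le> \<bar>snd p' - snd p\<bar>"
          by (rule relaxed_solution.space_lipschitz(2)[OF solution]) (use p p' in auto)
        moreover have "\<bar>u (\<theta> n) (fst p', snd p) - u (\<theta> n) (fst p, snd p)\<bar> \<le> L * \<bar>fst p' - fst p\<bar> + e / 3"
          by (rule est) (use p p' in auto)
        ultimately show ?thesis using d(2) e x unfolding prod.collapse by linarith
      qed
      then show "\<exists>d>0. \<forall>n. \<forall>p'\<in>?D. dist p' p < d \<longrightarrow> \<bar>u (\<theta> (r1 n)) p' - u (\<theta> (r1 n)) p\<bar> < e"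
        using d(1) by (intro exI[of _ d]) auto
    qed
    then obtain r2 :: "nat \<Rightarrow> nat" where r2: "strict_mono r2" "\<forall>p\<in>?D. convergent (\<lambda>n. u (\<theta> (r1 (r2 n))) p)" by blast
    \<comment> \<open>Two successive extractions, one for \<open>v\<close> and one for
      \<open>u\<close>; \<open>S\<close> and the data converge along the result.\<close>
    define r where "r n = r1 (r2 n)" for n
    have r: "strict_mono r"
      using strict_mono_o[OF r1(1) r2(1)] by (simp add: r_def[abs_def] o_def)
    define v' where "v' p = lim (\<lambda>n. v (\<theta> (r n)) p)" for p
    define u' where "u' p = lim (\<lambda>n. u (\<theta> (r n)) p)" for p
    have vl: "(\<lambda>n. v (\<theta> (r n)) p) \<longlonglongrightarrow> v' p" if p: "p \<in> ?D" for p
    proof -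
      have "convergent ((\<lambda>n. v (\<theta> (r1 n)) p) \<circ> r2)" using r1(2) p r2(1) by (intro convergent_subseq_convergent) blast+
      then show ?thesis by (simp add: v'_def r_def o_def convergent_LIMSEQ_iff)
    qed
    have ul: "(\<lambda>n. u (\<theta> (r n)) p) \<longlonglongrightarrow> u' p" if p: "p \<in> ?D" for p
    proof -
      have "convergent (\<lambda>n. u (\<theta> (r1 (r2 n))) p)" using r2(2) p by blast
      then show ?thesis by (simp add: u'_def r_def convergent_LIMSEQ_iff)
    qed
    have \<tau>l: "(\<lambda>n. \<theta> (r n)) \<longlonglongrightarrow> 0"
      using LIMSEQ_subseq_LIMSEQ[OF \<theta>(2) r] by (simp add: o_def)
    interpret relaxation_limit \<alpha> \<beta> \<mu> a \<gamma> C \<epsilon> "\<lambda>n. \<theta> (r n)" "\<lambda>n. v\<^sub>0 (\<theta> (r n))" "\<lambda>n. u\<^sub>0 (\<theta> (r n))" "\<lambda>n. S\<^sub>0 (\<theta> (r n))"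
      "\<lambda>n. v (\<theta> (r n))" "\<lambda>n. u (\<theta> (r n))" "\<lambda>n. S (\<theta> (r n))" v' u'
      by (rule relaxation_limit.intro[OF bounded_interval_axioms relaxation_limit_axioms.intro])
        (rule solution \<tau>l vl ul; simp)+
    obtain S' where S': "weakly_converges (L2_time (H_space \<Omega> 2) (H_norm \<Omega> 2)) (L2_time_norm (H_norm \<Omega> 2)) (\<lambda>n. S (\<theta> (r n))) S'"
      "AE t in lebesgue_on {0<..}. AE x in lebesgue_on \<Omega>. S' (t, x) = \<mu> * wderiv \<Omega> 1 (\<lambda>y. u' (t, y)) x / v' (t, x)"
      using S_weak_limit unfolding \<Omega>_def by blast
    have "S' \<in> L2_time (H_space \<Omega> 2) (H_norm \<Omega> 2)" using S'(1) by (simp add: weakly_converges_def)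
    then show ?case
      using r limit_Linf weakstar S' initial_weak_limit limit_navier_stokes unfolding \<Omega>_def[symmetric] by blast
  qed
qed



end
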